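(* Let $\alpha\in(0,2)$, let $\{X_{ij}: i,j\ge 1\}$ be i.i.d. symmetric real random variables such that $X_{11}$ is regularly varying with index $\alpha$, and let $\mathbf{Y}_n$ be the associated $n\times n$ self-normalized matrix. Let $\ell\ge1$ and let $k_1,\dots,k_\ell\ge1$ be integers. Then, as $n\to\infty$, $$\big(\mathrm{Tr}[\mathbf{Y}_n^{k_1}],\dots,\mathrm{Tr}[\mathbf{Y}_n^{k_\ell}]\big)\to\big(Z_{k_1}^{(\alpha)},\dots,Z_{k_\ell}^{(\alpha)}\big)\quad\text{in distribution},$$ where $(Z_k^{(\alpha)})_{k\ge1}$ is an $\alpha$-Poisson family.
   Context: Model. $\{X_{ij}\}_{i,j\ge1}$ are i.i.d., non-degenerate, symmetric ($X_{11}\overset{d}{=}-X_{11}$) real random variables. The self-normalized matrix is $\mathbf{Y}_n=(Y_{ij})_{1\le i,j\le n}$ with $Y_{ij}=X_{ij}/\sqrt{X_{i1}^2+\cdots+X_{in}^2}$ (a row of $\mathbf Y_n$ is set to $0$ if the corresponding row $(X_{i1},\dots,X_{in})$ vanishes). "Regularly varying with index $\alpha\ge 0$" means $\mathbb{P}(|X_{11}|>x)=x^{-\alpha}L(x)$ for $x>0$, where $L$ is slowly varying at infinity, i.e. $\lim_{x\to\infty}L(tx)/L(x)=1$ for all $t>0$. $q$-Poisson process ($\alpha\in(0,2)$, $q\ge1$ an integer). Let $U_1,U_2,\dots$ be i.i.d. $\mathrm{Beta}(1-\alpha/2,\alpha/2)$ variables and let $\mu_q^{(\alpha)}$ be the law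 of $W_q=\prod_{r=1}^qU_r$. Let $\nu_q^{(\alpha)}$ be the symmetric measure on $[-1,1]$ (giving no mass to $0$) with $\int f\,d\nu_q^{(\alpha)}=\frac{1}{2q}\int_0^1\frac1u\,(f(u)+f(-u))\,\mu_q^{(\alpha)}(du)$. The $q$-Poisson process $N_q^{(\alpha)}$ is the Poisson point process with intensity measure $\nu_q^{(\alpha)}$. $\alpha$-Poisson family. Let $(N_q^{(\alpha)})_{q\ge1}$ be independent $q$-Poisson processes and $f_m(u)=\mathrm{sign}(u)^m|u|^{m/2}$ for $m\ge1$, $u\in[-1,1]$. For $m\ge2$ set $V_{q,m}^{(\alpha)}=q\int f_m(u)\,N_q^{(\alpha)}(du)$ (an a.s. absolutely convergent sum over the points of the process); for $m=1$ set $V_{q,1}^{(\alpha)}=q\int f_1(u)\,\tilde N_q^{(\alpha)}(du)$, the compensated Poisson integral in $L^2(\mathbb{P})$, where $\tilde N_q^{(\alpha)}=N_q^{(\alpha)}-\nu_q^{(\alpha)}$ (note $f_1\in L^2(\nu_q^{(\alpha)})$). Then $Z_k^{(\alpha)}=\sum_{q\mid k}V_{q,k/q}^{(\alpha)}$ for $k\ge1$, the sum being over all positive divisors $q$ of $k$. *)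

theory Defs
  imports "HOL-Probability.Probability" "Jordan_Normal_Form.Matrix"
begin

section \<open>The matrix model\<close>

definition slowly_varying :: "(real \<Rightarrow> real) \<Rightarrow> bool" where
  "slowly_varying L \<longleftrightarrow> (\<forall>t>0. ((\<lambda>x. L (t * x) / L x) \<longlongrightarrow> 1) at_top)"

definition regularly_varying_tail :: "'a measure \<Rightarrow> ('a \<Rightarrow> real) \<Rightarrow> real \<Rightarrow> bool" where
  "regularly_varying_tail M \<xi> \<alpha> \<longleftrightarrow>
     (\<exists>L. slowly_varying L \<and>
          (\<forall>x>0. measure M {\<omega> \<in> space M. \<bar>\<xi> \<omega>\<bar> > x} = x powr (-\<alpha>) * L x))"

text \<open>The entries are indexed by pairs of integers \<open>i, j \<ge> 1\<close>; the values of \<open>X\<close> at index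
  \<open>0\<close> are irrelevant.\<close>

locale symmetric_iid_array = prob_space M for M :: "'a measure" +
  fixes X :: "nat \<Rightarrow> nat \<Rightarrow> 'a \<Rightarrow> real"
  assumes independent: "indep_vars (\<lambda>_. borel) (\<lambda>(i, j). X i j) ({1..} \<times> {1..})"
    and identically_distributed:
      "\<And>i j. i \<ge> 1 \<Longrightarrow> j \<ge> 1 \<Longrightarrow> distr M borel (X i j) = distr M borel (X 1 1)"
    and symmetric: "distr M borel (X 1 1) = distr M borel (\<lambda>\<omega>. - X 1 1 \<omega>)"
    and non_degenerate: "\<not> (\<exists>c. AE \<omega> in M. X 1 1 \<omega> = c)"

text \<open>Matrix positions are numbered from \<open>0\<close>, hence the shift by \<open>Suc\<close>. Since \<open>x / 0 = 0\<close>,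
  a vanishing row of \<open>X\<close> gives a zero row.\<close>

definition self_normalized_matrix ::
    "(nat \<Rightarrow> nat \<Rightarrow> 'a \<Rightarrow> real) \<Rightarrow> nat \<Rightarrow> 'a \<Rightarrow> real mat" where
  "self_normalized_matrix X n \<omega> =
     Matrix.mat n n (\<lambda>(i, j). X (Suc i) (Suc j) \<omega> / sqrt (\<Sum>l=1..n. (X (Suc i) l \<omega>)\<^sup>2))"

definition mat_trace :: "'a::comm_monoid_add mat \<Rightarrow> 'a" where
  "mat_trace A = (\<Sum>i<dim_row A. A $$ (i, i))"


section \<open>Convergence in distribution\<close>

definition converges_in_distribution ::
    "'a measure \<Rightarrow> (nat \<Rightarrow> 'a \<Rightarrow> 'v::topological_space) \<Rightarrow> 'b measure \<Rightarrow> ('b \<Rightarrow> 'v) \<Rightarrow> bool" where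
  "converges_in_distribution M T P S \<longleftrightarrow>
     (\<forall>n. T n \<in> borel_measurable M) \<and> S \<in> borel_measurable P \<and>
     (\<forall>g :: 'v \<Rightarrow> real. continuous_on UNIV g \<and> bounded (range g) \<longrightarrow>
        (\<lambda>n. \<integral>\<omega>. g (T n \<omega>) \<partial>M) \<longlonglongrightarrow> (\<integral>\<omega>. g (S \<omega>) \<partial>P))"


section \<open>Poisson point processes\<close>

text \<open>A point process is a random measure \<open>N\<close> with values in \<open>{0, 1, 2, \<dots>, \<infinity>}\<close>.\<close>

definition poisson_process :: "'b measure \<Rightarrow> 's measure \<Rightarrow> ('b \<Rightarrow> 's measure) \<Rightarrow> bool" where
  "poisson_process P \<nu> N \<longleftrightarrow>
     (\<forall>\<omega>\<in>space P. sets (N \<omega>) = sets \<nu> \<and>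
        (\<forall>A\<in>sets \<nu>. emeasure (N \<omega>) A \<in> insert \<infinity> (range of_nat))) \<and>
     (\<forall>A\<in>sets \<nu>. (\<lambda>\<omega>. emeasure (N \<omega>) A) \<in> borel_measurable P) \<and>
     (\<forall>A\<in>sets \<nu>. emeasure \<nu> A < \<infinity> \<longrightarrow>
        (\<forall>j::nat. measure P {\<omega> \<in> space P. emeasure (N \<omega>) A = of_nat j} =
           measure \<nu> A ^ j / fact j * exp (- measure \<nu> A))) \<and>
     (\<forall>A\<in>sets \<nu>. emeasure \<nu> A = \<infinity> \<longrightarrow> (AE \<omega> in P. emeasure (N \<omega>) A = \<infinity>)) \<and>
     (\<forall>(A :: nat \<Rightarrow> 's set) n. (\<forall>i<n. A i \<in> sets \<nu>) \<and> disjoint_family_on A {..<n} \<longrightarrow>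
        prob_space.indep_vars P (\<lambda>_. borel) (\<lambda>i \<omega>. emeasure (N \<omega>) (A i)) {..<n})"

text \<open>The events determined by a random measure \<open>N\<close> with values in the measures on \<open>\<S>\<close>.\<close>

definition random_measure_events :: "'b measure \<Rightarrow> 's measure \<Rightarrow> ('b \<Rightarrow> 's measure) \<Rightarrow> 'b set set" where
  "random_measure_events P \<S> N =
     sigma_sets (space P)
       {(\<lambda>\<omega>. emeasure (N \<omega>) A) -` B \<inter> space P | A B. A \<in> sets \<S> \<and> B \<in> sets borel}"

text \<open>\<open>I\<close> is a version of the compensated Poisson integral of \<open>f \<in> L\<^sup>2(\<nu>)\<close>: the map
  \<open>g \<mapsto> \<integral> g dN - \<integral> g d\<nu>\<close> on \<open>L\<^sup>1(\<nu>) \<inter> L\<^sup>2(\<nu>)\<close> is an isometry into \<open>L\<^sup>2(P)\<close> with respect to the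
  norm of \<open>L\<^sup>2(\<nu>)\<close>, and \<open>I\<close> is the value at \<open>f\<close> of its continuous extension to \<open>L\<^sup>2(\<nu>)\<close>.\<close>

definition compensated_poisson_integral ::
    "'b measure \<Rightarrow> 's measure \<Rightarrow> ('b \<Rightarrow> 's measure) \<Rightarrow> ('s \<Rightarrow> real) \<Rightarrow> ('b \<Rightarrow> real) \<Rightarrow> bool" where
  "compensated_poisson_integral P \<nu> N f I \<longleftrightarrow>
     f \<in> borel_measurable \<nu> \<and> integrable \<nu> (\<lambda>u. (f u)\<^sup>2) \<and> I \<in> borel_measurable P \<and>
     (\<exists>g :: nat \<Rightarrow> 's \<Rightarrow> real.
        (\<forall>n. integrable \<nu> (g n) \<and> integrable \<nu> (\<lambda>u. (g n u)\<^sup>2)) \<and>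
        (\<lambda>n. \<integral>\<^sup>+u. ennreal ((g n u - f u)\<^sup>2) \<partial>\<nu>) \<longlonglongrightarrow> 0 \<and>
        (\<lambda>n. \<integral>\<^sup>+\<omega>. ennreal (((\<integral>u. g n u \<partial>N \<omega>) - (\<integral>u. g n u \<partial>\<nu>) - I \<omega>)\<^sup>2) \<partial>P) \<longlonglongrightarrow> 0)"


section \<open>The \<open>q\<close>-Poisson processes\<close>

definition beta_distribution :: "real \<Rightarrow> real \<Rightarrow> real measure" where
  "beta_distribution a b =
     density lborel (\<lambda>x. ennreal (indicator {0<..<1} x *
       (x powr (a - 1) * (1 - x) powr (b - 1) / Beta a b)))"

lemma prob_space_beta_distribution:
  assumes "a > 0" and "b > 0"
  shows "prob_space (beta_distribution a b)"
proof (rule prob_spaceI)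
  have B: "Beta a b > 0"
    using assms by (simp add: Beta_def)
  have "((\<lambda>x. x powr (a - 1) * (1 - x) powr (b - 1)) has_integral Beta a b) {0<..<1}"
    using has_integral_Beta_real[OF assms] by (simp add: has_integral_Icc_iff_Ioo)
  from has_integral_divide[OF this, of "Beta a b"]
  have "((\<lambda>x. x powr (a - 1) * (1 - x) powr (b - 1) / Beta a b) has_integral 1) {0<..<1}"
    using B by simp
  then have "(\<integral>\<^sup>+x. ennreal (indicator {0<..<1} x *
      (x powr (a - 1) * (1 - x) powr (b - 1) / Beta a b)) \<partial>lborel) = ennreal 1"
    using B by (intro nn_integral_has_integral_lebesgue) auto
  then show "emeasure (beta_distribution a b) (space (beta_distribution a b)) = 1"
    by (simp add: beta_distribution_def emeasure_density)
qed

definition beta_product_distribution :: "real \<Rightarrow> nat \<Rightarrow> real measure" where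
  "beta_product_distribution \<alpha> q =
     distr (\<Pi>\<^sub>M r\<in>{1..q}. beta_distribution (1 - \<alpha> / 2) (\<alpha> / 2)) borel (\<lambda>U. \<Prod>r\<in>{1..q}. U r)"

text \<open>The intensity is a Borel measure on the real line; it gives no mass to \<open>0\<close> nor to the
  complement of \<open>[-1, 1]\<close>.\<close>

definition q_poisson_intensity :: "real \<Rightarrow> nat \<Rightarrow> real measure" where
  "q_poisson_intensity \<alpha> q =
     measure_of UNIV (sets borel)
       (\<lambda>A. \<integral>\<^sup>+u. ennreal (1 / (2 * real q * u)) * (indicator A u + indicator A (- u))
              \<partial>beta_product_distribution \<alpha> q)"

lemma sets_beta_product_distribution [simp, measurable_cong]:
  "sets (beta_product_distribution \<alpha> q) = sets borel"
  by (simp add: beta_product_distribution_def)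

lemma sets_q_poisson_intensity [simp, measurable_cong]:
  "sets (q_poisson_intensity \<alpha> q) = sets borel"
  using sets.sigma_sets_eq[of "borel :: real measure"] by (simp add: q_poisson_intensity_def)

lemma space_q_poisson_intensity [simp]: "space (q_poisson_intensity \<alpha> q) = UNIV"
  using sets_eq_imp_space_eq[OF sets_q_poisson_intensity] by simp

lemma emeasure_q_poisson_intensity:
  assumes A: "A \<in> sets borel"
  shows "emeasure (q_poisson_intensity \<alpha> q) A =
    (\<integral>\<^sup>+u. ennreal (1 / (2 * real q * u)) * (indicator A u + indicator A (- u))
       \<partial>beta_product_distribution \<alpha> q)"
proof (rule emeasure_measure_of[OF q_poisson_intensity_def])
  show "countably_additive (sets (q_poisson_intensity \<alpha> q))
     (\<lambda>A. \<integral>\<^sup>+u. ennreal (1 / (2 * real q * u)) * (indicator A u + indicator A (- u))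
       \<partial>beta_product_distribution \<alpha> q)"
  proof (rule countably_additiveI)
    fix B :: "nat \<Rightarrow> real set"
    assume "range B \<subseteq> sets (q_poisson_intensity \<alpha> q)" and disj: "disjoint_family B"
    then have [measurable]: "B i \<in> sets borel" for i by auto
    have eq: "(\<Sum>i. ennreal (1 / (2 * real q * u)) * (indicator (B i) u + indicator (B i) (- u))) =
        ennreal (1 / (2 * real q * u)) * (indicator (\<Union>i. B i) u + indicator (\<Union>i. B i) (- u))" for u
      by (simp add: suminf_add[symmetric] suminf_indicator[OF disj])
    show "(\<Sum>i. \<integral>\<^sup>+u. ennreal (1 / (2 * real q * u)) * (indicator (B i) u + indicator (B i) (- u))
          \<partial>beta_product_distribution \<alpha> q) =
      (\<integral>\<^sup>+u. ennreal (1 / (2 * real q * u)) * (indicator (\<Union>i. B i) u + indicator (\<Union>i. B i) (- u))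
          \<partial>beta_product_distribution \<alpha> q)"
      by (subst nn_integral_suminf[symmetric]) (measurable, simp only: eq)
  qed
qed (use A in \<open>auto simp: positive_def\<close>)

lemma nn_integral_q_poisson_intensity:
  assumes "f \<in> borel_measurable borel"
  shows "(\<integral>\<^sup>+u. f u \<partial>q_poisson_intensity \<alpha> q) =
    (\<integral>\<^sup>+u. ennreal (1 / (2 * real q * u)) * (f u + f (- u)) \<partial>beta_product_distribution \<alpha> q)"
  using assms
proof (induction rule: borel_measurable_induct)
  case (cong f g)
  then show ?case by (simp cong: nn_integral_cong_simp)
next
  case (set A)
  then show ?case by (simp add: emeasure_q_poisson_intensity)
next
  case (mult v c)
  note [measurable] = mult.hyps(2)
  have "ennreal (1 / (2 * real q * u)) * (c * v u + c * v (- u)) =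
      c * (ennreal (1 / (2 * real q * u)) * (v u + v (- u)))" for u
    by (simp only: distrib_left mult.left_commute[of c])
  then show ?case
    using mult.IH by (simp add: nn_integral_cmult)
next
  case (add v w)
  note [measurable] = add.hyps(1) add.hyps(3)
  have "ennreal (1 / (2 * real q * u)) * (w u + v u + (w (- u) + v (- u))) =
      ennreal (1 / (2 * real q * u)) * (w u + w (- u)) +
      ennreal (1 / (2 * real q * u)) * (v u + v (- u))" for u
    by (simp only: distrib_left add_ac)
  then show ?case
    using add.IH by (simp add: nn_integral_add)
next
  case (seq U)
  note [measurable] = seq.hyps(1)
  have sup: "(SUP i. U i) x = (SUP i. U i x)" for x by (simp add: image_image)
  have inc: "incseq (\<lambda>i. U i x)" for x using seq.hyps by (auto simp: incseq_def le_fun_def)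
  show ?case
    unfolding sup ennreal_SUP_add[OF inc inc, symmetric] SUP_mult_left_ennreal
    using seq.IH inc seq.hyps
    by (subst (1 2) nn_integral_monotone_convergence_SUP)
       (auto simp: incseq_def le_fun_def intro!: mult_left_mono add_mono)
qed


section \<open>The \<open>\<alpha>\<close>-Poisson family\<close>

definition signed_half_power :: "nat \<Rightarrow> real \<Rightarrow> real" where
  "signed_half_power m u = sgn u ^ m * \<bar>u\<bar> powr (real m / 2)"

text \<open>\<open>Z 0\<close> and \<open>N 0\<close> are irrelevant. \<open>V q 1\<close> is determined up to almost sure equality only.\<close>

definition alpha_poisson_family :: "'b measure \<Rightarrow> real \<Rightarrow> (nat \<Rightarrow> 'b \<Rightarrow> real) \<Rightarrow> bool" where
  "alpha_poisson_family P \<alpha> Z \<longleftrightarrow> prob_space P \<and>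
     (\<exists>(N :: nat \<Rightarrow> 'b \<Rightarrow> real measure) (V :: nat \<Rightarrow> nat \<Rightarrow> 'b \<Rightarrow> real).
        (\<forall>q\<ge>1. poisson_process P (q_poisson_intensity \<alpha> q) (N q)) \<and>
        prob_space.indep_sets P (\<lambda>q. random_measure_events P borel (N q)) {1..} \<and>
        (\<forall>q\<ge>1. \<forall>m\<ge>2. \<forall>\<omega>\<in>space P.
           V q m \<omega> = real q * (\<integral>u. signed_half_power m u \<partial>N q \<omega>)) \<and>
        (\<forall>q\<ge>1. \<exists>I. compensated_poisson_integral P (q_poisson_intensity \<alpha> q) (N q)
                        (signed_half_power 1) I \<and>
                     (\<forall>\<omega>\<in>space P. V q 1 \<omega> = real q * I \<omega>)) \<and>
        (\<forall>k\<ge>1. \<forall>\<omega>\<in>space P. Z k \<omega> = (\<Sum>q | q dvd k. V q (k div q) \<omega>)))"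

end

theory Submission
  imports Defs
begin

text \<open>Expand \<open>Tr (Y ^ k)\<close> over closed walks. The walks in which some row carries two different edges
  have a negligible second moment; the remaining ones run \<open>k / q\<close> times around a simple cycle of
  length \<open>q\<close>, so the trace is the sum over \<open>q\<close> dividing \<open>k\<close> of \<open>q\<close> times the sum of \<open>W E ^ (k / q)\<close>,
  where \<open>W E\<close> is the product of \<open>Y\<close> along the cycle \<open>E\<close>. Two such products are independent unless
  their cycles share a row, hence the sum of \<open>h (W E)\<close> is asymptotically compound Poisson as soon
  as \<open>h w = O (w\<^sup>2)\<close>: its characteristic function is close to the exponential of the sum of the
  expectations of \<open>cis (h (W E)) - 1\<close>. Those sums converge because the even moments of one entry,
  multiplied by \<open>n\<close>, converge to Beta moments (a Tauberian computation with the Laplace transform of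
  \<open>X\<^sup>2\<close>), and polynomials are dense in the continuous functions on the unit interval.

  The linear term \<open>W E\<close>, which produces the compensated integral, is not \<open>O (w\<^sup>2)\<close>. It is replaced by
  \<open>w - w (1 - w\<^sup>2) ^ N\<close>; by symmetry the terms \<open>w (1 - w\<^sup>2) ^ N\<close> are uncorrelated, so their sum is
  small in \<open>L\<^sup>2\<close> in the limit \<open>n \<rightarrow> \<infinity>\<close> when \<open>N\<close> is large.\<close>

section \<open>Moments of self-normalized sums\<close>

text \<open>There are about \<open>n ^ q / q\<close> cycles of length \<open>q\<close>, and the mean
  of \<open>(W E)\<^sup>2\<close> is at most \<open>(2 / n) ^ q\<close>, so the sum of these means
  stays bounded; the sum of the means of \<open>|W E|\<close> may not. Hence
  \<open>w\<^sup>2\<close> is the scale against which test functions are measured.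

  The intensity can be read off: weighted by \<open>(W E)\<^sup>2\<close>, the values
  \<open>u = (W E)\<^sup>2\<close> have in the limit the law of a product of \<open>q\<close> Beta
  variables, divided by \<open>q\<close>. Removing the weight gives \<open>1 / u\<close>, the
  symmetry of the entries the factor \<open>1 / 2\<close>, the \<open>q\<close> rotations of a cycle
  the factor \<open>1 / q\<close>. The same rotations give the factor \<open>q\<close> in front of
  the Poisson integrals.

  The traces are not centred, yet the integral for \<open>m = 1\<close> is compensated: the square
  root need not be integrable for the intensity, but the truncated linear terms are odd, so their
  compensator is 0 and subtracting it is free.

  The moments are calibrated by the second moment of an entry, which exchangeability and the
  normalization of a row determine; the Laplace transform only has to supply ratios.\<close>

text \<open>A Potter-type bound, which makes the tail ratios integrable near 0. For large
  \<open>x\<close> one halving of the scale costs at most a factor \<open>2 powr \<gamma>\<close>;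
  the gap between \<beta> and \<gamma> absorbs the error in the limit, and about log2 of
  \<open>1 / y\<close> halvings lead from \<open>x\<close> to \<open>y * x\<close>.\<close>

lemma potter_bound:
  fixes G :: "real \<Rightarrow> real"
  assumes mono: "\<And>x y. x \<le> y \<Longrightarrow> G y \<le> G x" and pos: "\<And>x. G x > 0" and le1: "\<And>x. G x \<le> 1"
    and lim: "((\<lambda>x. G (2 * x) / G x) \<longlongrightarrow> 2 powr (-\<beta>)) at_top"
    and \<gamma>: "\<beta> < \<gamma>" "0 < \<gamma>"
  shows "\<exists>C x1. C > 0 \<and> (\<forall>x\<ge>x1. \<forall>y. 0 < y \<and> y \<le> 1 \<longrightarrow> G (y * x) / G x \<le> C * y powr (-\<gamma>))"
proof -
  have "2 powr (-\<gamma>) < 2 powr (-\<beta>)" using \<gamma> by simp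
  then have "eventually (\<lambda>x. 2 powr (-\<gamma>) < G (2 * x) / G x) at_top"
    using order_tendstoD(1)[OF lim] by blast
  then obtain x0' where x0': "\<And>x. x \<ge> x0' \<Longrightarrow> 2 powr (-\<gamma>) < G (2 * x) / G x"
    by (auto simp: eventually_at_top_linorder)
  define x0 where "x0 = max x0' 1"
  have x0: "x0 > 0" by (simp add: x0_def)
  have step: "G x \<le> 2 powr \<gamma> * G (2 * x)" if "x \<ge> x0" for x
  proof -
    have "2 powr (-\<gamma>) * G x \<le> G (2 * x)"
      using x0'[of x] that pos[of x] by (simp add: x0_def field_simps)
    then have "2 powr \<gamma> * (2 powr (-\<gamma>) * G x) \<le> 2 powr \<gamma> * G (2 * x)"
      by (intro mult_left_mono) auto
    moreover have "2 powr \<gamma> * 2 powr (-\<gamma>) = (1::real)" by (simp flip: powr_add)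
    ultimately show ?thesis by (simp flip: mult.assoc)
  qed
  have iter: "G x \<le> (2 powr \<gamma>) ^ k * G (2 ^ k * x)" if "x \<ge> x0" for x k
  proof (induction k)
    case (Suc k)
    have "1 * x \<le> 2 ^ k * x" using that x0 by (intro mult_right_mono) auto
    then have "2 ^ k * x \<ge> x0" using that by linarith
    from step[OF this] have "(2 powr \<gamma>) ^ k * G (2 ^ k * x) \<le> (2 powr \<gamma>) ^ k * (2 powr \<gamma> * G (2 * (2 ^ k * x)))"
      by (intro mult_left_mono) auto
    with Suc have "G x \<le> (2 powr \<gamma>) ^ k * (2 powr \<gamma> * G (2 * (2 ^ k * x)))" by linarith
    then show ?case by (simp add: mult_ac)
  qed simp
  have main: "G (y * x) \<le> 2 powr \<gamma> * y powr (-\<gamma>) * G x" if "0 < y" "y \<le> 1" "y * x \<ge> x0" for x y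
  proof -
    have "\<exists>k. 1 \<le> 2 ^ k * y"
    proof -
      obtain k where "1 / y < 2 ^ k" using real_arch_pow[of 2 "1 / y"] by auto
      then show ?thesis using that by (intro exI[of _ k]) (simp add: field_simps)
    qed
    \<comment> \<open>The least such \<open>k\<close> gives
      \<open>1 \<le> 2 ^ k * y \<le> 2\<close>: the doubled point has passed \<open>x\<close>, and
      the accumulated factor is at most \<open>(2 / y) powr \<gamma>\<close>.\<close>
    define k where "k = (LEAST k. 1 \<le> 2 ^ k * y)"
    have k: "1 \<le> 2 ^ k * y" unfolding k_def by (rule LeastI_ex) fact
    have ky: "2 ^ k * y \<le> 2"
    proof (cases k)
      case (Suc j)
      have "\<not> 1 \<le> 2 ^ j * y" using not_less_Least[of j "\<lambda>k. 1 \<le> 2 ^ k * y"] Suc by (simp add: k_def)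
      then show ?thesis using Suc by simp
    qed (use that in simp)
    have "x > 0" using that x0 by (metis less_le_trans zero_less_mult_pos)
    have "G (y * x) \<le> (2 powr \<gamma>) ^ k * G (2 ^ k * (y * x))" using iter[OF that(3)] .
    also have "\<dots> \<le> (2 powr \<gamma>) ^ k * G x"
    proof (intro mult_left_mono mono)
      have "1 * x \<le> (2 ^ k * y) * x" using k \<open>x > 0\<close> by (intro mult_right_mono) auto
      then show "x \<le> 2 ^ k * (y * x)" by (simp add: mult_ac)
    qed auto
    also have "(2 powr \<gamma>) ^ k = (2 ^ k) powr \<gamma>"
      by (simp add: powr_power flip: powr_realpow powr_powr) (simp add: powr_powr mult.commute)
    also have "(2 ^ k) powr \<gamma> \<le> (2 / y) powr \<gamma>"
      using ky that \<gamma> by (intro powr_mono2) (auto simp: field_simps)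
    also have "(2 / y) powr \<gamma> = 2 powr \<gamma> * y powr (-\<gamma>)"
      using that by (simp add: powr_divide powr_minus_divide)
    finally show ?thesis using pos[of x] by (simp add: mult_right_mono)
  qed
  \<comment> \<open>The second entry serves \<open>y * x < x0\<close>: there
    \<open>G (y * x) \<le> 1\<close>, while the main case with \<open>x0 / x\<close> in place of
    \<open>y\<close> bounds \<open>G x\<close> from below.\<close>
  define C where "C = max (2 powr \<gamma>) (2 powr \<gamma> / G x0)"
  have "G (y * x) / G x \<le> C * y powr (-\<gamma>)" if xy: "x \<ge> x0" "0 < y" "y \<le> 1" for x y
  proof (cases "y * x \<ge> x0")
    case True
    have "G (y * x) \<le> 2 powr \<gamma> * y powr (-\<gamma>) * G x" using main xy True by blast
    also have "\<dots> \<le> C * y powr (-\<gamma>) * G x"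
      using pos[of x] by (intro mult_right_mono) (auto simp: C_def)
    finally show ?thesis using pos[of x] by (simp add: field_simps)
  next
    case False
    have x: "x > 0" using xy x0 by simp
    have "G x0 \<le> 2 powr \<gamma> * (x0 / x) powr (-\<gamma>) * G x"
      using main[of "x0 / x" x] xy x0 x by simp
    also have "(x0 / x) powr (-\<gamma>) \<le> y powr (-\<gamma>)"
    proof -
      have "y \<le> x0 / x" using False x by (simp add: field_simps)
      then show ?thesis using xy \<gamma> by (intro powr_mono2') auto
    qed
    finally have "G x0 \<le> 2 powr \<gamma> * y powr (-\<gamma>) * G x"
      using pos[of x] by (simp add: mult_left_mono mult_right_mono)
    then have "1 \<le> 2 powr \<gamma> / G x0 * y powr (-\<gamma>) * G x"
      using pos[of x0] by (simp add: field_simps)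
    also have "\<dots> \<le> C * y powr (-\<gamma>) * G x"
      using pos[of x] by (intro mult_right_mono) (auto simp: C_def)
    finally have "G (y * x) \<le> C * y powr (-\<gamma>) * G x" using le1[of "y * x"] by linarith
    then show ?thesis using pos[of x] by (simp add: field_simps)
  qed
  moreover have "C > 0" by (simp add: C_def less_max_iff_disj)
  ultimately show ?thesis by blast
qed

section \<open>Asymptotics of Laplace-type moments of a regularly varying law\<close>

definition gamma_kernel :: "real \<Rightarrow> real \<Rightarrow> real" where
  "gamma_kernel a z = indicator {0<..} z * (z powr (a - 1) * exp (- z))"

lemma gamma_kernel_measurable [measurable]: "gamma_kernel a \<in> borel_measurable borel"
  unfolding gamma_kernel_def by measurable

lemma gamma_kernel_nonneg [simp]: "gamma_kernel a z \<ge> 0"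
  by (simp add: gamma_kernel_def)

lemma has_bochner_integral_gamma_kernel:
  assumes "a > 0"
  shows "has_bochner_integral lborel (gamma_kernel a) (Gamma a)"
proof (rule has_bochner_integral_nn_integral)
  have "((\<lambda>t. t powr (a - 1) / exp t) has_integral Gamma a) {0..}"
    by (rule Gamma_integral_real[OF assms])
  then have "(\<integral>\<^sup>+x. ennreal (indicator {0..} x * (x powr (a - 1) / exp x)) \<partial>lborel) = ennreal (Gamma a)"
    using assms by (intro nn_integral_has_integral_lebesgue) (auto intro!: Gamma_real_pos less_imp_le)
  moreover have "gamma_kernel a x = indicator {0..} x * (x powr (a - 1) / exp x)" for x
    by (cases "x = 0") (auto simp: gamma_kernel_def exp_minus field_simps indicator_def)
  ultimately show "(\<integral>\<^sup>+x. ennreal (gamma_kernel a x) \<partial>lborel) = ennreal (Gamma a)" by simp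
qed (use assms in \<open>auto intro!: Gamma_real_pos less_imp_le\<close>)

lemma integrable_gamma_kernel: "a > 0 \<Longrightarrow> integrable lborel (gamma_kernel a)"
  and integral_gamma_kernel: "a > 0 \<Longrightarrow> (\<integral>z. gamma_kernel a z \<partial>lborel) = Gamma a"
  using has_bochner_integral_gamma_kernel[of a] by (simp_all add: has_bochner_integral_iff)

lemma gamma_kernel_add: "gamma_kernel (a + b) z = gamma_kernel a z * z powr b"
  by (auto simp: gamma_kernel_def indicator_def powr_add[symmetric] algebra_simps)

text \<open>The left side is the expectation of \<open>h (a / x)\<close> with \<open>h y = y ^ m * exp (- y)\<close>; the right side
  integrates \<open>h'\<close> against the tail.\<close>

lemma (in real_distribution) laplace_moment_eq_tail_integral:
  assumes nonneg: "AE a in M. a \<ge> 0" and m: "m \<ge> 1" and x: "x > 0"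
  shows "(\<integral>a. (a / x) ^ m * exp (- (a / x)) \<partial>M) =
    (\<integral>z. (real m * gamma_kernel (real m) z - gamma_kernel (real m + 1) z) * measure M {x * z<..} \<partial>lborel)"
proof -
  define h' where "h' z = (real m * z ^ (m - 1) - z ^ m) * exp (- z)" for z :: real
  define k where "k z = real m * gamma_kernel (real m) z - gamma_kernel (real m + 1) z" for z
  have kh: "k z = indicator {0<..} z * h' z" for z
    using m by (auto simp: k_def h'_def gamma_kernel_def indicator_def powr_realpow[symmetric] of_nat_diff algebra_simps)
  have k_int: "integrable lborel k"
    unfolding k_def using m by (intro Bochner_Integration.integrable_diff integrable_mult_right integrable_gamma_kernel) auto
  have [measurable]: "k \<in> borel_measurable borel" unfolding k_def by measurable
  interpret pair_sigma_finite M lborel ..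
  define f where "f = (\<lambda>(a, z). indicator {z. x * z < a} z * k z :: real)"
  have f_meas: "f \<in> borel_measurable (M \<Otimes>\<^sub>M lborel)"
    unfolding f_def by measurable
  have inner: "(\<integral>z. f (a, z) \<partial>lborel) = (a / x) ^ m * exp (- (a / x))" if "a \<ge> 0" for a
  proof -
    have "(\<integral>z. f (a, z) \<partial>lborel) = (\<integral>z. h' z * indicator {0..a / x} z \<partial>lborel)"
    \<comment> \<open>The two integrands may differ at the endpoints 0 and \<open>a / x\<close>, a
      null set.\<close>
    proof (rule integral_cong_AE)
      have "AE z in lborel. z \<noteq> 0 \<and> z \<noteq> a / x"
        using AE_lborel_singleton[of 0] AE_lborel_singleton[of "a / x"] by eventually_elim auto
      then show "AE z in lborel. f (a, z) = h' z * indicator {0..a / x} z"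
        by eventually_elim (use x in \<open>auto simp: f_def kh indicator_def field_simps\<close>)
    qed (auto simp: f_def h'_def)
    also have "\<dots> = (a / x) ^ m * exp (- (a / x)) - 0 ^ m * exp (- 0)"
      using that x m
      by (intro integral_FTC_Icc_real)
         (auto simp: h'_def intro!: derivative_eq_intros continuous_intros simp: algebra_simps)
    \<comment> \<open>The boundary value at 0 vanishes because \<open>m \<ge> 1\<close>.\<close>
    finally show ?thesis using m by simp
  qed
  have f_le: "\<bar>f (a, z)\<bar> \<le> \<bar>k z\<bar>" for a z
    by (auto simp: f_def indicator_def)
  have f_int: "integrable (M \<Otimes>\<^sub>M lborel) f"
  proof (rule Fubini_integrable[OF f_meas])
    show "AE a in M. integrable lborel (\<lambda>z. f (a, z))"
      by (intro AE_I2 Bochner_Integration.integrable_bound[OF k_int])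
         (auto simp: f_le, simp add: f_def)
    show "integrable M (\<lambda>a. \<integral>z. norm (f (a, z)) \<partial>lborel)"
    proof (rule integrable_const_bound[of _ "\<integral>z. \<bar>k z\<bar> \<partial>lborel"])
      show "AE a in M. norm (\<integral>z. norm (f (a, z)) \<partial>lborel) \<le> (\<integral>z. \<bar>k z\<bar> \<partial>lborel)"
      proof (intro AE_I2)
        fix a
        have "(\<integral>z. norm (f (a, z)) \<partial>lborel) \<le> (\<integral>z. \<bar>k z\<bar> \<partial>lborel)"
          using k_int f_le by (intro integral_mono') auto
        then show "norm (\<integral>z. norm (f (a, z)) \<partial>lborel) \<le> (\<integral>z. \<bar>k z\<bar> \<partial>lborel)" by simp
      qed
      show "(\<lambda>a. \<integral>z. norm (f (a, z)) \<partial>lborel) \<in> borel_measurable M"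
        using f_meas by measurable
    qed
  qed
  have "(\<integral>a. (a / x) ^ m * exp (- (a / x)) \<partial>M) = (\<integral>a. (\<integral>z. f (a, z) \<partial>lborel) \<partial>M)"
    by (rule integral_cong_AE) (use nonneg f_meas in \<open>auto simp: inner elim!: eventually_mono\<close>)
  also have "\<dots> = (\<integral>z. (\<integral>a. f (a, z) \<partial>M) \<partial>lborel)"
    using Fubini_integral[of "\<lambda>a z. f (a, z)"] f_int by simp
  also have "\<dots> = (\<integral>z. k z * measure M {x * z<..} \<partial>lborel)"
  proof (rule Bochner_Integration.integral_cong[OF refl])
    fix z
    have "(\<integral>a. f (a, z) \<partial>M) = (\<integral>a. k z * indicator {x * z<..} a \<partial>M)"
      by (intro Bochner_Integration.integral_cong) (auto simp: f_def indicator_def)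
    then show "(\<integral>a. f (a, z) \<partial>M) = k z * measure M {x * z<..}" by simp
  qed
  finally show ?thesis by (simp add: k_def)
qed

text \<open>Dominated convergence in the tail formula: the tail ratio tends to
  \<open>z powr (-\<beta>)\<close>, which shifts both Gamma integrals by \<beta>, and \<open>m *
  Gamma (m - \<beta>) - Gamma (m + 1 - \<beta>) = \<beta> * Gamma (m - \<beta>)\<close> by the
  functional equation.\<close>

lemma (in real_distribution) laplace_moment_asymptotics:
  assumes nonneg: "AE a in M. a \<ge> 0" and m: "m \<ge> 1" and \<beta>: "0 < \<beta>" "\<beta> < 1"
    and pos: "\<And>x. measure M {x<..} > 0"
    and rv: "\<And>t. t > 0 \<Longrightarrow> ((\<lambda>x. measure M {t * x<..} / measure M {x<..}) \<longlongrightarrow> t powr (-\<beta>)) at_top"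
  shows "((\<lambda>x. (\<integral>a. (a / x) ^ m * exp (- (a / x)) \<partial>M) / measure M {x<..}) \<longlongrightarrow> \<beta> * Gamma (real m - \<beta>)) at_top"
proof -
  define G where "G x = measure M {x<..}" for x
  define k where "k z = real m * gamma_kernel (real m) z - gamma_kernel (real m + 1) z" for z
  \<comment> \<open>Any exponent strictly between \<beta> and 1 works: above \<beta> for the Potter
    bound, below 1 so that the majorant \<open>gamma_kernel (m - \<gamma>)\<close> is integrable
    even for \<open>m = 1\<close>.\<close>
  define \<gamma> where "\<gamma> = (\<beta> + 1) / 2"
  have \<gamma>: "\<beta> < \<gamma>" "0 < \<gamma>" "\<gamma> < 1" using \<beta> by (auto simp: \<gamma>_def)
  have Gmono: "G y \<le> G x" if "x \<le> y" for x y
    unfolding G_def using that by (intro finite_measure_mono) auto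
  have Gpos: "G x > 0" and Gle: "G x \<le> 1" for x using pos by (auto simp: G_def)
  obtain C x1 where C: "C > 0" "\<And>x y. x \<ge> x1 \<Longrightarrow> 0 < y \<Longrightarrow> y \<le> 1 \<Longrightarrow> G (y * x) / G x \<le> C * y powr (-\<gamma>)"
  proof -
    have "\<exists>C x1. C > 0 \<and> (\<forall>x\<ge>x1. \<forall>y. 0 < y \<and> y \<le> 1 \<longrightarrow> G (y * x) / G x \<le> C * y powr (-\<gamma>))"
      using rv[of 2] \<gamma> by (intro potter_bound[of G \<beta> \<gamma>] Gmono Gpos Gle) (auto simp: G_def)
    then show ?thesis using that by blast
  qed
  have [measurable]: "G \<in> borel_measurable borel"
  proof -
    have "(\<lambda>x. - G x) \<in> borel_measurable borel"
      by (rule borel_measurable_mono) (auto simp: mono_def Gmono)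
    from borel_measurable_uminus[OF this] show ?thesis by simp
  qed
  have [measurable]: "k \<in> borel_measurable borel" unfolding k_def by measurable
  have kabs: "\<bar>k z\<bar> \<le> real m * gamma_kernel (real m) z + gamma_kernel (real m + 1) z" for z
    unfolding k_def by (rule order_trans[OF abs_triangle_ineq4]) (simp add: abs_mult)
  \<comment> \<open>The first summand dominates for \<open>z > 1\<close>, where the tail ratio is at
    most 1; the second dominates for \<open>z \<le> 1\<close> by the Potter bound.\<close>
  define w where "w z = (real m * gamma_kernel (real m) z + gamma_kernel (real m + 1) z) +
     C * (real m * gamma_kernel (real m - \<gamma>) z + gamma_kernel (real m + 1 - \<gamma>) z)" for z
  have lim: "((\<lambda>x. \<integral>z. k z * (G (x * z) / G x) \<partial>lborel) \<longlongrightarrow> (\<integral>z. k z * z powr (-\<beta>) \<partial>lborel)) at_top"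
  proof (rule integral_dominated_convergence_at_top[where w = w])
    show "integrable lborel w"
      unfolding w_def using m \<gamma>
      by (intro Bochner_Integration.integrable_add integrable_mult_right integrable_gamma_kernel) auto
    show "AE z in lborel. ((\<lambda>x. k z * (G (x * z) / G x)) \<longlongrightarrow> k z * z powr (-\<beta>)) at_top"
    proof (intro AE_I2)
      fix z show "((\<lambda>x. k z * (G (x * z) / G x)) \<longlongrightarrow> k z * z powr (-\<beta>)) at_top"
      proof (cases "z > 0")
        case True
        then show ?thesis using rv[OF True] by (intro tendsto_intros) (simp add: G_def mult.commute)
      qed (simp add: k_def gamma_kernel_def)
    qed
    show "eventually (\<lambda>x. AE z in lborel. norm (k z * (G (x * z) / G x)) \<le> w z) at_top"
      using eventually_ge_at_top[of "max x1 1"]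
    proof eventually_elim
      case (elim x)
      show ?case
      proof (intro AE_I2)
        fix z
        have r0: "G (x * z) / G x \<ge> 0" by (intro divide_nonneg_nonneg less_imp_le Gpos)
        consider "z \<le> 0" | "0 < z" "z \<le> 1" | "z > 1" by linarith
        then show "norm (k z * (G (x * z) / G x)) \<le> w z"
        proof cases
          case 1 then show ?thesis using C(1) by (simp add: k_def w_def gamma_kernel_def)
        next
          case 2
          have "norm (k z * (G (x * z) / G x)) \<le> (real m * gamma_kernel (real m) z + gamma_kernel (real m + 1) z) * (C * z powr (-\<gamma>))"
            using kabs[of z] r0 C(2)[of x z] 2 elim
            unfolding real_norm_def abs_mult by (intro mult_mono) (auto simp: mult.commute)
          also have "\<dots> = C * (real m * gamma_kernel (real m - \<gamma>) z + gamma_kernel (real m + 1 - \<gamma>) z)"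
            using gamma_kernel_add[of "real m" "-\<gamma>" z] gamma_kernel_add[of "real m + 1" "-\<gamma>" z]
            by (simp add: algebra_simps)
          also have "\<dots> \<le> w z" unfolding w_def by simp
          finally show ?thesis .
        next
          case 3
          have "x * 1 \<le> x * z" using 3 elim by (intro mult_left_mono) auto
          then have "G (x * z) / G x \<le> 1" using Gmono[of x "x * z"] Gpos[of x] by simp
          then have "norm (k z * (G (x * z) / G x)) \<le> (real m * gamma_kernel (real m) z + gamma_kernel (real m + 1) z) * 1"
            using kabs[of z] r0 unfolding real_norm_def abs_mult by (intro mult_mono) auto
          also have "\<dots> \<le> w z" unfolding w_def using C(1) by simp
          finally show ?thesis .
        qed
      qed
    qed
  qed (auto)
  have "(\<integral>z. k z * z powr (-\<beta>) \<partial>lborel) = (\<integral>z. real m * gamma_kernel (real m - \<beta>) z - gamma_kernel (real m + 1 - \<beta>) z \<partial>lborel)"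
    using gamma_kernel_add[of "real m" "-\<beta>"] gamma_kernel_add[of "real m + 1" "-\<beta>"]
    by (simp add: k_def algebra_simps)
  also have "\<dots> = real m * Gamma (real m - \<beta>) - Gamma (real m + 1 - \<beta>)"
    using m \<beta> by (subst Bochner_Integration.integral_diff) (auto simp: integrable_gamma_kernel integral_gamma_kernel)
  also have "\<dots> = \<beta> * Gamma (real m - \<beta>)"
  proof -
    have "real m - \<beta> \<notin> \<int>\<^sub>\<le>\<^sub>0" using m \<beta> by (auto elim!: nonpos_Ints_cases)
    from Gamma_plus1[OF this] show ?thesis by (simp add: algebra_simps)
  qed
  finally have val: "(\<integral>z. k z * z powr (-\<beta>) \<partial>lborel) = \<beta> * Gamma (real m - \<beta>)" .
  have ev: "eventually (\<lambda>x. (\<integral>z. k z * (G (x * z) / G x) \<partial>lborel) = (\<integral>a. (a / x) ^ m * exp (- (a / x)) \<partial>M) / G x) at_top"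
    using eventually_gt_at_top[of 0]
  proof eventually_elim
    case (elim x)
    show ?case
      unfolding laplace_moment_eq_tail_integral[OF nonneg m elim]
      by (simp add: k_def G_def flip: integral_divide_zero)
  qed
  from Lim_transform_eventually[OF lim ev] show ?thesis by (simp add: val G_def)
qed

text \<open>\<open>A i0 / sum A\<close> is \<open>0\<close> when the sum vanishes.\<close>

lemma (in prob_space) moment_of_normalized_summand:
  assumes I: "finite I" "i0 \<in> I" and ind: "indep_vars (\<lambda>_. borel) A I"
    and id: "\<And>i. i \<in> I \<Longrightarrow> distr M borel (A i) = N"
    and nn: "\<And>i \<omega>. (A i \<omega> :: real) \<ge> 0" and m: "m \<ge> 1"
  shows "ennreal (Gamma (real m) * (\<integral>\<omega>. (A i0 \<omega> / (\<Sum>i\<in>I. A i \<omega>)) ^ m \<partial>M)) =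
    (\<integral>\<^sup>+s. ennreal (indicator {0<..} s * (s ^ (m - 1) * (\<integral>a. a ^ m * exp (- (s * a)) \<partial>N)
        * (\<integral>a. exp (- (s * a)) \<partial>N) ^ (card I - 1))) \<partial>lborel)"
proof -
  have meas: "A i \<in> borel_measurable M" if "i \<in> I" for i using ind that by (auto simp: indep_vars_def)
  define S where "S \<omega> = (\<Sum>i\<in>I. A i \<omega>)" for \<omega>
  have [measurable]: "A i0 \<in> borel_measurable M" "S \<in> borel_measurable M"
    unfolding S_def using meas I by (auto intro!: borel_measurable_sum)
  have AS: "0 \<le> A i0 \<omega>" "A i0 \<omega> \<le> S \<omega>" for \<omega>
    using nn I by (auto simp: S_def intro!: member_le_sum)
  have R01: "0 \<le> A i0 \<omega> / S \<omega>" "A i0 \<omega> / S \<omega> \<le> 1" for \<omega>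
    using AS[of \<omega>] by (auto simp: divide_le_eq_1)
  \<comment> \<open>The substitution \<open>z = S \<omega> * s\<close> in the Gamma integral turns
    division by a power of the sum into an exponential of the sum, which factorizes by
    independence.\<close>
  have inner: "(\<integral>\<^sup>+s. ennreal (indicator {0<..} s * (s ^ (m - 1) * (A i0 \<omega> ^ m * exp (- (s * S \<omega>))))) \<partial>lborel)
     = ennreal (Gamma (real m) * (A i0 \<omega> / S \<omega>) ^ m)" for \<omega>
  proof (cases "A i0 \<omega> = 0")
    case True
    then show ?thesis using m by (simp add: power_0_left)
  next
    case False
    then have S: "S \<omega> > 0" using AS[of \<omega>] by linarith
    have "ennreal (Gamma (real m)) = (\<integral>\<^sup>+z. ennreal (gamma_kernel (real m) z) \<partial>lborel)"
      using has_bochner_integral_gamma_kernel[of "real m"] m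
      by (subst nn_integral_eq_integral) (auto simp: integrable_gamma_kernel integral_gamma_kernel)
    also have "\<dots> = ennreal (S \<omega>) * (\<integral>\<^sup>+s. ennreal (gamma_kernel (real m) (0 + S \<omega> * s)) \<partial>lborel)"
      using S by (subst nn_integral_real_affine[of _ "S \<omega>" 0]) auto
    also have "\<dots> = (\<integral>\<^sup>+s. ennreal (S \<omega> * gamma_kernel (real m) (S \<omega> * s)) \<partial>lborel)"
      using S by (subst nn_integral_cmult[symmetric]) (auto simp: ennreal_mult)
    finally have "ennreal ((A i0 \<omega> / S \<omega>) ^ m) * ennreal (Gamma (real m)) =
        ennreal ((A i0 \<omega> / S \<omega>) ^ m) * (\<integral>\<^sup>+s. ennreal (S \<omega> * gamma_kernel (real m) (S \<omega> * s)) \<partial>lborel)" by simp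
    also have "\<dots> = (\<integral>\<^sup>+s. ennreal ((A i0 \<omega> / S \<omega>) ^ m * (S \<omega> * gamma_kernel (real m) (S \<omega> * s))) \<partial>lborel)"
      using R01 by (subst nn_integral_cmult[symmetric]) (auto simp: ennreal_mult')
    also have "\<dots> = (\<integral>\<^sup>+s. ennreal (indicator {0<..} s * (s ^ (m - 1) * (A i0 \<omega> ^ m * exp (- (s * S \<omega>))))) \<partial>lborel)"
    proof (intro nn_integral_cong arg_cong[where f = ennreal])
      fix s :: real
      show "(A i0 \<omega> / S \<omega>) ^ m * (S \<omega> * gamma_kernel (real m) (S \<omega> * s)) =
        indicator {0<..} s * (s ^ (m - 1) * (A i0 \<omega> ^ m * exp (- (s * S \<omega>))))"
      proof (cases "s > 0")
        case True
        have "(S \<omega> * s) powr (real m - 1) = S \<omega> ^ (m - 1) * s ^ (m - 1)"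
          using True S m by (simp add: powr_realpow[symmetric] of_nat_diff powr_mult)
        moreover have "S \<omega> * S \<omega> ^ (m - 1) = S \<omega> ^ m" using m by (simp flip: power_Suc)
        ultimately show ?thesis using True S
          by (simp add: gamma_kernel_def power_divide field_simps)
      next
        case False
        then show ?thesis using S by (simp add: gamma_kernel_def mult_le_0_iff not_less)
      qed
    qed
    finally show ?thesis using R01 m by (simp add: ennreal_mult' mult.commute Gamma_real_nonneg)
  qed
  have outer: "(\<integral>\<^sup>+\<omega>. ennreal (A i0 \<omega> ^ m * exp (- (s * S \<omega>))) \<partial>M) =
     ennreal ((\<integral>a. a ^ m * exp (- (s * a)) \<partial>N) * (\<integral>a. exp (- (s * a)) \<partial>N) ^ (card I - 1))" if s: "s > 0" for s
  proof -
    define g where "g i a = (if i = i0 then a ^ m * exp (- (s * a)) else exp (- (s * a)))" for i and a :: real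
    have gm [measurable]: "g i \<in> borel_measurable borel" for i unfolding g_def by measurable
    have "(\<integral>\<^sup>+\<omega>. ennreal (A i0 \<omega> ^ m * exp (- (s * S \<omega>))) \<partial>M) = (\<integral>\<^sup>+\<omega>. (\<Prod>i\<in>I. ennreal (g i (A i \<omega>))) \<partial>M)"
    proof (intro nn_integral_cong)
      fix \<omega>
      have "(\<Prod>i\<in>I. g i (A i \<omega>)) = g i0 (A i0 \<omega>) * (\<Prod>i\<in>I - {i0}. exp (- (s * A i \<omega>)))"
        using I by (subst prod.remove[of I i0]) (auto simp: g_def intro!: prod.cong)
      also have "\<dots> = A i0 \<omega> ^ m * (\<Prod>i\<in>I. exp (- (s * A i \<omega>)))"
        using I by (subst prod.remove[of I i0]) (auto simp: g_def)
      also have "(\<Prod>i\<in>I. exp (- (s * A i \<omega>))) = exp (- (s * S \<omega>))"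
        using I by (simp add: S_def exp_sum[symmetric] sum_distrib_left sum_negf)
      finally show "ennreal (A i0 \<omega> ^ m * exp (- (s * S \<omega>))) = (\<Prod>i\<in>I. ennreal (g i (A i \<omega>)))"
        using nn by (subst prod_ennreal) (auto simp: g_def)
    qed
    also have "\<dots> = (\<Prod>i\<in>I. \<integral>\<^sup>+\<omega>. ennreal (g i (A i \<omega>)) \<partial>M)"
    proof (rule indep_vars_nn_integral[OF I(1)])
      show "indep_vars (\<lambda>_. borel) (\<lambda>i \<omega>. ennreal (g i (A i \<omega>))) I"
        by (rule indep_vars_compose2[OF ind]) measurable
    qed auto
    also have "\<dots> = (\<Prod>i\<in>I. ennreal (\<integral>a. g i a \<partial>N))"
    proof (rule prod.cong[OF refl])
      fix i assume i: "i \<in> I"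
      have bd: "norm (g i (A i \<omega>)) \<le> max 1 (fact m / s ^ m)" for \<omega>
      proof -
        have a: "A i \<omega> \<ge> 0" using nn by simp
        have e1: "exp (- (s * A i \<omega>)) \<le> 1" using a s by simp
        \<comment> \<open>A single term of the exponential series bounds
          \<open>a ^ m * exp (- (s * a))\<close> uniformly in \<open>a\<close>.\<close>
        have "(s * A i \<omega>) ^ m / fact m \<le> exp (s * A i \<omega>)"
        proof -
          have "(\<Sum>k\<in>{m}. (s * A i \<omega>) ^ k / fact k) \<le> (\<Sum>k. (s * A i \<omega>) ^ k / fact k)"
            using a s summable_exp[of "s * A i \<omega>"]
            by (intro sum_le_suminf) (auto simp: field_simps)
          then show ?thesis by (simp add: exp_def divide_inverse mult.commute)
        qed
        then have "A i \<omega> ^ m * exp (- (s * A i \<omega>)) \<le> fact m / s ^ m"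
          using s by (simp add: exp_minus power_mult_distrib field_simps)
        then show ?thesis using e1 a by (auto simp: g_def le_max_iff_disj)
      qed
      have [measurable]: "A i \<in> borel_measurable M" using meas i .
      have "integrable M (\<lambda>\<omega>. g i (A i \<omega>))"
        by (rule integrable_const_bound[of _ "max 1 (fact m / s ^ m)"]) (use bd in auto)
      then have "(\<integral>\<^sup>+\<omega>. ennreal (g i (A i \<omega>)) \<partial>M) = ennreal (\<integral>\<omega>. g i (A i \<omega>) \<partial>M)"
        by (rule nn_integral_eq_integral) (use nn in \<open>auto simp: g_def\<close>)
      also have "(\<integral>\<omega>. g i (A i \<omega>) \<partial>M) = (\<integral>a. g i a \<partial>N)"
        using id[OF i] integral_distr[of "A i" M borel "g i"] by simp
      finally show "(\<integral>\<^sup>+\<omega>. ennreal (g i (A i \<omega>)) \<partial>M) = ennreal (\<integral>a. g i a \<partial>N)" .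
    qed
    also have "\<dots> = ennreal (\<Prod>i\<in>I. \<integral>a. g i a \<partial>N)"
    proof (rule prod_ennreal)
      fix i assume i: "i \<in> I"
      have [measurable]: "A i \<in> borel_measurable M" using meas i .
      have "(\<integral>a. g i a \<partial>N) = (\<integral>\<omega>. g i (A i \<omega>) \<partial>M)"
        using id[OF i] integral_distr[of "A i" M borel "g i"] by simp
      also have "\<dots> \<ge> 0" using nn by (auto simp: g_def)
      finally show "(\<integral>a. g i a \<partial>N) \<ge> 0" .
    qed
    also have "(\<Prod>i\<in>I. \<integral>a. g i a \<partial>N) = (\<integral>a. g i0 a \<partial>N) * (\<Prod>i\<in>I - {i0}. \<integral>a. g i a \<partial>N)"
      using I by (rule prod.remove)
    also have "(\<Prod>i\<in>I - {i0}. \<integral>a. g i a \<partial>N) = (\<Prod>i\<in>I - {i0}. \<integral>a. exp (- (s * a)) \<partial>N)"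
      by (intro prod.cong) (auto simp: g_def)
    finally show ?thesis using I by (simp add: g_def)
  qed
  have "ennreal (Gamma (real m) * (\<integral>\<omega>. (A i0 \<omega> / S \<omega>) ^ m \<partial>M)) =
    (\<integral>\<^sup>+\<omega>. ennreal (Gamma (real m) * (A i0 \<omega> / S \<omega>) ^ m) \<partial>M)"
  proof (subst nn_integral_eq_integral)
    show "integrable M (\<lambda>\<omega>. Gamma (real m) * (A i0 \<omega> / S \<omega>) ^ m)"
      using R01 by (intro integrable_mult_right integrable_const_bound[of _ 1]) (auto intro!: power_le_one)
  qed (use R01 m in \<open>auto simp: Gamma_real_nonneg\<close>)
  also have "\<dots> = (\<integral>\<^sup>+\<omega>. (\<integral>\<^sup>+s. ennreal (indicator {0<..} s * (s ^ (m - 1) * (A i0 \<omega> ^ m * exp (- (s * S \<omega>))))) \<partial>lborel) \<partial>M)"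
    by (simp only: inner)
  also have "\<dots> = (\<integral>\<^sup>+s. (\<integral>\<^sup>+\<omega>. ennreal (indicator {0<..} s * (s ^ (m - 1) * (A i0 \<omega> ^ m * exp (- (s * S \<omega>))))) \<partial>M) \<partial>lborel)"
  proof -
    interpret P: pair_sigma_finite lborel M ..
    show ?thesis by (rule P.Fubini') measurable
  qed
  also have "\<dots> = (\<integral>\<^sup>+s. ennreal (indicator {0<..} s * (s ^ (m - 1) * (\<integral>a. a ^ m * exp (- (s * a)) \<partial>N)
        * (\<integral>a. exp (- (s * a)) \<partial>N) ^ (card I - 1))) \<partial>lborel)"
  proof (intro nn_integral_cong)
    fix s :: real
    show "(\<integral>\<^sup>+\<omega>. ennreal (indicator {0<..} s * (s ^ (m - 1) * (A i0 \<omega> ^ m * exp (- (s * S \<omega>))))) \<partial>M) =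
      ennreal (indicator {0<..} s * (s ^ (m - 1) * (\<integral>a. a ^ m * exp (- (s * a)) \<partial>N)
        * (\<integral>a. exp (- (s * a)) \<partial>N) ^ (card I - 1)))"
    proof (cases "s > 0")
      case True
      have "(\<integral>\<^sup>+\<omega>. ennreal (indicator {0<..} s * (s ^ (m - 1) * (A i0 \<omega> ^ m * exp (- (s * S \<omega>))))) \<partial>M) =
        ennreal (s ^ (m - 1)) * (\<integral>\<^sup>+\<omega>. ennreal (A i0 \<omega> ^ m * exp (- (s * S \<omega>))) \<partial>M)"
        using True by (subst nn_integral_cmult[symmetric]) (auto simp: ennreal_mult')
      then show ?thesis using True by (simp add: outer ennreal_mult'[symmetric] mult_ac)
    qed simp
  qed
  finally show ?thesis by (simp add: S_def)
qed

section \<open>Limits of the moments of a normalized summand\<close>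

text \<open>The factor \<open>\<phi> s ^ (n - 1)\<close> concentrates the integral at
  \<open>s = 0\<close> as \<open>n\<close> grows, and there \<open>D m\<close> is close to
  \<open>c * D 1\<close>. The case \<open>m = 1\<close>, whose limit is assumed, thus determines all
  the others.\<close>

lemma normalized_moment_limit:
  fixes D :: "nat \<Rightarrow> real \<Rightarrow> real" and \<phi> :: "real \<Rightarrow> real" and K :: "nat \<Rightarrow> nat \<Rightarrow> real"
  assumes K: "\<And>m n. m \<ge> 1 \<Longrightarrow> n \<ge> 1 \<Longrightarrow> ennreal (Gamma (real m) * K m n) =
      (\<integral>\<^sup>+s. ennreal (indicator {0<..} s * (D m s * \<phi> s ^ (n - 1))) \<partial>lborel)"
    and Dnn: "\<And>m s. s > 0 \<Longrightarrow> D m s \<ge> 0"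
    and Dm [measurable]: "\<And>m. D m \<in> borel_measurable borel" and phim [measurable]: "\<phi> \<in> borel_measurable borel"
    and phi: "\<And>s. s > 0 \<Longrightarrow> 0 \<le> \<phi> s \<and> \<phi> s < 1" "\<And>s t. 0 < s \<Longrightarrow> s \<le> t \<Longrightarrow> \<phi> t \<le> \<phi> s"
    and Knn: "\<And>m n. K m n \<ge> 0"
    and K1: "(\<lambda>n. real n * K 1 n) \<longlonglongrightarrow> 1"
    and ratio: "eventually (\<lambda>s. D 1 s > 0) (at_right 0)" "((\<lambda>s. D m s / D 1 s) \<longlongrightarrow> c) (at_right 0)"
    and m: "m \<ge> 1" and c: "c \<ge> 0"
  shows "(\<lambda>n. real n * K m n) \<longlonglongrightarrow> c / Gamma (real m)"
proof -
  define J where "J m n = Gamma (real m) * (real n * K m n)" for m n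
  have Gpos: "Gamma (real m) > 0" if "m \<ge> 1" for m using that by (auto intro: Gamma_real_pos)
  have J: "ennreal (J m n) = (\<integral>\<^sup>+s. ennreal (indicator {0<..} s * (real n * D m s * \<phi> s ^ (n - 1))) \<partial>lborel)"
    if "m \<ge> 1" "n \<ge> 1" for m n
  proof -
    have "ennreal (J m n) = ennreal (real n) * ennreal (Gamma (real m) * K m n)"
      using Gpos[OF that(1)] Knn by (simp add: J_def ennreal_mult'[symmetric] mult_ac)
    also have "\<dots> = (\<integral>\<^sup>+s. ennreal (real n) * ennreal (indicator {0<..} s * (D m s * \<phi> s ^ (n - 1))) \<partial>lborel)"
      unfolding K[OF that] by (subst nn_integral_cmult) auto
    finally show ?thesis by (simp add: ennreal_mult'[symmetric] mult_ac)
  qed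
  have Jnn: "J m n \<ge> 0" if "m \<ge> 1" for m n using Gpos[OF that] Knn by (simp add: J_def)
  text \<open>The error term comes from \<open>s \<ge> \<delta>\<close> and decays geometrically in \<open>n\<close>.\<close>
  have cmp: "a * J m1 n \<le> b * J m2 n + a * (real n * \<phi> \<delta> ^ (n - 1) * J m1 1)"
    if le: "\<And>s. 0 < s \<Longrightarrow> s < \<delta> \<Longrightarrow> a * D m1 s \<le> b * D m2 s" and ab: "a \<ge> 0" "b \<ge> 0" and \<delta>: "\<delta> > 0"
      and n: "n \<ge> 1" and m12: "m1 \<ge> 1" "m2 \<ge> 1" for a b \<delta> m1 m2 n
  proof -
    have pw: "a * (indicator {0<..} s * (real n * D m1 s * \<phi> s ^ (n - 1))) \<le>
       b * (indicator {0<..} s * (real n * D m2 s * \<phi> s ^ (n - 1))) +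
       a * (real n * \<phi> \<delta> ^ (n - 1)) * (indicator {0<..} s * (real 1 * D m1 s * \<phi> s ^ (1 - 1)))" for s
    proof (cases "s > 0")
      case True
      have nn: "0 \<le> real n * \<phi> s ^ (n - 1)" "0 \<le> real n * \<phi> \<delta> ^ (n - 1)" using phi(1) True \<delta> by auto
      show ?thesis
      proof (cases "s < \<delta>")
        case less: True
        have "(a * D m1 s) * (real n * \<phi> s ^ (n - 1)) \<le> (b * D m2 s) * (real n * \<phi> s ^ (n - 1))"
          using le[OF True less] nn by (intro mult_right_mono)
        moreover have "0 \<le> a * (real n * \<phi> \<delta> ^ (n - 1)) * D m1 s" using ab nn Dnn[OF True] by simp
        ultimately show ?thesis using True by (simp add: mult_ac)
      next
        case False
        have "\<phi> s ^ (n - 1) \<le> \<phi> \<delta> ^ (n - 1)" using False True phi \<delta> by (intro power_mono) auto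
        then have "a * (real n * D m1 s) * \<phi> s ^ (n - 1) \<le> a * (real n * D m1 s) * \<phi> \<delta> ^ (n - 1)"
          using ab Dnn[OF True] by (intro mult_left_mono) auto
        moreover have "0 \<le> b * (D m2 s * (real n * \<phi> s ^ (n - 1)))" using ab nn Dnn[OF True] by simp
        ultimately show ?thesis using True by (simp add: mult_ac)
      qed
    qed simp
    have nn: "0 \<le> indicator {0<..} s * (real k * D l s * \<phi> s ^ (k - 1))" for k l s
      using Dnn phi(1) by (auto simp: indicator_def)
    have \<phi>\<delta>: "0 \<le> \<phi> \<delta>" using phi(1)[OF \<delta>] by simp
    then have p\<delta>: "0 \<le> real n * \<phi> \<delta> ^ (n - 1)" by simp
    define u where "u l k s = indicator {0<..} s * (real k * D l s * \<phi> s ^ (k - 1))" for l k s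
    have um [measurable]: "u l k \<in> borel_measurable borel" for l k unfolding u_def by measurable
    have unn: "0 \<le> u l k s" for l k s using nn by (simp add: u_def)
    have Ju: "ennreal (J l k) = (\<integral>\<^sup>+s. ennreal (u l k s) \<partial>lborel)" if "l \<ge> 1" "k \<ge> 1" for l k
      using J[OF that] by (simp add: u_def)
    have cJ: "ennreal (t * J l k) = (\<integral>\<^sup>+s. ennreal (t * u l k s) \<partial>lborel)" if "t \<ge> 0" "l \<ge> 1" "k \<ge> 1" for t l k
      using that by (simp add: ennreal_mult' Ju nn_integral_cmult)
    have "ennreal (a * J m1 n) = (\<integral>\<^sup>+s. ennreal (a * u m1 n s) \<partial>lborel)"
      using ab n m12 by (intro cJ)
    also have "\<dots> \<le> (\<integral>\<^sup>+s. ennreal (b * u m2 n s) + ennreal (a * (real n * \<phi> \<delta> ^ (n - 1)) * u m1 1 s) \<partial>lborel)"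
    proof (intro nn_integral_mono)
      fix s
      have "ennreal (a * u m1 n s) \<le> ennreal (b * u m2 n s + a * (real n * \<phi> \<delta> ^ (n - 1)) * u m1 1 s)"
        using pw[of s] by (intro ennreal_leI) (simp add: u_def)
      then show "ennreal (a * u m1 n s) \<le> ennreal (b * u m2 n s) + ennreal (a * (real n * \<phi> \<delta> ^ (n - 1)) * u m1 1 s)"
        using ab p\<delta> unn by (subst ennreal_plus[symmetric]) (auto intro!: mult_nonneg_nonneg)
    qed
    also have "\<dots> = ennreal (b * J m2 n) + ennreal (a * (real n * \<phi> \<delta> ^ (n - 1)) * J m1 1)"
      using ab p\<delta> n m12 by (subst nn_integral_add) (auto simp: cJ)
    also have "\<dots> = ennreal (b * J m2 n + a * (real n * \<phi> \<delta> ^ (n - 1) * J m1 1))"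
      using ab \<phi>\<delta> Jnn m12 by (subst ennreal_plus[symmetric]) (auto simp: mult_ac intro!: mult_nonneg_nonneg)
    finally show ?thesis
      using ab \<phi>\<delta> Jnn m12 by (subst (asm) ennreal_le_iff) (auto intro!: add_nonneg_nonneg mult_nonneg_nonneg)
  qed
  have J1: "J 1 \<longlonglongrightarrow> 1" using K1 by (simp add: J_def[abs_def])
  have "J m \<longlonglongrightarrow> c"
  proof (rule LIMSEQ_I)
    fix r :: real assume r: "r > 0"
    define e where "e = r / 4"
    have e: "e > 0" using r by (simp add: e_def)
    have "eventually (\<lambda>s. dist (D m s / D 1 s) c < e \<and> D 1 s > 0) (at_right 0)"
      using tendstoD[OF ratio(2) e] ratio(1) by eventually_elim auto
    then obtain \<delta> where \<delta>: "\<delta> > 0" "\<And>s. 0 < s \<Longrightarrow> s < \<delta> \<Longrightarrow> dist (D m s / D 1 s) c < e \<and> D 1 s > 0"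
      by (auto simp: eventually_at_right_field)
    have up: "1 * D m s \<le> (c + e) * D 1 s" and lo: "c * D 1 s \<le> 1 * D m s + e * D 1 s" if "0 < s" "s < \<delta>" for s
    proof -
      have "D 1 s > 0" "\<bar>D m s / D 1 s - c\<bar> < e" using \<delta>(2)[OF that] by (auto simp: dist_real_def)
      then have "D m s / D 1 s < c + e" "c - e < D m s / D 1 s" by auto
      with \<open>D 1 s > 0\<close> show "1 * D m s \<le> (c + e) * D 1 s" "c * D 1 s \<le> 1 * D m s + e * D 1 s"
        by (auto simp: field_simps)
    qed
    have geo: "(\<lambda>n. real n * \<phi> \<delta> ^ (n - 1)) \<longlonglongrightarrow> 0"
    proof -
      have "(\<lambda>n. real (Suc n) * \<phi> \<delta> ^ n) \<longlonglongrightarrow> 0 + 0"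
        unfolding of_nat_Suc distrib_right using phi(1)[OF \<delta>(1)]
        by (intro tendsto_add) (auto intro!: powser_times_n_limit_0 LIMSEQ_realpow_zero)
      then show ?thesis by (subst filterlim_sequentially_Suc[symmetric]) simp
    qed
    have g0: "(\<lambda>n. real n * \<phi> \<delta> ^ (n - 1) * J l 1) \<longlonglongrightarrow> 0" for l
      using tendsto_mult_left_zero[OF geo] by simp
    have A: "eventually (\<lambda>n. (c + e) * J 1 n < c + 2 * e) sequentially"
      using e c by (intro order_tendstoD(2)[of _ "(c + e) * 1"] tendsto_intros J1) auto
    have B: "eventually (\<lambda>n. c - 2 * e < (c - e) * J 1 n) sequentially"
      using e by (intro order_tendstoD(1)[of _ "(c - e) * 1"] tendsto_intros J1) auto
    have "eventually (\<lambda>n. real n * \<phi> \<delta> ^ (n - 1) * J m 1 < e \<and> c * (real n * \<phi> \<delta> ^ (n - 1) * J 1 1) < e) sequentially"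
      using order_tendstoD(2)[OF g0[of m] e] order_tendstoD(2)[OF tendsto_mult_right_zero[OF g0[of 1], of c] e]
      by eventually_elim auto
    with A B eventually_ge_at_top[of 1] have "eventually (\<lambda>n. norm (J m n - c) < r) sequentially"
    proof eventually_elim
      case (elim n)
      have "1 * J m n \<le> (c + e) * J 1 n + 1 * (real n * \<phi> \<delta> ^ (n - 1) * J m 1)"
        by (rule cmp[OF up]) (use c e \<delta> elim m in auto)
      then have upper: "J m n < c + 3 * e" using elim by linarith
      have lower: "c - 3 * e < J m n"
      \<comment> \<open>The comparison requires a nonnegative coefficient; if \<open>c - e\<close>
        is negative, the claim follows from \<open>J m n \<ge> 0\<close>.\<close>
      proof (cases "c - e \<ge> 0")
        case True
        have "(c - e) * J 1 n \<le> 1 * J m n + (c - e) * (real n * \<phi> \<delta> ^ (n - 1) * J 1 1)"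
          by (rule cmp) (use lo c e \<delta> elim m True in \<open>auto simp: algebra_simps\<close>)
        also have "(c - e) * (real n * \<phi> \<delta> ^ (n - 1) * J 1 1) \<le> c * (real n * \<phi> \<delta> ^ (n - 1) * J 1 1)"
          using e Jnn[of 1] phi(1)[OF \<delta>(1)] by (intro mult_right_mono) auto
        finally show ?thesis using elim by linarith
      next
        case False
        then show ?thesis using Jnn[OF m, of n] e by linarith
      qed
      show ?case using upper lower r by (simp add: e_def abs_less_iff)
    qed
    then show "\<exists>no. \<forall>n\<ge>no. norm (J m n - c) < r" by (auto simp: eventually_sequentially)
  qed
  then have "(\<lambda>n. J m n / Gamma (real m)) \<longlonglongrightarrow> c / Gamma (real m)"
    using Gpos[OF m] by (intro tendsto_intros) auto
  then show ?thesis using Gpos[OF m] by (simp add: J_def)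
qed

text \<open>The ratios over a row add up to 1 unless the whole row vanishes, so exchangeability
  gives the first moment exactly. The Laplace asymptotics at \<open>s = 1 / x\<close> supply the
  ratio of the other moments to it, in which the tail probability cancels.\<close>

lemma (in prob_space) normalized_summand_moment_limit:
  fixes A :: "nat \<Rightarrow> 'a \<Rightarrow> real"
  assumes ind: "indep_vars (\<lambda>_. borel) A {1..}"
    and id: "\<And>i. i \<ge> 1 \<Longrightarrow> distr M borel (A i) = N"
    and nn: "\<And>i \<omega>. A i \<omega> \<ge> 0" and m: "m \<ge> 1" and \<beta>: "0 < \<beta>" "\<beta> < 1"
    and pos: "\<And>x. measure N {x<..} > 0"
    and rv: "\<And>t. t > 0 \<Longrightarrow> ((\<lambda>x. measure N {t * x<..} / measure N {x<..}) \<longlongrightarrow> t powr (-\<beta>)) at_top"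
  shows "(\<lambda>n. real n * (\<integral>\<omega>. (A 1 \<omega> / (\<Sum>i=1..n. A i \<omega>)) ^ m \<partial>M)) \<longlonglongrightarrow>
     Gamma (real m - \<beta>) / (Gamma (1 - \<beta>) * Gamma (real m))"
proof -
  have meas: "A i \<in> borel_measurable M" if "i \<ge> 1" for i using ind that by (auto simp: indep_vars_def)
  have N: "N = distr M borel (A 1)" using id[of 1] by simp
  interpret N: real_distribution N
    unfolding N using meas[of 1] by (intro real_distribution_distr) auto
  have nonneg: "AE a in N. a \<ge> 0" unfolding N using meas[of 1] nn by (subst AE_distr_iff) auto
  have indn: "indep_vars (\<lambda>_. borel) A {1..n}" for n using indep_vars_subset[OF ind, of "{1..n}"] by auto
  define E where "E m s = (\<integral>a. a ^ m * exp (- (s * a)) \<partial>N)" for m :: nat and s :: real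
  define D where "D m s = s ^ (m - 1) * E m s" for m s
  define \<phi> where "\<phi> s = (\<integral>a. exp (- (s * a)) \<partial>N)" for s :: real
  define R where "R i m n = (\<integral>\<omega>. (A i \<omega> / (\<Sum>i=1..n. A i \<omega>)) ^ m \<partial>M)" for i m n
  have Enn: "E m s \<ge> 0" for m s
    unfolding E_def by (intro integral_nonneg_AE) (use nonneg in auto)
  have mom: "ennreal (Gamma (real l) * R i l n) =
      (\<integral>\<^sup>+s. ennreal (indicator {0<..} s * (D l s * \<phi> s ^ (n - 1))) \<partial>lborel)" if "l \<ge> 1" "1 \<le> i" "i \<le> n" for l i n
    using moment_of_normalized_summand[of "{1..n}" i A N l] that indn[of n] id nn
    by (simp add: R_def D_def E_def \<phi>_def mult.assoc)
  have Rnn: "R i l n \<ge> 0" for i l n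
    unfolding R_def using nn by (intro integral_nonneg_AE AE_I2 zero_le_power divide_nonneg_nonneg sum_nonneg)
  \<comment> \<open>The integral formula for the moment does not mention the index
    \<open>i\<close>.\<close>
  have Req: "R i l n = R 1 l n" if "l \<ge> 1" "1 \<le> i" "i \<le> n" for i l n
  proof -
    have "ennreal (Gamma (real l) * R i l n) = ennreal (Gamma (real l) * R 1 l n)"
      using mom[OF that] mom[of l 1 n] that by simp
    moreover have "Gamma (real l) > 0" using that by (intro Gamma_real_pos) auto
    ultimately show ?thesis using Rnn by (subst (asm) ennreal_inj) auto
  qed
  define p0 where "p0 = prob (A 1 -` {0} \<inter> space M)"
  have p0: "0 \<le> p0" "p0 < 1"
  proof -
    have "measure N {0<..} \<le> measure N (- {0})" by (intro N.finite_measure_mono) auto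
    also have "measure N (- {0}) = 1 - measure N {0}"
      using N.prob_compl[of "{0}"] by (simp add: Compl_eq_Diff_UNIV)
    also have "measure N {0} = p0" using meas[of 1] by (simp add: N measure_distr p0_def)
    finally show "p0 < 1" using pos[of 0] by linarith
  qed (simp add: p0_def)
  \<comment> \<open>The deficit \<open>p0 ^ n\<close> is the probability that all \<open>n\<close>
    summands vanish, in which case the quotients are 0 by convention.\<close>
  have R1: "real n * R 1 1 n = 1 - p0 ^ n" if n: "n \<ge> 1" for n
  proof -
    define S where "S \<omega> = (\<Sum>i=1..n. A i \<omega>)" for \<omega>
    have Sm [measurable]: "S \<in> borel_measurable M" unfolding S_def using meas by (intro borel_measurable_sum) auto
    have int: "integrable M (\<lambda>\<omega>. A i \<omega> / S \<omega>)" if i: "i \<in> {1..n}" for i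
    proof (rule integrable_const_bound[of _ 1])
      show "AE \<omega> in M. norm (A i \<omega> / S \<omega>) \<le> 1"
      proof (intro AE_I2)
        fix \<omega>
        have "A i \<omega> \<le> S \<omega>" unfolding S_def using i nn by (intro member_le_sum) auto
        then show "norm (A i \<omega> / S \<omega>) \<le> 1" using nn[of i \<omega>] by (auto simp: divide_le_eq_1)
      qed
    qed (use meas i in auto)
    have zero: "{\<omega> \<in> space M. S \<omega> = 0} = (\<Inter>i\<in>{1..n}. A i -` {0} \<inter> space M)"
      using nn n by (auto simp: S_def sum_nonneg_eq_0_iff)
    have "(\<Sum>i=1..n. R i 1 n) = (\<Sum>i=1..n. R 1 1 n)" by (intro sum.cong refl Req) auto
    then have "real n * R 1 1 n = (\<Sum>i=1..n. R i 1 n)" by simp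
    also have "\<dots> = (\<integral>\<omega>. (\<Sum>i=1..n. A i \<omega> / S \<omega>) \<partial>M)"
      using int by (subst Bochner_Integration.integral_sum) (auto simp: R_def S_def)
    also have "\<dots> = (\<integral>\<omega>. 1 - indicator {\<omega> \<in> space M. S \<omega> = 0} \<omega> \<partial>M)"
      by (intro Bochner_Integration.integral_cong)
         (auto simp: sum_divide_distrib[symmetric] indicator_def S_def)
    also have "\<dots> = 1 - prob {\<omega> \<in> space M. S \<omega> = 0}"
      by (subst Bochner_Integration.integral_diff)
         (auto simp: prob_space intro!: integrable_real_indicator simp: emeasure_eq_measure)
    also have "prob {\<omega> \<in> space M. S \<omega> = 0} = (\<Prod>i\<in>{1..n}. prob (A i -` {0} \<inter> space M))"
      unfolding zero using n by (intro indep_varsD[OF indn]) auto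
    also have "\<dots> = (\<Prod>i\<in>{1..n}. p0)"
    proof (rule prod.cong[OF refl])
      fix i assume "i \<in> {1..n}"
      then have "measure (distr M borel (A i)) {0} = measure (distr M borel (A 1)) {0}" using id by simp
      then show "prob (A i -` {0} \<inter> space M) = p0"
        using meas \<open>i \<in> {1..n}\<close> by (simp add: measure_distr p0_def)
    qed
    finally show ?thesis by simp
  qed
  have "(\<lambda>n. 1 - p0 ^ n) \<longlonglongrightarrow> 1 - 0" using p0 by (intro tendsto_intros LIMSEQ_realpow_zero)
  moreover have "eventually (\<lambda>n. 1 - p0 ^ n = real n * R 1 1 n) sequentially"
    using eventually_ge_at_top[of 1] by eventually_elim (simp only: R1)
  ultimately have K1: "(\<lambda>n. real n * R 1 1 n) \<longlonglongrightarrow> 1"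
    using Lim_transform_eventually by fastforce
  have em [measurable]: "E m \<in> borel_measurable borel" for m
    unfolding E_def by (rule N.borel_measurable_lebesgue_integral) measurable
  have asym: "((\<lambda>x. (inverse x ^ l * E l (inverse x)) / measure N {x<..}) \<longlongrightarrow> \<beta> * Gamma (real l - \<beta>)) at_top"
    if "l \<ge> 1" for l
  proof -
    have "inverse x ^ l * E l (inverse x) = (\<integral>a. (a / x) ^ l * exp (- (a / x)) \<partial>N)" for x
      unfolding E_def integral_mult_right_zero[symmetric]
      by (intro Bochner_Integration.integral_cong refl)
         (simp add: divide_inverse power_mult_distrib mult.commute)
    then show ?thesis
      using N.laplace_moment_asymptotics[OF nonneg that \<beta> pos rv] by (simp only:)
  qed
  have G1: "\<beta> * Gamma (1 - \<beta>) > 0" using \<beta> by (auto intro!: mult_pos_pos Gamma_real_pos)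
  have Epos: "eventually (\<lambda>x. inverse x * E 1 (inverse x) > 0) at_top"
  proof -
    have "eventually (\<lambda>x. (inverse x ^ 1 * E 1 (inverse x)) / measure N {x<..} > 0) at_top"
      using order_tendstoD(1)[OF asym[of 1]] G1 by simp
    then show ?thesis by eventually_elim (use pos in \<open>auto simp: zero_less_divide_iff not_less[symmetric]\<close>)
  qed
  have "(\<lambda>n. real n * R 1 m n) \<longlonglongrightarrow> (Gamma (real m - \<beta>) / Gamma (1 - \<beta>)) / Gamma (real m)"
  proof (rule normalized_moment_limit[where D = D and \<phi> = \<phi>])
    show "D m s \<ge> 0" if "s > 0" for m s using Enn that by (simp add: D_def)
    show "0 \<le> \<phi> s \<and> \<phi> s < 1" if s: "s > 0" for s
    proof
      have ie: "integrable N (\<lambda>a. exp (- (s * a)))"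
        by (rule N.integrable_const_bound[of _ 1]) (use nonneg s in auto)
      have "integral\<^sup>L N (\<lambda>a. 0) < (\<integral>a. 1 - exp (- (s * a)) \<partial>N)"
      proof (rule N.integral_less_AE[where A = "{0<..}"])
        show "emeasure N {0<..} \<noteq> 0" using pos[of 0] by (simp add: N.emeasure_eq_measure)
        show "AE a in N. a \<in> {0<..} \<longrightarrow> 0 \<noteq> 1 - exp (- (s * a))" using s by (intro AE_I2) auto
        show "AE a in N. 0 \<le> 1 - exp (- (s * a))" using nonneg s by auto
      qed (use ie in auto)
      also have "(\<integral>a. 1 - exp (- (s * a)) \<partial>N) = 1 - \<phi> s"
        using ie N.prob_space by (subst Bochner_Integration.integral_diff) (auto simp: \<phi>_def)
      finally show "\<phi> s < 1" by simp
    qed (simp add: \<phi>_def)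
    show "\<phi> t \<le> \<phi> s" if "0 < s" "s \<le> t" for s t
      unfolding \<phi>_def
    proof (rule integral_mono_AE)
      show "integrable N (\<lambda>a. exp (- (t * a)))" "integrable N (\<lambda>a. exp (- (s * a)))"
        by (rule N.integrable_const_bound[of _ 1]; use nonneg that in auto)+
      show "AE a in N. exp (- (t * a)) \<le> exp (- (s * a))"
        using nonneg by eventually_elim (use that in \<open>auto intro: mult_right_mono\<close>)
    qed
    show "D m \<in> borel_measurable borel" for m unfolding D_def by measurable
    show "\<phi> \<in> borel_measurable borel"
      unfolding \<phi>_def by (rule N.borel_measurable_lebesgue_integral) measurable
    show "eventually (\<lambda>s. D 1 s > 0) (at_right 0)"
      unfolding eventually_at_right_to_top using Epos eventually_gt_at_top[of 0]
      by eventually_elim (auto simp: D_def zero_less_mult_iff)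
    show "((\<lambda>s. D m s / D 1 s) \<longlongrightarrow> Gamma (real m - \<beta>) / Gamma (1 - \<beta>)) (at_right 0)"
      unfolding filterlim_at_right_to_top
    proof (rule Lim_transform_eventually)
      show "((\<lambda>x. ((inverse x ^ m * E m (inverse x)) / measure N {x<..}) / ((inverse x ^ 1 * E 1 (inverse x)) / measure N {x<..}))
        \<longlongrightarrow> Gamma (real m - \<beta>) / Gamma (1 - \<beta>)) at_top"
      proof -
        have G: "\<beta> * Gamma (real 1 - \<beta>) \<noteq> 0" using G1 by auto
        have "\<beta> * Gamma (real m - \<beta>) / (\<beta> * Gamma (real 1 - \<beta>)) = Gamma (real m - \<beta>) / Gamma (1 - \<beta>)"
          using \<beta> by simp
        with tendsto_divide[OF asym[OF m] asym[OF order_refl] G] show ?thesis by (simp only:)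
      qed
      show "eventually (\<lambda>x. ((inverse x ^ m * E m (inverse x)) / measure N {x<..}) / ((inverse x ^ 1 * E 1 (inverse x)) / measure N {x<..})
         = D m (inverse x) / D 1 (inverse x)) at_top"
        using eventually_gt_at_top[of 0]
      proof eventually_elim
        case (elim x)
        have "inverse x ^ m = inverse x * inverse x ^ (m - 1)" using m by (simp flip: power_Suc)
        then show ?case using pos[of x] elim by (simp add: D_def)
      qed
    qed
    show "Gamma (real m - \<beta>) / Gamma (1 - \<beta>) \<ge> 0"
      using m \<beta> by (intro divide_nonneg_nonneg less_imp_le[OF Gamma_real_pos]) auto
  qed (use mom Rnn K1 m in auto)
  then show ?thesis by (simp add: R_def mult.commute)
qed

section \<open>Closed walks and cycles\<close>

text \<open>A list is read as a closed walk; an edge is a matrix position, with its row as first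
  component.\<close>

definition cyc_edges :: "'v list \<Rightarrow> ('v \<times> 'v) set" where
  "cyc_edges xs = (\<lambda>i. (xs ! i, xs ! (Suc i mod length xs))) ` {..<length xs}"

text \<open>Repeated edges count with multiplicity here, unlike in \<open>cyc_edges\<close>.\<close>

definition cyc_weight :: "('v \<times> 'v \<Rightarrow> 'b::comm_monoid_mult) \<Rightarrow> 'v list \<Rightarrow> 'b" where
  "cyc_weight y xs = (\<Prod>i<length xs. y (xs ! i, xs ! (Suc i mod length xs)))"

lemma finite_cyc_edges [simp]: "finite (cyc_edges xs)"
  by (simp add: cyc_edges_def)

lemma fst_cyc_edges: "fst ` cyc_edges xs = set xs"
  by (auto simp: cyc_edges_def image_image in_set_conv_nth)

lemma snd_cyc_edges: "snd ` cyc_edges xs \<subseteq> set xs"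
proof
  fix v assume "v \<in> snd ` cyc_edges xs"
  then obtain i where i: "i < length xs" "v = xs ! (Suc i mod length xs)"
    by (auto simp: cyc_edges_def)
  have "Suc i mod length xs < length xs" using i(1) by (intro mod_less_divisor) linarith
  with i(2) show "v \<in> set xs" by simp
qed

lemma cyc_edges_subset:
  assumes "set xs \<subseteq> V"
  shows "cyc_edges xs \<subseteq> V \<times> V"
proof
  fix e assume e: "e \<in> cyc_edges xs"
  have "fst e \<in> V" using e fst_cyc_edges[of xs] assms by blast
  moreover have "snd e \<in> V" using e snd_cyc_edges[of xs] assms by blast
  ultimately show "e \<in> V \<times> V" by (simp add: mem_Times_iff)
qed

lemma card_cyc_edges_le: "card (cyc_edges xs) \<le> length xs"
  unfolding cyc_edges_def using card_image_le[OF finite_lessThan[of "length xs"]] by simp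

text \<open>A row that carries two edges makes the vertices fewer than the edges. Each edge will
  contribute a factor of order \<open>1 / n\<close> and each vertex \<open>n\<close> choices, so
  this is where a factor \<open>1 / n\<close> is gained.\<close>

lemma card_fst_image_less:
  assumes "finite E" "\<not> inj_on fst E"
  shows "card (fst ` E) < card E"
  using assms card_image_le[of E fst] eq_card_imp_inj_on[of E fst] by linarith

text \<open>Starting from a vertex in \<open>B\<close>, one meets every vertex of the walk by taking
  successors, and each successor stays in \<open>B\<close>.\<close>

lemma cyc_closed:
  assumes ne: "set xs \<inter> B \<noteq> {}"
    and cl: "\<And>u v. (u, v) \<in> cyc_edges xs \<Longrightarrow> u \<in> B \<Longrightarrow> v \<in> B"
  shows "set xs \<subseteq> B"
proof
  let ?q = "length xs"
  obtain i where i: "i < ?q" "xs ! i \<in> B"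
    using ne by (auto simp: in_set_conv_nth)
  have step: "xs ! ((i + j) mod ?q) \<in> B" for j
  proof (induction j)
    case (Suc j)
    have "(i + j) mod ?q < ?q" using i(1) by (intro mod_less_divisor) auto
    then have "(xs ! ((i + j) mod ?q), xs ! (Suc ((i + j) mod ?q) mod ?q)) \<in> cyc_edges xs"
      by (auto simp: cyc_edges_def)
    from cl[OF this Suc] show ?case by (simp add: mod_Suc_eq)
  qed (use i in auto)
  fix v assume "v \<in> set xs"
  then obtain l where l: "l < ?q" "v = xs ! l" by (auto simp: in_set_conv_nth)
  have "(i + (l + ?q - i)) mod ?q = l" using i(1) l(1) by simp
  with step[of "l + ?q - i"] l show "v \<in> B" by simp
qed

text \<open>If \<open>fst\<close> is injective on the union, each row has a single outgoing edge,
  which belongs to each of the two walks that visits the row. From a common vertex neither walk can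
  therefore leave the other.\<close>

lemma cyc_edges_eq_of_touching:
  assumes inj: "inj_on fst (cyc_edges xs \<union> cyc_edges ys)"
    and ne: "set xs \<inter> set ys \<noteq> {}"
  shows "cyc_edges xs = cyc_edges ys"
proof -
  have one: "e \<in> cyc_edges zs"
    if "zs = xs \<or> zs = ys" "e \<in> cyc_edges xs \<union> cyc_edges ys" "fst e \<in> set zs" for e zs
  proof -
    obtain e' where "e' \<in> cyc_edges zs" "fst e' = fst e"
      using \<open>fst e \<in> set zs\<close> fst_cyc_edges[of zs] by (metis imageE)
    then show ?thesis using inj that by (metis UnCI inj_onD)
  qed
  have "set xs \<subseteq> set ys"
    using ne one[of ys] snd_cyc_edges[of ys] by (intro cyc_closed) force+
  moreover have "set ys \<subseteq> set xs"
    using ne one[of xs] snd_cyc_edges[of xs] by (intro cyc_closed) force+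
  ultimately have eq: "set xs = set ys" by blast
  show ?thesis
    using one[of xs] one[of ys] fst_cyc_edges[of xs] fst_cyc_edges[of ys] eq by blast
qed

text \<open>Two different walks that touch must have a row with two outgoing edges.\<close>

lemma card_touching_cycles:
  assumes "cyc_edges xs \<noteq> cyc_edges ys" "set xs \<inter> set ys \<noteq> {}"
  shows "card (set (xs @ ys)) < card (cyc_edges xs \<union> cyc_edges ys)"
  using card_fst_image_less[of "cyc_edges xs \<union> cyc_edges ys"] cyc_edges_eq_of_touching[of xs ys] assms
  by (auto simp: image_Un fst_cyc_edges)

lemma distinct_cyc_inj:
  assumes "distinct xs"
  shows "inj_on (\<lambda>i. (xs ! i, xs ! (Suc i mod length xs))) {..<length xs}"
    and "inj_on fst (cyc_edges xs)"
  using assms by (auto simp: inj_on_def cyc_edges_def nth_eq_iff_index_eq)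

lemma card_cyc_edges: "distinct xs \<Longrightarrow> card (cyc_edges xs) = length xs"
  using card_image[OF distinct_cyc_inj(1), of xs] by (simp add: cyc_edges_def)

lemma cyc_weight_distinct: "distinct xs \<Longrightarrow> cyc_weight y xs = (\<Prod>e\<in>cyc_edges xs. y e)"
  unfolding cyc_weight_def cyc_edges_def
  by (subst prod.reindex[OF distinct_cyc_inj(1)]) (auto simp: o_def)

lemma cyc_edges_succ:
  assumes "inj_on fst (cyc_edges xs)" "cyc_edges xs = cyc_edges ys"
    and "i < length xs" "j < length ys" "xs ! i = ys ! j"
  shows "xs ! (Suc i mod length xs) = ys ! (Suc j mod length ys)"
proof -
  have "(xs ! i, xs ! (Suc i mod length xs)) \<in> cyc_edges xs"
    "(ys ! j, ys ! (Suc j mod length ys)) \<in> cyc_edges xs"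
    using assms(2-4) by (auto simp: cyc_edges_def)
  with assms(1,5) show ?thesis by (metis inj_onD fst_conv snd_conv)
qed

lemma cyc_edges_rotate: "cyc_edges (rotate r xs) = cyc_edges xs"
proof (cases "xs = []")
  case False
  let ?q = "length xs"
  have q: "?q > 0" using False by simp
  have "cyc_edges (rotate r xs) = (\<lambda>i. (xs ! ((r + i) mod ?q), xs ! (Suc ((r + i) mod ?q) mod ?q))) ` {..<?q}"
    unfolding cyc_edges_def using q
    by (intro image_cong) (auto simp: nth_rotate mod_simps)
  also have "\<dots> = (\<lambda>i. (xs ! i, xs ! (Suc i mod ?q))) ` ((\<lambda>i. (r + i) mod ?q) ` {..<?q})"
    by (simp add: image_image)
  also have "(\<lambda>i. (r + i) mod ?q) ` {..<?q} = {..<?q}"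
  proof safe
    fix l assume l: "l < ?q"
    have "l = (r + ((l + (?q - r mod ?q)) mod ?q)) mod ?q"
    proof -
      have "(r + ((l + (?q - r mod ?q)) mod ?q)) mod ?q = (r mod ?q + (l + (?q - r mod ?q))) mod ?q"
        by (simp add: mod_simps)
      also have "r mod ?q + (l + (?q - r mod ?q)) = l + ?q"
          using mod_less_divisor[OF q, of r] by linarith
      finally show ?thesis using l by simp
    qed
    moreover have "(l + (?q - r mod ?q)) mod ?q < ?q" using q by simp
    ultimately show "l \<in> (\<lambda>i. (r + i) mod ?q) ` {..<?q}" by blast
  qed (use q in auto)
  finally show ?thesis by (simp add: cyc_edges_def)
qed (simp add: cyc_edges_def)

text \<open>The cycles with a given edge set are the rotations of one another.\<close>

lemma card_cyc_fibre:
  assumes xs: "distinct xs" "length xs = q" "q \<ge> 1"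
  shows "card {ys. distinct ys \<and> length ys = q \<and> cyc_edges ys = cyc_edges xs} = q"
proof -
  have "{ys. distinct ys \<and> length ys = q \<and> cyc_edges ys = cyc_edges xs} = (\<lambda>r. rotate r xs) ` {..<q}"
  proof safe
    fix ys assume ys: "distinct ys" "q = length ys" "cyc_edges ys = cyc_edges xs"
    have "set ys = set xs" using fst_cyc_edges[of xs] fst_cyc_edges[of ys] ys(3) by simp
    moreover have "0 < length ys" using ys(2) xs(3) by linarith
    ultimately have "ys ! 0 \<in> set xs" using nth_mem[of 0 ys] by simp
    \<comment> \<open>\<open>r\<close> is the position in \<open>xs\<close> of the first vertex of
      \<open>ys\<close>; from there on the unique successors force \<open>ys\<close> to be the
      rotation by \<open>r\<close>.\<close>
    then obtain r where r: "r < q" "ys ! 0 = xs ! r" using xs by (auto simp: in_set_conv_nth)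
    have "i < q \<longrightarrow> ys ! i = xs ! ((r + i) mod q)" for i
    proof (induction i)
      case (Suc i)
      show ?case
      proof
        assume i: "Suc i < q"
        have lt: "(r + i) mod length xs < length xs" using xs by (intro mod_less_divisor) linarith
        have "ys ! (Suc i mod length ys) = xs ! (Suc ((r + i) mod length xs) mod length xs)"
          by (rule cyc_edges_succ[OF distinct_cyc_inj(2)[OF ys(1)] ys(3) _ lt]) (use Suc i xs ys in auto)
        then show "ys ! Suc i = xs ! ((r + Suc i) mod q)"
          using i xs ys by (simp add: mod_Suc_eq)
      qed
    qed (use r in auto)
    then have "ys = rotate r xs" using xs ys by (auto intro!: nth_equalityI simp: nth_rotate)
    then show "ys \<in> (\<lambda>r. rotate r xs) ` {..<length ys}" using r ys by auto
  qed (use xs in \<open>auto simp: cyc_edges_rotate\<close>)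
  moreover have "inj_on (\<lambda>r. rotate r xs) {..<q}"
  proof (rule inj_onI)
    fix r s assume rs: "r \<in> {..<q}" "s \<in> {..<q}" "rotate r xs = rotate s xs"
    have "rotate t xs ! 0 = xs ! t" if "t < q" for t
      using that xs nth_rotate[of 0 xs t] by (simp del: length_0_conv)
    then have "xs ! r = xs ! s" using rs by (metis lessThan_iff)
    then show "r = s" using rs xs by (auto simp: nth_eq_iff_index_eq)
  qed
  ultimately show ?thesis by (simp add: card_image)
qed

section \<open>Walks with one outgoing edge per row, as repetitions of simple cycles\<close>

definition periodic_walk :: "nat \<Rightarrow> 'v list \<Rightarrow> 'v list" where
  "periodic_walk k c = map (\<lambda>i. c ! (i mod length c)) [0..<k]"

text \<open>The product splits into blocks of \<open>length c\<close> factors, each block being the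
  weight of \<open>c\<close>; divisibility makes the wrap-around at \<open>k\<close> agree with the
  one at \<open>length c\<close>.\<close>

lemma cyc_weight_periodic_walk:
  assumes "length c dvd k" "k \<ge> 1"
  shows "cyc_weight y (periodic_walk k c) = cyc_weight y c ^ (k div length c)"
proof -
  let ?q = "length c"
  have q: "?q > 0" using assms by (auto intro: Nat.gr0I)
  obtain m where m: "k = m * ?q" using assms by (auto simp: dvd_def mult.commute)
  have "cyc_weight y (periodic_walk k c) = (\<Prod>i<m * ?q. y (c ! (i mod ?q), c ! (Suc i mod ?q)))"
  proof -
    have "Suc x mod k mod ?q = Suc x mod ?q" "Suc x mod k < k" for x
      using assms by (auto simp: mod_mod_cancel)
    then show ?thesis
      unfolding cyc_weight_def periodic_walk_def m[symmetric] by (intro prod.cong) auto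
  qed
  also have "\<dots> = (\<Prod>b<m. \<Prod>i\<in>{b * ?q..<b * ?q + ?q}. y (c ! (i mod ?q), c ! (Suc i mod ?q)))"
    by (rule prod.nat_group[symmetric])
  also have "\<dots> = (\<Prod>b<m. cyc_weight y c)"
  proof (rule prod.cong[OF refl])
    fix b
    have "(\<Prod>i\<in>{b * ?q..<b * ?q + ?q}. y (c ! (i mod ?q), c ! (Suc i mod ?q)))
      = (\<Prod>i\<in>{0..<?q}. y (c ! ((i + b * ?q) mod ?q), c ! (Suc (i + b * ?q) mod ?q)))"
      using prod.shift_bounds_nat_ivl[of "\<lambda>i. y (c ! (i mod ?q), c ! (Suc i mod ?q))" 0 "b * ?q" ?q]
      by (simp add: add.commute)
    also have "\<dots> = cyc_weight y c"
      unfolding cyc_weight_def atLeast0LessThan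
    proof (rule prod.cong[OF refl])
      fix i assume "i \<in> {..<?q}"
      moreover have "Suc (i + b * ?q) mod ?q = Suc i mod ?q"
        using mod_mult_self1[of "Suc i" b ?q] by simp
      ultimately show "y (c ! ((i + b * ?q) mod ?q), c ! (Suc (i + b * ?q) mod ?q)) = y (c ! i, c ! (Suc i mod ?q))"
        by simp
    qed
    finally show "(\<Prod>i\<in>{b * ?q..<b * ?q + ?q}. y (c ! (i mod ?q), c ! (Suc i mod ?q))) = cyc_weight y c" .
  qed
  finally show ?thesis using m q by simp
qed

definition closed_walks :: "'v set \<Rightarrow> nat \<Rightarrow> 'v list set" where
  "closed_walks V k = {zs. set zs \<subseteq> V \<and> length zs = k}"

definition simple_cycles :: "'v set \<Rightarrow> nat \<Rightarrow> 'v list set" where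
  "simple_cycles V q = {c. distinct c \<and> set c \<subseteq> V \<and> length c = q}"

lemma finite_closed_walks [simp]: "finite V \<Longrightarrow> finite (closed_walks V k)"
  unfolding closed_walks_def by (rule finite_lists_length_eq)

lemma simple_cycles_subset: "simple_cycles V q \<subseteq> closed_walks V q"
  by (auto simp: closed_walks_def simple_cycles_def)

lemma finite_simple_cycles [simp]: "finite V \<Longrightarrow> finite (simple_cycles V k)"
  by (rule finite_subset[OF simple_cycles_subset]) simp

text \<open>Every vertex determines its successor, so the walk is an orbit of a map that returns to
  its start. The least period divides \<open>k\<close>, and one period is the cycle.\<close>

lemma functional_walk_periodic:
  assumes inj: "inj_on fst (cyc_edges zs)" and k: "length zs = k" "k \<ge> 1"
  shows "\<exists>c. distinct c \<and> set c \<subseteq> set zs \<and> length c dvd k \<and> zs = periodic_walk k c"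
proof -
  define z where "z i = zs ! (i mod k)" for i
  have succ: "z (Suc i) = z (Suc j)" if "z i = z j" for i j
    using cyc_edges_succ[OF inj refl, of "i mod k" "j mod k"] that k by (simp add: z_def mod_Suc_eq)
  have shift: "z i = z j \<Longrightarrow> z (i + t) = z (j + t)" for i j t
  proof (induction t)
    case (Suc t)
    from succ[OF Suc.IH[OF Suc.prems]] show ?case by simp
  qed simp
  have per: "z (i + k) = z i" for i by (simp add: z_def)
  define q where "q = (LEAST q. q > 0 \<and> z q = z 0)"
  have ex: "\<exists>q. q > 0 \<and> z q = z 0" using k per[of 0] by (intro exI[of _ k]) auto
  have q: "q > 0" "z q = z 0" using LeastI_ex[OF ex] by (auto simp: q_def)
  have least: "q \<le> p" if "p > 0" "z p = z 0" for p
    unfolding q_def using that by (intro Least_le) auto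
  have perq: "z (i + q) = z i" for i using shift[OF q(2), of i] by (simp add: add.commute)
  have permq: "z (i + m * q) = z i" for i m
  proof (induction m)
    case (Suc m)
    show ?case using perq[of "i + m * q"] Suc by (simp add: ac_simps)
  qed simp
  have modq: "z i = z (i mod q)" for i
    using permq[of "i mod q" "i div q"] by (metis mod_mult_div_eq mult.commute)
  have "q dvd k"
  proof (rule ccontr)
    assume "\<not> q dvd k"
    then have "k mod q > 0" by (auto simp: dvd_eq_mod_eq_0)
    moreover have "z (k mod q) = z 0" using modq[of k] per[of 0] by simp
    ultimately have "q \<le> k mod q" by (intro least)
    with q show False by (meson mod_less_divisor not_le)
  qed
  \<comment> \<open>A repetition at \<open>i < j < q\<close>, continued for \<open>q - i\<close>
    steps, would be a return to the start at time \<open>j - i\<close>, earlier than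
    \<open>q\<close>.\<close>
  have neq: "z i \<noteq> z j" if "i < j" "j < q" for i j
  proof
    assume "z i = z j"
    from shift[OF this, of "q - i"] have "z (j - i + q) = z q" using that by simp
    then have "z (j - i) = z 0" using perq q by simp
    from least[OF _ this] that show False by simp
  qed
  define c where "c = map z [0..<q]"
  have lc: "length c = q" by (simp add: c_def)
  have zs: "zs = map z [0..<k]" using k by (intro nth_equalityI) (auto simp: z_def)
  have "distinct c" unfolding c_def using neq
    by (auto simp: distinct_map inj_on_def) (metis linorder_neqE_nat)
  moreover have "set c \<subseteq> set zs"
  proof -
    have "i mod k < length zs" for i using k by simp
    then show ?thesis by (auto simp: c_def z_def)
  qed
  moreover have "zs = periodic_walk k c"
    unfolding periodic_walk_def lc zs using q modq by (auto simp: c_def)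
  ultimately show ?thesis using \<open>q dvd k\<close> lc by blast
qed

text \<open>The cycle is recovered from the walk: its length is the number of vertices visited, and
  it is the prefix of that length. A walk has a starting point, so the cycles are lists here and not
  edge sets.\<close>

lemma sum_functional_walks:
  fixes f :: "'v list \<Rightarrow> 'b::comm_monoid_add"
  assumes V: "finite V" and k: "k \<ge> 1"
  shows "(\<Sum>zs | zs \<in> closed_walks V k \<and> inj_on fst (cyc_edges zs). f zs) =
    (\<Sum>q | q dvd k. \<Sum>c\<in>simple_cycles V q. f (periodic_walk k c))"
proof -
  have fin: "finite {q. q dvd k}" using k by simp
  have pos: "q > 0" if "q dvd k" for q using that k by (auto intro: Nat.gr0I)
  have take: "take (length c) (periodic_walk k c) = c" if "length c dvd k" for c :: "'v list"
  proof -
    have "length c \<le> k" using that k by (auto intro: dvd_imp_le)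
    then show ?thesis by (auto intro!: nth_equalityI simp: periodic_walk_def)
  qed
  have set: "set (periodic_walk k c) = set c" if "length c dvd k" for c :: "'v list"
  proof -
    have "set c \<subseteq> set (periodic_walk k c)" using set_take_subset take[OF that] by metis
    then show ?thesis using pos[OF that] by (auto simp: periodic_walk_def)
  qed
  have edges: "cyc_edges (periodic_walk k c) \<subseteq> cyc_edges c" if "length c dvd k" for c :: "'v list"
  proof -
    have "Suc i mod k mod length c = Suc (i mod length c) mod length c" for i
      using that by (simp add: mod_mod_cancel mod_Suc_eq)
    moreover have "i mod length c < length c" "Suc i mod k < k" for i using pos[OF that] k by simp_all
    ultimately show ?thesis
      unfolding cyc_edges_def periodic_walk_def
      by (auto simp del: mod_less_divisor intro!: image_eqI[where x = "i mod length c" for i])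
  qed
  have "(\<Sum>q | q dvd k. \<Sum>c\<in>simple_cycles V q. f (periodic_walk k c)) =
    (\<Sum>(q, c)\<in>(SIGMA q:{q. q dvd k}. simple_cycles V q). f (periodic_walk k c))"
    using fin V by (intro sum.Sigma) auto
  also have "\<dots> = (\<Sum>zs | zs \<in> closed_walks V k \<and> inj_on fst (cyc_edges zs). f zs)"
  proof -
    have bij: "bij_betw (\<lambda>p. periodic_walk k (snd p)) (SIGMA q:{q. q dvd k}. simple_cycles V q)
      {zs. zs \<in> closed_walks V k \<and> inj_on fst (cyc_edges zs)}"
      unfolding bij_betw_def
    proof
      show "inj_on (\<lambda>p. periodic_walk k (snd p)) (SIGMA q:{q. q dvd k}. simple_cycles V q)"
      proof (rule inj_onI, clarsimp simp: simple_cycles_def)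
        fix c d :: "'v list" assume cd: "length c dvd k" "length d dvd k" "distinct c" "distinct d"
          "periodic_walk k c = periodic_walk k d"
        have "set c = set d" using set[OF cd(1)] set[OF cd(2)] cd(5) by simp
        then have "length c = length d" using distinct_card[OF cd(3)] distinct_card[OF cd(4)] by simp
        moreover from this have "take (length c) (periodic_walk k c) = take (length d) (periodic_walk k d)"
          by (simp only: cd(5))
        then have "c = d" by (simp only: take[OF cd(1)] take[OF cd(2)])
        ultimately show "length c = length d \<and> c = d" by blast
      qed
      show "(\<lambda>p. periodic_walk k (snd p)) ` (SIGMA q:{q. q dvd k}. simple_cycles V q) =
        {zs. zs \<in> closed_walks V k \<and> inj_on fst (cyc_edges zs)}"
      proof safe
        fix q c assume "q dvd k" "c \<in> simple_cycles V q"
        then have c: "distinct c" "set c \<subseteq> V" "length c dvd k" by (auto simp: simple_cycles_def)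
        show "periodic_walk k (snd (q, c)) \<in> closed_walks V k"
          using set c by (auto simp: closed_walks_def periodic_walk_def)
        show "inj_on fst (cyc_edges (periodic_walk k (snd (q, c))))"
          using inj_on_subset[OF distinct_cyc_inj(2) edges] c by auto
      next
        fix zs assume zs: "zs \<in> closed_walks V k" "inj_on fst (cyc_edges zs)"
        then obtain c where "distinct c" "set c \<subseteq> set zs" "length c dvd k" "zs = periodic_walk k c"
          using functional_walk_periodic[of zs k] k by (auto simp: closed_walks_def)
        then show "zs \<in> (\<lambda>p. periodic_walk k (snd p)) ` (SIGMA q:{q. q dvd k}. simple_cycles V q)"
          using zs by (intro image_eqI[of _ _ "(length c, c)"]) (auto simp: closed_walks_def simple_cycles_def)
      qed
    qed
    show ?thesis
      using sum.reindex_bij_betw[OF bij, of f] by (simp add: case_prod_unfold)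
  qed
  finally show ?thesis ..
qed

text \<open>A new vertex can be chosen in \<open>card V\<close> ways and costs a factor \<open>2 / card V\<close>; an old one can be
  chosen in at most \<open>L\<close> ways.\<close>

lemma sum_walks_card_bound:
  assumes V: "finite V" "V \<noteq> {}"
  shows "(\<Sum>zs\<in>closed_walks V L. (2 / real (card V)) ^ card (set zs)) \<le> fact (Suc L)"
proof (induction L)
  case 0
  have "closed_walks V 0 = {[]}" by (auto simp: closed_walks_def)
  then show ?case by simp
next
  case (Suc L)
  let ?a = "2 / real (card V)"
  have n: "real (card V) > 0" using V by (simp add: card_gt_0_iff)
  have "closed_walks V (Suc L) = (\<lambda>(z, zs). z # zs) ` (V \<times> closed_walks V L)"
    by (auto simp: closed_walks_def length_Suc_conv image_iff)
  moreover have "inj_on (\<lambda>(z, zs). z # zs) (V \<times> closed_walks V L)" by (auto simp: inj_on_def)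
  ultimately have "(\<Sum>zs\<in>closed_walks V (Suc L). ?a ^ card (set zs)) =
      (\<Sum>p\<in>V \<times> closed_walks V L. ?a ^ card (set (case p of (z, zs) \<Rightarrow> z # zs)))"
    by (simp only: sum.reindex o_def)
  also have "\<dots> = (\<Sum>z\<in>V. \<Sum>zs\<in>closed_walks V L. ?a ^ card (insert z (set zs)))"
    by (simp add: sum.cartesian_product case_prod_unfold)
  also have "\<dots> = (\<Sum>zs\<in>closed_walks V L. \<Sum>z\<in>V. ?a ^ card (insert z (set zs)))"
    by (rule sum.swap)
  also have "\<dots> \<le> (\<Sum>zs\<in>closed_walks V L. real (L + 2) * ?a ^ card (set zs))"
  proof (rule sum_mono)
    fix zs assume zs: "zs \<in> closed_walks V L"
    have "(\<Sum>z\<in>V. ?a ^ card (insert z (set zs))) =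
       (\<Sum>z\<in>set zs. ?a ^ card (insert z (set zs))) + (\<Sum>z\<in>V - set zs. ?a ^ card (insert z (set zs)))"
      using V zs by (subst sum.subset_diff[of "set zs"]) (auto simp: closed_walks_def)
    also have "(\<Sum>z\<in>set zs. ?a ^ card (insert z (set zs))) = real (card (set zs)) * ?a ^ card (set zs)"
      by (simp add: insert_absorb)
    also have "(\<Sum>z\<in>V - set zs. ?a ^ card (insert z (set zs))) = real (card (V - set zs)) * (?a * ?a ^ card (set zs))"
      by simp
    also have "\<dots> \<le> real (card V) * (?a * ?a ^ card (set zs))"
      using V n by (intro mult_right_mono) (auto intro!: card_mono)
    also have "\<dots> = 2 * ?a ^ card (set zs)" using n by simp
    also have "real (card (set zs)) * ?a ^ card (set zs) \<le> real L * ?a ^ card (set zs)"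
      using zs card_length[of zs] n by (intro mult_right_mono) (auto simp: closed_walks_def)
    finally show "(\<Sum>z\<in>V. ?a ^ card (insert z (set zs))) \<le> real (L + 2) * ?a ^ card (set zs)"
      by (simp add: algebra_simps)
  qed
  also have "\<dots> \<le> real (L + 2) * fact (Suc L)"
    unfolding sum_distrib_left[symmetric] by (intro mult_left_mono Suc) auto
  also have "\<dots> = fact (Suc (Suc L))" by (simp add: algebra_simps)
  finally show ?case .
qed

section \<open>Levy continuity in several dimensions\<close>

lemma abs_integral_diff_le:
  fixes f g :: "'a \<Rightarrow> real"
  assumes "integrable M f" "integrable M g"
  shows "\<bar>(\<integral>x. f x \<partial>M) - (\<integral>x. g x \<partial>M)\<bar> \<le> (\<integral>x. \<bar>f x - g x\<bar> \<partial>M)"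
  using integral_norm_bound[of M "\<lambda>x. f x - g x"] assms by simp

text \<open>The class to which convergence of characteristic functions extends by linearity; it is
  an algebra because characters multiply to characters.\<close>

inductive trig_poly :: "('v::euclidean_space \<Rightarrow> complex) \<Rightarrow> bool" where
  cis: "trig_poly (\<lambda>x. c * cis (t \<bullet> x))"
| add: "trig_poly f \<Longrightarrow> trig_poly g \<Longrightarrow> trig_poly (\<lambda>x. f x + g x)"

lemma trig_poly_mult:
  assumes "trig_poly f" "trig_poly g"
  shows "trig_poly (\<lambda>x. f x * g x)"
  using assms(1)
proof induction
  case (cis c t)
  from assms(2) show ?case
  proof induction
    case (cis d s)
    have "(\<lambda>x. c * cis (t \<bullet> x) * (d * cis (s \<bullet> x))) = (\<lambda>x. (c * d) * cis ((t + s) \<bullet> x))"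
      by (simp add: fun_eq_iff cis_mult[symmetric] inner_add_left)
    then show ?case by (simp add: trig_poly.cis)
  next
    case (add f g)
    then show ?case using trig_poly.add[OF add.IH] by (simp add: distrib_left)
  qed
next
  case (add f g)
  then show ?case using trig_poly.add[OF add.IH] by (simp add: distrib_right)
qed

lemma trig_poly_const: "trig_poly (\<lambda>x. c)"
  using trig_poly.cis[of c 0] by simp

lemma trig_poly_sum: "finite I \<Longrightarrow> (\<And>i. i \<in> I \<Longrightarrow> trig_poly (f i)) \<Longrightarrow> trig_poly (\<lambda>x. \<Sum>i\<in>I. f i x)"
  by (induction I rule: finite_induct) (auto intro: trig_poly_const trig_poly.add)

lemma trig_poly_sin: "trig_poly (\<lambda>x. complex_of_real (sin (t \<bullet> x)))"
proof -
  have "complex_of_real (sin (t \<bullet> x)) = (1 / (2 * \<i>)) * cis (t \<bullet> x) + (- 1 / (2 * \<i>)) * cis ((- t) \<bullet> x)" for x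
    by (simp add: complex_eq_iff Re_divide Im_divide)
  then show ?thesis by (simp only: trig_poly.intros)
qed

text \<open>Sines of the scaled coordinates stay in a cube, so Stone-Weierstrass on that cube yields
  trigonometric polynomials that are controlled on the whole space.\<close>

lemma trig_poly_polynomial_sin:
  assumes "real_polynomial_function p"
  shows "trig_poly (\<lambda>x. complex_of_real (p (\<Sum>b\<in>Basis. sin ((a *\<^sub>R b) \<bullet> x) *\<^sub>R (b :: 'v::euclidean_space))))"
  using assms
proof induction
  case (linear L)
  then have "L (\<Sum>b\<in>Basis. sin ((a *\<^sub>R b) \<bullet> x) *\<^sub>R b) = (\<Sum>b\<in>Basis. L b * sin ((a *\<^sub>R b) \<bullet> x))" for x
    by (simp only: linear_sum[OF bounded_linear.linear] linear_cmul[OF bounded_linear.linear]) (simp add: mult.commute)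
  then show ?case
    by (simp only: of_real_sum of_real_mult) (intro trig_poly_sum finite_Basis trig_poly_mult trig_poly_const trig_poly_sin)
qed (auto intro: trig_poly_const trig_poly.add trig_poly_mult)

lemma trig_poly_bounded_measurable:
  assumes "trig_poly f"
  shows "f \<in> borel_measurable borel \<and> (\<exists>B. \<forall>x. norm (f x) \<le> B)"
  using assms
proof induction
  case (cis c t)
  have "norm (c * cis (t \<bullet> x)) \<le> norm c" for x by (simp add: norm_mult)
  moreover have "(\<lambda>x. c * cis (t \<bullet> x)) \<in> borel_measurable borel"
    by (intro borel_measurable_continuous_onI continuous_intros)
  ultimately show ?case by blast
next
  case (add f g)
  then obtain A B where "\<forall>x. norm (f x) \<le> A" "\<forall>x. norm (g x) \<le> B" by auto
  then have "norm (f x + g x) \<le> A + B" for x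
    using norm_triangle_mono by blast
  with add show ?case by auto
qed

lemma trig_poly_integral_tendsto:
  fixes T :: "nat \<Rightarrow> 'a \<Rightarrow> 'v::euclidean_space" and S :: "'b \<Rightarrow> 'v"
  assumes "prob_space M" "prob_space P"
    and [measurable]: "\<And>n. T n \<in> borel_measurable M" "S \<in> borel_measurable P"
    and char: "\<And>t. (\<lambda>n. \<integral>\<omega>. cis (t \<bullet> T n \<omega>) \<partial>M) \<longlonglongrightarrow> (\<integral>\<omega>. cis (t \<bullet> S \<omega>) \<partial>P)"
    and "trig_poly f"
  shows "(\<lambda>n. \<integral>\<omega>. f (T n \<omega>) \<partial>M) \<longlonglongrightarrow> (\<integral>\<omega>. f (S \<omega>) \<partial>P)"
proof -
  interpret M: prob_space M by fact
  interpret P: prob_space P by fact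
  have int: "integrable M (\<lambda>\<omega>. f (T n \<omega>))" "integrable P (\<lambda>\<omega>. f (S \<omega>))"
    if f: "trig_poly f" for f :: "'v \<Rightarrow> complex" and n
  proof -
    obtain B where "\<And>x. norm (f x) \<le> B" and [measurable]: "f \<in> borel_measurable borel"
      using trig_poly_bounded_measurable[OF f] by auto
    then show "integrable M (\<lambda>\<omega>. f (T n \<omega>))" "integrable P (\<lambda>\<omega>. f (S \<omega>))"
      by (auto intro!: M.integrable_const_bound[of _ B] P.integrable_const_bound[of _ B])
  qed
  from assms(6) show ?thesis
  proof induction
    case (cis c t)
    show ?case by (simp add: tendsto_mult_left char)
  next
    case (add f g)
    then show ?case by (simp add: int tendsto_add)
  qed
qed

text \<open>The one-dimensional theorem along the coordinate directions gives tightness. On a large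
  cube \<open>g\<close> is approximated by a trigonometric polynomial, through the coordinates
  \<open>sin (a * x)\<close>; outside the cube both functions are bounded and the mass is
  small.\<close>

theorem levy_continuity_multivariate:
  fixes T :: "nat \<Rightarrow> 'a \<Rightarrow> 'v::euclidean_space" and S :: "'b \<Rightarrow> 'v" and g :: "'v \<Rightarrow> real"
  assumes "prob_space M" "prob_space P"
    and [measurable]: "\<And>n. T n \<in> borel_measurable M" "S \<in> borel_measurable P"
    and char: "\<And>t. (\<lambda>n. \<integral>\<omega>. cis (t \<bullet> T n \<omega>) \<partial>M) \<longlonglongrightarrow> (\<integral>\<omega>. cis (t \<bullet> S \<omega>) \<partial>P)"
    and g: "continuous_on UNIV g" "bounded (range g)"
  shows "(\<lambda>n. \<integral>\<omega>. g (T n \<omega>) \<partial>M) \<longlonglongrightarrow> (\<integral>\<omega>. g (S \<omega>) \<partial>P)"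
proof -
  interpret M: prob_space M by fact
  interpret P: prob_space P by fact
  obtain B0 where B0: "\<And>x. \<bar>g x\<bar> \<le> B0" using g(2) by (auto simp: bounded_iff)
  define B where "B = max B0 1"
  have B: "\<bar>g x\<bar> \<le> B" "B \<ge> 1" for x using B0[of x] by (auto simp: B_def)
  have [measurable]: "g \<in> borel_measurable borel" using g(1) by (rule borel_measurable_continuous_onI)
  \<comment> \<open>A continuous test function lying between the indicators of
    \<open>\<bar>x\<bar> \<ge> R + 1\<close> and \<open>\<bar>x\<bar> > R\<close>.\<close>
  define cut where "cut R x = min 1 (max 0 (\<bar>x\<bar> - R))" for R x :: real
  have cut: "0 \<le> cut R x" "cut R x \<le> 1" "continuous_on UNIV (cut R)" "\<bar>x\<bar> \<ge> R + 1 \<Longrightarrow> cut R x = 1" for R x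
    by (auto simp: cut_def[abs_def] intro!: continuous_intros)
  have [measurable]: "cut R \<in> borel_measurable borel" for R
    using cut(3) by (rule borel_measurable_continuous_onI)
  have cut_lim: "(\<lambda>n. \<integral>\<omega>. cut R (b \<bullet> T n \<omega>) \<partial>M) \<longlonglongrightarrow> (\<integral>\<omega>. cut R (b \<bullet> S \<omega>) \<partial>P)" for R b
  proof -
    interpret D: real_distribution "distr M borel (\<lambda>\<omega>. b \<bullet> T n \<omega>)" for n
      by (rule M.real_distribution_distr) simp
    interpret E: real_distribution "distr P borel (\<lambda>\<omega>. b \<bullet> S \<omega>)"
      by (rule P.real_distribution_distr) simp
    have "weak_conv_m (\<lambda>n. distr M borel (\<lambda>\<omega>. b \<bullet> T n \<omega>)) (distr P borel (\<lambda>\<omega>. b \<bullet> S \<omega>))"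
    proof (rule levy_continuity)
      fix s
      have "char (distr M borel (\<lambda>\<omega>. b \<bullet> T n \<omega>)) s = (\<integral>\<omega>. cis ((s *\<^sub>R b) \<bullet> T n \<omega>) \<partial>M)" for n
        by (simp add: char_def integral_distr cis_conv_exp)
      moreover have "char (distr P borel (\<lambda>\<omega>. b \<bullet> S \<omega>)) s = (\<integral>\<omega>. cis ((s *\<^sub>R b) \<bullet> S \<omega>) \<partial>P)"
        by (simp add: char_def integral_distr cis_conv_exp)
      ultimately show "(\<lambda>n. char (distr M borel (\<lambda>\<omega>. b \<bullet> T n \<omega>)) s) \<longlonglongrightarrow> char (distr P borel (\<lambda>\<omega>. b \<bullet> S \<omega>)) s"
        using char[of "s *\<^sub>R b"] by simp
    qed (unfold_locales)
    then have "(\<lambda>n. integral\<^sup>L (distr M borel (\<lambda>\<omega>. b \<bullet> T n \<omega>)) (cut R)) \<longlonglongrightarrow> integral\<^sup>L (distr P borel (\<lambda>\<omega>. b \<bullet> S \<omega>)) (cut R)"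
      using cut D.real_distribution_axioms E.real_distribution_axioms
      by (intro weak_conv_imp_integral_bdd_continuous_conv[where B = 1]) (auto simp: continuous_on_eq_continuous_at)
    then show ?thesis by (simp add: integral_distr)
  qed
  have cut_int: "integrable M (\<lambda>\<omega>. cut R (b \<bullet> T n \<omega>))" "integrable P (\<lambda>\<omega>. cut R (b \<bullet> S \<omega>))" for R b n
    using cut by (auto intro!: M.integrable_const_bound[of _ 1] P.integrable_const_bound[of _ 1])
  define tail where "tail R x = (\<Sum>b\<in>Basis. cut R (b \<bullet> x))" for R and x :: 'v
  have [measurable]: "tail R \<in> borel_measurable borel" for R unfolding tail_def by measurable
  have tail_nn: "tail R x \<ge> 0" for R x using cut by (simp add: tail_def sum_nonneg)
  have tail_ge: "tail R x \<ge> 1" if "b \<in> Basis" "\<bar>b \<bullet> x\<bar> \<ge> R + 1" for R b and x :: 'v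
    using member_le_sum[of b Basis "\<lambda>b. cut R (b \<bullet> x)"] cut that by (simp add: tail_def)
  have tail_int: "integrable M (\<lambda>\<omega>. tail R (T n \<omega>))" "integrable P (\<lambda>\<omega>. tail R (S \<omega>))" for R n
    unfolding tail_def using cut_int by auto
  have tail_lim: "(\<lambda>n. \<integral>\<omega>. tail R (T n \<omega>) \<partial>M) \<longlonglongrightarrow> (\<integral>\<omega>. tail R (S \<omega>) \<partial>P)" for R
    unfolding tail_def using cut_int cut_lim by (simp add: tendsto_sum)
  have tail0: "((\<lambda>k. \<integral>\<omega>. tail (real k) (S \<omega>) \<partial>P) \<longlonglongrightarrow> (\<integral>\<omega>. 0 \<partial>P))"
  proof (rule integral_dominated_convergence[where w = "\<lambda>_. real DIM('v)"])
    show "AE \<omega> in P. (\<lambda>k. tail (real k) (S \<omega>)) \<longlonglongrightarrow> 0"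
    proof (intro AE_I2)
      fix \<omega>
      have "eventually (\<lambda>k. tail (real k) (S \<omega>) = 0) sequentially"
        using eventually_ge_at_top[of "nat \<lceil>norm (S \<omega>)\<rceil>"]
      proof eventually_elim
        case (elim k)
        have "cut (real k) (b \<bullet> S \<omega>) = 0" if "b \<in> Basis" for b
        proof -
          have "\<bar>b \<bullet> S \<omega>\<bar> \<le> norm (S \<omega>)" using Basis_le_norm[OF that, of "S \<omega>"] by (simp add: inner_commute)
          also have "\<dots> \<le> real k" using elim by linarith
          finally show ?thesis by (simp add: cut_def)
        qed
        then show ?case by (simp add: tail_def)
      qed
      then show "(\<lambda>k. tail (real k) (S \<omega>)) \<longlonglongrightarrow> 0" by (rule tendsto_eventually)
    qed
    show "AE \<omega> in P. norm (tail (real k) (S \<omega>)) \<le> real DIM('v)" for k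
    proof (intro AE_I2)
      fix \<omega>
      have "tail (real k) (S \<omega>) \<le> (\<Sum>b\<in>(Basis :: 'v set). 1)" unfolding tail_def using cut by (intro sum_mono) auto
      then show "norm (tail (real k) (S \<omega>)) \<le> real DIM('v)" using tail_nn by simp
    qed
  qed auto
  show ?thesis
  proof (rule LIMSEQ_I)
    fix r :: real assume r: "r > 0"
    \<comment> \<open>\<open>e \<le> 1 \<le> B\<close> keeps the approximant below
      \<open>2 * B\<close>; the final estimate adds five terms, each at most
      \<open>e\<close>.\<close>
    define e where "e = min 1 (r / 8)"
    have e: "e > 0" "e \<le> 1" "8 * e \<le> r" using r by (auto simp: e_def)
    \<comment> \<open>The factor \<open>3 * B\<close> bounds the difference between \<open>g\<close>
      and its approximant outside the cube.\<close>
    define d where "d = e / (3 * B)"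
    have d: "d > 0" using e B by (auto simp: d_def intro!: divide_pos_pos)
    have "eventually (\<lambda>k. (\<integral>\<omega>. tail (real k) (S \<omega>) \<partial>P) < d) sequentially"
      using order_tendstoD(2)[OF tail0] d by simp
    then obtain k where k: "(\<integral>\<omega>. tail (real k) (S \<omega>) \<partial>P) < d" by (auto dest: eventually_happens)
    define R where "R = real k + 1"
    \<comment> \<open>With this scale the coordinates of the cube of half-width \<open>R\<close> are
      mapped into \<open>[- pi / 2, pi / 2]\<close>, where \<open>arcsin\<close> inverts
      \<open>sin\<close>.\<close>
    define a where "a = pi / (2 * R)"
    have R: "R > 0" by (simp add: R_def)
    have a: "a > 0" using R by (simp add: a_def)
    define G where "G y = g (\<Sum>b\<in>Basis. (arcsin (y \<bullet> b) / a) *\<^sub>R b)" for y :: 'v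
    have cG: "continuous_on (cbox (- One) One) G"
      unfolding G_def
    proof (rule continuous_on_compose2[OF g(1)])
      show "continuous_on (cbox (- One) One) (\<lambda>y. \<Sum>b\<in>Basis. (arcsin (y \<bullet> b) / a) *\<^sub>R (b :: 'v))"
        using a by (intro continuous_intros) (auto simp: mem_box)
    qed auto
    obtain p where p: "real_polynomial_function p" "\<And>y. y \<in> cbox (- One) One \<Longrightarrow> \<bar>G y - p y\<bar> < e"
      using Stone_Weierstrass_real_polynomial_function[OF compact_cbox cG e(1)] by blast
    define \<sigma> where "\<sigma> x = (\<Sum>b\<in>Basis. sin ((a *\<^sub>R b) \<bullet> x) *\<^sub>R b)" for x :: 'v
    have \<sigma>b: "\<sigma> x \<bullet> b = sin (a * (b \<bullet> x))" if "b \<in> Basis" for x b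
      using that by (simp add: \<sigma>_def inner_sum_left inner_Basis if_distrib cong: if_cong)
    have \<sigma>K: "\<sigma> x \<in> cbox (- One) One" for x by (simp add: mem_box \<sigma>b)
    define f where "f x = p (\<sigma> x)" for x
    have tf: "trig_poly (\<lambda>x. complex_of_real (f x))"
      unfolding f_def \<sigma>_def by (rule trig_poly_polynomial_sin[OF p(1)])
    have fB: "\<bar>f x\<bar> \<le> 2 * B" for x
    proof -
      have "\<bar>f x\<bar> \<le> \<bar>G (\<sigma> x)\<bar> + e" using p(2)[OF \<sigma>K[of x]] by (simp add: f_def)
      also have "\<bar>G (\<sigma> x)\<bar> \<le> B" using B by (simp add: G_def)
      finally show ?thesis using e B(2) by linarith
    qed
    have fg: "\<bar>g x - f x\<bar> \<le> e + 3 * B * tail (real k) x" for x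
    proof (cases "\<exists>b\<in>Basis. \<bar>b \<bullet> x\<bar> > R")
      case True
      then obtain b where "b \<in> Basis" "\<bar>b \<bullet> x\<bar> > R" by blast
      then have "tail (real k) x \<ge> 1" using tail_ge[of b "real k" x] by (simp add: R_def)
      then have "3 * B * 1 \<le> 3 * B * tail (real k) x" using B by (intro mult_left_mono) auto
      moreover have "\<bar>g x - f x\<bar> \<le> B + 2 * B" using B(1)[of x] fB[of x] by linarith
      ultimately show ?thesis using e by linarith
    next
      case False
      have "(\<Sum>b\<in>Basis. (arcsin (\<sigma> x \<bullet> b) / a) *\<^sub>R b) = (\<Sum>b\<in>Basis. (x \<bullet> b) *\<^sub>R b)"
      proof (rule sum.cong[OF refl])
        fix b :: 'v assume b: "b \<in> Basis"
        have "\<bar>b \<bullet> x\<bar> \<le> R" using False b by force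
        then have "a * \<bar>b \<bullet> x\<bar> \<le> a * R" using a by (intro mult_left_mono) auto
        then have "\<bar>a * (b \<bullet> x)\<bar> \<le> pi / 2" using R a by (simp add: a_def abs_mult)
        then have "arcsin (sin (a * (b \<bullet> x))) = a * (b \<bullet> x)" by (intro arcsin_sin) auto
        then show "(arcsin (\<sigma> x \<bullet> b) / a) *\<^sub>R b = (x \<bullet> b) *\<^sub>R b"
          using a by (simp add: \<sigma>b[OF b] inner_commute[of x b])
      qed
      then have "G (\<sigma> x) = g x" by (simp add: G_def euclidean_representation)
      then have "\<bar>g x - f x\<bar> \<le> e" using p(2)[OF \<sigma>K[of x]] by (simp add: f_def)
      moreover have "0 \<le> 3 * B * tail (real k) x" using B tail_nn by (intro mult_nonneg_nonneg) auto
      ultimately show ?thesis by linarith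
    qed
    have [measurable]: "f \<in> borel_measurable borel"
    proof -
      have "(\<lambda>x. complex_of_real (f x)) \<in> borel_measurable borel"
        using trig_poly_bounded_measurable[OF tf] by blast
      from measurable_compose[OF this borel_measurable_Re] show ?thesis by simp
    qed
    have gB: "\<bar>g x\<bar> \<le> 2 * B" for x using B(1)[of x] B(2) by linarith
    have ints: "integrable M (\<lambda>\<omega>. f (T n \<omega>))" "integrable P (\<lambda>\<omega>. f (S \<omega>))"
       "integrable M (\<lambda>\<omega>. g (T n \<omega>))" "integrable P (\<lambda>\<omega>. g (S \<omega>))" for n
      using fB gB by (auto intro!: M.integrable_const_bound[of _ "2 * B"] P.integrable_const_bound[of _ "2 * B"])
    have flim: "(\<lambda>n. \<integral>\<omega>. f (T n \<omega>) \<partial>M) \<longlonglongrightarrow> (\<integral>\<omega>. f (S \<omega>) \<partial>P)"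
      using tendsto_Re[OF trig_poly_integral_tendsto[OF assms(1-4) char tf]] by simp
    have dP: "\<bar>(\<integral>\<omega>. g (S \<omega>) \<partial>P) - (\<integral>\<omega>. f (S \<omega>) \<partial>P)\<bar> \<le> e + 3 * B * (\<integral>\<omega>. tail (real k) (S \<omega>) \<partial>P)"
    proof -
      have "\<bar>(\<integral>\<omega>. g (S \<omega>) \<partial>P) - (\<integral>\<omega>. f (S \<omega>) \<partial>P)\<bar> \<le> (\<integral>\<omega>. \<bar>g (S \<omega>) - f (S \<omega>)\<bar> \<partial>P)"
        using ints by (intro abs_integral_diff_le)
      also have "\<dots> \<le> (\<integral>\<omega>. e + 3 * B * tail (real k) (S \<omega>) \<partial>P)"
        using ints tail_int fg by (intro integral_mono) auto
      also have "\<dots> = e + 3 * B * (\<integral>\<omega>. tail (real k) (S \<omega>) \<partial>P)"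
        using tail_int by (subst Bochner_Integration.integral_add) (auto simp: P.prob_space)
      finally show ?thesis .
    qed
    have dM: "\<bar>(\<integral>\<omega>. g (T n \<omega>) \<partial>M) - (\<integral>\<omega>. f (T n \<omega>) \<partial>M)\<bar> \<le> e + 3 * B * (\<integral>\<omega>. tail (real k) (T n \<omega>) \<partial>M)" for n
    proof -
      have "\<bar>(\<integral>\<omega>. g (T n \<omega>) \<partial>M) - (\<integral>\<omega>. f (T n \<omega>) \<partial>M)\<bar> \<le> (\<integral>\<omega>. \<bar>g (T n \<omega>) - f (T n \<omega>)\<bar> \<partial>M)"
        using ints by (intro abs_integral_diff_le)
      also have "\<dots> \<le> (\<integral>\<omega>. e + 3 * B * tail (real k) (T n \<omega>) \<partial>M)"
        using ints tail_int fg by (intro integral_mono) auto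
      also have "\<dots> = e + 3 * B * (\<integral>\<omega>. tail (real k) (T n \<omega>) \<partial>M)"
        using tail_int by (subst Bochner_Integration.integral_add) (auto simp: M.prob_space)
      finally show ?thesis .
    qed
    have small: "3 * B * t \<le> e" if "t < d" for t
      using that B by (simp add: d_def field_simps)
    have "eventually (\<lambda>n. norm ((\<integral>\<omega>. g (T n \<omega>) \<partial>M) - (\<integral>\<omega>. g (S \<omega>) \<partial>P)) < r) sequentially"
      using order_tendstoD(2)[OF tail_lim k] tendstoD[OF flim e(1)]
    proof eventually_elim
      case (elim n)
      show ?case
        using dM[of n] dP small[OF k] small[OF elim(1)] elim(2) e unfolding dist_real_def real_norm_def by linarith
    qed
    then show "\<exists>no. \<forall>n\<ge>no. norm ((\<integral>\<omega>. g (T n \<omega>) \<partial>M) - (\<integral>\<omega>. g (S \<omega>) \<partial>P)) < r"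
      by (auto simp: eventually_sequentially)
  qed
qed

section \<open>Poisson integrals\<close>

lemma norm_cis_diff_le: "norm (cis x - cis y) \<le> \<bar>x - y\<bar>"
proof -
  have "cis x - cis y = cis y * (cis (x - y) - 1)" by (simp add: algebra_simps cis_mult)
  then have "norm (cis x - cis y) = norm (cis (x - y) - 1)" by (simp add: norm_mult)
  also have "\<dots> \<le> \<bar>x - y\<bar>"
    using iexp_approx1[of "x - y" 0] by (simp add: cis_conv_exp)
  finally show ?thesis .
qed

lemma norm_cis_minus_one_le: "norm (cis x - 1) \<le> \<bar>x\<bar>"
  using norm_cis_diff_le[of x 0] by simp

lemma norm_cis_second_order: "norm (cis x - 1 - \<i> * of_real x) \<le> x\<^sup>2 / 2"
  using iexp_approx1[of x 1] by (simp add: cis_conv_exp diff_diff_eq numeral_2_eq_2)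

lemma integral_Cauchy_Schwarz:
  fixes f g :: "'a \<Rightarrow> real"
  assumes [measurable]: "f \<in> borel_measurable M" "g \<in> borel_measurable M"
    and int: "integrable M (\<lambda>x. (f x)\<^sup>2)" "integrable M (\<lambda>x. (g x)\<^sup>2)"
  shows "integrable M (\<lambda>x. f x * g x)"
    and "(\<integral>x. \<bar>f x * g x\<bar> \<partial>M) \<le> sqrt (\<integral>x. (f x)\<^sup>2 \<partial>M) * sqrt (\<integral>x. (g x)\<^sup>2 \<partial>M)"
proof -
  have "\<bar>f x * g x\<bar> \<le> (f x)\<^sup>2 + (g x)\<^sup>2" for x
  proof -
    have "0 \<le> (\<bar>f x\<bar> - \<bar>g x\<bar>)\<^sup>2" by simp
    also have "\<dots> = (f x)\<^sup>2 + (g x)\<^sup>2 - 2 * (\<bar>f x\<bar> * \<bar>g x\<bar>)" by (simp add: power2_eq_square algebra_simps)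
    finally have "2 * (\<bar>f x\<bar> * \<bar>g x\<bar>) \<le> (f x)\<^sup>2 + (g x)\<^sup>2" by simp
    moreover have "0 \<le> \<bar>f x\<bar> * \<bar>g x\<bar>" by simp
    ultimately show ?thesis unfolding abs_mult by linarith
  qed
  then show i: "integrable M (\<lambda>x. f x * g x)"
    by (intro Bochner_Integration.integrable_bound[OF Bochner_Integration.integrable_add[OF int]]) (auto intro!: AE_I2 order_trans[OF _ abs_ge_self])
  have "(\<integral>\<^sup>+x. ennreal \<bar>f x\<bar> * ennreal \<bar>g x\<bar> \<partial>M)\<^sup>2 \<le> (\<integral>\<^sup>+x. (ennreal \<bar>f x\<bar>)\<^sup>2 \<partial>M) * (\<integral>\<^sup>+x. (ennreal \<bar>g x\<bar>)\<^sup>2 \<partial>M)"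
    by (rule Cauchy_Schwarz_nn_integral) auto
  also have "(\<integral>\<^sup>+x. ennreal \<bar>f x\<bar> * ennreal \<bar>g x\<bar> \<partial>M) = ennreal (\<integral>x. \<bar>f x * g x\<bar> \<partial>M)"
    using integrable_abs[OF i]
    by (subst nn_integral_eq_integral[symmetric]) (auto simp: abs_mult ennreal_mult')
  also have "(\<integral>\<^sup>+x. (ennreal \<bar>f x\<bar>)\<^sup>2 \<partial>M) = ennreal (\<integral>x. (f x)\<^sup>2 \<partial>M)"
    using int by (subst nn_integral_eq_integral[symmetric]) (auto simp: ennreal_power)
  also have "(\<integral>\<^sup>+x. (ennreal \<bar>g x\<bar>)\<^sup>2 \<partial>M) = ennreal (\<integral>x. (g x)\<^sup>2 \<partial>M)"
    using int by (subst nn_integral_eq_integral[symmetric]) (auto simp: ennreal_power)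
  finally have "(\<integral>x. \<bar>f x * g x\<bar> \<partial>M)\<^sup>2 \<le> (\<integral>x. (f x)\<^sup>2 \<partial>M) * (\<integral>x. (g x)\<^sup>2 \<partial>M)"
    by (simp add: ennreal_power ennreal_mult'[symmetric] integral_nonneg_AE ennreal_le_iff)
  then show "(\<integral>x. \<bar>f x * g x\<bar> \<partial>M) \<le> sqrt (\<integral>x. (f x)\<^sup>2 \<partial>M) * sqrt (\<integral>x. (g x)\<^sup>2 \<partial>M)"
    by (simp add: real_le_rsqrt real_sqrt_mult[symmetric])
qed

lemma (in prob_space) expectation_abs_le_sqrt:
  fixes f :: "'a \<Rightarrow> real"
  assumes "f \<in> borel_measurable M" "integrable M (\<lambda>x. (f x)\<^sup>2)"
  shows "integrable M f" "(\<integral>x. \<bar>f x\<bar> \<partial>M) \<le> sqrt (\<integral>x. (f x)\<^sup>2 \<partial>M)"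
  using integral_Cauchy_Schwarz[of f M "\<lambda>_. 1"] assms by (auto simp: prob_space)

text \<open>The exponent of the characteristic function of the compensated Poisson integral of \<open>f\<close> plus
  the plain Poisson integral of \<open>h\<close>.\<close>

definition poisson_exponent :: "'s measure \<Rightarrow> ('s \<Rightarrow> real) \<Rightarrow> ('s \<Rightarrow> real) \<Rightarrow> complex" where
  "poisson_exponent \<nu> f h = (\<integral>u. (cis (f u + h u) - 1 - \<i> * of_real (f u)) \<partial>\<nu>)"

text \<open>The linear correction makes the contribution of \<open>f\<close> second order, so that
  square-integrability suffices for \<open>f\<close>; the function \<open>h\<close> enters to first
  order.\<close>

lemma integrable_poisson_exponent:
  fixes f h :: "'s \<Rightarrow> real"
  assumes [measurable]: "f \<in> borel_measurable \<nu>" and f: "integrable \<nu> (\<lambda>u. (f u)\<^sup>2)" and h: "integrable \<nu> h"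
  shows "integrable \<nu> (\<lambda>u. cis (f u + h u) - 1 - \<i> * of_real (f u))"
proof (rule Bochner_Integration.integrable_bound)
  show "integrable \<nu> (\<lambda>u. (f u)\<^sup>2 / 2 + \<bar>h u\<bar>)" using f h by auto
  have [measurable]: "h \<in> borel_measurable \<nu>" using h by auto
  show "(\<lambda>u. cis (f u + h u) - 1 - \<i> * of_real (f u)) \<in> borel_measurable \<nu>"
    by (simp add: cis_conv_exp)
  show "AE u in \<nu>. norm (cis (f u + h u) - 1 - \<i> * of_real (f u)) \<le> norm ((f u)\<^sup>2 / 2 + \<bar>h u\<bar>)"
  proof (intro AE_I2)
    fix u
    have "cis (f u + h u) - 1 - \<i> * of_real (f u) = (cis (f u) - 1 - \<i> * of_real (f u)) + (cis (f u + h u) - cis (f u))"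
      by simp
    also have "norm \<dots> \<le> (f u)\<^sup>2 / 2 + \<bar>f u + h u - f u\<bar>"
      by (intro norm_triangle_mono norm_cis_second_order norm_cis_diff_le)
    finally show "norm (cis (f u + h u) - 1 - \<i> * of_real (f u)) \<le> norm ((f u)\<^sup>2 / 2 + \<bar>h u\<bar>)" by simp
  qed
qed

text \<open>Factoring out \<open>cis (x' + y)\<close> leaves a second-order remainder in
  \<open>x - x'\<close> plus a first-order term whose coefficient \<open>cis (x' + y) - 1\<close> is
  small with \<open>x'\<close> and \<open>y\<close>.\<close>

lemma poisson_exponent_diff_bound:
  fixes x x' y :: real
  shows "norm ((cis (x + y) - 1 - \<i> * of_real x) - (cis (x' + y) - 1 - \<i> * of_real x')) \<le>
    (x - x')\<^sup>2 / 2 + \<bar>x'\<bar> * \<bar>x - x'\<bar> + \<bar>y\<bar> * \<bar>x - x'\<bar>"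
proof -
  let ?d = "x - x'"
  have "(cis (x + y) - 1 - \<i> * of_real x) - (cis (x' + y) - 1 - \<i> * of_real x') =
    cis (x' + y) * (cis ?d - 1 - \<i> * of_real ?d) + (cis (x' + y) - 1) * (\<i> * of_real ?d)"
    by (simp add: algebra_simps cis_mult)
  also have "norm \<dots> \<le> ?d\<^sup>2 / 2 + \<bar>x' + y\<bar> * \<bar>?d\<bar>"
  proof (rule norm_triangle_mono)
    show "norm (cis (x' + y) * (cis ?d - 1 - \<i> * of_real ?d)) \<le> ?d\<^sup>2 / 2"
      using norm_cis_second_order[of ?d] by (simp add: norm_mult)
    have "norm ((cis (x' + y) - 1) * (\<i> * of_real ?d)) = norm (cis (x' + y) - 1) * \<bar>?d\<bar>"
      by (simp only: norm_mult norm_of_real norm_ii mult_1)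
    also have "\<dots> \<le> \<bar>x' + y\<bar> * \<bar>?d\<bar>"
      by (intro mult_right_mono norm_cis_minus_one_le) auto
    finally show "norm ((cis (x' + y) - 1) * (\<i> * of_real ?d)) \<le> \<bar>x' + y\<bar> * \<bar>?d\<bar>" .
  qed
  also have "\<bar>x' + y\<bar> * \<bar>?d\<bar> \<le> (\<bar>x'\<bar> + \<bar>y\<bar>) * \<bar>?d\<bar>" by (intro mult_right_mono) auto
  finally show ?thesis by (simp add: distrib_right)
qed

text \<open>Convergence in L2 is the right topology: the pointwise bound on the difference is
  quadratic or bilinear, and Cauchy-Schwarz handles the bilinear terms, using square-integrability
  of \<open>f\<close> and \<open>h\<close>.\<close>

lemma poisson_exponent_tendsto:
  fixes f h :: "'s \<Rightarrow> real" and g :: "nat \<Rightarrow> 's \<Rightarrow> real"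
  assumes [measurable]: "f \<in> borel_measurable \<nu>" "\<And>n. g n \<in> borel_measurable \<nu>"
    and f: "integrable \<nu> (\<lambda>u. (f u)\<^sup>2)" and g: "\<And>n. integrable \<nu> (\<lambda>u. (g n u)\<^sup>2)"
    and h: "integrable \<nu> h" "integrable \<nu> (\<lambda>u. (h u)\<^sup>2)"
    and lim: "(\<lambda>n. \<integral>u. (g n u - f u)\<^sup>2 \<partial>\<nu>) \<longlonglongrightarrow> 0"
  shows "(\<lambda>n. poisson_exponent \<nu> (g n) h) \<longlonglongrightarrow> poisson_exponent \<nu> f h"
proof -
  have [measurable]: "h \<in> borel_measurable \<nu>" using h by auto
  define D where "D n = (\<integral>u. (g n u - f u)\<^sup>2 \<partial>\<nu>)" for n
  have dint: "integrable \<nu> (\<lambda>u. (g n u - f u)\<^sup>2)" for n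
  proof -
    have "(\<lambda>u. (g n u - f u)\<^sup>2) = (\<lambda>u. (g n u)\<^sup>2 - 2 * (g n u * f u) + (f u)\<^sup>2)"
      by (simp add: fun_eq_iff power2_eq_square algebra_simps)
    then show ?thesis using f g integral_Cauchy_Schwarz(1)[of "g n" \<nu> f] by auto
  qed
  define B where "B n = D n / 2 + sqrt (\<integral>u. (f u)\<^sup>2 \<partial>\<nu>) * sqrt (D n) + sqrt (\<integral>u. (h u)\<^sup>2 \<partial>\<nu>) * sqrt (D n)" for n
  have bound: "norm (poisson_exponent \<nu> (g n) h - poisson_exponent \<nu> f h) \<le> B n" for n
  proof -
    let ?d = "\<lambda>u. g n u - f u"
    have if1: "integrable \<nu> (\<lambda>u. \<bar>f u * ?d u\<bar>)" and if2: "integrable \<nu> (\<lambda>u. \<bar>h u * ?d u\<bar>)"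
      using f h dint by (auto intro!: integrable_abs integral_Cauchy_Schwarz(1))
    have "poisson_exponent \<nu> (g n) h - poisson_exponent \<nu> f h =
       (\<integral>u. (cis (g n u + h u) - 1 - \<i> * of_real (g n u)) - (cis (f u + h u) - 1 - \<i> * of_real (f u)) \<partial>\<nu>)"
      unfolding poisson_exponent_def using f g h
      by (intro Bochner_Integration.integral_diff[symmetric] integrable_poisson_exponent) auto
    also have "norm \<dots> \<le> (\<integral>u. ?d u ^ 2 / 2 + \<bar>f u * ?d u\<bar> + \<bar>h u * ?d u\<bar> \<partial>\<nu>)"
    proof (rule order_trans[OF integral_norm_bound integral_mono])
      show "integrable \<nu> (\<lambda>u. norm ((cis (g n u + h u) - 1 - \<i> * of_real (g n u)) - (cis (f u + h u) - 1 - \<i> * of_real (f u))))"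
        using f g h by (intro integrable_norm Bochner_Integration.integrable_diff integrable_poisson_exponent) auto
      show "integrable \<nu> (\<lambda>u. ?d u ^ 2 / 2 + \<bar>f u * ?d u\<bar> + \<bar>h u * ?d u\<bar>)"
        using dint if1 if2 by auto
    qed (use poisson_exponent_diff_bound in \<open>simp only: abs_mult\<close>)
    also have "\<dots> = D n / 2 + (\<integral>u. \<bar>f u * ?d u\<bar> \<partial>\<nu>) + (\<integral>u. \<bar>h u * ?d u\<bar> \<partial>\<nu>)"
      using dint if1 if2 by (simp add: D_def)
    also have "\<dots> \<le> B n"
      unfolding B_def D_def using f h dint by (intro add_mono order_refl integral_Cauchy_Schwarz(2)) auto
    finally show ?thesis .
  qed
  have sD: "(\<lambda>n. sqrt (D n)) \<longlonglongrightarrow> 0" using tendsto_real_sqrt[OF lim] by (simp add: D_def)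
  have "B \<longlonglongrightarrow> 0 / 2 + sqrt (\<integral>u. (f u)\<^sup>2 \<partial>\<nu>) * 0 + sqrt (\<integral>u. (h u)\<^sup>2 \<partial>\<nu>) * 0"
    unfolding B_def[abs_def] by (intro tendsto_intros sD) (use lim in \<open>simp_all add: D_def\<close>)
  then have "B \<longlonglongrightarrow> 0" by simp
  then have "(\<lambda>n. poisson_exponent \<nu> (g n) h - poisson_exponent \<nu> f h) \<longlonglongrightarrow> 0"
    by (rule Lim_null_comparison[rotated]) (simp add: bound)
  then show ?thesis by (simp add: LIM_zero_iff)
qed

section \<open>Measurability of integrals against a random measure\<close>

text \<open>\<open>Q\<close> need not carry the probability: the result serves both for the whole
  space and for the sigma-algebra generated by the counts, which is the one that independence speaks
  of.\<close>

lemma nn_integral_random_measure_measurable: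
  fixes \<nu> :: "'s measure" and f :: "'s \<Rightarrow> ennreal"
  assumes N: "\<And>\<omega>. \<omega> \<in> space Q \<Longrightarrow> sets (N \<omega>) = sets \<nu>"
    and meas: "\<And>A. A \<in> sets \<nu> \<Longrightarrow> (\<lambda>\<omega>. emeasure (N \<omega>) A) \<in> borel_measurable Q"
    and f: "f \<in> borel_measurable \<nu>"
  shows "(\<lambda>\<omega>. \<integral>\<^sup>+u. f u \<partial>N \<omega>) \<in> borel_measurable Q"
proof -
  have mN: "f \<in> borel_measurable (N \<omega>)" if "\<omega> \<in> space Q" "f \<in> borel_measurable \<nu>"
    for f :: "'s \<Rightarrow> ennreal" and \<omega>
    using measurable_cong_sets[OF N[OF that(1)] refl] that(2) by blast
  from f show ?thesis
  proof (induction rule: borel_measurable_induct)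
    case (cong f g)
    have "(\<integral>\<^sup>+u. f u \<partial>N \<omega>) = (\<integral>\<^sup>+u. g u \<partial>N \<omega>)" if "\<omega> \<in> space Q" for \<omega>
      using cong sets_eq_imp_space_eq[OF N[OF that]] by (intro nn_integral_cong) auto
    with cong show ?case by (simp cong: measurable_cong)
  next
    case (set A)
    have "(\<integral>\<^sup>+u. indicator A u \<partial>N \<omega>) = emeasure (N \<omega>) A" if "\<omega> \<in> space Q" for \<omega>
      using set N[OF that] by (intro nn_integral_indicator) auto
    with meas[OF set] show ?case by (simp cong: measurable_cong)
  next
    case (mult u c)
    have "(\<integral>\<^sup>+x. c * u x \<partial>N \<omega>) = c * (\<integral>\<^sup>+x. u x \<partial>N \<omega>)" if "\<omega> \<in> space Q" for \<omega>
      by (rule nn_integral_cmult[OF mN[OF that mult.hyps(2)]])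
    then have "(\<lambda>\<omega>. \<integral>\<^sup>+x. c * u x \<partial>N \<omega>) \<in> borel_measurable Q \<longleftrightarrow> (\<lambda>\<omega>. c * (\<integral>\<^sup>+x. u x \<partial>N \<omega>)) \<in> borel_measurable Q"
      by (intro measurable_cong) auto
    with mult.IH show ?case by simp
  next
    case (add u v)
    have "(\<integral>\<^sup>+x. v x + u x \<partial>N \<omega>) = (\<integral>\<^sup>+x. v x \<partial>N \<omega>) + (\<integral>\<^sup>+x. u x \<partial>N \<omega>)" if "\<omega> \<in> space Q" for \<omega>
      by (rule nn_integral_add) (rule mN[OF that add.hyps(3)], rule mN[OF that add.hyps(1)])
    then have "(\<lambda>\<omega>. \<integral>\<^sup>+x. v x + u x \<partial>N \<omega>) \<in> borel_measurable Q \<longleftrightarrow>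
        (\<lambda>\<omega>. (\<integral>\<^sup>+x. v x \<partial>N \<omega>) + (\<integral>\<^sup>+x. u x \<partial>N \<omega>)) \<in> borel_measurable Q"
      by (intro measurable_cong) auto
    with add.IH show ?case by simp
  next
    case (seq U)
    have sup: "(SUP i. U i) x = (SUP i. U i x)" for x by (simp add: image_image)
    have "(\<integral>\<^sup>+x. (SUP i. U i) x \<partial>N \<omega>) = (SUP i. \<integral>\<^sup>+x. U i x \<partial>N \<omega>)" if "\<omega> \<in> space Q" for \<omega>
      unfolding sup
      by (rule nn_integral_monotone_convergence_SUP[OF seq.hyps(3)]) (rule mN[OF that seq.hyps(1)])
    then have "(\<lambda>\<omega>. \<integral>\<^sup>+x. (SUP i. U i) x \<partial>N \<omega>) \<in> borel_measurable Q \<longleftrightarrow>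
        (\<lambda>\<omega>. SUP i. \<integral>\<^sup>+x. U i x \<partial>N \<omega>) \<in> borel_measurable Q"
      by (intro measurable_cong) auto
    with seq.IH show ?case by simp
  qed
qed

lemma integral_random_measure_measurable:
  fixes f :: "'s \<Rightarrow> real"
  assumes N: "\<And>\<omega>. \<omega> \<in> space Q \<Longrightarrow> sets (N \<omega>) = sets \<nu>"
    and meas: "\<And>A. A \<in> sets \<nu> \<Longrightarrow> (\<lambda>\<omega>. emeasure (N \<omega>) A) \<in> borel_measurable Q"
    and f [measurable]: "f \<in> borel_measurable \<nu>"
  shows "(\<lambda>\<omega>. \<integral>u. f u \<partial>N \<omega>) \<in> borel_measurable Q"
proof -
  note nn = nn_integral_random_measure_measurable[OF N meas]
  have [measurable]: "(\<lambda>\<omega>. \<integral>\<^sup>+u. ennreal (f u) \<partial>N \<omega>) \<in> borel_measurable Q"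
    "(\<lambda>\<omega>. \<integral>\<^sup>+u. ennreal (- f u) \<partial>N \<omega>) \<in> borel_measurable Q"
    "(\<lambda>\<omega>. \<integral>\<^sup>+u. ennreal (norm (f u)) \<partial>N \<omega>) \<in> borel_measurable Q"
    by (rule nn; simp)+
  \<comment> \<open>The Bochner integral of a non-integrable function is 0, hence the case
    distinction.\<close>
  have "(\<integral>u. f u \<partial>N \<omega>) = (if (\<integral>\<^sup>+u. ennreal (norm (f u)) \<partial>N \<omega>) < \<infinity>
      then enn2real (\<integral>\<^sup>+u. ennreal (f u) \<partial>N \<omega>) - enn2real (\<integral>\<^sup>+u. ennreal (- f u) \<partial>N \<omega>) else 0)"
    if "\<omega> \<in> space Q" for \<omega>
  proof -
    have "f \<in> borel_measurable (N \<omega>)" using f measurable_cong_sets[OF N[OF that] refl] by blast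
    then show ?thesis
      by (auto simp: real_lebesgue_integral_def integrable_iff_bounded intro!: not_integrable_integral_eq)
  qed
  then have "(\<lambda>\<omega>. \<integral>u. f u \<partial>N \<omega>) \<in> borel_measurable Q \<longleftrightarrow>
     (\<lambda>\<omega>. if (\<integral>\<^sup>+u. ennreal (norm (f u)) \<partial>N \<omega>) < \<infinity>
      then enn2real (\<integral>\<^sup>+u. ennreal (f u) \<partial>N \<omega>) - enn2real (\<integral>\<^sup>+u. ennreal (- f u) \<partial>N \<omega>) else 0) \<in> borel_measurable Q"
    by (intro measurable_cong) auto
  also have "\<dots>" by measurable
  finally show ?thesis .
qed

section \<open>Campbell's formula and the characteristic function of a Poisson integral\<close>

locale poisson_point_process = prob_space P for P :: "'b measure" +
  fixes \<nu> :: "'s measure" and N :: "'b \<Rightarrow> 's measure"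
  assumes poisson: "poisson_process P \<nu> N"
begin

lemma sets_N: "\<omega> \<in> space P \<Longrightarrow> sets (N \<omega>) = sets \<nu>"
  using poisson by (simp add: poisson_process_def)

lemma emeasure_N_measurable: "A \<in> sets \<nu> \<Longrightarrow> (\<lambda>\<omega>. emeasure (N \<omega>) A) \<in> borel_measurable P"
  using poisson by (simp add: poisson_process_def)

lemmas nn_integral_N_measurable = nn_integral_random_measure_measurable[OF sets_N emeasure_N_measurable]
lemmas integral_N_measurable = integral_random_measure_measurable[OF sets_N emeasure_N_measurable]

lemma borel_measurable_N: "\<omega> \<in> space P \<Longrightarrow> f \<in> borel_measurable \<nu> \<Longrightarrow> f \<in> borel_measurable (N \<omega>)"
  using measurable_cong_sets[OF sets_N refl] by blast

text \<open>The Poisson probabilities of the finite values sum to 1, so the value infinity has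
  probability 0 and the count may be taken as a natural number.\<close>

lemma emeasure_N_counts:
  assumes A: "A \<in> sets \<nu>" "emeasure \<nu> A < \<infinity>"
  obtains \<kappa> :: "'b \<Rightarrow> nat" where "\<kappa> \<in> measurable P (count_space UNIV)"
    and "AE \<omega> in P. emeasure (N \<omega>) A = of_nat (\<kappa> \<omega>)"
    and "distr P (count_space UNIV) \<kappa> =
      density (count_space UNIV) (\<lambda>j. ennreal (measure \<nu> A ^ j / fact j * exp (- measure \<nu> A)))"
proof -
  let ?\<xi> = "\<lambda>\<omega>. emeasure (N \<omega>) A"
  have [measurable]: "?\<xi> \<in> borel_measurable P" by (rule emeasure_N_measurable[OF A(1)])
  define \<kappa> where "\<kappa> \<omega> = nat \<lfloor>enn2real (?\<xi> \<omega>)\<rfloor>" for \<omega>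
  have km [measurable]: "\<kappa> \<in> measurable P (count_space UNIV)" unfolding \<kappa>_def by measurable
  have \<kappa>j: "\<kappa> \<omega> = j" if "?\<xi> \<omega> = of_nat j" for \<omega> j using that by (simp add: \<kappa>_def)
  define p where "p j = measure \<nu> A ^ j / fact j * exp (- measure \<nu> A)" for j
  have pnn: "p j \<ge> 0" for j by (simp add: p_def)
  have pj: "prob {\<omega> \<in> space P. ?\<xi> \<omega> = of_nat j} = p j" for j
    using poisson A by (simp add: poisson_process_def p_def)
  have p1: "p sums 1"
  proof -
    have "p = (\<lambda>j. (measure \<nu> A ^ j /\<^sub>R fact j) * exp (- measure \<nu> A))"
      by (simp add: p_def fun_eq_iff divide_inverse mult.commute)
    then show ?thesis
      using sums_mult2[OF exp_converges[of "measure \<nu> A"], of "exp (- measure \<nu> A)"]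
      by (simp flip: exp_add)
  qed
  have ae: "AE \<omega> in P. ?\<xi> \<omega> = of_nat (\<kappa> \<omega>)"
  proof -
    have "(\<lambda>j. prob {\<omega> \<in> space P. ?\<xi> \<omega> = of_nat j}) sums prob (\<Union>j. {\<omega> \<in> space P. ?\<xi> \<omega> = of_nat j})"
      by (rule finite_measure_UNION) (auto simp: disjoint_family_on_def)
    then have "prob (\<Union>j. {\<omega> \<in> space P. ?\<xi> \<omega> = of_nat j}) = 1"
      using p1 by (simp add: pj sums_unique2)
    then have "AE \<omega> in P. \<omega> \<in> (\<Union>j. {\<omega> \<in> space P. ?\<xi> \<omega> = of_nat j})"
      by (subst (asm) prob_eq_1) auto
    then show ?thesis by eventually_elim (auto simp: \<kappa>j)
  qed
  have "distr P (count_space UNIV) \<kappa> = density (count_space UNIV) (\<lambda>j. ennreal (p j))"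
  proof (rule measure_eqI_countable[where A = UNIV])
    fix j :: nat
    have "emeasure P (\<kappa> -` {j} \<inter> space P) = emeasure P {\<omega> \<in> space P. ?\<xi> \<omega> = of_nat j}"
      by (rule emeasure_eq_AE) (use ae in \<open>auto elim!: eventually_mono simp: \<kappa>j\<close>)
    then show "emeasure (distr P (count_space UNIV) \<kappa>) {j} = emeasure (density (count_space UNIV) (\<lambda>j. ennreal (p j))) {j}"
      using pj[of j] by (simp add: emeasure_distr emeasure_density emeasure_eq_measure)
  qed auto
  with that[OF km ae] show ?thesis by (simp add: p_def)
qed

lemma nn_integral_emeasure_N:
  assumes A: "A \<in> sets \<nu>"
  shows "(\<integral>\<^sup>+\<omega>. emeasure (N \<omega>) A \<partial>P) = emeasure \<nu> A"
proof (cases "emeasure \<nu> A < \<infinity>")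
  case False
  then have "emeasure \<nu> A = \<infinity>" by (metis infinity_ennreal_def less_top)
  moreover from this have "AE \<omega> in P. emeasure (N \<omega>) A = \<infinity>"
    using poisson A by (simp add: poisson_process_def)
  then have "(\<integral>\<^sup>+\<omega>. emeasure (N \<omega>) A \<partial>P) = (\<integral>\<^sup>+\<omega>. \<infinity> \<partial>P)" by (rule nn_integral_cong_AE)
  ultimately show ?thesis by (simp add: emeasure_space_1)
next
  case True
  obtain \<kappa> where \<kappa>: "\<kappa> \<in> measurable P (count_space UNIV)" "AE \<omega> in P. emeasure (N \<omega>) A = of_nat (\<kappa> \<omega>)"
    "distr P (count_space UNIV) \<kappa> = density (count_space UNIV) (\<lambda>j. ennreal (measure \<nu> A ^ j / fact j * exp (- measure \<nu> A)))"
    using emeasure_N_counts[OF A True] by blast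
  define l where "l = measure \<nu> A"
  have "(\<integral>\<^sup>+\<omega>. emeasure (N \<omega>) A \<partial>P) = (\<integral>\<^sup>+\<omega>. of_nat (\<kappa> \<omega>) \<partial>P)" using \<kappa>(2) by (rule nn_integral_cong_AE)
  also have "\<dots> = (\<integral>\<^sup>+j. of_nat j \<partial>distr P (count_space UNIV) \<kappa>)" using \<kappa>(1) by (simp add: nn_integral_distr)
  also have "\<dots> = (\<Sum>j. ennreal (l ^ j / fact j * exp (- l)) * of_nat j)"
    unfolding \<kappa>(3) l_def by (simp add: nn_integral_density nn_integral_count_space_nat)
  also have "\<dots> = (\<Sum>j. ennreal (l ^ j / fact j * exp (- l) * real j))"
    unfolding ennreal_of_nat_eq_real_of_nat by (intro suminf_cong ennreal_mult''[symmetric]) simp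
  also have "\<dots> = ennreal l"
  proof (rule suminf_ennreal_eq)
    have "(\<lambda>j. l * exp (- l) * (l ^ j / fact j)) sums (l * exp (- l) * exp l)"
      using exp_converges[of l] by (intro sums_mult) (simp add: divide_inverse mult.commute)
    then have "(\<lambda>j. l ^ Suc j / fact (Suc j) * exp (- l) * real (Suc j)) sums l"
      by (simp add: exp_minus field_simps del: of_nat_Suc)
    then show "(\<lambda>j. l ^ j / fact j * exp (- l) * real j) sums l"
      by (subst (asm) sums_Suc_iff) simp
  qed (simp add: l_def)
  finally show ?thesis using True by (simp add: l_def emeasure_eq_ennreal_measure)
qed

lemma nn_integral_campbell:
  assumes "f \<in> borel_measurable \<nu>"
  shows "(\<integral>\<^sup>+\<omega>. \<integral>\<^sup>+u. f u \<partial>N \<omega> \<partial>P) = (\<integral>\<^sup>+u. f u \<partial>\<nu>)"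
  using assms
proof (induction rule: borel_measurable_induct)
  case (cong f g)
  have "(\<integral>\<^sup>+u. f u \<partial>N \<omega>) = (\<integral>\<^sup>+u. g u \<partial>N \<omega>)" if "\<omega> \<in> space P" for \<omega>
    using cong sets_eq_imp_space_eq[OF sets_N[OF that]] by (intro nn_integral_cong) auto
  moreover have "(\<integral>\<^sup>+u. f u \<partial>\<nu>) = (\<integral>\<^sup>+u. g u \<partial>\<nu>)" using cong by (intro nn_integral_cong) auto
  ultimately show ?case using cong by (simp cong: nn_integral_cong_simp)
next
  case (set A)
  have "(\<integral>\<^sup>+\<omega>. \<integral>\<^sup>+u. indicator A u \<partial>N \<omega> \<partial>P) = (\<integral>\<^sup>+\<omega>. emeasure (N \<omega>) A \<partial>P)"
    using set sets_N by (intro nn_integral_cong nn_integral_indicator) auto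
  then show ?case using set by (simp add: nn_integral_emeasure_N)
next
  case (mult u c)
  have "(\<integral>\<^sup>+x. c * u x \<partial>N \<omega>) = c * (\<integral>\<^sup>+x. u x \<partial>N \<omega>)" if "\<omega> \<in> space P" for \<omega>
    by (rule nn_integral_cmult[OF borel_measurable_N[OF that mult.hyps(2)]])
  with mult nn_integral_N_measurable[OF _ _ mult.hyps(2)] show ?case by (simp add: nn_integral_cmult cong: nn_integral_cong_simp)
next
  case (add u v)
  have "(\<integral>\<^sup>+x. v x + u x \<partial>N \<omega>) = (\<integral>\<^sup>+x. v x \<partial>N \<omega>) + (\<integral>\<^sup>+x. u x \<partial>N \<omega>)" if "\<omega> \<in> space P" for \<omega>
    by (rule nn_integral_add) (rule borel_measurable_N[OF that add.hyps(3)], rule borel_measurable_N[OF that add.hyps(1)])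
  with add nn_integral_N_measurable[OF _ _ add.hyps(1)] nn_integral_N_measurable[OF _ _ add.hyps(3)] show ?case by (simp add: nn_integral_add cong: nn_integral_cong_simp)
next
  case (seq U)
  have sup: "(SUP i. U i) x = (SUP i. U i x)" for x by (simp add: image_image)
  have "(\<integral>\<^sup>+x. (SUP i. U i) x \<partial>N \<omega>) = (SUP i. \<integral>\<^sup>+x. U i x \<partial>N \<omega>)" if "\<omega> \<in> space P" for \<omega>
    unfolding sup
    by (rule nn_integral_monotone_convergence_SUP[OF seq.hyps(3)]) (rule borel_measurable_N[OF that seq.hyps(1)])
  then have "(\<integral>\<^sup>+\<omega>. \<integral>\<^sup>+u. (SUP i. U i) u \<partial>N \<omega> \<partial>P) = (\<integral>\<^sup>+\<omega>. (SUP i. \<integral>\<^sup>+x. U i x \<partial>N \<omega>) \<partial>P)"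
    by (intro nn_integral_cong) auto
  also have "\<dots> = (SUP i. \<integral>\<^sup>+\<omega>. (\<integral>\<^sup>+x. U i x \<partial>N \<omega>) \<partial>P)"
    using nn_integral_N_measurable[OF _ _ seq.hyps(1)] seq.hyps(3)
    by (intro nn_integral_monotone_convergence_SUP) (auto simp: incseq_def le_fun_def intro!: nn_integral_mono)
  also have "\<dots> = (SUP i. \<integral>\<^sup>+x. U i x \<partial>\<nu>)" using seq.IH by simp
  also have "\<dots> = (\<integral>\<^sup>+x. (SUP i. U i) x \<partial>\<nu>)"
    unfolding sup by (rule nn_integral_monotone_convergence_SUP[OF seq.hyps(3) seq.hyps(1), symmetric])
  finally show ?case .
qed

text \<open>By Campbell's formula the integral of \<open>|f|\<close> against \<open>N\<close> has
  finite mean.\<close>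

lemma AE_integrable_N:
  fixes f :: "'s \<Rightarrow> real"
  assumes f: "integrable \<nu> f"
  shows "AE \<omega> in P. integrable (N \<omega>) f"
proof -
  have [measurable]: "f \<in> borel_measurable \<nu>" using f by auto
  have "(\<integral>\<^sup>+\<omega>. \<integral>\<^sup>+u. norm (f u) \<partial>N \<omega> \<partial>P) = (\<integral>\<^sup>+u. norm (f u) \<partial>\<nu>)"
    by (rule nn_integral_campbell) simp
  also have "\<dots> < \<infinity>" using f by (simp add: integrable_iff_bounded)
  finally have "AE \<omega> in P. (\<integral>\<^sup>+u. norm (f u) \<partial>N \<omega>) \<noteq> \<infinity>"
    by (intro nn_integral_PInf_AE nn_integral_N_measurable) auto
  then show ?thesis
    using AE_space
  proof eventually_elim
    case (elim \<omega>)
    then show ?case using borel_measurable_N[of \<omega> f] by (simp add: integrable_iff_bounded less_top)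
  qed
qed

text \<open>Campbell's formula applied to \<open>|f - g|\<close>. It makes the Poisson integral
  continuous from L1 to L1, which extends identities from simple to integrable functions.\<close>

lemma integral_N_L1:
  fixes f g :: "'s \<Rightarrow> real"
  assumes f: "integrable \<nu> f" and g: "integrable \<nu> g"
  shows "integrable P (\<lambda>\<omega>. (\<integral>u. f u \<partial>N \<omega>) - (\<integral>u. g u \<partial>N \<omega>))"
    and "(\<integral>\<omega>. \<bar>(\<integral>u. f u \<partial>N \<omega>) - (\<integral>u. g u \<partial>N \<omega>)\<bar> \<partial>P) \<le> (\<integral>u. \<bar>f u - g u\<bar> \<partial>\<nu>)"
proof -
  have [measurable]: "f \<in> borel_measurable \<nu>" "g \<in> borel_measurable \<nu>" using f g by auto
  have [measurable]: "(\<lambda>\<omega>. \<integral>u. f u \<partial>N \<omega>) \<in> borel_measurable P" "(\<lambda>\<omega>. \<integral>u. g u \<partial>N \<omega>) \<in> borel_measurable P"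
    by (rule integral_N_measurable; simp)+
  have "(\<integral>\<^sup>+\<omega>. \<bar>(\<integral>u. f u \<partial>N \<omega>) - (\<integral>u. g u \<partial>N \<omega>)\<bar> \<partial>P) \<le> (\<integral>\<^sup>+\<omega>. \<integral>\<^sup>+u. ennreal \<bar>f u - g u\<bar> \<partial>N \<omega> \<partial>P)"
  proof (rule nn_integral_mono_AE)
    show "AE \<omega> in P. ennreal \<bar>(\<integral>u. f u \<partial>N \<omega>) - (\<integral>u. g u \<partial>N \<omega>)\<bar> \<le> (\<integral>\<^sup>+u. ennreal \<bar>f u - g u\<bar> \<partial>N \<omega>)"
      using AE_integrable_N[OF f] AE_integrable_N[OF g]
    proof eventually_elim
      case (elim \<omega>)
      have "\<bar>(\<integral>u. f u \<partial>N \<omega>) - (\<integral>u. g u \<partial>N \<omega>)\<bar> \<le> (\<integral>u. \<bar>f u - g u\<bar> \<partial>N \<omega>)"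
        using elim by (intro abs_integral_diff_le)
      then have "ennreal \<bar>(\<integral>u. f u \<partial>N \<omega>) - (\<integral>u. g u \<partial>N \<omega>)\<bar> \<le> ennreal (\<integral>u. \<bar>f u - g u\<bar> \<partial>N \<omega>)"
        by (rule ennreal_leI)
      also have "\<dots> = (\<integral>\<^sup>+u. ennreal \<bar>f u - g u\<bar> \<partial>N \<omega>)"
        using elim by (intro nn_integral_eq_integral[symmetric]) auto
      finally show ?case .
    qed
  qed
  also have "\<dots> = (\<integral>\<^sup>+u. ennreal \<bar>f u - g u\<bar> \<partial>\<nu>)" by (rule nn_integral_campbell) simp
  also have "\<dots> = ennreal (\<integral>u. \<bar>f u - g u\<bar> \<partial>\<nu>)" using f g by (intro nn_integral_eq_integral) auto
  finally have *: "(\<integral>\<^sup>+\<omega>. \<bar>(\<integral>u. f u \<partial>N \<omega>) - (\<integral>u. g u \<partial>N \<omega>)\<bar> \<partial>P) \<le> ennreal (\<integral>u. \<bar>f u - g u\<bar> \<partial>\<nu>)" .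
  show i: "integrable P (\<lambda>\<omega>. (\<integral>u. f u \<partial>N \<omega>) - (\<integral>u. g u \<partial>N \<omega>))"
    using * by (auto simp: integrable_iff_bounded intro: le_less_trans)
  then have "ennreal (\<integral>\<omega>. \<bar>(\<integral>u. f u \<partial>N \<omega>) - (\<integral>u. g u \<partial>N \<omega>)\<bar> \<partial>P) \<le> ennreal (\<integral>u. \<bar>f u - g u\<bar> \<partial>\<nu>)"
    using * by (subst nn_integral_eq_integral[symmetric]) auto
  then show "(\<integral>\<omega>. \<bar>(\<integral>u. f u \<partial>N \<omega>) - (\<integral>u. g u \<partial>N \<omega>)\<bar> \<partial>P) \<le> (\<integral>u. \<bar>f u - g u\<bar> \<partial>\<nu>)"
    by (simp add: ennreal_le_iff)
qed

end

context poisson_point_process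
begin

lemma char_count:
  assumes A: "A \<in> sets \<nu>" "emeasure \<nu> A < \<infinity>"
  shows "(\<integral>\<omega>. cis (a * measure (N \<omega>) A) \<partial>P) = exp (of_real (measure \<nu> A) * (cis a - 1))"
proof -
  define l where "l = measure \<nu> A"
  define p where "p j = l ^ j / fact j * exp (- l)" for j :: nat
  have pnn: "p j \<ge> 0" for j by (simp add: p_def l_def)
  obtain \<kappa> where \<kappa> [measurable]: "\<kappa> \<in> measurable P (count_space UNIV)" "AE \<omega> in P. emeasure (N \<omega>) A = of_nat (\<kappa> \<omega>)"
    "distr P (count_space UNIV) \<kappa> = density (count_space UNIV) (\<lambda>j. ennreal (p j))"
    using emeasure_N_counts[OF A] unfolding p_def l_def by blast
  have [measurable]: "(\<lambda>\<omega>. measure (N \<omega>) A) \<in> borel_measurable P"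
    unfolding measure_def using emeasure_N_measurable[OF A(1)] by measurable
  have "(\<integral>\<omega>. cis (a * measure (N \<omega>) A) \<partial>P) = (\<integral>\<omega>. cis (a * real (\<kappa> \<omega>)) \<partial>P)"
  proof (rule integral_cong_AE)
    show "AE \<omega> in P. cis (a * measure (N \<omega>) A) = cis (a * real (\<kappa> \<omega>))"
      using \<kappa>(2) by eventually_elim (simp add: measure_def)
  qed (simp_all add: cis_conv_exp)
  also have "\<dots> = (\<integral>j. cis (a * real j) \<partial>distr P (count_space UNIV) \<kappa>)"
    by (simp add: integral_distr)
  also have "\<dots> = (\<integral>j. p j *\<^sub>R cis (a * real j) \<partial>count_space UNIV)"
    unfolding \<kappa>(3) using pnn by (subst integral_density) auto
  also have "\<dots> = (\<Sum>j. p j *\<^sub>R cis (a * real j))"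
  proof (rule integral_count_space_nat)
    have "summable p"
      unfolding p_def[abs_def] using summable_exp[of l] by (intro summable_mult2) (simp add: divide_inverse mult.commute)
    then show "integrable (count_space UNIV) (\<lambda>j. p j *\<^sub>R cis (a * real j))"
      using pnn by (simp add: integrable_count_space_nat_iff)
  qed
  also have "\<dots> = exp (of_real l * cis a) * exp (- of_real l)"
  proof (rule sums_unique[symmetric])
    have "(\<lambda>j. ((of_real l * cis a) ^ j /\<^sub>R fact j) * exp (- of_real l :: complex)) sums (exp (of_real l * cis a) * exp (- of_real l))"
      by (intro sums_mult2 exp_converges)
    moreover have dm: "cis (a * real j) = cis a ^ j" for j :: nat
      using Complex.DeMoivre[of a j] by (simp add: mult.commute)
    have "((of_real l * cis a) ^ j /\<^sub>R fact j) * exp (- of_real l :: complex) = p j *\<^sub>R cis (a * real j)" for j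
      by (simp add: p_def scaleR_conv_of_real power_mult_distrib dm exp_of_real[symmetric] field_simps)
    ultimately show "(\<lambda>j. p j *\<^sub>R cis (a * real j)) sums (exp (of_real l * cis a) * exp (- of_real l))" by simp
  qed
  also have "\<dots> = exp (of_real l * (cis a - 1))" by (simp add: exp_add[symmetric] algebra_simps)
  finally show ?thesis by (simp add: l_def)
qed

text \<open>The level sets of the nonzero values are disjoint and of finite intensity, so their
  counts are independent Poisson variables and the characteristic function is a product.\<close>

lemma char_simple_integral:
  fixes s :: "'s \<Rightarrow> real"
  assumes s: "Bochner_Integration.simple_bochner_integrable \<nu> s"
  shows "(\<integral>\<omega>. cis (\<integral>u. s u \<partial>N \<omega>) \<partial>P) = exp (\<integral>u. (cis (s u) - 1) \<partial>\<nu>)"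
proof -
  have sf: "simple_function \<nu> s" and fin: "emeasure \<nu> {u \<in> space \<nu>. s u \<noteq> 0} < \<infinity>"
    using s by (auto simp: Bochner_Integration.simple_bochner_integrable.simps less_top)
  have [measurable]: "s \<in> borel_measurable \<nu>" using sf by (rule borel_measurable_simple_function)
  have "finite (s ` space \<nu> - {0})" using sf by (auto simp: simple_function_def)
  then have "\<exists>h. bij_betw h {0..<card (s ` space \<nu> - {0})} (s ` space \<nu> - {0})"
    by (rule ex_bij_betw_nat_finite)
  then obtain h where h': "bij_betw h {0..<card (s ` space \<nu> - {0})} (s ` space \<nu> - {0})" by blast
  define n where "n = card (s ` space \<nu> - {0})"
  have h: "bij_betw h {..<n} (s ` space \<nu> - {0})" using h' by (simp add: n_def atLeast0LessThan)
  define A where "A j = s -` {h j} \<inter> space \<nu>" for j :: nat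
  have hn0: "h j \<noteq> 0" if "j < n" for j using h that by (auto simp: bij_betw_def)
  have A [measurable]: "A j \<in> sets \<nu>" for j unfolding A_def by measurable
  have Afin: "emeasure \<nu> (A j) < \<infinity>" if "j < n" for j
  proof -
    have "emeasure \<nu> (A j) \<le> emeasure \<nu> {u \<in> space \<nu>. s u \<noteq> 0}"
      using hn0[OF that] by (intro emeasure_mono) (auto simp: A_def)
    then show ?thesis using fin by (rule le_less_trans)
  qed
  have disj: "disjoint_family_on A {..<n}"
    using h by (auto simp: disjoint_family_on_def A_def bij_betw_def inj_on_def)
  \<comment> \<open>Used twice: with the identity for the integral against \<open>N\<close>, and
    with \<open>cis x - 1\<close> for the exponent.\<close>
  have rep: "\<phi> (s u) = (\<Sum>j<n. indicator (A j) u *\<^sub>R \<phi> (h j))" if "u \<in> space \<nu>" "\<phi> 0 = 0"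
    for u and \<phi> :: "real \<Rightarrow> 'x::real_vector"
  proof (cases "s u = 0")
    case True
    then have "indicator (A j) u = (0::real)" if "j < n" for j using hn0[OF that] by (auto simp: A_def)
    then show ?thesis using True that by simp
  next
    case False
    then have "s u \<in> h ` {..<n}" using that h by (auto simp: bij_betw_def)
    then obtain i where i: "i < n" "s u = h i" by auto
    have "indicator (A j) u *\<^sub>R \<phi> (h j) = (if j = i then \<phi> (h i) else 0)" if "j < n" for j
      using i \<open>u \<in> space \<nu>\<close> h that by (auto simp: A_def indicator_def bij_betw_def inj_on_def)
    then show ?thesis using i by simp
  qed
  have meas [measurable]: "(\<lambda>\<omega>. measure (N \<omega>) (A j)) \<in> borel_measurable P" for j
    unfolding measure_def using emeasure_N_measurable[OF A] by measurable
  have ae: "AE \<omega> in P. \<forall>j\<in>{..<n}. emeasure (N \<omega>) (A j) < \<infinity>"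
  proof (rule AE_finite_allI)
    fix j assume "j \<in> {..<n}"
    then obtain \<kappa> :: "'b \<Rightarrow> nat" where "AE \<omega> in P. emeasure (N \<omega>) (A j) = of_nat (\<kappa> \<omega>)"
      using emeasure_N_counts[OF A Afin] by blast
    then show "AE \<omega> in P. emeasure (N \<omega>) (A j) < \<infinity>" by eventually_elim (simp add: of_nat_less_top)
  qed simp
  have "(\<integral>\<omega>. cis (\<integral>u. s u \<partial>N \<omega>) \<partial>P) = (\<integral>\<omega>. (\<Prod>j<n. cis (h j * measure (N \<omega>) (A j))) \<partial>P)"
  proof (rule integral_cong_AE)
    show "AE \<omega> in P. cis (\<integral>u. s u \<partial>N \<omega>) = (\<Prod>j<n. cis (h j * measure (N \<omega>) (A j)))"
      using ae AE_space
    proof eventually_elim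
      case (elim \<omega>)
      have sp: "space (N \<omega>) = space \<nu>" using sets_eq_imp_space_eq[OF sets_N[OF elim(2)]] .
      have "(\<integral>u. s u \<partial>N \<omega>) = (\<integral>u. (\<Sum>j<n. indicator (A j) u *\<^sub>R h j) \<partial>N \<omega>)"
        using rep[of _ "\<lambda>x. x"] sp by (intro Bochner_Integration.integral_cong) auto
      also have "\<dots> = (\<Sum>j<n. measure (N \<omega>) (A j) * h j)"
        using elim sets_N[OF elim(2)] by (subst Bochner_Integration.integral_sum) (auto intro!: integrable_real_indicator)
      finally have "(\<integral>u. s u \<partial>N \<omega>) = (\<Sum>j<n. h j * measure (N \<omega>) (A j))" by (simp add: mult.commute)
      then show ?case by (simp add: cis_conv_exp sum_distrib_left exp_sum)
    qed
    show "(\<lambda>\<omega>. cis (\<integral>u. s u \<partial>N \<omega>)) \<in> borel_measurable P"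
      unfolding cis_conv_exp using integral_N_measurable[of s] by simp
  qed (simp add: cis_conv_exp)
  also have "\<dots> = (\<Prod>j<n. \<integral>\<omega>. cis (h j * measure (N \<omega>) (A j)) \<partial>P)"
  proof (rule indep_vars_lebesgue_integral)
    have "indep_vars (\<lambda>_. borel) (\<lambda>j \<omega>. emeasure (N \<omega>) (A j)) {..<n}"
      using poisson A disj by (simp add: poisson_process_def)
    then have "indep_vars (\<lambda>_. borel) (\<lambda>j \<omega>. cis (h j * enn2real (emeasure (N \<omega>) (A j)))) {..<n}"
      by (rule indep_vars_compose2) (simp add: cis_conv_exp)
    then show "indep_vars (\<lambda>_. borel) (\<lambda>j \<omega>. cis (h j * measure (N \<omega>) (A j))) {..<n}"
      by (simp add: measure_def)
  next
    fix j assume "j \<in> {..<n}"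
    show "integrable P (\<lambda>\<omega>. cis (h j * measure (N \<omega>) (A j)))"
      by (rule integrable_const_bound[of _ 1]) (simp_all add: cis_conv_exp)
  qed simp
  also have "\<dots> = (\<Prod>j<n. exp (of_real (measure \<nu> (A j)) * (cis (h j) - 1)))"
    using A Afin by (intro prod.cong refl char_count) auto
  also have "\<dots> = exp (\<Sum>j<n. of_real (measure \<nu> (A j)) * (cis (h j) - 1))"
    by (simp add: exp_sum)
  also have "(\<Sum>j<n. of_real (measure \<nu> (A j)) * (cis (h j) - 1)) = (\<integral>u. (\<Sum>j<n. indicator (A j) u *\<^sub>R (cis (h j) - 1)) \<partial>\<nu>)"
    using Afin by (subst Bochner_Integration.integral_sum) (auto simp: scaleR_conv_of_real)
  also have "\<dots> = (\<integral>u. (cis (s u) - 1) \<partial>\<nu>)"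
    using rep[of _ "\<lambda>x. cis x - 1"] by (intro Bochner_Integration.integral_cong) auto
  finally show ?thesis .
qed

lemma integrable_cis_minus_one:
  fixes f :: "'x \<Rightarrow> real"
  assumes "integrable R f"
  shows "integrable R (\<lambda>u. cis (f u) - 1)"
proof (rule Bochner_Integration.integrable_bound[OF assms])
  have [measurable]: "f \<in> borel_measurable R" using assms by auto
  show "(\<lambda>u. cis (f u) - 1) \<in> borel_measurable R" by (simp add: cis_conv_exp)
qed (simp add: norm_cis_minus_one_le)

lemma char_integral:
  fixes f :: "'s \<Rightarrow> real"
  assumes f: "integrable \<nu> f"
  shows "(\<integral>\<omega>. cis (\<integral>u. f u \<partial>N \<omega>) \<partial>P) = exp (\<integral>u. (cis (f u) - 1) \<partial>\<nu>)"
proof -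
  \<comment> \<open>Unfolding the Bochner integral supplies simple functions that converge to
    \<open>f\<close> in L1; both sides of the claim are continuous in that sense.\<close>
  obtain x where "has_bochner_integral \<nu> f x" using f by (auto simp: integrable.simps)
  then have "\<exists>s. (\<forall>i. Bochner_Integration.simple_bochner_integrable \<nu> (s i)) \<and>
      (\<lambda>i. \<integral>\<^sup>+x. norm (f x - s i x) \<partial>\<nu>) \<longlonglongrightarrow> 0"
    by (cases rule: has_bochner_integral.cases) blast
  then obtain s where s: "\<And>i. Bochner_Integration.simple_bochner_integrable \<nu> (s i)"
    and lim: "(\<lambda>i. \<integral>\<^sup>+x. norm (f x - s i x) \<partial>\<nu>) \<longlonglongrightarrow> 0" by blast
  have si: "integrable \<nu> (s i)" for i
    using has_bochner_integral_simple_bochner_integrable[OF s[of i]] by (auto simp: integrable.simps)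
  define d where "d i = (\<integral>u. \<bar>f u - s i u\<bar> \<partial>\<nu>)" for i
  have "(\<integral>\<^sup>+x. norm (f x - s i x) \<partial>\<nu>) = ennreal (d i)" for i
    using f si[of i] by (subst nn_integral_eq_integral) (auto simp: d_def)
  with lim have "(\<lambda>i. ennreal (d i)) \<longlonglongrightarrow> ennreal 0" by simp
  then have d0: "d \<longlonglongrightarrow> 0" by (subst (asm) tendsto_ennreal_iff) (auto simp: d_def)
  have fm: "(\<lambda>\<omega>. \<integral>u. f u \<partial>N \<omega>) \<in> borel_measurable P" and sm: "(\<lambda>\<omega>. \<integral>u. s i u \<partial>N \<omega>) \<in> borel_measurable P" for i
    using f si by (auto intro!: integral_N_measurable)
  have cis_int: "integrable P (\<lambda>\<omega>. cis (X \<omega>))" if "X \<in> borel_measurable P" for X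
    using that by (intro integrable_const_bound[of _ 1]) (simp_all add: cis_conv_exp)
  have L: "(\<lambda>i. \<integral>\<omega>. cis (\<integral>u. s i u \<partial>N \<omega>) \<partial>P) \<longlonglongrightarrow> (\<integral>\<omega>. cis (\<integral>u. f u \<partial>N \<omega>) \<partial>P)"
  proof (rule LIM_zero_cancel, rule Lim_null_comparison[OF _ d0], rule always_eventually, rule allI)
    fix i
    have "norm ((\<integral>\<omega>. cis (\<integral>u. s i u \<partial>N \<omega>) \<partial>P) - (\<integral>\<omega>. cis (\<integral>u. f u \<partial>N \<omega>) \<partial>P)) =
        norm (\<integral>\<omega>. cis (\<integral>u. s i u \<partial>N \<omega>) - cis (\<integral>u. f u \<partial>N \<omega>) \<partial>P)"
      using fm sm by (subst Bochner_Integration.integral_diff) (auto intro!: cis_int)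
    also have "\<dots> \<le> (\<integral>\<omega>. \<bar>(\<integral>u. f u \<partial>N \<omega>) - (\<integral>u. s i u \<partial>N \<omega>)\<bar> \<partial>P)"
    proof (rule order_trans[OF integral_norm_bound integral_mono])
      show "norm (cis (\<integral>u. s i u \<partial>N \<omega>) - cis (\<integral>u. f u \<partial>N \<omega>)) \<le> \<bar>(\<integral>u. f u \<partial>N \<omega>) - (\<integral>u. s i u \<partial>N \<omega>)\<bar>" for \<omega>
        using norm_cis_diff_le by (subst abs_minus_commute) auto
    qed (use f si integral_N_L1(1) fm sm cis_int in auto)
    also have "\<dots> \<le> d i" unfolding d_def by (rule integral_N_L1(2)[OF f si])
    finally show "norm ((\<integral>\<omega>. cis (\<integral>u. s i u \<partial>N \<omega>) \<partial>P) - (\<integral>\<omega>. cis (\<integral>u. f u \<partial>N \<omega>) \<partial>P)) \<le> d i" .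
  qed
  have "(\<lambda>i. \<integral>u. (cis (s i u) - 1) \<partial>\<nu>) \<longlonglongrightarrow> (\<integral>u. (cis (f u) - 1) \<partial>\<nu>)"
  proof (rule LIM_zero_cancel, rule Lim_null_comparison[OF _ d0], rule always_eventually, rule allI)
    fix i
    have "norm ((\<integral>u. (cis (s i u) - 1) \<partial>\<nu>) - (\<integral>u. (cis (f u) - 1) \<partial>\<nu>)) = norm (\<integral>u. (cis (s i u) - 1) - (cis (f u) - 1) \<partial>\<nu>)"
      using f si by (subst Bochner_Integration.integral_diff) (auto intro!: integrable_cis_minus_one)
    also have "\<dots> \<le> d i"
      unfolding d_def
    proof (rule order_trans[OF integral_norm_bound integral_mono])
      show "norm ((cis (s i u) - 1) - (cis (f u) - 1)) \<le> \<bar>f u - s i u\<bar>" for u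
        using norm_cis_diff_le[of "s i u" "f u"] by (simp add: abs_minus_commute)
      show "integrable \<nu> (\<lambda>u. norm ((cis (s i u) - 1) - (cis (f u) - 1)))"
        by (intro integrable_norm Bochner_Integration.integrable_diff[OF integrable_cis_minus_one[OF si] integrable_cis_minus_one[OF f]])
    qed (use f si in auto)
    finally show "norm ((\<integral>u. (cis (s i u) - 1) \<partial>\<nu>) - (\<integral>u. (cis (f u) - 1) \<partial>\<nu>)) \<le> d i" .
  qed
  then have "(\<lambda>i. exp (\<integral>u. (cis (s i u) - 1) \<partial>\<nu>)) \<longlonglongrightarrow> exp (\<integral>u. (cis (f u) - 1) \<partial>\<nu>)"
    by (rule tendsto_exp)
  then have "(\<lambda>i. \<integral>\<omega>. cis (\<integral>u. s i u \<partial>N \<omega>) \<partial>P) \<longlonglongrightarrow> exp (\<integral>u. (cis (f u) - 1) \<partial>\<nu>)"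
    by (simp add: char_simple_integral[OF s])
  from LIMSEQ_unique[OF L this] show ?thesis .
qed

end

section \<open>The trace of powers of the self-normalized matrix\<close>

lemma (in prob_space) distr_PiM_iid:
  assumes "I \<noteq> {}" "indep_vars (\<lambda>_. borel) A I" "\<And>i. i \<in> I \<Longrightarrow> distr M borel (A i) = \<rho>"
  shows "distr M (\<Pi>\<^sub>M i\<in>I. borel) (\<lambda>\<omega>. \<lambda>i\<in>I. A i \<omega>) = (\<Pi>\<^sub>M i\<in>I. \<rho>)"
proof -
  have "distr M (\<Pi>\<^sub>M i\<in>I. borel) (\<lambda>\<omega>. \<lambda>i\<in>I. A i \<omega>) = (\<Pi>\<^sub>M i\<in>I. distr M borel (A i))"
    using assms(2) by (subst indep_vars_iff_distr_eq_PiM'[symmetric]) (use assms in \<open>auto simp: indep_vars_def\<close>)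
  also have "\<dots> = (\<Pi>\<^sub>M i\<in>I. \<rho>)" by (rule PiM_cong) (use assms in auto)
  finally show ?thesis .
qed

text \<open>Written as a function of the array of entries, so that equality in law of two arrays
  carries over to the normalized ones.\<close>

definition normalized_entry :: "nat \<Rightarrow> (nat \<times> nat \<Rightarrow> real) \<Rightarrow> nat \<times> nat \<Rightarrow> real" where
  "normalized_entry n x e = x e / sqrt (\<Sum>l<n. (x (fst e, l))\<^sup>2)"

section \<open>Independence and symmetries of the normalized entries\<close>

context symmetric_iid_array
begin

definition entry :: "nat \<times> nat \<Rightarrow> 'a \<Rightarrow> real" where
  "entry e \<omega> = X (Suc (fst e)) (Suc (snd e)) \<omega>"

definition Y :: "nat \<Rightarrow> nat \<times> nat \<Rightarrow> 'a \<Rightarrow> real" where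
  "Y n e \<omega> = normalized_entry n (\<lambda>e. entry e \<omega>) e"

definition square :: "nat \<Rightarrow> (nat \<times> nat) set" where
  "square n = {..<n} \<times> {..<n}"

lemma X_measurable: "i \<ge> 1 \<Longrightarrow> j \<ge> 1 \<Longrightarrow> X i j \<in> borel_measurable M"
  using independent by (auto simp: indep_vars_def)

lemma entry_measurable [measurable]: "entry e \<in> borel_measurable M"
  unfolding entry_def[abs_def] by (rule X_measurable) auto

lemma distr_entry: "distr M borel (entry e) = distr M borel (X 1 1)"
  unfolding entry_def[abs_def] by (rule identically_distributed) auto

lemma indep_vars_entry: "indep_vars (\<lambda>_. borel) entry K"
proof -
  define f where "f e = (Suc (fst e), Suc (snd e))" for e :: "nat \<times> nat"
  have "indep_vars (\<lambda>e. PiM {f e} (\<lambda>_. borel)) (\<lambda>e \<omega>. \<lambda>p\<in>{f e}. (case p of (i, j) \<Rightarrow> X i j) \<omega>) K"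
    by (rule indep_vars_restrict[OF independent]) (auto simp: f_def disjoint_family_on_def)
  then have "indep_vars (\<lambda>_. borel) (\<lambda>e \<omega>. (\<lambda>z. z (f e)) (\<lambda>p\<in>{f e}. (case p of (i, j) \<Rightarrow> X i j) \<omega>)) K"
    by (rule indep_vars_compose2) measurable
  then show ?thesis by (simp add: f_def entry_def[abs_def])
qed

lemma Y_measurable [measurable]: "Y n e \<in> borel_measurable M"
  unfolding Y_def normalized_entry_def by measurable

text \<open>The sum is \<open>s / s\<close>, which is 1 or, for a vanishing row, 0 by
  convention.\<close>

lemma sum_Y_le_1: "(\<Sum>j<n. (Y n (i, j) \<omega>)\<^sup>2) \<le> 1"
proof -
  define s where "s = (\<Sum>l<n. (entry (i, l) \<omega>)\<^sup>2)"
  have s: "s \<ge> 0" by (simp add: s_def sum_nonneg)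
  have "(\<Sum>j<n. (Y n (i, j) \<omega>)\<^sup>2) = s / s"
    using s by (simp add: Y_def normalized_entry_def s_def[symmetric] power_divide sum_divide_distrib[symmetric])
  then show ?thesis by simp
qed

lemma Y_sq_le_1: "e \<in> square n \<Longrightarrow> (Y n e \<omega>)\<^sup>2 \<le> 1"
  using member_le_sum[of "snd e" "{..<n}" "\<lambda>j. (Y n (fst e, j) \<omega>)\<^sup>2"] sum_Y_le_1[of n "fst e" \<omega>]
  by (auto simp: square_def)

lemma Y_abs_le_1: "e \<in> square n \<Longrightarrow> \<bar>Y n e \<omega>\<bar> \<le> 1"
  using Y_sq_le_1[of e n \<omega>] by (simp add: abs_square_le_1)

lemma Y_measurable_PiM:
  assumes "R \<subseteq> {..<n}"
  shows "(\<lambda>x. \<lambda>e\<in>R \<times> {..<n}. normalized_entry n x e) \<in> measurable (\<Pi>\<^sub>M e\<in>R \<times> {..<n}. borel) (\<Pi>\<^sub>M e\<in>R \<times> {..<n}. borel)"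
proof (rule measurable_restrict)
  fix e assume e: "e \<in> R \<times> {..<n}"
  have [measurable]: "(\<lambda>x. x (fst e, l)) \<in> borel_measurable (\<Pi>\<^sub>M e\<in>R \<times> {..<n}. borel)" if "l \<in> {..<n}" for l
    using e that by (intro measurable_component_singleton) auto
  have [measurable]: "(\<lambda>x. x e) \<in> borel_measurable (\<Pi>\<^sub>M e\<in>R \<times> {..<n}. borel)"
    using e by (intro measurable_component_singleton) auto
  show "(\<lambda>x. normalized_entry n x e) \<in> borel_measurable (\<Pi>\<^sub>M e\<in>R \<times> {..<n}. borel)"
    unfolding normalized_entry_def by measurable
qed

lemma Y_restrict:
  "e \<in> R \<times> {..<n} \<Longrightarrow> normalized_entry n (\<lambda>e\<in>R \<times> {..<n}. x e) e = normalized_entry n x e"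
  by (auto simp: normalized_entry_def intro!: arg_cong2[where f = "(/)"] arg_cong[where f = sqrt] sum.cong)

lemma indep_rows:
  assumes "R \<inter> S = {}" "R \<subseteq> {..<n}" "S \<subseteq> {..<n}"
  shows "indep_var (\<Pi>\<^sub>M e\<in>R \<times> {..<n}. borel) (\<lambda>\<omega>. \<lambda>e\<in>R \<times> {..<n}. Y n e \<omega>)
    (\<Pi>\<^sub>M e\<in>S \<times> {..<n}. borel) (\<lambda>\<omega>. \<lambda>e\<in>S \<times> {..<n}. Y n e \<omega>)"
proof -
  have "indep_var (\<Pi>\<^sub>M e\<in>R \<times> {..<n}. borel) (\<lambda>\<omega>. \<lambda>e\<in>R \<times> {..<n}. entry e \<omega>)
    (\<Pi>\<^sub>M e\<in>S \<times> {..<n}. borel) (\<lambda>\<omega>. \<lambda>e\<in>S \<times> {..<n}. entry e \<omega>)"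
    using assms by (intro indep_var_restrict[OF indep_vars_entry[of UNIV]]) auto
  from indep_var_compose[OF this Y_measurable_PiM[OF assms(2)] Y_measurable_PiM[OF assms(3)]]
  show ?thesis by (simp add: o_def Y_def Y_restrict cong: restrict_cong)
qed

text \<open>That \<open>f\<close> depends on the rows in \<open>R\<close> only is expressed by
  invariance under restriction. Disjoint sets of rows are independent because each row is normalized
  by its own entries.\<close>

lemma expectation_rows_mult:
  fixes f g :: "(nat \<times> nat \<Rightarrow> real) \<Rightarrow> 'c::{real_normed_field, banach, second_countable_topology}"
  assumes "R \<inter> S = {}" "R \<subseteq> {..<n}" "S \<subseteq> {..<n}"
    and f: "f \<in> borel_measurable (\<Pi>\<^sub>M e\<in>R \<times> {..<n}. borel)" "\<And>x. f (\<lambda>e\<in>R \<times> {..<n}. x e) = f x"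
    and g: "g \<in> borel_measurable (\<Pi>\<^sub>M e\<in>S \<times> {..<n}. borel)" "\<And>x. g (\<lambda>e\<in>S \<times> {..<n}. x e) = g x"
    and int: "integrable M (\<lambda>\<omega>. f (\<lambda>e. Y n e \<omega>))" "integrable M (\<lambda>\<omega>. g (\<lambda>e. Y n e \<omega>))"
  shows "(\<integral>\<omega>. f (\<lambda>e. Y n e \<omega>) * g (\<lambda>e. Y n e \<omega>) \<partial>M) = (\<integral>\<omega>. f (\<lambda>e. Y n e \<omega>) \<partial>M) * (\<integral>\<omega>. g (\<lambda>e. Y n e \<omega>) \<partial>M)"
proof (rule indep_var_lebesgue_integral[OF _ int])
  have "indep_var borel (\<lambda>\<omega>. f (\<lambda>e\<in>R \<times> {..<n}. Y n e \<omega>)) borel (\<lambda>\<omega>. g (\<lambda>e\<in>S \<times> {..<n}. Y n e \<omega>))"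
    using indep_var_compose[OF indep_rows[OF assms(1-3)] f(1) g(1)] by (simp add: o_def)
  then show "indep_var borel (\<lambda>\<omega>. f (\<lambda>e. Y n e \<omega>)) borel (\<lambda>\<omega>. g (\<lambda>e. Y n e \<omega>))"
    by (simp add: f(2) g(2))
qed

text \<open>The joint law of the raw entries determines the expectations of functions of the
  normalized ones. The sign flip and the exchange of columns below are the two choices of
  \<open>A\<close>.\<close>

lemma expectation_invariant:
  fixes \<Phi> :: "(nat \<times> nat \<Rightarrow> real) \<Rightarrow> real"
  assumes n: "n \<ge> 1" and A: "distr M (\<Pi>\<^sub>M e\<in>square n. borel) (\<lambda>\<omega>. \<lambda>e\<in>square n. A e \<omega>) = (\<Pi>\<^sub>M e\<in>square n. distr M borel (X 1 1))"
    and Am: "\<And>e. A e \<in> borel_measurable M"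
    and \<Phi>: "\<Phi> \<in> borel_measurable (\<Pi>\<^sub>M e\<in>square n. borel)" "\<And>x. \<Phi> (\<lambda>e\<in>square n. x e) = \<Phi> x"
  shows "(\<integral>\<omega>. \<Phi> (\<lambda>e. Y n e \<omega>) \<partial>M) = (\<integral>\<omega>. \<Phi> (\<lambda>e. normalized_entry n (\<lambda>e. A e \<omega>) e) \<partial>M)"
proof -
  define \<Psi> where "\<Psi> x = \<Phi> (\<lambda>e\<in>square n. normalized_entry n x e)" for x
  have \<Psi>m: "\<Psi> \<in> borel_measurable (\<Pi>\<^sub>M e\<in>square n. borel)"
    unfolding \<Psi>_def using measurable_compose[OF Y_measurable_PiM[OF order_refl, of n], folded square_def, OF \<Phi>(1)] by simp
  have \<Psi>r: "\<Psi> (\<lambda>e\<in>square n. x e) = \<Phi> (\<lambda>e. normalized_entry n x e)" for x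
    using Y_restrict[of _ "{..<n}" n x, folded square_def] \<Phi>(2)[of "normalized_entry n x"]
    by (simp add: \<Psi>_def cong: restrict_cong)
  have law: "(\<integral>\<omega>. \<Phi> (\<lambda>e. normalized_entry n (\<lambda>e. B e \<omega>) e) \<partial>M) = (\<integral>x. \<Psi> x \<partial>(\<Pi>\<^sub>M e\<in>square n. distr M borel (X 1 1)))"
    if B: "distr M (\<Pi>\<^sub>M e\<in>square n. borel) (\<lambda>\<omega>. \<lambda>e\<in>square n. B e \<omega>) = (\<Pi>\<^sub>M e\<in>square n. distr M borel (X 1 1))"
      and Bm: "\<And>e. B e \<in> borel_measurable M" for B
    unfolding B[symmetric] using Bm \<Psi>m by (subst integral_distr) (auto simp: \<Psi>r intro!: measurable_restrict)
  have ne: "square n \<noteq> {}" using n by (auto simp: square_def lessThan_empty_iff)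
  have "(\<integral>\<omega>. \<Phi> (\<lambda>e. normalized_entry n (\<lambda>e. entry e \<omega>) e) \<partial>M) = (\<integral>x. \<Psi> x \<partial>(\<Pi>\<^sub>M e\<in>square n. distr M borel (X 1 1)))"
    by (rule law[OF distr_PiM_iid[OF ne indep_vars_entry distr_entry]]) simp
  then show ?thesis using law[OF A Am] by (simp add: Y_def)
qed

text \<open>The normalization sees squares only, so changing the sign of one entry changes the sign
  of one normalized entry and nothing else.\<close>

lemma expectation_flip:
  fixes \<Phi> :: "(nat \<times> nat \<Rightarrow> real) \<Rightarrow> real"
  assumes n: "n \<ge> 1"
    and \<Phi>: "\<Phi> \<in> borel_measurable (\<Pi>\<^sub>M e\<in>square n. borel)" "\<And>x. \<Phi> (\<lambda>e\<in>square n. x e) = \<Phi> x"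
  shows "(\<integral>\<omega>. \<Phi> (\<lambda>e. Y n e \<omega>) \<partial>M) = (\<integral>\<omega>. \<Phi> (\<lambda>e. if e = e0 then - Y n e \<omega> else Y n e \<omega>) \<partial>M)"
proof -
  define \<sigma> where "\<sigma> e t = (if e = e0 then - t else t)" for e and t :: real
  define A where "A e \<omega> = \<sigma> e (entry e \<omega>)" for e \<omega>
  have \<sigma>m [measurable]: "\<sigma> e \<in> borel_measurable borel" for e unfolding \<sigma>_def by measurable
  have ne: "square n \<noteq> {}" using n by (auto simp: square_def lessThan_empty_iff)
  have "distr M borel (A e) = distr M borel (X 1 1)" for e
  proof -
    have "distr M borel (A e) = distr (distr M borel (entry e)) borel (\<sigma> e)"
      by (simp add: distr_distr o_def A_def[abs_def])
    also have "\<dots> = distr M borel (\<lambda>\<omega>. \<sigma> e (X 1 1 \<omega>))"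
      unfolding distr_entry using X_measurable[of 1 1] by (simp add: distr_distr o_def)
    also have "\<dots> = distr M borel (X 1 1)"
      using symmetric by (cases "e = e0") (simp_all add: \<sigma>_def)
    finally show ?thesis .
  qed
  moreover have "indep_vars (\<lambda>_. borel) A (square n)"
    unfolding A_def[abs_def] by (rule indep_vars_compose2[OF indep_vars_entry]) measurable
  ultimately have "distr M (\<Pi>\<^sub>M e\<in>square n. borel) (\<lambda>\<omega>. \<lambda>e\<in>square n. A e \<omega>) = (\<Pi>\<^sub>M e\<in>square n. distr M borel (X 1 1))"
    by (intro distr_PiM_iid[OF ne])
  moreover have "A e \<in> borel_measurable M" for e unfolding A_def[abs_def] by measurable
  moreover have "normalized_entry n (\<lambda>e. A e \<omega>) e = (if e = e0 then - Y n e \<omega> else Y n e \<omega>)" for e \<omega>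
  proof -
    have "(A e \<omega>)\<^sup>2 = (entry e \<omega>)\<^sup>2" for e by (simp add: A_def \<sigma>_def)
    then show ?thesis by (simp add: Y_def normalized_entry_def) (simp add: A_def \<sigma>_def)
  qed
  ultimately show ?thesis using expectation_invariant[OF n _ _ \<Phi>, of A] by simp
qed

text \<open>Exchanging two entries of the same row permutes the summands of its
  normalization.\<close>

lemma expectation_swap:
  fixes \<Phi> :: "(nat \<times> nat \<Rightarrow> real) \<Rightarrow> real"
  assumes ab: "a < n" "b < n"
    and \<Phi>: "\<Phi> \<in> borel_measurable (\<Pi>\<^sub>M e\<in>square n. borel)" "\<And>x. \<Phi> (\<lambda>e\<in>square n. x e) = \<Phi> x"
  shows "(\<integral>\<omega>. \<Phi> (\<lambda>e. Y n e \<omega>) \<partial>M) = (\<integral>\<omega>. \<Phi> (\<lambda>e. Y n (Transposition.transpose (i, a) (i, b) e) \<omega>) \<partial>M)"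
\<comment> \<open>For a row outside the square the transposition moves no position that
  \<open>\<Phi>\<close> sees.\<close>
proof (cases "i < n")
  case False
  then have "Transposition.transpose (i, a) (i, b) e = e" if "e \<in> square n" for e
    using that by (auto simp: Transposition.transpose_def square_def)
  then have "(\<lambda>e\<in>square n. Y n (Transposition.transpose (i, a) (i, b) e) \<omega>) = (\<lambda>e\<in>square n. Y n e \<omega>)" for \<omega>
    by (auto simp: restrict_def)
  then show ?thesis using \<Phi>(2) by metis
next
  case i: True
  let ?\<tau> = "Transposition.transpose (i, a) (i, b)"
  define A where "A e = entry (?\<tau> e)" for e
  have n: "n \<ge> 1" using ab by auto
  have ne: "square n \<noteq> {}" using n by (auto simp: square_def lessThan_empty_iff)
  interpret \<rho>: prob_space "distr M borel (X 1 1)" using X_measurable[of 1 1] by (intro prob_space_distr) auto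
  have "distr M (\<Pi>\<^sub>M e\<in>square n. borel) (\<lambda>\<omega>. \<lambda>e\<in>square n. A e \<omega>) =
     distr (distr M (\<Pi>\<^sub>M e\<in>square n. borel) (\<lambda>\<omega>. \<lambda>e\<in>square n. entry e \<omega>)) (\<Pi>\<^sub>M e\<in>square n. borel) (\<lambda>x. \<lambda>e\<in>square n. x (?\<tau> e))"
  proof (subst distr_distr)
    have \<tau>: "?\<tau> e \<in> square n" if "e \<in> square n" for e using that i ab by (auto simp: Transposition.transpose_def square_def)
    show "(\<lambda>x. \<lambda>e\<in>square n. x (?\<tau> e)) \<in> measurable (\<Pi>\<^sub>M e\<in>square n. borel) (\<Pi>\<^sub>M e\<in>square n. borel)"
      using \<tau> by (intro measurable_restrict measurable_component_singleton) auto
    show "distr M (\<Pi>\<^sub>M e\<in>square n. borel) (\<lambda>\<omega>. \<lambda>e\<in>square n. A e \<omega>) =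
      distr M (\<Pi>\<^sub>M e\<in>square n. borel) ((\<lambda>x. \<lambda>e\<in>square n. x (?\<tau> e)) \<circ> (\<lambda>\<omega>. \<lambda>e\<in>square n. entry e \<omega>))"
      using \<tau> by (simp add: o_def A_def cong: restrict_cong)
  qed (auto intro!: measurable_restrict)
  also have "distr M (\<Pi>\<^sub>M e\<in>square n. borel) (\<lambda>\<omega>. \<lambda>e\<in>square n. entry e \<omega>) = (\<Pi>\<^sub>M e\<in>square n. distr M borel (X 1 1))"
    by (rule distr_PiM_iid[OF ne indep_vars_entry distr_entry])
  also have "distr \<dots> (\<Pi>\<^sub>M e\<in>square n. borel) (\<lambda>x. \<lambda>e\<in>square n. x (?\<tau> e)) =
    distr (\<Pi>\<^sub>M e\<in>square n. distr M borel (X 1 1)) (\<Pi>\<^sub>M e\<in>square n. distr M borel (X 1 1)) (\<lambda>x. \<lambda>e\<in>square n. x (?\<tau> e))"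
    by (intro distr_cong refl sets_PiM_cong) auto
  also have "\<dots> = (\<Pi>\<^sub>M e\<in>square n. distr M borel (X 1 1))"
    using i ab by (intro distr_PiM_reindex) (use \<rho>.prob_space_axioms in \<open>auto simp: square_def Transposition.transpose_def inj_on_def split: if_splits\<close>)
  finally have "distr M (\<Pi>\<^sub>M e\<in>square n. borel) (\<lambda>\<omega>. \<lambda>e\<in>square n. A e \<omega>) = (\<Pi>\<^sub>M e\<in>square n. distr M borel (X 1 1))" .
  moreover have "normalized_entry n (\<lambda>e. A e \<omega>) e = Y n (?\<tau> e) \<omega>" for e \<omega>
  proof -
    have "(\<Sum>l<n. (A (i', l) \<omega>)\<^sup>2) = (\<Sum>l<n. (entry (i', l) \<omega>)\<^sup>2)" for i'
    proof (cases "i' = i")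
      case True
      have "(\<Sum>l<n. (A (i', l) \<omega>)\<^sup>2) = (\<Sum>l<n. (entry (i', Transposition.transpose a b l) \<omega>)\<^sup>2)"
        using True by (intro sum.cong) (auto simp: A_def Transposition.transpose_def)
      also have "\<dots> = (\<Sum>l<n. (entry (i', l) \<omega>)\<^sup>2)"
        by (rule sum.reindex_bij_betw[of "Transposition.transpose a b"])
           (rule bij_betw_byWitness[of _ "Transposition.transpose a b"], use ab in \<open>auto simp: Transposition.transpose_def\<close>)
      finally show ?thesis .
    qed (auto simp: A_def Transposition.transpose_def)
    moreover have "fst (?\<tau> e) = fst e" by (auto simp: Transposition.transpose_def)
    ultimately show ?thesis by (simp add: Y_def normalized_entry_def) (simp add: A_def)
  qed
  ultimately show ?thesis using expectation_invariant[OF n _ _ \<Phi>, of A] by (simp add: A_def)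
qed

section \<open>Bounds for mixed moments of the entries\<close>

lemma prod_PiM_measurable:
  assumes "finite E" "E \<subseteq> I"
  shows "(\<lambda>x. \<Prod>e\<in>E. (x e :: real) ^ m e) \<in> borel_measurable (\<Pi>\<^sub>M e\<in>I. borel)"
proof -
  have [measurable]: "(\<lambda>x. x e) \<in> borel_measurable (\<Pi>\<^sub>M e\<in>I. borel)" if "e \<in> E" for e
    using that assms by (intro measurable_component_singleton) auto
  show ?thesis by measurable
qed

lemma finite_square [simp]: "finite (square n)"
  by (simp add: square_def)

lemma prod_Y_abs_le_1:
  assumes "E \<subseteq> square n"
  shows "\<bar>\<Prod>e\<in>E. Y n e \<omega> ^ m e\<bar> \<le> 1"
proof -
  have "\<bar>\<Prod>e\<in>E. Y n e \<omega> ^ m e\<bar> = (\<Prod>e\<in>E. \<bar>Y n e \<omega>\<bar> ^ m e)" by (simp add: abs_prod power_abs)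
  also have "\<dots> \<le> 1" using assms Y_abs_le_1 by (intro prod_le_1) (auto intro!: power_le_one)
  finally show ?thesis .
qed

lemma integrable_prod_Y:
  assumes "E \<subseteq> square n"
  shows "integrable M (\<lambda>\<omega>. \<Prod>e\<in>E. Y n e \<omega> ^ m e)"
  by (rule integrable_const_bound[of _ 1]) (auto simp: prod_Y_abs_le_1[OF assms])

text \<open>Flipping the sign of the entry at \<open>e0\<close> reverses the product but preserves
  its law.\<close>

lemma expectation_odd:
  assumes E: "E \<subseteq> square n" and e0: "e0 \<in> E" "odd (m e0)"
  shows "(\<integral>\<omega>. (\<Prod>e\<in>E. Y n e \<omega> ^ m e) \<partial>M) = 0"
proof -
  have fin: "finite E" using E by (rule finite_subset) simp
  have n: "n \<ge> 1" using E e0 by (auto simp: square_def)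
  have "(\<integral>\<omega>. (\<Prod>e\<in>E. Y n e \<omega> ^ m e) \<partial>M) = (\<integral>\<omega>. (\<Prod>e\<in>E. (if e = e0 then - Y n e \<omega> else Y n e \<omega>) ^ m e) \<partial>M)"
    using prod_PiM_measurable[OF fin E, of m] E
    by (intro expectation_flip[OF n, where \<Phi> = "\<lambda>x. \<Prod>e\<in>E. x e ^ m e"]) (auto intro!: prod.cong)
  moreover have "(\<Prod>e\<in>E. (if e = e0 then - Y n e \<omega> else Y n e \<omega>) ^ m e) = - (\<Prod>e\<in>E. Y n e \<omega> ^ m e)" for \<omega>
  proof -
    have "(\<Prod>e\<in>E. (if e = e0 then - Y n e \<omega> else Y n e \<omega>) ^ m e) = (- Y n e0 \<omega>) ^ m e0 * (\<Prod>e\<in>E - {e0}. Y n e \<omega> ^ m e)"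
      using fin e0 by (subst prod.remove[of E e0]) (auto intro!: prod.cong)
    also have "\<dots> = - (Y n e0 \<omega> ^ m e0 * (\<Prod>e\<in>E - {e0}. Y n e \<omega> ^ m e))" using e0 by simp
    also have "Y n e0 \<omega> ^ m e0 * (\<Prod>e\<in>E - {e0}. Y n e \<omega> ^ m e) = (\<Prod>e\<in>E. Y n e \<omega> ^ m e)"
      using fin e0 by (subst prod.remove[of E e0]) auto
    finally show ?thesis .
  qed
  ultimately show ?thesis by simp
qed

text \<open>One edge is removed at a time. By exchangeability within its row it may sit in any
  column of that row that the other edges leave free; there are at least \<open>n / 2\<close> of
  them, and the squares in a row sum to at most 1. The constant 2 is the price of the occupied
  columns.\<close>

lemma expectation_prod_sq_le:
  assumes "E \<subseteq> square n" "2 * card E \<le> n"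
  shows "(\<integral>\<omega>. (\<Prod>e\<in>E. (Y n e \<omega>)\<^sup>2) \<partial>M) \<le> (2 / real n) ^ card E"
proof -
  have "finite E" using assms(1) by (rule finite_subset) simp
  then show ?thesis using assms
  proof (induction E)
    case empty
    then show ?case by (simp add: prob_space)
  next
    case (insert e E)
    obtain i a where e: "e = (i, a)" by (cases e)
    have ia: "i < n" "a < n" and E: "E \<subseteq> square n" using insert.prems e by (auto simp: square_def)
    define J where "J = {j. j < n \<and> (i, j) \<notin> E}"
    have Jn: "J \<subseteq> {..<n}" and finJ: "finite J" by (auto simp: J_def)
    have cardJ: "real n / 2 \<le> real (card J)"
    proof -
      have "{..<n} - J \<subseteq> snd ` E" by (force simp: J_def)
      then have "card ({..<n} - J) \<le> card E"
        using insert.hyps(1) card_mono[of "snd ` E" "{..<n} - J"] card_image_le[of E snd] by auto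
      moreover have "card ({..<n} - J) = n - card J" using Jn finJ by (simp add: card_Diff_subset)
      moreover have "2 * card E \<le> n" using insert.prems insert.hyps by simp
      ultimately show ?thesis by linarith
    qed
    have same: "(\<integral>\<omega>. (\<Prod>e\<in>insert (i, j) E. (Y n e \<omega>)\<^sup>2) \<partial>M) = (\<integral>\<omega>. (\<Prod>e\<in>insert e E. (Y n e \<omega>)\<^sup>2) \<partial>M)" if j: "j \<in> J" for j
    proof -
      let ?\<tau> = "Transposition.transpose (i, j) (i, a)"
      have jn: "j < n" "(i, j) \<notin> E" using j by (auto simp: J_def)
      have "(\<integral>\<omega>. (\<Prod>e\<in>insert (i, j) E. (Y n e \<omega>)\<^sup>2) \<partial>M) = (\<integral>\<omega>. (\<Prod>e\<in>insert (i, j) E. (Y n (?\<tau> e) \<omega>)\<^sup>2) \<partial>M)"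
        using jn ia E insert.hyps prod_PiM_measurable[of "insert (i, j) E" "square n" "\<lambda>_. 2"]
        by (intro expectation_swap[where \<Phi> = "\<lambda>x. \<Prod>e\<in>insert (i, j) E. (x e)\<^sup>2"]) (auto simp: square_def intro!: prod.cong)
      moreover have "(\<Prod>e\<in>insert (i, j) E. (Y n (?\<tau> e) \<omega>)\<^sup>2) = (\<Prod>e\<in>insert e E. (Y n e \<omega>)\<^sup>2)" for \<omega>
      proof -
        have "?\<tau> e' = e'" if "e' \<in> E" for e' using that jn insert.hyps e by (auto simp: Transposition.transpose_def)
        then show ?thesis using jn insert.hyps e by (simp add: Transposition.transpose_def)
      qed
      ultimately show ?thesis by simp
    qed
    have int: "integrable M (\<lambda>\<omega>. \<Prod>e\<in>F. (Y n e \<omega>)\<^sup>2)" if "F \<subseteq> square n" for F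
      using integrable_prod_Y[OF that, of "\<lambda>_. 2"] by simp
    have "real (card J) * (\<integral>\<omega>. (\<Prod>e\<in>insert e E. (Y n e \<omega>)\<^sup>2) \<partial>M) = (\<Sum>j\<in>J. \<integral>\<omega>. (\<Prod>e\<in>insert (i, j) E. (Y n e \<omega>)\<^sup>2) \<partial>M)"
      by (simp add: same)
    also have "\<dots> = (\<integral>\<omega>. (\<Sum>j\<in>J. \<Prod>e\<in>insert (i, j) E. (Y n e \<omega>)\<^sup>2) \<partial>M)"
      using ia E Jn by (intro Bochner_Integration.integral_sum[symmetric] int) (auto simp: square_def)
    also have "\<dots> \<le> (\<integral>\<omega>. (\<Prod>e\<in>E. (Y n e \<omega>)\<^sup>2) \<partial>M)"
    proof (rule integral_mono)
      show "integrable M (\<lambda>\<omega>. \<Sum>j\<in>J. \<Prod>e\<in>insert (i, j) E. (Y n e \<omega>)\<^sup>2)"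
        using ia E Jn by (intro Bochner_Integration.integrable_sum int) (auto simp: square_def)
      fix \<omega>
      have "(\<Sum>j\<in>J. \<Prod>e\<in>insert (i, j) E. (Y n e \<omega>)\<^sup>2) = (\<Sum>j\<in>J. (Y n (i, j) \<omega>)\<^sup>2) * (\<Prod>e\<in>E. (Y n e \<omega>)\<^sup>2)"
        using insert.hyps(1) by (auto simp: sum_distrib_right J_def intro!: sum.cong)
      also have "\<dots> \<le> 1 * (\<Prod>e\<in>E. (Y n e \<omega>)\<^sup>2)"
      proof (rule mult_right_mono)
        have "(\<Sum>j\<in>J. (Y n (i, j) \<omega>)\<^sup>2) \<le> (\<Sum>j<n. (Y n (i, j) \<omega>)\<^sup>2)" using Jn by (intro sum_mono2) auto
        then show "(\<Sum>j\<in>J. (Y n (i, j) \<omega>)\<^sup>2) \<le> 1" using sum_Y_le_1[of n i \<omega>] by linarith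
      qed (simp add: prod_nonneg)
      finally show "(\<Sum>j\<in>J. \<Prod>e\<in>insert (i, j) E. (Y n e \<omega>)\<^sup>2) \<le> (\<Prod>e\<in>E. (Y n e \<omega>)\<^sup>2)" by simp
    qed (rule int[OF E])
    also have "\<dots> \<le> (2 / real n) ^ card E" using insert by auto
    finally have le: "real (card J) * (\<integral>\<omega>. (\<Prod>e\<in>insert e E. (Y n e \<omega>)\<^sup>2) \<partial>M) \<le> (2 / real n) ^ card E" .
    have "real n / 2 * (\<integral>\<omega>. (\<Prod>e\<in>insert e E. (Y n e \<omega>)\<^sup>2) \<partial>M) \<le> (2 / real n) ^ card E"
      by (rule order_trans[OF mult_right_mono[OF cardJ] le]) (simp add: prod_nonneg)
    then show ?case using insert.hyps ia by (simp add: field_simps)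
  qed
qed

section \<open>Even moments of a single entry\<close>

lemma expectation_Y_even_power:
  assumes "i < n" "j < n" "m \<ge> 1"
  shows "ennreal (Gamma (real m) * (\<integral>\<omega>. Y n (i, j) \<omega> ^ (2 * m) \<partial>M)) =
    (\<integral>\<^sup>+s. ennreal (indicator {0<..} s * (s ^ (m - 1) *
        (\<integral>a. a ^ m * exp (- (s * a)) \<partial>distr M borel (\<lambda>\<omega>. (X 1 1 \<omega>)\<^sup>2)) *
        (\<integral>a. exp (- (s * a)) \<partial>distr M borel (\<lambda>\<omega>. (X 1 1 \<omega>)\<^sup>2)) ^ (n - 1))) \<partial>lborel)"
proof -
  define A where "A l \<omega> = (entry (i, l) \<omega>)\<^sup>2" for l \<omega>
  have ind: "indep_vars (\<lambda>_. borel) A {..<n}"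
  proof -
    have "indep_vars (\<lambda>l. PiM {(i, l)} (\<lambda>_. borel)) (\<lambda>l \<omega>. \<lambda>p\<in>{(i, l)}. entry p \<omega>) {..<n}"
      by (rule indep_vars_restrict[OF indep_vars_entry[of UNIV]]) (auto simp: disjoint_family_on_def)
    then have "indep_vars (\<lambda>_. borel) (\<lambda>l \<omega>. (\<lambda>z. (z (i, l))\<^sup>2) (\<lambda>p\<in>{(i, l)}. entry p \<omega>)) {..<n}"
      by (rule indep_vars_compose2) measurable
    then show ?thesis by (simp add: A_def[abs_def])
  qed
  have "distr M borel (A l) = distr M borel (\<lambda>\<omega>. (X 1 1 \<omega>)\<^sup>2)" for l
  proof -
    have "distr M borel (A l) = distr (distr M borel (entry (i, l))) borel (\<lambda>x. x\<^sup>2)"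
      by (simp add: distr_distr o_def A_def[abs_def])
    then show ?thesis unfolding distr_entry using X_measurable[of 1 1] by (simp add: distr_distr o_def)
  qed
  moreover have "Y n (i, j) \<omega> ^ (2 * m) = (A j \<omega> / (\<Sum>l\<in>{..<n}. A l \<omega>)) ^ m" for \<omega>
  proof -
    have "(\<Sum>l\<in>{..<n}. A l \<omega>) \<ge> 0" by (simp add: A_def sum_nonneg)
    then have "(Y n (i, j) \<omega>)\<^sup>2 = A j \<omega> / (\<Sum>l\<in>{..<n}. A l \<omega>)"
      by (simp add: Y_def normalized_entry_def A_def power_divide)
    then show ?thesis by (simp add: power_mult)
  qed
  ultimately show ?thesis
    using moment_of_normalized_summand[OF _ _ ind, of j _ m] assms by (simp add: A_def)
qed

definition even_moment :: "nat \<Rightarrow> nat \<Rightarrow> real" where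
  "even_moment n m = (\<integral>\<omega>. Y n (0, 0) \<omega> ^ (2 * m) \<partial>M)"

lemma even_moment_nonneg: "even_moment n m \<ge> 0"
  unfolding even_moment_def by (rule integral_nonneg_AE) (simp add: power_mult)

text \<open>The integral formula for the even moments is the same for all positions.\<close>

lemma expectation_Y_power_eq:
  assumes "e \<in> square n" "m \<ge> 1"
  shows "(\<integral>\<omega>. Y n e \<omega> ^ (2 * m) \<partial>M) = even_moment n m"
proof -
  obtain i j where e: "e = (i, j)" "i < n" "j < n" using assms by (auto simp: square_def)
  have "ennreal (Gamma (real m) * (\<integral>\<omega>. Y n e \<omega> ^ (2 * m) \<partial>M)) = ennreal (Gamma (real m) * even_moment n m)"
    unfolding even_moment_def e(1) using e(2,3) assms(2) by (subst (1 2) expectation_Y_even_power) auto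
  moreover have "(\<integral>\<omega>. Y n e \<omega> ^ (2 * m) \<partial>M) \<ge> 0"
    by (rule integral_nonneg_AE) (simp add: power_mult)
  moreover have "Gamma (real m) > 0" using assms by (intro Gamma_real_pos) auto
  ultimately show ?thesis using even_moment_nonneg by (subst (asm) ennreal_inj) auto
qed

text \<open>The square of an entry has a regularly varying tail of index
  \<open>\<alpha> / 2\<close>, which is the \<beta> of the moment limit.\<close>

lemma even_moment_limit:
  assumes \<alpha>: "0 < \<alpha>" "\<alpha> < 2" and rv: "regularly_varying_tail M (X 1 1) \<alpha>" and m: "m \<ge> 1"
  shows "(\<lambda>n. real n * even_moment n m) \<longlonglongrightarrow>
     Gamma (real m - \<alpha> / 2) / (Gamma (1 - \<alpha> / 2) * Gamma (real m))"
proof -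
  have [measurable]: "X 1 1 \<in> borel_measurable M" "X (Suc 0) (Suc 0) \<in> borel_measurable M"
    by (rule X_measurable; simp)+
  obtain L where L: "slowly_varying L" "\<And>x. x > 0 \<Longrightarrow> prob {\<omega> \<in> space M. \<bar>X 1 1 \<omega>\<bar> > x} = x powr (-\<alpha>) * L x"
    using rv by (auto simp: regularly_varying_tail_def)
  define N where "N = distr M borel (\<lambda>\<omega>. (X 1 1 \<omega>)\<^sup>2)"
  define T where "T x = prob {\<omega> \<in> space M. \<bar>X 1 1 \<omega>\<bar> > x}" for x
  \<comment> \<open>If the tail vanished somewhere, \<open>L\<close> would vanish from some point
    on, and the quotients \<open>0 / 0 = 0\<close> could not tend to 1.\<close>
  have Tpos: "T x > 0" for x
  proof (rule ccontr)
    assume "\<not> T x > 0"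
    moreover have "T x \<ge> 0" by (simp add: T_def)
    ultimately have "T x = 0" by linarith
    have zero: "L y = 0" if "y \<ge> max x 1" for y
    proof -
      have "T y \<le> T x" unfolding T_def using that by (intro finite_measure_mono) auto
      moreover have "T y \<ge> 0" by (simp add: T_def)
      ultimately have "T y = 0" using \<open>T x = 0\<close> by linarith
      have y: "y > 0" using that by (rule less_le_trans[rotated]) simp
      have "y powr (-\<alpha>) * L y = 0" using L(2)[OF y] \<open>T y = 0\<close> unfolding T_def by (rule subst)
      then show ?thesis using y unfolding mult_eq_0_iff powr_eq_0_iff by blast
    qed
    have sv: "((\<lambda>y. L (t * y) / L y) \<longlongrightarrow> 1) at_top" if "t > 0" for t :: real
      using L(1) that by (simp add: slowly_varying_def)
    have "((\<lambda>y. L (1 * y) / L y) \<longlongrightarrow> 1) at_top" by (rule sv) simp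
    moreover have "((\<lambda>y. L (1 * y) / L y) \<longlongrightarrow> 0) at_top"
      by (rule tendsto_eventually) (use eventually_ge_at_top[of "max x 1"] zero in \<open>auto elim!: eventually_mono\<close>)
    ultimately show False using tendsto_unique[of at_top "\<lambda>y. L (1 * y) / L y" 1 0] by simp
  qed
  have NT: "measure N {x<..} = T (sqrt x)" if "x \<ge> 0" for x
  proof -
    have "x < t\<^sup>2 \<longleftrightarrow> sqrt x < \<bar>t\<bar>" for t
      using real_sqrt_less_iff[of x "t\<^sup>2"] by simp
    then have "(\<lambda>\<omega>. (X 1 1 \<omega>)\<^sup>2) -` {x<..} \<inter> space M = {\<omega> \<in> space M. \<bar>X 1 1 \<omega>\<bar> > sqrt x}"
      by auto
    then show ?thesis by (simp add: N_def measure_distr T_def)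
  qed
  interpret N: prob_space N unfolding N_def by (rule prob_space_distr) simp
  have pos: "measure N {x<..} > 0" for x
  proof -
    have "T (sqrt (max x 0)) \<le> measure N {x<..}"
      unfolding NT[of "max x 0", symmetric, simplified] by (intro N.finite_measure_mono) (auto simp: N_def)
    then show ?thesis using Tpos[of "sqrt (max x 0)"] by linarith
  qed
  have tail: "((\<lambda>x. measure N {t * x<..} / measure N {x<..}) \<longlongrightarrow> t powr (- (\<alpha> / 2))) at_top" if t: "t > 0" for t
  proof -
    have "((\<lambda>x. L (sqrt t * x) / L x) \<longlongrightarrow> 1) at_top" using L(1) t by (simp add: slowly_varying_def)
    then have "((\<lambda>x. L (sqrt t * sqrt x) / L (sqrt x)) \<longlongrightarrow> 1) at_top"
      by (rule filterlim_compose[OF _ sqrt_at_top])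
    then have "((\<lambda>x. sqrt t powr (-\<alpha>) * (L (sqrt t * sqrt x) / L (sqrt x))) \<longlongrightarrow> sqrt t powr (-\<alpha>) * 1) at_top"
      by (intro tendsto_intros)
    moreover have "sqrt t powr (-\<alpha>) * 1 = t powr (- (\<alpha> / 2))"
      using t by (simp add: powr_half_sqrt[symmetric] powr_powr)
    ultimately have "((\<lambda>x. sqrt t powr (-\<alpha>) * (L (sqrt t * sqrt x) / L (sqrt x))) \<longlongrightarrow> t powr (- (\<alpha> / 2))) at_top"
      by (simp only:)
    then show ?thesis
    proof (rule Lim_transform_eventually)
      show "eventually (\<lambda>x. sqrt t powr (-\<alpha>) * (L (sqrt t * sqrt x) / L (sqrt x)) = measure N {t * x<..} / measure N {x<..}) at_top"
        using eventually_gt_at_top[of 0]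
      proof eventually_elim
        case (elim x)
        have "measure N {t * x<..} = (sqrt t * sqrt x) powr (-\<alpha>) * L (sqrt t * sqrt x)"
          using elim t L(2)[of "sqrt t * sqrt x"] by (simp add: NT T_def real_sqrt_mult)
        moreover have "measure N {x<..} = sqrt x powr (-\<alpha>) * L (sqrt x)"
          using elim L(2)[of "sqrt x"] by (simp add: NT T_def)
        ultimately show ?case using elim t by (simp add: powr_mult)
      qed
    qed
  qed
  define A where "A l \<omega> = (X 1 l \<omega>)\<^sup>2" for l \<omega>
  have "indep_vars (\<lambda>l. PiM {(1, l)} (\<lambda>_. borel)) (\<lambda>l \<omega>. \<lambda>p\<in>{(1, l)}. (case p of (i, j) \<Rightarrow> X i j) \<omega>) {1..}"
    by (rule indep_vars_restrict[OF independent]) (auto simp: disjoint_family_on_def)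
  then have "indep_vars (\<lambda>_. borel) (\<lambda>l \<omega>. (\<lambda>z. (z (1, l))\<^sup>2) (\<lambda>p\<in>{(1, l)}. (case p of (i, j) \<Rightarrow> X i j) \<omega>)) {1..}"
    by (rule indep_vars_compose2) measurable
  then have ind: "indep_vars (\<lambda>_. borel) A {1..}" by (simp add: A_def[abs_def])
  have "(\<lambda>n. real n * (\<integral>\<omega>. (A 1 \<omega> / (\<Sum>i=1..n. A i \<omega>)) ^ m \<partial>M)) \<longlonglongrightarrow>
     Gamma (real m - \<alpha> / 2) / (Gamma (1 - \<alpha> / 2) * Gamma (real m))"
  proof (rule normalized_summand_moment_limit[OF ind, of N])
    show "distr M borel (A i) = N" if "i \<ge> 1" for i
    proof -
      have [measurable]: "X (Suc 0) i \<in> borel_measurable M" using that by (intro X_measurable) auto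
      have "distr M borel (A i) = distr (distr M borel (X 1 i)) borel (\<lambda>x. x\<^sup>2)"
        by (simp add: distr_distr o_def A_def[abs_def])
      also have "distr M borel (X 1 i) = distr M borel (X 1 1)"
        by (rule identically_distributed[OF order_refl that])
      also have "distr \<dots> borel (\<lambda>x. x\<^sup>2) = N" by (simp add: distr_distr o_def N_def)
      finally show ?thesis .
    qed
  qed (use \<alpha> m pos tail in \<open>auto simp: A_def\<close>)
  moreover have "(A 1 \<omega> / (\<Sum>i=1..n. A i \<omega>)) ^ m = Y n (0, 0) \<omega> ^ (2 * m)" for n \<omega>
  proof -
    have s: "(\<Sum>i=1..n. A i \<omega>) = (\<Sum>l<n. (entry (0, l) \<omega>)\<^sup>2)"
      by (simp add: A_def entry_def sum.atLeast1_atMost_eq)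
    have "(\<Sum>l<n. (entry (0, l) \<omega>)\<^sup>2) \<ge> 0" by (simp add: sum_nonneg)
    then have "(Y n (0, 0) \<omega>)\<^sup>2 = A 1 \<omega> / (\<Sum>i=1..n. A i \<omega>)"
      unfolding s by (simp add: Y_def normalized_entry_def A_def entry_def power_divide)
    then show ?thesis by (simp add: power_mult)
  qed
  ultimately show ?thesis by (simp add: even_moment_def)
qed

end

section \<open>Traces of matrix powers as sums over closed walks\<close>

fun path_weight :: "(nat \<times> nat \<Rightarrow> real) \<Rightarrow> nat \<Rightarrow> nat list \<Rightarrow> nat \<Rightarrow> real" where
  "path_weight y i [] j = y (i, j)"
| "path_weight y i (x # xs) j = y (i, x) * path_weight y x xs j"

lemma path_weight_prod:
  "path_weight y i xs j = (\<Prod>r<Suc (length xs). y ((i # xs @ [j]) ! r, (i # xs @ [j]) ! Suc r))"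
  by (induction xs arbitrary: i) (simp_all add: prod.lessThan_Suc_shift del: prod.lessThan_Suc)

lemma path_weight_closed: "path_weight y i xs i = cyc_weight y (i # xs)"
  unfolding path_weight_prod cyc_weight_def
proof (rule prod.cong)
  fix r assume r: "r \<in> {..<length (i # xs)}"
  show "y ((i # xs @ [i]) ! r, (i # xs @ [i]) ! Suc r) =
    y ((i # xs) ! r, (i # xs) ! (Suc r mod length (i # xs)))"
  proof (cases "r = length xs")
    case False
    then show ?thesis using r by (cases r) (auto simp: nth_append)
  qed (cases xs; auto simp: nth_append nth_Cons')
qed simp

lemma closed_walks_Suc: "closed_walks V (Suc L) = (\<lambda>(z, zs). z # zs) ` (V \<times> closed_walks V L)"
  by (auto simp: closed_walks_def length_Suc_conv image_iff)

lemma sum_closed_walks_Suc: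
  fixes f :: "'v list \<Rightarrow> 'b::comm_monoid_add"
  shows "(\<Sum>zs\<in>closed_walks V (Suc L). f zs) = (\<Sum>z\<in>V. \<Sum>zs\<in>closed_walks V L. f (z # zs))"
proof -
  have "inj_on (\<lambda>(z, zs). z # zs) (V \<times> closed_walks V L)" by (auto simp: inj_on_def)
  then show ?thesis
    unfolding closed_walks_Suc by (simp add: sum.reindex sum.cartesian_product case_prod_unfold)
qed

lemma pow_mat_entry:
  assumes A: "A \<in> carrier_mat n n" and "i < n" "j < n"
  shows "(A ^\<^sub>m Suc k) $$ (i, j) = (\<Sum>xs\<in>closed_walks {..<n} k. path_weight (\<lambda>e. A $$ e) i xs j)"
  using assms(2,3)
proof (induction k arbitrary: i)
  case 0
  have "closed_walks {..<n} 0 = {[]}" by (auto simp: closed_walks_def)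
  then show ?case using A by simp
next
  case (Suc k)
  have dims: "A ^\<^sub>m k \<in> carrier_mat n n" for k using A by (rule pow_carrier_mat)
  \<comment> \<open>\<open>pow_mat\<close> multiplies on the right, whereas
    \<open>path_weight\<close> splits off the first step of the walk.\<close>
  have comm: "A ^\<^sub>m Suc k = A * A ^\<^sub>m k" for k
  proof (induction k)
    case (Suc k)
    have "A ^\<^sub>m Suc (Suc k) = (A * A ^\<^sub>m k) * A" by (simp only: pow_mat.simps(2)[of A "Suc k"] Suc)
    also have "\<dots> = A * (A ^\<^sub>m k * A)" by (rule assoc_mult_mat[OF A dims A])
    finally show ?case by simp
  qed (use A in simp)
  have "(A ^\<^sub>m Suc (Suc k)) $$ (i, j) = (\<Sum>x\<in>{..<n}. A $$ (i, x) * (A ^\<^sub>m Suc k) $$ (x, j))"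
    unfolding comm[of "Suc k"] using A dims[of "Suc k"] Suc.prems
    by (subst index_mult_mat) (auto simp: scalar_prod_def lessThan_atLeast0 simp del: pow_mat.simps)
  also have "\<dots> = (\<Sum>x\<in>{..<n}. \<Sum>xs\<in>closed_walks {..<n} k. path_weight (\<lambda>e. A $$ e) i (x # xs) j)"
    using Suc.IH Suc.prems by (auto simp: sum_distrib_left intro!: sum.cong simp del: pow_mat.simps)
  finally show ?case by (simp only: sum_closed_walks_Suc)
qed

lemma mat_trace_pow:
  fixes A :: "real mat"
  assumes A: "A \<in> carrier_mat n n" and k: "k \<ge> 1"
  shows "mat_trace (A ^\<^sub>m k) = (\<Sum>zs\<in>closed_walks {..<n} k. cyc_weight (\<lambda>e. A $$ e) zs)"
proof -
  obtain l where l: "k = Suc l" using k by (cases k) auto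
  have "A ^\<^sub>m k \<in> carrier_mat n n" using A by (rule pow_carrier_mat)
  then have "mat_trace (A ^\<^sub>m k) = (\<Sum>i<n. (A ^\<^sub>m Suc l) $$ (i, i))"
    unfolding mat_trace_def l by (simp only: carrier_matD)
  also have "\<dots> = (\<Sum>i<n. \<Sum>xs\<in>closed_walks {..<n} l. cyc_weight (\<lambda>e. A $$ e) (i # xs))"
    by (intro sum.cong refl) (simp only: pow_mat_entry[OF A] lessThan_iff path_weight_closed)
  finally show ?thesis by (simp only: l sum_closed_walks_Suc)
qed

context symmetric_iid_array
begin

lemma cyc_weight_cong: "(\<And>e. e \<in> cyc_edges zs \<Longrightarrow> y e = y' e) \<Longrightarrow> cyc_weight y zs = cyc_weight y' zs"
  unfolding cyc_weight_def cyc_edges_def by (intro prod.cong) auto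

lemma trace_self_normalized:
  assumes "k \<ge> 1"
  shows "mat_trace (self_normalized_matrix X n \<omega> ^\<^sub>m k) = (\<Sum>zs\<in>closed_walks {..<n} k. cyc_weight (\<lambda>e. Y n e \<omega>) zs)"
proof -
  have A: "self_normalized_matrix X n \<omega> \<in> carrier_mat n n" by (simp add: self_normalized_matrix_def)
  have "self_normalized_matrix X n \<omega> $$ e = Y n e \<omega>" if "e \<in> {..<n} \<times> {..<n}" for e
    using that by (auto simp: self_normalized_matrix_def Y_def normalized_entry_def entry_def sum.atLeast1_atMost_eq)
  then show ?thesis
    unfolding mat_trace_pow[OF A assms]
    using cyc_edges_subset[of _ "{..<n}"]
    by (intro sum.cong refl cyc_weight_cong) (unfold closed_walks_def, blast)
qed

end

section \<open>Poisson approximation of dissociated sums\<close>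

text \<open>Differentiation under the integral: for bounded \<open>X\<close> the second-order
  remainder of \<open>cis\<close> is at most \<open>h\<^sup>2 * b\<^sup>2 / 2\<close>, uniformly in
  the outcome.\<close>

lemma (in prob_space) has_vector_derivative_expectation_cis:
  fixes X :: "'a \<Rightarrow> real"
  assumes [measurable]: "X \<in> borel_measurable M" and b: "\<And>\<omega>. \<bar>X \<omega>\<bar> \<le> b"
  shows "((\<lambda>s. \<integral>\<omega>. cis (s * X \<omega>) \<partial>M) has_vector_derivative (\<integral>\<omega>. \<i> * of_real (X \<omega>) * cis (s * X \<omega>) \<partial>M)) (at s)"
  unfolding has_vector_derivative_def has_derivative_at
proof
  let ?D = "\<integral>\<omega>. \<i> * of_real (X \<omega>) * cis (s * X \<omega>) \<partial>M"
  show "bounded_linear (\<lambda>h. h *\<^sub>R ?D)" by (rule bounded_linear_scaleR_left)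
  have b0: "b \<ge> 0" using b[of undefined] by linarith
  have ic: "integrable M (\<lambda>\<omega>. cis (t * X \<omega>))" for t
    by (rule integrable_const_bound[of _ 1]) (simp_all add: cis_conv_exp)
  have iD: "integrable M (\<lambda>\<omega>. \<i> * of_real (X \<omega>) * cis (s * X \<omega>))"
    by (rule integrable_const_bound[of _ b]) (use b in \<open>simp_all add: norm_mult, simp add: cis_conv_exp\<close>)
  have quad: "norm ((\<integral>\<omega>. cis ((s + h) * X \<omega>) \<partial>M) - (\<integral>\<omega>. cis (s * X \<omega>) \<partial>M) - h *\<^sub>R ?D) \<le> h\<^sup>2 * (b\<^sup>2 / 2)" for h
  proof -
    have "(\<integral>\<omega>. cis ((s + h) * X \<omega>) \<partial>M) - (\<integral>\<omega>. cis (s * X \<omega>) \<partial>M) - h *\<^sub>R ?D =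
      (\<integral>\<omega>. cis ((s + h) * X \<omega>) - cis (s * X \<omega>) - h *\<^sub>R (\<i> * of_real (X \<omega>) * cis (s * X \<omega>)) \<partial>M)"
      using ic iD by simp
    also have "norm \<dots> \<le> (\<integral>\<omega>. h\<^sup>2 * (b\<^sup>2 / 2) \<partial>M)"
    proof (rule order_trans[OF integral_norm_bound integral_mono])
      fix \<omega>
      have "cis ((s + h) * X \<omega>) - cis (s * X \<omega>) - h *\<^sub>R (\<i> * of_real (X \<omega>) * cis (s * X \<omega>)) =
        cis (s * X \<omega>) * (cis (h * X \<omega>) - 1 - \<i> * of_real (h * X \<omega>))"
        by (simp add: algebra_simps cis_mult scaleR_conv_of_real)
      also have "norm \<dots> \<le> (h * X \<omega>)\<^sup>2 / 2" using norm_cis_second_order[of "h * X \<omega>"] by (simp add: norm_mult)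
      also have "\<dots> \<le> h\<^sup>2 * (b\<^sup>2 / 2)"
      proof -
        have "(X \<omega>)\<^sup>2 \<le> b\<^sup>2" using b[of \<omega>] b0 by (metis abs_ge_zero power2_abs power_mono)
        then show ?thesis by (simp add: power_mult_distrib mult_left_mono)
      qed
      finally show "norm (cis ((s + h) * X \<omega>) - cis (s * X \<omega>) - h *\<^sub>R (\<i> * of_real (X \<omega>) * cis (s * X \<omega>))) \<le> h\<^sup>2 * (b\<^sup>2 / 2)" .
    qed (use ic iD in auto)
    finally show ?thesis by (simp add: prob_space)
  qed
  have le': "norm ((\<integral>\<omega>. cis ((s + h) * X \<omega>) \<partial>M) - (\<integral>\<omega>. cis (s * X \<omega>) \<partial>M) - h *\<^sub>R ?D) \<le> (\<bar>h\<bar> * (b\<^sup>2 / 2)) * \<bar>h\<bar>" for h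
  proof -
    have "(\<bar>h\<bar> * (b\<^sup>2 / 2)) * \<bar>h\<bar> = (\<bar>h\<bar> * \<bar>h\<bar>) * (b\<^sup>2 / 2)" by (simp only: mult_ac)
    also have "\<dots> = h\<^sup>2 * (b\<^sup>2 / 2)" by (simp only: abs_mult_self_eq power2_eq_square)
    finally show ?thesis using quad[of h] by (simp only:)
  qed
  have le: "norm (norm ((\<integral>\<omega>. cis ((s + h) * X \<omega>) \<partial>M) - (\<integral>\<omega>. cis (s * X \<omega>) \<partial>M) - h *\<^sub>R ?D) / norm h) \<le> \<bar>h\<bar> * (b\<^sup>2 / 2)" for h
  proof (cases "h = 0")
    case False
    then show ?thesis using le'[of h] by (simp only: real_norm_def abs_divide abs_norm_cancel abs_idempotent pos_divide_le_eq zero_less_abs_iff not_False_eq_True)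
  next
    case True
    show ?thesis unfolding True by (simp only: norm_zero div_by_0 abs_zero mult_zero_left order_refl)
  qed
  have "((\<lambda>h :: real. \<bar>h\<bar> * (b\<^sup>2 / 2)) \<longlongrightarrow> \<bar>0\<bar> * (b\<^sup>2 / 2)) (at 0)" by (intro tendsto_intros)
  then have z: "((\<lambda>h :: real. \<bar>h\<bar> * (b\<^sup>2 / 2)) \<longlongrightarrow> 0) (at 0)" by simp
  show "(\<lambda>h. norm ((\<integral>\<omega>. cis ((s + h) * X \<omega>) \<partial>M) - (\<integral>\<omega>. cis (s * X \<omega>) \<partial>M) - h *\<^sub>R ?D) / norm h) \<midarrow>0\<rightarrow> 0"
    by (rule Lim_null_comparison[OF always_eventually[OF allI[OF le]] z])
qed

text \<open>Poisson approximation of a dissociated sum: each \<open>\<eta> E\<close> is independent of the sum over the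
  indices that do not touch \<open>E\<close>. With \<open>\<psi> s\<close> and \<open>exp (A s)\<close> the two characteristic functions at \<open>s\<close>,
  \<open>\<psi> * exp (- A)\<close> has a small derivative.\<close>

lemma (in prob_space) dissociated_sum_char_approx:
  fixes \<eta> :: "'i \<Rightarrow> 'a \<Rightarrow> real" and touch :: "'i \<Rightarrow> 'i \<Rightarrow> bool"
  assumes fin: "finite I"
    and [measurable]: "\<And>E. E \<in> I \<Longrightarrow> \<eta> E \<in> borel_measurable M"
    and bnd: "\<And>E \<omega>. E \<in> I \<Longrightarrow> \<bar>\<eta> E \<omega>\<bar> \<le> b"
    and refl: "\<And>E. E \<in> I \<Longrightarrow> touch E E"
    and ind: "\<And>E s. E \<in> I \<Longrightarrow>
      (\<integral>\<omega>. (of_real (\<eta> E \<omega>) * cis (s * \<eta> E \<omega>)) * cis (s * (\<Sum>E' | E' \<in> I \<and> \<not> touch E E'. \<eta> E' \<omega>)) \<partial>M) =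
      (\<integral>\<omega>. of_real (\<eta> E \<omega>) * cis (s * \<eta> E \<omega>) \<partial>M) * (\<integral>\<omega>. cis (s * (\<Sum>E' | E' \<in> I \<and> \<not> touch E E'. \<eta> E' \<omega>)) \<partial>M)"
  defines "S \<equiv> (\<Sum>E\<in>I. \<integral>\<omega>. \<bar>\<eta> E \<omega>\<bar> \<partial>M)"
    and "T1 \<equiv> (\<Sum>E\<in>I. \<Sum>E' | E' \<in> I \<and> touch E E' \<and> E' \<noteq> E. \<integral>\<omega>. \<bar>\<eta> E \<omega>\<bar> * \<bar>\<eta> E' \<omega>\<bar> \<partial>M)"
    and "T2 \<equiv> (\<Sum>E\<in>I. \<Sum>E' | E' \<in> I \<and> touch E E'. (\<integral>\<omega>. \<bar>\<eta> E \<omega>\<bar> \<partial>M) * (\<integral>\<omega>. \<bar>\<eta> E' \<omega>\<bar> \<partial>M))"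
  shows "norm ((\<integral>\<omega>. cis (\<Sum>E\<in>I. \<eta> E \<omega>) \<partial>M) - exp (\<Sum>E\<in>I. \<integral>\<omega>. cis (\<eta> E \<omega>) - 1 \<partial>M)) \<le> exp (2 * S) * (T1 + T2)"
proof -
  define F where "F \<omega> = (\<Sum>E\<in>I. \<eta> E \<omega>)" for \<omega>
  \<comment> \<open>For an index \<open>E\<close> in \<open>I\<close> the full sum is
    \<open>\<eta> E + G E + D E\<close>: \<open>G E\<close> collects the indices that do not touch
    \<open>E\<close>, and \<open>D E\<close> the other indices that do.\<close>
  define G where "G E \<omega> = (\<Sum>E' | E' \<in> I \<and> \<not> touch E E'. \<eta> E' \<omega>)" for E \<omega>
  define D where "D E \<omega> = (\<Sum>E' | E' \<in> I \<and> touch E E' \<and> E' \<noteq> E. \<eta> E' \<omega>)" for E \<omega>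
  have Fm [measurable]: "F \<in> borel_measurable M" unfolding F_def[abs_def] by measurable
  have Gm [measurable]: "G E \<in> borel_measurable M" for E unfolding G_def[abs_def] by (intro borel_measurable_sum) auto
  have Dm [measurable]: "D E \<in> borel_measurable M" for E unfolding D_def[abs_def] by (intro borel_measurable_sum) auto
  have sumb: "\<bar>\<Sum>E\<in>J. \<eta> E \<omega>\<bar> \<le> real (card I) * \<bar>b\<bar>" if "J \<subseteq> I" for J \<omega>
  proof -
    have "\<bar>\<Sum>E\<in>J. \<eta> E \<omega>\<bar> \<le> (\<Sum>E\<in>J. \<bar>\<eta> E \<omega>\<bar>)" by (rule sum_abs)
    also have "\<dots> \<le> (\<Sum>E\<in>I. \<bar>\<eta> E \<omega>\<bar>)" using that fin by (intro sum_mono2) auto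
    also have "\<dots> \<le> (\<Sum>E\<in>I. \<bar>b\<bar>)" using bnd by (intro sum_mono) (meson abs_ge_self order_trans)
    finally show ?thesis by simp
  qed
  have split: "F \<omega> = \<eta> E \<omega> + G E \<omega> + D E \<omega>" if "E \<in> I" for E \<omega>
  proof -
    have "I = insert E ({E'. E' \<in> I \<and> \<not> touch E E'} \<union> {E'. E' \<in> I \<and> touch E E' \<and> E' \<noteq> E})"
      using that by auto
    then have "F \<omega> = (\<Sum>E'\<in>insert E ({E'. E' \<in> I \<and> \<not> touch E E'} \<union> {E'. E' \<in> I \<and> touch E E' \<and> E' \<noteq> E}). \<eta> E' \<omega>)"
      by (simp add: F_def)
    also have "\<dots> = \<eta> E \<omega> + (\<Sum>E'\<in>{E'. E' \<in> I \<and> \<not> touch E E'} \<union> {E'. E' \<in> I \<and> touch E E' \<and> E' \<noteq> E}. \<eta> E' \<omega>)"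
      using fin refl[OF that] by (subst sum.insert) auto
    also have "(\<Sum>E'\<in>{E'. E' \<in> I \<and> \<not> touch E E'} \<union> {E'. E' \<in> I \<and> touch E E' \<and> E' \<noteq> E}. \<eta> E' \<omega>) = G E \<omega> + D E \<omega>"
      unfolding G_def D_def using fin by (intro sum.union_disjoint) auto
    finally show ?thesis by (simp add: add.assoc)
  qed
  have ic: "integrable M (\<lambda>\<omega>. cis (X \<omega>))" if "X \<in> borel_measurable M" for X
    using that by (intro integrable_const_bound[of _ 1]) (simp_all add: cis_conv_exp)
  have ie: "integrable M (\<eta> E)" if "E \<in> I" for E
    using that bnd by (intro integrable_const_bound[of _ b]) auto
  have iec: "integrable M (\<lambda>\<omega>. of_real (\<eta> E \<omega>) * cis (X \<omega>))" if "E \<in> I" "X \<in> borel_measurable M" for E X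
    using that bnd by (intro integrable_const_bound[of _ b]) (auto simp: norm_mult, simp add: cis_conv_exp)
  have iee: "integrable M (\<lambda>\<omega>. \<bar>\<eta> E \<omega>\<bar> * \<bar>\<eta> E' \<omega>\<bar>)" if "E \<in> I" "E' \<in> I" for E E'
    using that bnd by (intro integrable_const_bound[of _ "b * b"]) (auto simp: abs_mult intro!: mult_mono intro: order_trans[OF abs_ge_zero bnd])
  define \<psi> where "\<psi> s = (\<integral>\<omega>. cis (s * F \<omega>) \<partial>M)" for s
  define a where "a s = (\<Sum>E\<in>I. \<integral>\<omega>. of_real (\<eta> E \<omega>) * cis (s * \<eta> E \<omega>) \<partial>M)" for s
  define A where "A s = (\<Sum>E\<in>I. (\<integral>\<omega>. cis (s * \<eta> E \<omega>) \<partial>M) - 1)" for s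
  define \<psi>' where "\<psi>' s = (\<integral>\<omega>. \<i> * of_real (F \<omega>) * cis (s * F \<omega>) \<partial>M)" for s
  have d\<psi>: "(\<psi> has_vector_derivative \<psi>' s) (at s)" for s
    unfolding \<psi>_def \<psi>'_def
    by (rule has_vector_derivative_expectation_cis[of _ "real (card I) * \<bar>b\<bar>"]) (use sumb[OF order_refl] in \<open>auto simp: F_def\<close>)
  have dA: "(A has_vector_derivative \<i> * a s) (at s)" for s
  proof -
    have "(A has_vector_derivative (\<Sum>E\<in>I. (\<integral>\<omega>. \<i> * of_real (\<eta> E \<omega>) * cis (s * \<eta> E \<omega>) \<partial>M) - 0)) (at s)"
      unfolding A_def[abs_def] using bnd
      by (intro has_vector_derivative_sum has_vector_derivative_diff has_vector_derivative_const
           has_vector_derivative_expectation_cis[of _ b]) auto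
    moreover have "(\<integral>\<omega>. \<i> * of_real (\<eta> E \<omega>) * cis (s * \<eta> E \<omega>) \<partial>M) = \<i> * (\<integral>\<omega>. of_real (\<eta> E \<omega>) * cis (s * \<eta> E \<omega>) \<partial>M)" for E
      by (subst integral_mult_right_zero[symmetric]) (simp add: mult.assoc)
    ultimately show ?thesis by (simp add: a_def sum_distrib_left)
  qed
  have diff: "norm (\<psi>' s - \<i> * a s * \<psi> s) \<le> T1 + T2" if s: "0 \<le> s" "s \<le> 1" for s
  proof -
    have p: "\<psi>' s = \<i> * (\<Sum>E\<in>I. \<integral>\<omega>. of_real (\<eta> E \<omega>) * cis (s * F \<omega>) \<partial>M)"
    proof -
      have "\<psi>' s = (\<integral>\<omega>. \<i> * (\<Sum>E\<in>I. of_real (\<eta> E \<omega>) * cis (s * F \<omega>)) \<partial>M)"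
        unfolding \<psi>'_def by (intro Bochner_Integration.integral_cong) (simp_all add: F_def sum_distrib_right mult.assoc)
      then show ?thesis using iec by (simp add: Bochner_Integration.integral_sum)
    qed
    have one: "norm ((\<integral>\<omega>. of_real (\<eta> E \<omega>) * cis (s * F \<omega>) \<partial>M) - (\<integral>\<omega>. of_real (\<eta> E \<omega>) * cis (s * \<eta> E \<omega>) \<partial>M) * \<psi> s)
      \<le> (\<Sum>E' | E' \<in> I \<and> touch E E' \<and> E' \<noteq> E. \<integral>\<omega>. \<bar>\<eta> E \<omega>\<bar> * \<bar>\<eta> E' \<omega>\<bar> \<partial>M) +
        (\<Sum>E' | E' \<in> I \<and> touch E E'. (\<integral>\<omega>. \<bar>\<eta> E \<omega>\<bar> \<partial>M) * (\<integral>\<omega>. \<bar>\<eta> E' \<omega>\<bar> \<partial>M))" if E: "E \<in> I" for E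
    proof -
      have [measurable]: "\<eta> E \<in> borel_measurable M" using E by simp
      let ?x = "\<integral>\<omega>. of_real (\<eta> E \<omega>) * cis (s * F \<omega>) \<partial>M"
      let ?y = "\<integral>\<omega>. of_real (\<eta> E \<omega>) * cis (s * (\<eta> E \<omega> + G E \<omega>)) \<partial>M"
      let ?z = "\<integral>\<omega>. of_real (\<eta> E \<omega>) * cis (s * \<eta> E \<omega>) \<partial>M"
      let ?w = "\<integral>\<omega>. cis (s * G E \<omega>) \<partial>M"
      have "?y = (\<integral>\<omega>. (of_real (\<eta> E \<omega>) * cis (s * \<eta> E \<omega>)) * cis (s * G E \<omega>) \<partial>M)"
        by (rule Bochner_Integration.integral_cong[OF HOL.refl]) (simp only: distrib_left cis_mult mult.assoc)
      also have "\<dots> = ?z * ?w" unfolding G_def by (rule ind[OF E])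
      finally have yz: "?y = ?z * ?w" .
      \<comment> \<open>The error splits in two: dropping \<open>D E\<close> from the phase costs
        the joint means in \<open>T1\<close>, and replacing the mean of the phase of
        \<open>G E\<close> by \<open>\<psi> s\<close> costs the products of means in
        \<open>T2\<close>.\<close>
      have alg: "x - z * p = (x - z * w) + z * (w - p)" for x z w p :: complex by (simp add: algebra_simps)
      have "norm (?x - ?z * \<psi> s) = norm ((?x - ?y) + ?z * (?w - \<psi> s))"
        unfolding yz by (rule arg_cong[where f = norm, OF alg])
      also have "\<dots> \<le> (\<Sum>E' | E' \<in> I \<and> touch E E' \<and> E' \<noteq> E. \<integral>\<omega>. \<bar>\<eta> E \<omega>\<bar> * \<bar>\<eta> E' \<omega>\<bar> \<partial>M) +
        (\<Sum>E' | E' \<in> I \<and> touch E E'. (\<integral>\<omega>. \<bar>\<eta> E \<omega>\<bar> \<partial>M) * (\<integral>\<omega>. \<bar>\<eta> E' \<omega>\<bar> \<partial>M))"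
      proof (rule norm_triangle_mono)
        have "norm (?x - ?y) = norm (\<integral>\<omega>. of_real (\<eta> E \<omega>) * (cis (s * F \<omega>) - cis (s * (\<eta> E \<omega> + G E \<omega>))) \<partial>M)"
          using iec[OF E] by (simp add: right_diff_distrib)
        also have "\<dots> \<le> (\<integral>\<omega>. (\<Sum>E' | E' \<in> I \<and> touch E E' \<and> E' \<noteq> E. \<bar>\<eta> E \<omega>\<bar> * \<bar>\<eta> E' \<omega>\<bar>) \<partial>M)"
        proof (rule order_trans[OF integral_norm_bound integral_mono])
          show "integrable M (\<lambda>\<omega>. norm (of_real (\<eta> E \<omega>) * (cis (s * F \<omega>) - cis (s * (\<eta> E \<omega> + G E \<omega>)))))"
            using iec[OF E] by (simp add: right_diff_distrib)
          show "integrable M (\<lambda>\<omega>. \<Sum>E' | E' \<in> I \<and> touch E E' \<and> E' \<noteq> E. \<bar>\<eta> E \<omega>\<bar> * \<bar>\<eta> E' \<omega>\<bar>)"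
            using iee[OF E] by auto
          fix \<omega>
          have "norm (cis (s * F \<omega>) - cis (s * (\<eta> E \<omega> + G E \<omega>))) \<le> \<bar>s * F \<omega> - s * (\<eta> E \<omega> + G E \<omega>)\<bar>"
            by (rule norm_cis_diff_le)
          also have "\<dots> = s * \<bar>D E \<omega>\<bar>" using s by (simp add: split[OF E] algebra_simps abs_mult)
          also have "\<dots> \<le> 1 * \<bar>D E \<omega>\<bar>" using s by (intro mult_right_mono) auto
          also have "\<dots> \<le> (\<Sum>E' | E' \<in> I \<and> touch E E' \<and> E' \<noteq> E. \<bar>\<eta> E' \<omega>\<bar>)" by (simp add: D_def sum_abs)
          finally show "norm (of_real (\<eta> E \<omega>) * (cis (s * F \<omega>) - cis (s * (\<eta> E \<omega> + G E \<omega>)))) \<le>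
            (\<Sum>E' | E' \<in> I \<and> touch E E' \<and> E' \<noteq> E. \<bar>\<eta> E \<omega>\<bar> * \<bar>\<eta> E' \<omega>\<bar>)"
            by (simp add: norm_mult sum_distrib_left[symmetric] mult_left_mono)
        qed
        finally show "norm (?x - ?y) \<le> (\<Sum>E' | E' \<in> I \<and> touch E E' \<and> E' \<noteq> E. \<integral>\<omega>. \<bar>\<eta> E \<omega>\<bar> * \<bar>\<eta> E' \<omega>\<bar> \<partial>M)"
          using iee[OF E] by (simp add: Bochner_Integration.integral_sum)
        have "norm (?w - \<psi> s) \<le> (\<integral>\<omega>. (\<Sum>E' | E' \<in> I \<and> touch E E'. \<bar>\<eta> E' \<omega>\<bar>) \<partial>M)"
        proof -
          have "norm (?w - \<psi> s) = norm (\<integral>\<omega>. cis (s * G E \<omega>) - cis (s * F \<omega>) \<partial>M)"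
            unfolding \<psi>_def by (subst Bochner_Integration.integral_diff) (auto intro!: ic)
          also have "\<dots> \<le> (\<integral>\<omega>. (\<Sum>E' | E' \<in> I \<and> touch E E'. \<bar>\<eta> E' \<omega>\<bar>) \<partial>M)"
          proof (rule order_trans[OF integral_norm_bound integral_mono])
            show "integrable M (\<lambda>\<omega>. norm (cis (s * G E \<omega>) - cis (s * F \<omega>)))"
              by (intro integrable_norm Bochner_Integration.integrable_diff ic) auto
            show "integrable M (\<lambda>\<omega>. \<Sum>E' | E' \<in> I \<and> touch E E'. \<bar>\<eta> E' \<omega>\<bar>)"
              using ie by auto
            fix \<omega>
            have "norm (cis (s * G E \<omega>) - cis (s * F \<omega>)) \<le> \<bar>s * G E \<omega> - s * F \<omega>\<bar>" by (rule norm_cis_diff_le)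
            also have "\<dots> = s * \<bar>F \<omega> - G E \<omega>\<bar>" using s by (simp add: abs_mult abs_minus_commute flip: right_diff_distrib)
            also have "\<dots> \<le> 1 * \<bar>F \<omega> - G E \<omega>\<bar>" using s by (intro mult_right_mono) auto
            also have "F \<omega> - G E \<omega> = (\<Sum>E' | E' \<in> I \<and> touch E E'. \<eta> E' \<omega>)"
            proof -
              have "{E'. E' \<in> I \<and> touch E E'} = insert E {E'. E' \<in> I \<and> touch E E' \<and> E' \<noteq> E}" using E refl by auto
              then show ?thesis using fin by (simp add: split[OF E] D_def)
            qed
            finally show "norm (cis (s * G E \<omega>) - cis (s * F \<omega>)) \<le> (\<Sum>E' | E' \<in> I \<and> touch E E'. \<bar>\<eta> E' \<omega>\<bar>)"
              using sum_abs[of "\<lambda>E'. \<eta> E' \<omega>" "{E'. E' \<in> I \<and> touch E E'}"] by linarith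
          qed
          finally show ?thesis .
        qed
        moreover have "norm ?z \<le> (\<integral>\<omega>. \<bar>\<eta> E \<omega>\<bar> \<partial>M)"
          using integral_norm_bound[of M "\<lambda>\<omega>. of_real (\<eta> E \<omega>) * cis (s * \<eta> E \<omega>)"] by (simp add: norm_mult)
        ultimately have "norm ?z * norm (?w - \<psi> s) \<le> (\<integral>\<omega>. \<bar>\<eta> E \<omega>\<bar> \<partial>M) * (\<integral>\<omega>. (\<Sum>E' | E' \<in> I \<and> touch E E'. \<bar>\<eta> E' \<omega>\<bar>) \<partial>M)"
          by (intro mult_mono) auto
        then show "norm (?z * (?w - \<psi> s)) \<le> (\<Sum>E' | E' \<in> I \<and> touch E E'. (\<integral>\<omega>. \<bar>\<eta> E \<omega>\<bar> \<partial>M) * (\<integral>\<omega>. \<bar>\<eta> E' \<omega>\<bar> \<partial>M))"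
          using ie by (simp add: norm_mult Bochner_Integration.integral_sum sum_distrib_left)
      qed
      finally show ?thesis .
    qed
    have "\<psi>' s - \<i> * a s * \<psi> s = \<i> * (\<Sum>E\<in>I. (\<integral>\<omega>. of_real (\<eta> E \<omega>) * cis (s * F \<omega>) \<partial>M) - (\<integral>\<omega>. of_real (\<eta> E \<omega>) * cis (s * \<eta> E \<omega>) \<partial>M) * \<psi> s)"
      by (simp add: p a_def sum_subtractf sum_distrib_right right_diff_distrib mult.assoc)
    also have "norm \<dots> \<le> (\<Sum>E\<in>I. (\<Sum>E' | E' \<in> I \<and> touch E E' \<and> E' \<noteq> E. \<integral>\<omega>. \<bar>\<eta> E \<omega>\<bar> * \<bar>\<eta> E' \<omega>\<bar> \<partial>M) +
        (\<Sum>E' | E' \<in> I \<and> touch E E'. (\<integral>\<omega>. \<bar>\<eta> E \<omega>\<bar> \<partial>M) * (\<integral>\<omega>. \<bar>\<eta> E' \<omega>\<bar> \<partial>M)))"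
      unfolding norm_mult norm_ii mult_1 by (rule order_trans[OF norm_sum sum_mono[OF one]])
    finally show ?thesis by (simp add: T1_def T2_def sum.distrib)
  qed
  have T0: "T1 + T2 \<ge> 0" by (simp add: T1_def T2_def sum_nonneg)
  \<comment> \<open>The exponent stays bounded by \<open>S\<close>, so multiplying by
    \<open>exp (- A s)\<close> and going back by \<open>exp (A 1)\<close> each cost a factor
    \<open>exp S\<close>.\<close>
  have Sle: "norm (A s) \<le> S" if s: "0 \<le> s" "s \<le> 1" for s
  proof -
    have "norm ((\<integral>\<omega>. cis (s * \<eta> E \<omega>) \<partial>M) - 1) \<le> (\<integral>\<omega>. \<bar>\<eta> E \<omega>\<bar> \<partial>M)" if E: "E \<in> I" for E
    proof -
      have [measurable]: "\<eta> E \<in> borel_measurable M" using E by simp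
      have "norm ((\<integral>\<omega>. cis (s * \<eta> E \<omega>) \<partial>M) - 1) = norm (\<integral>\<omega>. cis (s * \<eta> E \<omega>) - 1 \<partial>M)"
        by (subst Bochner_Integration.integral_diff) (auto intro!: ic simp: prob_space)
      also have "\<dots> \<le> (\<integral>\<omega>. \<bar>\<eta> E \<omega>\<bar> \<partial>M)"
      proof (rule order_trans[OF integral_norm_bound integral_mono])
        show "integrable M (\<lambda>\<omega>. norm (cis (s * \<eta> E \<omega>) - 1))"
          by (intro integrable_norm Bochner_Integration.integrable_diff ic) auto
        fix \<omega>
        have "norm (cis (s * \<eta> E \<omega>) - 1) \<le> \<bar>s * \<eta> E \<omega>\<bar>" by (rule norm_cis_minus_one_le)
        also have "\<dots> \<le> 1 * \<bar>\<eta> E \<omega>\<bar>" unfolding abs_mult using s by (intro mult_right_mono) auto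
        finally show "norm (cis (s * \<eta> E \<omega>) - 1) \<le> \<bar>\<eta> E \<omega>\<bar>" by simp
      qed (use ie[OF E] in auto)
      finally show ?thesis .
    qed
    then show ?thesis unfolding A_def S_def by (intro order_trans[OF norm_sum] sum_mono)
  qed
  \<comment> \<open>\<open>g 0 = 1\<close>, so the mean value inequality on the unit interval
    compares \<open>\<psi> 1\<close> with \<open>exp (A 1)\<close>.\<close>
  define g where "g s = \<psi> s * exp (- A s)" for s
  have dg: "(g has_vector_derivative (\<psi>' s - \<i> * a s * \<psi> s) * exp (- A s)) (at s)" for s
  proof -
    have "((\<lambda>s. exp (- A s)) has_vector_derivative (- (\<i> * a s)) * exp (- A s)) (at s)"
      using field_vector_diff_chain_at[OF has_vector_derivative_minus[OF dA[of s]] DERIV_exp[of "- A s"]]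
      by (simp add: o_def)
    from has_vector_derivative_mult[OF d\<psi>[of s] this] show ?thesis
      unfolding g_def by (simp add: algebra_simps)
  qed
  have "norm (g 1 - g 0) \<le> (T1 + T2) * exp S * norm (1 - 0 :: real)"
  proof (rule differentiable_bound[of "{0..1}" g "\<lambda>s h. h *\<^sub>R ((\<psi>' s - \<i> * a s * \<psi> s) * exp (- A s))"])
    fix s :: real assume s: "s \<in> {0..1}"
    show "(g has_derivative (\<lambda>h. h *\<^sub>R ((\<psi>' s - \<i> * a s * \<psi> s) * exp (- A s)))) (at s within {0..1})"
      using dg[of s] unfolding has_vector_derivative_def by (rule has_derivative_at_withinI)
    have "norm ((\<psi>' s - \<i> * a s * \<psi> s) * exp (- A s)) \<le> (T1 + T2) * exp S"
      unfolding norm_mult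
    proof (rule mult_mono)
      show "norm (exp (- A s)) \<le> exp S"
        using Sle[of s] s norm_exp[of "- A s"] by (auto intro: order_trans)
    qed (use diff s T0 in auto)
    then show "onorm (\<lambda>h. h *\<^sub>R ((\<psi>' s - \<i> * a s * \<psi> s) * exp (- A s))) \<le> (T1 + T2) * exp S"
      by (intro onorm_le) (simp add: mult.commute[of _ "\<bar>_\<bar>"] mult_left_mono)
  qed auto
  moreover have "g 0 = 1" by (simp add: g_def \<psi>_def A_def prob_space)
  ultimately have g1: "norm (g 1 - 1) \<le> (T1 + T2) * exp S" by simp
  have "\<psi> 1 - exp (A 1) = (g 1 - 1) * exp (A 1)"
    by (simp add: g_def left_diff_distrib mult.assoc exp_add[symmetric])
  also have "norm \<dots> \<le> ((T1 + T2) * exp S) * exp S"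
    unfolding norm_mult
    using g1 Sle[of 1] norm_exp[of "A 1"] T0 by (intro mult_mono) (auto intro: order_trans)
  finally have "norm (\<psi> 1 - exp (A 1)) \<le> ((T1 + T2) * exp S) * exp S" .
  also have "((T1 + T2) * exp S) * exp S = exp (2 * S) * (T1 + T2)"
    unfolding mult_2 exp_add by (simp only: mult_ac)
  finally have "norm (\<psi> 1 - exp (A 1)) \<le> exp (2 * S) * (T1 + T2)" .
  moreover have "A 1 = (\<Sum>E\<in>I. \<integral>\<omega>. cis (\<eta> E \<omega>) - 1 \<partial>M)"
    unfolding A_def
  proof (rule sum.cong[OF HOL.refl])
    fix E assume "E \<in> I"
    then have "integrable M (\<lambda>\<omega>. cis (\<eta> E \<omega>))" by (intro ic) simp
    then show "(\<integral>\<omega>. cis (1 * \<eta> E \<omega>) \<partial>M) - 1 = (\<integral>\<omega>. cis (\<eta> E \<omega>) - 1 \<partial>M)"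
      by (simp add: prob_space)
  qed
  ultimately show ?thesis by (simp add: \<psi>_def F_def)
qed

section \<open>Sums over simple cycles\<close>

text \<open>Concatenation is injective because the lengths are prescribed; it embeds the pairs into
  the walks of length \<open>q + q'\<close>, for which the sum is already bounded.\<close>

lemma sum_simple_cycles_pairs_le:
  assumes n: "n \<ge> 1"
  shows "(\<Sum>xs\<in>simple_cycles {..<n} q. \<Sum>ys\<in>simple_cycles {..<n} q'. (2 / real n) ^ card (set (xs @ ys))) \<le> fact (Suc (q + q'))"
proof -
  let ?A = "simple_cycles {..<n} q \<times> simple_cycles {..<n} q'"
  have inj: "inj_on (\<lambda>(xs, ys). xs @ ys) ?A"
    by (auto simp: inj_on_def simple_cycles_def)
  have "(\<Sum>xs\<in>simple_cycles {..<n} q. \<Sum>ys\<in>simple_cycles {..<n} q'. (2 / real n) ^ card (set (xs @ ys))) =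
    (\<Sum>p\<in>?A. (2 / real n) ^ card (set (case p of (xs, ys) \<Rightarrow> xs @ ys)))"
    by (simp add: sum.cartesian_product case_prod_unfold)
  also have "\<dots> = (\<Sum>zs\<in>(\<lambda>(xs, ys). xs @ ys) ` ?A. (2 / real n) ^ card (set zs))"
    by (subst sum.reindex[OF inj]) (simp add: o_def)
  also have "\<dots> \<le> (\<Sum>zs\<in>closed_walks {..<n} (q + q'). (2 / real n) ^ card (set zs))"
    by (intro sum_mono2 finite_closed_walks) (auto simp: closed_walks_def simple_cycles_def)
  also have "\<dots> \<le> fact (Suc (q + q'))"
    using sum_walks_card_bound[of "{..<n}" "q + q'"] n by (auto simp: lessThan_empty_iff)
  finally show ?thesis .
qed

context symmetric_iid_array
begin

text \<open>The edge set identifies the \<open>q\<close> rotations of a cycle, along which the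
  product of the entries is the same random variable.\<close>

definition cycle_sets :: "nat \<Rightarrow> nat \<Rightarrow> (nat \<times> nat) set set" where
  "cycle_sets n q = cyc_edges ` simple_cycles {..<n} q"

definition all_cycles :: "nat \<Rightarrow> nat \<Rightarrow> (nat \<times> nat) set set" where
  "all_cycles n K = (\<Union>q\<in>{1..K}. cycle_sets n q)"

definition W :: "nat \<Rightarrow> (nat \<times> nat) set \<Rightarrow> 'a \<Rightarrow> real" where
  "W n E \<omega> = (\<Prod>e\<in>E. Y n e \<omega>)"

lemma W_measurable [measurable]: "W n E \<in> borel_measurable M"
  unfolding W_def[abs_def] by measurable

lemma cycle_setsD:
  assumes "E \<in> cycle_sets n q"
  shows "card E = q" "E \<subseteq> square n" "inj_on fst E" "finite E"
proof -
  obtain c where c: "distinct c" "set c \<subseteq> {..<n}" "length c = q" "E = cyc_edges c"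
    using assms by (auto simp: cycle_sets_def simple_cycles_def)
  then show "card E = q" "E \<subseteq> square n" "inj_on fst E" "finite E"
    using card_cyc_edges cyc_edges_subset[OF c(2)] distinct_cyc_inj(2) by (auto simp: square_def)
qed

lemma finite_cycle_sets [simp]: "finite (cycle_sets n q)"
  by (simp add: cycle_sets_def)

lemma finite_all_cycles [simp]: "finite (all_cycles n K)"
  by (simp add: all_cycles_def)

lemma all_cyclesD:
  assumes "E \<in> all_cycles n K"
  shows "E \<subseteq> square n" "finite E" "1 \<le> card E" "card E \<le> K" "E \<in> cycle_sets n (card E)"
proof -
  obtain q where q: "q \<in> {1..K}" "E \<in> cycle_sets n q" using assms by (auto simp: all_cycles_def)
  show "E \<subseteq> square n" "finite E" "1 \<le> card E" "card E \<le> K" "E \<in> cycle_sets n (card E)"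
    using cycle_setsD[OF q(2)] q by simp_all
qed

lemma sum_all_cycles:
  "(\<Sum>E\<in>all_cycles n K. f E) = (\<Sum>q\<in>{1..K}. \<Sum>E\<in>cycle_sets n q. f E)"
proof -
  have "cycle_sets n p \<inter> cycle_sets n q = {}" if "p \<noteq> q" for p q
    using cycle_setsD(1)[of _ n p] cycle_setsD(1)[of _ n q] that by blast
  then show ?thesis unfolding all_cycles_def by (intro sum.UNION_disjoint) auto
qed

text \<open>Passing from edge sets to lists only repeats nonnegative terms.\<close>

lemma sum_cycle_sets_le:
  fixes f :: "(nat \<times> nat) set \<Rightarrow> real"
  assumes "\<And>E. E \<in> cycle_sets n q \<Longrightarrow> f E \<ge> 0"
  shows "(\<Sum>E\<in>cycle_sets n q. f E) \<le> (\<Sum>xs\<in>simple_cycles {..<n} q. f (cyc_edges xs))"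
  unfolding cycle_sets_def using assms sum_image_le[of "simple_cycles {..<n} q" f cyc_edges]
  by (auto simp: cycle_sets_def o_def)

lemma W_abs_le_1: "E \<subseteq> square n \<Longrightarrow> \<bar>W n E \<omega>\<bar> \<le> 1"
  using prod_Y_abs_le_1[of E n \<omega> "\<lambda>_. 1"] by (simp add: W_def)

lemma W_sq: "(W n E \<omega>)\<^sup>2 = (\<Prod>e\<in>E. (Y n e \<omega>)\<^sup>2)"
  by (simp add: W_def prod_power_distrib)

lemma W_sq_le_1: "E \<subseteq> square n \<Longrightarrow> (W n E \<omega>)\<^sup>2 \<le> 1"
  using W_abs_le_1[of E n \<omega>] by (simp add: abs_square_le_1)

lemma integrable_bounded_W:
  fixes f :: "real \<Rightarrow> 'c::{banach, second_countable_topology}"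
  assumes "E \<subseteq> square n" "f \<in> borel_measurable borel" "\<And>w. \<bar>w\<bar> \<le> 1 \<Longrightarrow> norm (f w) \<le> B"
  shows "integrable M (\<lambda>\<omega>. f (W n E \<omega>))"
  using assms W_abs_le_1[OF assms(1)] by (intro integrable_const_bound[of _ B]) auto

lemma expectation_W_sq_le:
  assumes "E \<subseteq> square n" "2 * card E \<le> n"
  shows "(\<integral>\<omega>. (W n E \<omega>)\<^sup>2 \<partial>M) \<le> (2 / real n) ^ card E"
  using expectation_prod_sq_le[OF assms] by (simp add: W_sq)

lemma integrable_W_sq: "E \<subseteq> square n \<Longrightarrow> integrable M (\<lambda>\<omega>. (W n E \<omega>)\<^sup>2)"
  by (rule integrable_bounded_W[of _ _ _ 1]) (auto simp: abs_square_le_1)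

lemma integrable_W_sq_mult: "E \<subseteq> square n \<Longrightarrow> E' \<subseteq> square n \<Longrightarrow> integrable M (\<lambda>\<omega>. (W n E \<omega>)\<^sup>2 * (W n E' \<omega>)\<^sup>2)"
  using W_sq_le_1 by (intro integrable_const_bound[of _ 1]) (auto simp: abs_mult intro!: mult_le_one)

text \<open>An edge common to both sets carries the fourth power of an entry, from which one square
  is dropped since it is at most 1.\<close>

lemma expectation_W_sq_mult_le:
  assumes E: "E \<subseteq> square n" "E' \<subseteq> square n" and n: "2 * card (E \<union> E') \<le> n"
  shows "(\<integral>\<omega>. (W n E \<omega>)\<^sup>2 * (W n E' \<omega>)\<^sup>2 \<partial>M) \<le> (2 / real n) ^ card (E \<union> E')"
proof -
  have fin: "finite E" "finite E'" using E by (auto intro: finite_subset)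
  have "(\<integral>\<omega>. (W n E \<omega>)\<^sup>2 * (W n E' \<omega>)\<^sup>2 \<partial>M) \<le> (\<integral>\<omega>. (\<Prod>e\<in>E \<union> E'. (Y n e \<omega>)\<^sup>2) \<partial>M)"
  proof (rule integral_mono[OF integrable_W_sq_mult[OF E]])
    show "integrable M (\<lambda>\<omega>. \<Prod>e\<in>E \<union> E'. (Y n e \<omega>)\<^sup>2)"
      using integrable_prod_Y[of "E \<union> E'" n "\<lambda>_. 2"] E by simp
    fix \<omega>
    have "(W n E \<omega>)\<^sup>2 * (W n E' \<omega>)\<^sup>2 = (\<Prod>e\<in>E \<union> E'. (Y n e \<omega>)\<^sup>2) * (\<Prod>e\<in>E \<inter> E'. (Y n e \<omega>)\<^sup>2)"
      using prod.union_inter[OF fin, of "\<lambda>e. (Y n e \<omega>)\<^sup>2"] by (simp add: W_sq)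
    also have "\<dots> \<le> (\<Prod>e\<in>E \<union> E'. (Y n e \<omega>)\<^sup>2) * 1"
    proof (rule mult_left_mono)
      have "E \<inter> E' \<subseteq> square n" using E by auto
      from W_sq_le_1[OF this] show "(\<Prod>e\<in>E \<inter> E'. (Y n e \<omega>)\<^sup>2) \<le> 1" by (simp add: W_sq)
    qed (simp add: prod_nonneg)
    finally show "(W n E \<omega>)\<^sup>2 * (W n E' \<omega>)\<^sup>2 \<le> (\<Prod>e\<in>E \<union> E'. (Y n e \<omega>)\<^sup>2)" by simp
  qed
  also have "\<dots> \<le> (2 / real n) ^ card (E \<union> E')" using E n by (intro expectation_prod_sq_le) auto
  finally show ?thesis .
qed

text \<open>Each pair has one factor \<open>2 / n\<close> more than its number of vertices; the
  summation over the vertices uses up the others, and this one survives. The pair of lengths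
  accounts for the square of \<open>K\<close>.\<close>

lemma sum_all_cycles_pairs_le:
  fixes \<Theta> :: "(nat \<times> nat) set \<Rightarrow> (nat \<times> nat) set \<Rightarrow> real"
  assumes n: "n \<ge> 1" and nn: "\<And>E E'. E \<in> all_cycles n K \<Longrightarrow> E' \<in> all_cycles n K \<Longrightarrow> \<Theta> E E' \<ge> 0"
    and le: "\<And>q q' xs ys. q \<in> {1..K} \<Longrightarrow> q' \<in> {1..K} \<Longrightarrow> xs \<in> simple_cycles {..<n} q \<Longrightarrow> ys \<in> simple_cycles {..<n} q' \<Longrightarrow>
       \<Theta> (cyc_edges xs) (cyc_edges ys) \<le> (2 / real n) * (2 / real n) ^ card (set (xs @ ys))"
  shows "(\<Sum>E\<in>all_cycles n K. \<Sum>E'\<in>all_cycles n K. \<Theta> E E') \<le> real K ^ 2 * fact (Suc (2 * K)) * (2 / real n)"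
proof -
  have cyc: "cyc_edges xs \<in> all_cycles n K" if "xs \<in> simple_cycles {..<n} q" "q \<in> {1..K}" for xs q
    using that by (auto simp: all_cycles_def cycle_sets_def)
  have cs: "E \<in> all_cycles n K" if "E \<in> cycle_sets n q" "q \<in> {1..K}" for E q
    using that by (auto simp: all_cycles_def)
  have "(\<Sum>E\<in>all_cycles n K. \<Sum>E'\<in>all_cycles n K. \<Theta> E E') =
    (\<Sum>q\<in>{1..K}. \<Sum>E\<in>cycle_sets n q. \<Sum>q'\<in>{1..K}. \<Sum>E'\<in>cycle_sets n q'. \<Theta> E E')"
    by (simp only: sum_all_cycles)
  also have "\<dots> = (\<Sum>q\<in>{1..K}. \<Sum>q'\<in>{1..K}. \<Sum>E\<in>cycle_sets n q. \<Sum>E'\<in>cycle_sets n q'. \<Theta> E E')"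
    by (intro sum.cong refl sum.swap)
  also have "\<dots> \<le> (\<Sum>q\<in>{1..K}. \<Sum>q'\<in>{1..K}. fact (Suc (2 * K)) * (2 / real n))"
  proof (intro sum_mono)
    fix q q' assume q: "q \<in> {1..K}" "q' \<in> {1..K}"
    have "(\<Sum>E\<in>cycle_sets n q. \<Sum>E'\<in>cycle_sets n q'. \<Theta> E E') \<le>
      (\<Sum>xs\<in>simple_cycles {..<n} q. \<Sum>E'\<in>cycle_sets n q'. \<Theta> (cyc_edges xs) E')"
      using nn cs q by (intro sum_cycle_sets_le sum_nonneg) auto
    also have "\<dots> \<le> (\<Sum>xs\<in>simple_cycles {..<n} q. \<Sum>ys\<in>simple_cycles {..<n} q'. \<Theta> (cyc_edges xs) (cyc_edges ys))"
      using nn cs cyc q by (intro sum_mono sum_cycle_sets_le) auto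
    also have "\<dots> \<le> (\<Sum>xs\<in>simple_cycles {..<n} q. \<Sum>ys\<in>simple_cycles {..<n} q'. (2 / real n) * (2 / real n) ^ card (set (xs @ ys)))"
      using le q by (intro sum_mono) auto
    also have "\<dots> = (2 / real n) * (\<Sum>xs\<in>simple_cycles {..<n} q. \<Sum>ys\<in>simple_cycles {..<n} q'. (2 / real n) ^ card (set (xs @ ys)))"
      by (simp only: sum_distrib_left)
    also have "\<dots> \<le> (2 / real n) * fact (Suc (q + q'))"
      by (intro mult_left_mono sum_simple_cycles_pairs_le n) auto
    also have "\<dots> \<le> (2 / real n) * fact (Suc (2 * K))"
      using q by (intro mult_left_mono fact_mono) auto
    finally show "(\<Sum>E\<in>cycle_sets n q. \<Sum>E'\<in>cycle_sets n q'. \<Theta> E E') \<le> fact (Suc (2 * K)) * (2 / real n)"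
      by (simp add: mult.commute)
  qed
  also have "\<dots> = real K ^ 2 * fact (Suc (2 * K)) * (2 / real n)" by (simp add: power2_eq_square)
  finally show ?thesis .
qed

section \<open>Poisson approximation for functions of the cycle weights\<close>

text \<open>Sharing a row is what matters: products over disjoint sets of rows are independent even
  when columns coincide.\<close>

definition touch :: "(nat \<times> nat) set \<Rightarrow> (nat \<times> nat) set \<Rightarrow> bool" where
  "touch E E' \<longleftrightarrow> fst ` E \<inter> fst ` E' \<noteq> {}"

lemma power_le_next_power:
  assumes "Suc a \<le> b" "n \<ge> 2"
  shows "(2 / real n) ^ b \<le> (2 / real n) * (2 / real n) ^ a"
  using power_decreasing[of "Suc a" b "2 / real n"] assms by simp

text \<open>Both sums gain a factor \<open>2 / n\<close>. Two different touching cycles have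
  together more edges than vertices. In the second sum the exponents add up to
  \<open>q + q'\<close>, while a common vertex leaves at most \<open>q + q' - 1\<close> distinct
  vertices; this also covers the pair of a cycle with itself.\<close>

lemma touching_pairs_bound:
  assumes n: "n \<ge> 4 * K" "n \<ge> 2"
  shows "(\<Sum>E\<in>all_cycles n K. \<Sum>E' | E' \<in> all_cycles n K \<and> touch E E' \<and> E' \<noteq> E. \<integral>\<omega>. (W n E \<omega>)\<^sup>2 * (W n E' \<omega>)\<^sup>2 \<partial>M)
      \<le> real K ^ 2 * fact (Suc (2 * K)) * (2 / real n)" (is ?A)
    and "(\<Sum>E\<in>all_cycles n K. \<Sum>E' | E' \<in> all_cycles n K \<and> touch E E'. (\<integral>\<omega>. (W n E \<omega>)\<^sup>2 \<partial>M) * (\<integral>\<omega>. (W n E' \<omega>)\<^sup>2 \<partial>M))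
      \<le> real K ^ 2 * fact (Suc (2 * K)) * (2 / real n)" (is ?B)
proof -
  have t: "touch (cyc_edges xs) (cyc_edges ys) \<longleftrightarrow> set xs \<inter> set ys \<noteq> {}" for xs ys :: "nat list"
    by (simp add: touch_def fst_cyc_edges)
  have sub: "cyc_edges xs \<subseteq> square n" "card (cyc_edges xs) = q" if "xs \<in> simple_cycles {..<n} q" for xs q
    using that cyc_edges_subset[of xs "{..<n}"] card_cyc_edges[of xs] by (auto simp: simple_cycles_def square_def)
  have n1: "n \<ge> 1" using n by simp
  show ?A
  proof -
    let ?T = "\<lambda>E E'. if touch E E' \<and> E' \<noteq> E then \<integral>\<omega>. (W n E \<omega>)\<^sup>2 * (W n E' \<omega>)\<^sup>2 \<partial>M else 0"
    have "(\<Sum>E\<in>all_cycles n K. \<Sum>E' | E' \<in> all_cycles n K \<and> touch E E' \<and> E' \<noteq> E. \<integral>\<omega>. (W n E \<omega>)\<^sup>2 * (W n E' \<omega>)\<^sup>2 \<partial>M) =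
      (\<Sum>E\<in>all_cycles n K. \<Sum>E'\<in>all_cycles n K. ?T E E')"
      by (simp only: sum.inter_filter[OF finite_all_cycles])
    also have "\<dots> \<le> real K ^ 2 * fact (Suc (2 * K)) * (2 / real n)"
    proof (rule sum_all_cycles_pairs_le[OF n1])
      fix q q' xs ys assume q: "q \<in> {1..K}" "q' \<in> {1..K}" and xs: "xs \<in> simple_cycles {..<n} q" and ys: "ys \<in> simple_cycles {..<n} q'"
      show "?T (cyc_edges xs) (cyc_edges ys) \<le> (2 / real n) * (2 / real n) ^ card (set (xs @ ys))"
      proof (cases "touch (cyc_edges xs) (cyc_edges ys) \<and> cyc_edges ys \<noteq> cyc_edges xs")
        case True
        have cu: "card (cyc_edges xs \<union> cyc_edges ys) \<le> q + q'" using card_Un_le[of "cyc_edges xs" "cyc_edges ys"] sub xs ys by simp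
        have "?T (cyc_edges xs) (cyc_edges ys) = (\<integral>\<omega>. (W n (cyc_edges xs) \<omega>)\<^sup>2 * (W n (cyc_edges ys) \<omega>)\<^sup>2 \<partial>M)"
          using True by simp
        also have "\<dots> \<le> (2 / real n) ^ card (cyc_edges xs \<union> cyc_edges ys)"
          using cu q n by (intro expectation_W_sq_mult_le sub(1)[OF xs] sub(1)[OF ys]) auto
        also have "\<dots> \<le> (2 / real n) * (2 / real n) ^ card (set (xs @ ys))"
        proof (rule power_le_next_power[OF Suc_leI[OF card_touching_cycles]])
          show "cyc_edges xs \<noteq> cyc_edges ys" using True by (rule conjunct2[THEN not_sym])
          show "set xs \<inter> set ys \<noteq> {}" using True by (simp only: t not_False_eq_True)
        qed (rule n(2))
        finally show ?thesis .
      qed auto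
    qed (auto intro!: integral_nonneg_AE)
    finally show ?A .
  qed
  show ?B
  proof -
    let ?T = "\<lambda>E E'. if touch E E' then (\<integral>\<omega>. (W n E \<omega>)\<^sup>2 \<partial>M) * (\<integral>\<omega>. (W n E' \<omega>)\<^sup>2 \<partial>M) else 0"
    have "(\<Sum>E\<in>all_cycles n K. \<Sum>E' | E' \<in> all_cycles n K \<and> touch E E'. (\<integral>\<omega>. (W n E \<omega>)\<^sup>2 \<partial>M) * (\<integral>\<omega>. (W n E' \<omega>)\<^sup>2 \<partial>M)) =
      (\<Sum>E\<in>all_cycles n K. \<Sum>E'\<in>all_cycles n K. ?T E E')"
      by (simp only: sum.inter_filter[OF finite_all_cycles])
    also have "\<dots> \<le> real K ^ 2 * fact (Suc (2 * K)) * (2 / real n)"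
    proof (rule sum_all_cycles_pairs_le[OF n1])
      fix q q' xs ys assume q: "q \<in> {1..K}" "q' \<in> {1..K}" and xs: "xs \<in> simple_cycles {..<n} q" and ys: "ys \<in> simple_cycles {..<n} q'"
      show "?T (cyc_edges xs) (cyc_edges ys) \<le> (2 / real n) * (2 / real n) ^ card (set (xs @ ys))"
      proof (cases "touch (cyc_edges xs) (cyc_edges ys)")
        case True
        have "?T (cyc_edges xs) (cyc_edges ys) = (\<integral>\<omega>. (W n (cyc_edges xs) \<omega>)\<^sup>2 \<partial>M) * (\<integral>\<omega>. (W n (cyc_edges ys) \<omega>)\<^sup>2 \<partial>M)"
          using True by simp
        also have "\<dots> \<le> (2 / real n) ^ q * (2 / real n) ^ q'"
        proof (rule mult_mono)
          show "(\<integral>\<omega>. (W n (cyc_edges xs) \<omega>)\<^sup>2 \<partial>M) \<le> (2 / real n) ^ q"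
            using expectation_W_sq_le[OF sub(1)[OF xs]] sub(2)[OF xs] q n by simp
          show "(\<integral>\<omega>. (W n (cyc_edges ys) \<omega>)\<^sup>2 \<partial>M) \<le> (2 / real n) ^ q'"
            using expectation_W_sq_le[OF sub(1)[OF ys]] sub(2)[OF ys] q n by simp
        qed (auto intro!: integral_nonneg_AE)
        also have "\<dots> = (2 / real n) ^ (q + q')" by (simp add: power_add)
        also have "\<dots> \<le> (2 / real n) * (2 / real n) ^ card (set (xs @ ys))"
        proof (rule power_le_next_power)
          have "card (set xs \<inter> set ys) \<ge> 1" using True by (simp add: t Suc_le_eq card_gt_0_iff)
          moreover have "card (set xs) + card (set ys) = card (set xs \<union> set ys) + card (set xs \<inter> set ys)"
            by (rule card_Un_Int) auto
          moreover have "card (set xs) = q" "card (set ys) = q'" using xs ys distinct_card by (auto simp: simple_cycles_def)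
          ultimately show "Suc (card (set (xs @ ys))) \<le> q + q'" by simp
        qed (use n in auto)
        finally show ?thesis .
      qed auto
    qed (auto intro!: integral_nonneg_AE mult_nonneg_nonneg)
    finally show ?B .
  qed
qed

text \<open>A simple cycle has as many edges as vertices, so the choices of vertices and the factors
  \<open>2 / n\<close> balance.\<close>

lemma sum_W_sq_bound:
  assumes n: "n \<ge> 4 * K" "n \<ge> 2"
  shows "(\<Sum>E\<in>all_cycles n K. \<integral>\<omega>. (W n E \<omega>)\<^sup>2 \<partial>M) \<le> real K * fact (Suc K)"
proof -
  have "(\<Sum>E\<in>all_cycles n K. \<integral>\<omega>. (W n E \<omega>)\<^sup>2 \<partial>M) \<le> (\<Sum>q\<in>{1..K}. fact (Suc K))"
    unfolding sum_all_cycles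
  proof (rule sum_mono)
    fix q assume q: "q \<in> {1..K}"
    have "(\<Sum>E\<in>cycle_sets n q. \<integral>\<omega>. (W n E \<omega>)\<^sup>2 \<partial>M) \<le> (\<Sum>xs\<in>simple_cycles {..<n} q. \<integral>\<omega>. (W n (cyc_edges xs) \<omega>)\<^sup>2 \<partial>M)"
      by (intro sum_cycle_sets_le integral_nonneg_AE) auto
    also have "\<dots> \<le> (\<Sum>xs\<in>simple_cycles {..<n} q. (2 / real n) ^ card (set xs))"
    proof (rule sum_mono)
      fix xs assume xs: "xs \<in> simple_cycles {..<n} q"
      then have E: "cyc_edges xs \<in> cycle_sets n q" by (auto simp: cycle_sets_def)
      have "card (set xs) = q" using xs distinct_card by (auto simp: simple_cycles_def)
      then show "(\<integral>\<omega>. (W n (cyc_edges xs) \<omega>)\<^sup>2 \<partial>M) \<le> (2 / real n) ^ card (set xs)"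
        using expectation_W_sq_le[of "cyc_edges xs" n] cycle_setsD[OF E] q n by simp
    qed
    also have "\<dots> \<le> (\<Sum>xs\<in>closed_walks {..<n} q. (2 / real n) ^ card (set xs))"
      using simple_cycles_subset by (intro sum_mono2) auto
    also have "\<dots> \<le> fact (Suc q)"
      using sum_walks_card_bound[of "{..<n}" q] n by (auto simp: lessThan_empty_iff)
    also have "\<dots> \<le> fact (Suc K)" using q by (intro fact_mono) auto
    finally show "(\<Sum>E\<in>cycle_sets n q. \<integral>\<omega>. (W n E \<omega>)\<^sup>2 \<partial>M) \<le> fact (Suc K)" .
  qed
  then show ?thesis by simp
qed

text \<open>The bound by \<open>B * w\<^sup>2\<close> reduces the error sums of the dissociated
  approximation to second moments of the weights: \<open>S\<close> stays bounded and the other two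
  are of order \<open>1 / n\<close>.\<close>

lemma cycle_sum_char_approx:
  fixes h :: "nat \<Rightarrow> real \<Rightarrow> real"
  assumes hm: "\<And>q. h q \<in> borel_measurable borel" and h: "\<And>q w. \<bar>w\<bar> \<le> 1 \<Longrightarrow> \<bar>h q w\<bar> \<le> B * w\<^sup>2" and B: "B \<ge> 0"
    and n: "n \<ge> 4 * K" "n \<ge> 2"
  shows "norm ((\<integral>\<omega>. cis (\<Sum>E\<in>all_cycles n K. h (card E) (W n E \<omega>)) \<partial>M) -
       exp (\<Sum>E\<in>all_cycles n K. \<integral>\<omega>. cis (h (card E) (W n E \<omega>)) - 1 \<partial>M))
     \<le> exp (2 * (B * (real K * fact (Suc K)))) * (2 * B\<^sup>2 * (real K ^ 2 * fact (Suc (2 * K)) * (2 / real n)))"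
proof -
  let ?I = "all_cycles n K"
  define \<eta> where "\<eta> E \<omega> = h (card E) (W n E \<omega>)" for E \<omega>
  note [measurable] = hm
  have \<eta>m [measurable]: "\<eta> E \<in> borel_measurable M" for E unfolding \<eta>_def[abs_def] by measurable
  have \<eta>W: "\<bar>\<eta> E \<omega>\<bar> \<le> B * (W n E \<omega>)\<^sup>2" if "E \<in> ?I" for E \<omega>
    unfolding \<eta>_def using all_cyclesD(1)[OF that] W_abs_le_1 by (intro h) auto
  have \<eta>B: "\<bar>\<eta> E \<omega>\<bar> \<le> B" if "E \<in> ?I" for E \<omega>
    using order_trans[OF \<eta>W[OF that] mult_left_mono[OF W_sq_le_1[OF all_cyclesD(1)[OF that]] B]] by simp
  have Eabs: "(\<integral>\<omega>. \<bar>\<eta> E \<omega>\<bar> \<partial>M) \<le> B * (\<integral>\<omega>. (W n E \<omega>)\<^sup>2 \<partial>M)" if E: "E \<in> ?I" for E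
  proof -
    have "(\<integral>\<omega>. \<bar>\<eta> E \<omega>\<bar> \<partial>M) \<le> (\<integral>\<omega>. B * (W n E \<omega>)\<^sup>2 \<partial>M)"
      using \<eta>B[OF E] \<eta>W[OF E] all_cyclesD(1)[OF E]
      by (intro integral_mono integrable_const_bound[of _ B] integrable_mult_right integrable_W_sq) auto
    then show ?thesis by simp
  qed
  have Eabs2: "(\<integral>\<omega>. \<bar>\<eta> E \<omega>\<bar> * \<bar>\<eta> E' \<omega>\<bar> \<partial>M) \<le> B\<^sup>2 * (\<integral>\<omega>. (W n E \<omega>)\<^sup>2 * (W n E' \<omega>)\<^sup>2 \<partial>M)" if E: "E \<in> ?I" "E' \<in> ?I" for E E'
  proof -
    have "(\<integral>\<omega>. \<bar>\<eta> E \<omega>\<bar> * \<bar>\<eta> E' \<omega>\<bar> \<partial>M) \<le> (\<integral>\<omega>. B\<^sup>2 * ((W n E \<omega>)\<^sup>2 * (W n E' \<omega>)\<^sup>2) \<partial>M)"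
    proof (rule integral_mono)
      show "integrable M (\<lambda>\<omega>. \<bar>\<eta> E \<omega>\<bar> * \<bar>\<eta> E' \<omega>\<bar>)"
        using \<eta>B E B by (intro integrable_const_bound[of _ "B * B"]) (auto simp: abs_mult intro!: mult_mono)
      show "integrable M (\<lambda>\<omega>. B\<^sup>2 * ((W n E \<omega>)\<^sup>2 * (W n E' \<omega>)\<^sup>2))"
        using E all_cyclesD(1) by (intro integrable_mult_right integrable_W_sq_mult) auto
      fix \<omega>
      have "\<bar>\<eta> E \<omega>\<bar> * \<bar>\<eta> E' \<omega>\<bar> \<le> (B * (W n E \<omega>)\<^sup>2) * (B * (W n E' \<omega>)\<^sup>2)"
        using \<eta>W E B by (intro mult_mono) auto
      then show "\<bar>\<eta> E \<omega>\<bar> * \<bar>\<eta> E' \<omega>\<bar> \<le> B\<^sup>2 * ((W n E \<omega>)\<^sup>2 * (W n E' \<omega>)\<^sup>2)"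
        by (simp add: power2_eq_square mult_ac)
    qed
    then show ?thesis by simp
  qed
  have nn: "0 \<le> (\<integral>\<omega>. \<bar>\<eta> E \<omega>\<bar> \<partial>M)" "0 \<le> (\<integral>\<omega>. (W n E \<omega>)\<^sup>2 \<partial>M)" for E by (auto intro!: integral_nonneg_AE)
  have ind: "(\<integral>\<omega>. (of_real (\<eta> E \<omega>) * cis (s * \<eta> E \<omega>)) * cis (s * (\<Sum>E' | E' \<in> ?I \<and> \<not> touch E E'. \<eta> E' \<omega>)) \<partial>M) =
      (\<integral>\<omega>. of_real (\<eta> E \<omega>) * cis (s * \<eta> E \<omega>) \<partial>M) * (\<integral>\<omega>. cis (s * (\<Sum>E' | E' \<in> ?I \<and> \<not> touch E E'. \<eta> E' \<omega>)) \<partial>M)"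
    if E: "E \<in> ?I" for E s
  proof -
    define w where "w E y = (\<Prod>e\<in>E. y e)" for E and y :: "nat \<times> nat \<Rightarrow> real"
    have wr: "w E (\<lambda>e\<in>R \<times> {..<n}. x e) = w E x" if "E \<subseteq> R \<times> {..<n}" for E R x
      using that unfolding w_def by (intro prod.cong) auto
    have wm: "w E \<in> borel_measurable (\<Pi>\<^sub>M e\<in>R \<times> {..<n}. borel)" if "E \<subseteq> R \<times> {..<n}" "finite E" for E R
      using prod_PiM_measurable[OF that(2,1), of "\<lambda>_. 1"] by (simp add: w_def[abs_def])
    define R where "R = fst ` E"
    \<comment> \<open>The cycles that do not touch \<open>E\<close> live in the rows complementary
      to those of \<open>E\<close>.\<close>
    define S where "S = {..<n} - R"
    define J where "J = {E'. E' \<in> ?I \<and> \<not> touch E E'}"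
    have ER: "E \<subseteq> R \<times> {..<n}" using all_cyclesD(1)[OF E] by (force simp: R_def square_def)
    have ES: "E' \<subseteq> S \<times> {..<n}" "finite E'" if "E' \<in> J" for E'
      using that all_cyclesD(1,2)[of E'] by (force simp: J_def S_def R_def touch_def square_def)+
    define f where "f y = complex_of_real (h (card E) (w E y)) * cis (s * h (card E) (w E y))" for y
    define g where "g y = cis (s * (\<Sum>E'\<in>J. h (card E') (w E' y)))" for y
    have fY: "f (\<lambda>e. Y n e \<omega>) = of_real (\<eta> E \<omega>) * cis (s * \<eta> E \<omega>)" for \<omega>
      by (simp add: f_def \<eta>_def W_def w_def)
    have gY: "g (\<lambda>e. Y n e \<omega>) = cis (s * (\<Sum>E'\<in>J. \<eta> E' \<omega>))" for \<omega>
      by (simp add: g_def \<eta>_def W_def w_def)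
    have "(\<integral>\<omega>. f (\<lambda>e. Y n e \<omega>) * g (\<lambda>e. Y n e \<omega>) \<partial>M) = (\<integral>\<omega>. f (\<lambda>e. Y n e \<omega>) \<partial>M) * (\<integral>\<omega>. g (\<lambda>e. Y n e \<omega>) \<partial>M)"
    proof (rule expectation_rows_mult[of R S])
      show "R \<inter> S = {}" "S \<subseteq> {..<n}" by (auto simp: S_def)
      show "R \<subseteq> {..<n}" using all_cyclesD(1)[OF E] by (auto simp: R_def square_def)
      have [measurable]: "w E \<in> borel_measurable (\<Pi>\<^sub>M e\<in>R \<times> {..<n}. borel)" by (rule wm[OF ER all_cyclesD(2)[OF E]])
      show "f \<in> borel_measurable (\<Pi>\<^sub>M e\<in>R \<times> {..<n}. borel)" unfolding f_def cis_conv_exp by measurable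
      have [measurable]: "w E' \<in> borel_measurable (\<Pi>\<^sub>M e\<in>S \<times> {..<n}. borel)" if "E' \<in> J" for E' by (rule wm[OF ES[OF that]])
      show "g \<in> borel_measurable (\<Pi>\<^sub>M e\<in>S \<times> {..<n}. borel)" unfolding g_def cis_conv_exp by measurable
      show "f (\<lambda>e\<in>R \<times> {..<n}. x e) = f x" for x by (simp add: f_def wr[OF ER])
      show "g (\<lambda>e\<in>S \<times> {..<n}. x e) = g x" for x
        unfolding g_def by (intro arg_cong[where f = cis] arg_cong2[where f = "(*)"] sum.cong refl) (simp add: wr ES)
      show "integrable M (\<lambda>\<omega>. f (\<lambda>e. Y n e \<omega>))"
        unfolding fY using \<eta>B[OF E] by (intro integrable_const_bound[of _ B]) (auto simp: norm_mult, simp add: cis_conv_exp)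
      show "integrable M (\<lambda>\<omega>. g (\<lambda>e. Y n e \<omega>))"
        unfolding gY by (intro integrable_const_bound[of _ 1]) (simp_all add: cis_conv_exp)
    qed
    then show ?thesis unfolding fY gY J_def .
  qed
  let ?S = "\<Sum>E\<in>?I. \<integral>\<omega>. \<bar>\<eta> E \<omega>\<bar> \<partial>M"
  let ?T1 = "\<Sum>E\<in>?I. \<Sum>E' | E' \<in> ?I \<and> touch E E' \<and> E' \<noteq> E. \<integral>\<omega>. \<bar>\<eta> E \<omega>\<bar> * \<bar>\<eta> E' \<omega>\<bar> \<partial>M"
  let ?T2 = "\<Sum>E\<in>?I. \<Sum>E' | E' \<in> ?I \<and> touch E E'. (\<integral>\<omega>. \<bar>\<eta> E \<omega>\<bar> \<partial>M) * (\<integral>\<omega>. \<bar>\<eta> E' \<omega>\<bar> \<partial>M)"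
  let ?b = "real K ^ 2 * fact (Suc (2 * K)) * (2 / real n)"
  have "norm ((\<integral>\<omega>. cis (\<Sum>E\<in>?I. \<eta> E \<omega>) \<partial>M) - exp (\<Sum>E\<in>?I. \<integral>\<omega>. cis (\<eta> E \<omega>) - 1 \<partial>M)) \<le> exp (2 * ?S) * (?T1 + ?T2)"
  proof (rule dissociated_sum_char_approx[where b = B and touch = touch])
    show "touch E E" if "E \<in> ?I" for E using all_cyclesD(3)[OF that] by (auto simp: touch_def)
  qed (use \<eta>B ind in auto)
  also have "\<dots> \<le> exp (2 * (B * (real K * fact (Suc K)))) * (2 * B\<^sup>2 * ?b)"
  proof (rule mult_mono)
    have "?S \<le> B * (\<Sum>E\<in>?I. \<integral>\<omega>. (W n E \<omega>)\<^sup>2 \<partial>M)" unfolding sum_distrib_left by (intro sum_mono Eabs)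
    also have "\<dots> \<le> B * (real K * fact (Suc K))" by (intro mult_left_mono sum_W_sq_bound n B)
    finally show "exp (2 * ?S) \<le> exp (2 * (B * (real K * fact (Suc K))))" by simp
    have "?T1 \<le> B\<^sup>2 * (\<Sum>E\<in>?I. \<Sum>E' | E' \<in> ?I \<and> touch E E' \<and> E' \<noteq> E. \<integral>\<omega>. (W n E \<omega>)\<^sup>2 * (W n E' \<omega>)\<^sup>2 \<partial>M)"
      unfolding sum_distrib_left by (intro sum_mono Eabs2) auto
    also have "\<dots> \<le> B\<^sup>2 * ?b" by (intro mult_left_mono touching_pairs_bound(1) n) auto
    finally have T1: "?T1 \<le> B\<^sup>2 * ?b" .
    have "?T2 \<le> (\<Sum>E\<in>?I. \<Sum>E' | E' \<in> ?I \<and> touch E E'. (B * (\<integral>\<omega>. (W n E \<omega>)\<^sup>2 \<partial>M)) * (B * (\<integral>\<omega>. (W n E' \<omega>)\<^sup>2 \<partial>M)))"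
      using nn B by (intro sum_mono mult_mono Eabs) auto
    also have "\<dots> = B\<^sup>2 * (\<Sum>E\<in>?I. \<Sum>E' | E' \<in> ?I \<and> touch E E'. (\<integral>\<omega>. (W n E \<omega>)\<^sup>2 \<partial>M) * (\<integral>\<omega>. (W n E' \<omega>)\<^sup>2 \<partial>M))"
      by (simp add: sum_distrib_left power2_eq_square mult_ac)
    also have "\<dots> \<le> B\<^sup>2 * ?b" by (intro mult_left_mono touching_pairs_bound(2) n) auto
    finally show "?T1 + ?T2 \<le> 2 * B\<^sup>2 * ?b" using T1 by linarith
    show "0 \<le> ?T1 + ?T2" using nn by (intro add_nonneg_nonneg sum_nonneg mult_nonneg_nonneg integral_nonneg_AE) auto
  qed simp
  finally show ?thesis by (simp add: \<eta>_def)
qed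

end

section \<open>Products of Beta variables as limits of cycle moments\<close>

lemma continuous_on_Icc_bound:
  fixes f :: "real \<Rightarrow> 'b::real_normed_vector"
  assumes "continuous_on {a..b} f"
  shows "\<exists>B. \<forall>x\<in>{a..b}. norm (f x) \<le> B"
  using compact_imp_bounded[OF compact_continuous_image[OF assms compact_Icc]] by (auto simp: bounded_iff)

text \<open>Multiplying a Beta density by \<open>x ^ m\<close> shifts its first parameter by
  \<open>m\<close>, up to the quotient of the normalizing constants.\<close>

lemma beta_distribution_moment:
  assumes ab: "a > 0" "b > 0"
  shows "(\<integral>u. u ^ m \<partial>beta_distribution a b) = Beta (a + real m) b / Beta a b"
    and "AE u in beta_distribution a b. 0 < u \<and> u < 1"
proof -
  define d where "d c x = indicator {0<..<1} x * (x powr (c - 1) * (1 - x) powr (b - 1) / Beta c b)" for c x :: real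
  have dm [measurable]: "d c \<in> borel_measurable borel" for c unfolding d_def by measurable
  have Bpos: "Beta c b > 0" if "c > 0" for c using that ab by (simp add: Beta_def)
  have dnn: "d c x \<ge> 0" if "c > 0" for c x using Bpos[OF that] by (simp add: d_def)
  have beta: "beta_distribution c b = density lborel (\<lambda>x. ennreal (d c x))" for c
    by (simp add: beta_distribution_def d_def)
  have one: "(\<integral>x. d c x \<partial>lborel) = 1" if c: "c > 0" for c
  proof -
    interpret prob_space "beta_distribution c b" using c ab by (intro prob_space_beta_distribution)
    have "(\<integral>\<^sup>+x. ennreal (d c x) \<partial>lborel) = 1"
      using emeasure_space_1 by (simp add: beta emeasure_density)
    then show ?thesis using dnn[OF c] by (subst integral_eq_nn_integral) auto
  qed
  have "(\<integral>u. u ^ m \<partial>beta_distribution a b) = (\<integral>x. d a x *\<^sub>R x ^ m \<partial>lborel)"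
    unfolding beta using dnn[OF ab(1)] by (intro integral_density) auto
  also have "\<dots> = (\<integral>x. (Beta (a + real m) b / Beta a b) * d (a + real m) x \<partial>lborel)"
  proof (intro Bochner_Integration.integral_cong refl)
    fix x :: real
    have "x ^ m * x powr (a - 1) = x powr (a + real m - 1)" if "x > 0"
      using that by (simp add: powr_realpow[symmetric] powr_add[symmetric] algebra_simps)
    then show "d a x *\<^sub>R x ^ m = (Beta (a + real m) b / Beta a b) * d (a + real m) x"
      using Bpos[of a] Bpos[of "a + real m"] ab by (auto simp: d_def indicator_def field_simps)
  qed
  also have "\<dots> = Beta (a + real m) b / Beta a b" using ab by (simp add: one)
  finally show "(\<integral>u. u ^ m \<partial>beta_distribution a b) = Beta (a + real m) b / Beta a b" .
  show "AE u in beta_distribution a b. 0 < u \<and> u < 1"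
    unfolding beta by (subst AE_density) (auto simp: d_def indicator_def)
qed

text \<open>The limit of \<open>n\<close> times the moment of order \<open>2 * m\<close> of an
  entry. It is also the moment of order \<open>m - 1\<close> of the Beta law with parameters
  \<open>1 - \<alpha> / 2\<close> and \<open>\<alpha> / 2\<close>; hence the \<open>Suc m\<close>
  below.\<close>

definition beta_moment :: "real \<Rightarrow> nat \<Rightarrow> real" where
  "beta_moment \<alpha> m = Gamma (real m - \<alpha> / 2) / (Gamma (1 - \<alpha> / 2) * Gamma (real m))"

lemma
  assumes \<alpha>: "0 < \<alpha>" "\<alpha> < 2"
  shows prob_space_beta_product: "prob_space (beta_product_distribution \<alpha> q)"
    and beta_product_moment: "(\<integral>v. v ^ m \<partial>beta_product_distribution \<alpha> q) = beta_moment \<alpha> (Suc m) ^ q"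
    and AE_beta_product: "AE v in beta_product_distribution \<alpha> q. 0 < v \<and> v \<le> 1"
proof -
  let ?U = "beta_distribution (1 - \<alpha> / 2) (\<alpha> / 2)"
  let ?P = "\<Pi>\<^sub>M r\<in>{1..q}. ?U"
  have sU: "sets ?U = sets borel" by (simp add: beta_distribution_def)
  interpret U: prob_space ?U using \<alpha> by (intro prob_space_beta_distribution) auto
  interpret P: prob_space ?P by (intro prob_space_PiM U.prob_space_axioms)
  interpret ps: product_sigma_finite "\<lambda>_. ?U" ..
  have comp: "(\<lambda>U. U r) \<in> borel_measurable ?P" if "r \<in> {1..q}" for r
    using measurable_component_singleton[OF that, of "\<lambda>_. ?U"] measurable_cong_sets[OF refl sU] by blast
  have meas [measurable]: "(\<lambda>U. \<Prod>r\<in>{1..q}. U r) \<in> borel_measurable ?P"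
    by (intro borel_measurable_prod comp)
  show "prob_space (beta_product_distribution \<alpha> q)"
    unfolding beta_product_distribution_def by (rule P.prob_space_distr[OF meas])
  have bU: "(\<integral>u. u ^ m \<partial>?U) = beta_moment \<alpha> (Suc m)"
  proof -
    have "(\<integral>u. u ^ m \<partial>?U) = Beta (1 - \<alpha> / 2 + real m) (\<alpha> / 2) / Beta (1 - \<alpha> / 2) (\<alpha> / 2)"
      using \<alpha> by (intro beta_distribution_moment) auto
    moreover have "Gamma (\<alpha> / 2) \<noteq> 0"
      by (rule less_imp_neq[THEN not_sym], rule Gamma_real_pos) (use \<alpha> in simp)
    moreover have "1 - \<alpha> / 2 + real m = real (Suc m) - \<alpha> / 2" "1 - \<alpha> / 2 + real m + \<alpha> / 2 = real (Suc m)" by simp_all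
    ultimately show ?thesis by (simp add: Beta_def beta_moment_def)
  qed
  show "(\<integral>v. v ^ m \<partial>beta_product_distribution \<alpha> q) = beta_moment \<alpha> (Suc m) ^ q"
  proof -
    have "(\<integral>v. v ^ m \<partial>beta_product_distribution \<alpha> q) = (\<integral>U. (\<Prod>r\<in>{1..q}. U r ^ m) \<partial>?P)"
      unfolding beta_product_distribution_def
      by (subst integral_distr[OF meas]) (simp_all add: prod_power_distrib)
    also have "\<dots> = (\<Prod>r\<in>{1..q}. \<integral>u. u ^ m \<partial>?U)"
    proof (rule ps.product_integral_prod)
      have "AE u in ?U. norm (u ^ m) \<le> 1"
      proof -
        have "AE u in ?U. 0 < u \<and> u < 1" using \<alpha> by (intro beta_distribution_moment(2)) auto
        then show ?thesis by eventually_elim (auto intro: power_le_one)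
      qed
      then show "integrable ?U (\<lambda>u. u ^ m)"
        by (rule U.integrable_const_bound) (simp add: measurable_cong_sets[OF sU refl])
    qed simp
    finally show ?thesis by (simp add: bU)
  qed
  have "AE U in ?P. \<forall>r\<in>{1..q}. 0 < U r \<and> U r < 1"
  proof (rule AE_finite_allI)
    fix r assume r: "r \<in> {1..q}"
    show "AE U in ?P. 0 < U r \<and> U r < 1"
      by (rule AE_PiM_component[OF U.prob_space_axioms r beta_distribution_moment(2)]) (use \<alpha> in simp_all)
  qed simp
  then have "AE U in ?P. 0 < (\<Prod>r\<in>{1..q}. U r) \<and> (\<Prod>r\<in>{1..q}. U r) \<le> 1"
  proof eventually_elim
    case (elim U)
    then have "0 < U r" "0 \<le> U r \<and> U r \<le> 1" if "r \<in> {1..q}" for r using that by (auto intro: less_imp_le)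
    then show ?case by (intro conjI prod_pos prod_le_1) blast+
  qed
  then show "AE v in beta_product_distribution \<alpha> q. 0 < v \<and> v \<le> 1"
    unfolding beta_product_distribution_def by (subst AE_distr_iff[OF meas]) simp_all
qed

text \<open>Every edge set comes from exactly \<open>q\<close> lists, its rotations; this is the
  origin of the factor \<open>q\<close> in the limit variables.\<close>

lemma sum_simple_cycles_edges:
  fixes f :: "('v \<times> 'v) set \<Rightarrow> real"
  assumes V: "finite V" and q: "q \<ge> 1"
  shows "(\<Sum>c\<in>simple_cycles V q. f (cyc_edges c)) = real q * (\<Sum>E\<in>cyc_edges ` simple_cycles V q. f E)"
proof -
  have "(\<Sum>c\<in>simple_cycles V q. f (cyc_edges c)) =
    (\<Sum>E\<in>cyc_edges ` simple_cycles V q. \<Sum>c | c \<in> simple_cycles V q \<and> cyc_edges c = E. f (cyc_edges c))"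
    using V by (intro sum.image_gen) simp
  also have "\<dots> = (\<Sum>E\<in>cyc_edges ` simple_cycles V q. real q * f E)"
  proof (rule sum.cong[OF refl])
    fix E assume "E \<in> cyc_edges ` simple_cycles V q"
    then obtain xs where xs: "xs \<in> simple_cycles V q" "E = cyc_edges xs" by auto
    have "{c. c \<in> simple_cycles V q \<and> cyc_edges c = E} = {ys. distinct ys \<and> length ys = q \<and> cyc_edges ys = cyc_edges xs}"
    proof -
      have "set xs \<subseteq> V" using xs by (simp add: simple_cycles_def)
      then have "set ys \<subseteq> V" if "cyc_edges ys = cyc_edges xs" for ys
        using that by (metis fst_cyc_edges)
      then show ?thesis using xs by (auto simp: simple_cycles_def)
    qed
    moreover have "card {ys. distinct ys \<and> length ys = q \<and> cyc_edges ys = cyc_edges xs} = q"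
      using xs q by (intro card_cyc_fibre) (auto simp: simple_cycles_def)
    moreover have "(\<Sum>c | c \<in> simple_cycles V q \<and> cyc_edges c = E. f (cyc_edges c)) = (\<Sum>c | c \<in> simple_cycles V q \<and> cyc_edges c = E. f E)"
      by (intro sum.cong) auto
    ultimately show "(\<Sum>c | c \<in> simple_cycles V q \<and> cyc_edges c = E. f (cyc_edges c)) = real q * f E" by simp
  qed
  finally show ?thesis by (simp add: sum_distrib_left)
qed

text \<open>The count is a falling factorial, which lies between \<open>(n - q) ^ q\<close> and
  \<open>n ^ q\<close>.\<close>

lemma card_simple_cycles_limit:
  "(\<lambda>n. real (card (simple_cycles {..<n} q)) / real n ^ q) \<longlonglongrightarrow> 1"
proof (rule tendsto_sandwich)
  have card: "real (card (simple_cycles {..<n} q)) = (\<Prod>x\<in>{n - q + 1..n}. real x)" if "n \<ge> q" for n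
    using card_lists_distinct_length_eq[of "{..<n}" q] that
    by (simp add: simple_cycles_def conj_commute conj_left_commute)
  have lo: "real (n - q) ^ q \<le> real (card (simple_cycles {..<n} q))" "real (card (simple_cycles {..<n} q)) \<le> real n ^ q" if "n \<ge> q" for n
  proof -
    have "(\<Prod>x\<in>{n - q + 1..n}. real (n - q)) \<le> (\<Prod>x\<in>{n - q + 1..n}. real x)" by (intro prod_mono) auto
    moreover have "(\<Prod>x\<in>{n - q + 1..n}. real x) \<le> (\<Prod>x\<in>{n - q + 1..n}. real n)" by (intro prod_mono) auto
    ultimately show "real (n - q) ^ q \<le> real (card (simple_cycles {..<n} q))" "real (card (simple_cycles {..<n} q)) \<le> real n ^ q"
      using that by (simp_all add: card)
  qed
  show "eventually (\<lambda>n. (1 - real q / real n) ^ q \<le> real (card (simple_cycles {..<n} q)) / real n ^ q) sequentially"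
    using eventually_ge_at_top[of "Suc q"]
  proof eventually_elim
    case (elim n)
    have "1 - real q / real n = real (n - q) / real n"
      using elim by (simp add: of_nat_diff diff_divide_distrib)
    then have "(1 - real q / real n) ^ q = real (n - q) ^ q / real n ^ q"
      by (simp only: power_divide)
    also have "\<dots> \<le> real (card (simple_cycles {..<n} q)) / real n ^ q"
      using lo(1)[of n] elim by (intro divide_right_mono) auto
    finally show ?case .
  qed
  show "eventually (\<lambda>n. real (card (simple_cycles {..<n} q)) / real n ^ q \<le> 1) sequentially"
    using eventually_ge_at_top[of "Suc q"] by eventually_elim (use lo in \<open>auto simp: divide_le_eq_1\<close>)
  have "(\<lambda>n. (1 - real q / real n) ^ q) \<longlonglongrightarrow> (1 - 0) ^ q"
    by (intro tendsto_intros lim_const_over_n)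
  then show "(\<lambda>n. (1 - real q / real n) ^ q) \<longlonglongrightarrow> 1" by simp
qed simp

context symmetric_iid_array
begin

text \<open>The edges lie in different rows, so the expectation factorizes; the induction splits off
  one row at a time.\<close>

lemma expectation_cycle_even_power:
  assumes "E \<subseteq> square n" "inj_on fst E" "m \<ge> 1"
  shows "(\<integral>\<omega>. W n E \<omega> ^ (2 * m) \<partial>M) = even_moment n m ^ card E"
proof -
  have "finite E" using assms(1) by (rule finite_subset) simp
  then show ?thesis using assms(1,2)
  proof (induction E)
    case empty
    then show ?case by (simp add: W_def prob_space)
  next
    case (insert e E)
    have e: "e \<in> square n" and E: "E \<subseteq> square n" "inj_on fst E" "fst e \<notin> fst ` E"
      using insert.prems insert.hyps by auto
    define R where "R = {fst e}"
    define S where "S = {..<n} - R"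
    define f where "f y = (\<Prod>e\<in>{e}. y e ^ (2 * m))" for y :: "nat \<times> nat \<Rightarrow> real"
    define g where "g y = (\<Prod>e\<in>E. y e ^ (2 * m))" for y :: "nat \<times> nat \<Rightarrow> real"
    have eR: "{e} \<subseteq> R \<times> {..<n}" using e by (auto simp: R_def square_def mem_Times_iff)
    have ES: "E \<subseteq> S \<times> {..<n}"
    proof
      fix x assume x: "x \<in> E"
      have "x \<in> square n" using E(1) x by blast
      moreover have "fst x \<noteq> fst e" using E(3) x by (metis image_eqI)
      ultimately show "x \<in> S \<times> {..<n}" by (auto simp: S_def R_def square_def mem_Times_iff)
    qed
    have "(\<integral>\<omega>. f (\<lambda>e. Y n e \<omega>) * g (\<lambda>e. Y n e \<omega>) \<partial>M) = (\<integral>\<omega>. f (\<lambda>e. Y n e \<omega>) \<partial>M) * (\<integral>\<omega>. g (\<lambda>e. Y n e \<omega>) \<partial>M)"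
    proof (rule expectation_rows_mult[of R S])
      show "R \<inter> S = {}" "S \<subseteq> {..<n}" by (auto simp: S_def)
      show "R \<subseteq> {..<n}" using e by (auto simp: R_def square_def)
      show "f \<in> borel_measurable (\<Pi>\<^sub>M e\<in>R \<times> {..<n}. borel)"
        unfolding f_def by (rule prod_PiM_measurable[OF _ eR]) simp
      show "g \<in> borel_measurable (\<Pi>\<^sub>M e\<in>S \<times> {..<n}. borel)"
        unfolding g_def by (rule prod_PiM_measurable[OF insert.hyps(1) ES])
      show "f (\<lambda>e\<in>R \<times> {..<n}. x e) = f x" for x unfolding f_def using eR by (intro prod.cong) auto
      show "g (\<lambda>e\<in>S \<times> {..<n}. x e) = g x" for x unfolding g_def using ES by (intro prod.cong) auto
      show "integrable M (\<lambda>\<omega>. f (\<lambda>e. Y n e \<omega>))" unfolding f_def using e by (intro integrable_prod_Y) auto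
      show "integrable M (\<lambda>\<omega>. g (\<lambda>e. Y n e \<omega>))" unfolding g_def by (intro integrable_prod_Y E)
    qed
    moreover have "f (\<lambda>e. Y n e \<omega>) * g (\<lambda>e. Y n e \<omega>) = W n (insert e E) \<omega> ^ (2 * m)" "g (\<lambda>e. Y n e \<omega>) = W n E \<omega> ^ (2 * m)" for \<omega>
      using insert.hyps by (auto simp: f_def g_def W_def power_mult_distrib prod_power_distrib)
    moreover have "(\<integral>\<omega>. f (\<lambda>e. Y n e \<omega>) \<partial>M) = even_moment n m"
      using expectation_Y_power_eq[OF e assms(3)] by (simp add: f_def)
    ultimately show ?case using insert.IH[OF E(1,2)] insert.hyps by simp
  qed
qed

lemma prod_flip:
  assumes "finite E" "e0 \<in> E"
  shows "(\<Prod>e\<in>E. (if e = e0 then - y e else y e)) = - (\<Prod>e\<in>E. y e :: real)"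
proof -
  have "(\<Prod>e\<in>E. (if e = e0 then - y e else y e)) = - y e0 * (\<Prod>e\<in>E - {e0}. y e)"
    using assms by (subst prod.remove[of E e0]) (auto intro!: prod.cong)
  then show ?thesis using assms by (simp add: prod.remove[of E e0])
qed

text \<open>Flipping the sign of a single edge of the cycle flips the sign of its weight.\<close>

lemma expectation_W_neg:
  fixes g :: "real \<Rightarrow> real"
  assumes E: "E \<in> cycle_sets n q" and q: "q \<ge> 1" and [measurable]: "g \<in> borel_measurable borel"
  shows "(\<integral>\<omega>. g (W n E \<omega>) \<partial>M) = (\<integral>\<omega>. g (- W n E \<omega>) \<partial>M)"
proof -
  note P = cycle_setsD[OF E]
  have "E \<noteq> {}" using P(1) q by auto
  then obtain e0 where e0: "e0 \<in> E" by auto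
  then have n: "n \<ge> 1" using P(2) by (auto simp: square_def)
  have m: "(\<lambda>x. \<Prod>e\<in>E. x e) \<in> borel_measurable (\<Pi>\<^sub>M e\<in>square n. borel :: real measure)"
    using prod_PiM_measurable[OF P(4,2), of "\<lambda>_. 1"] by simp
  have "(\<integral>\<omega>. g (W n E \<omega>) \<partial>M) = (\<integral>\<omega>. g (\<Prod>e\<in>E. if e = e0 then - Y n e \<omega> else Y n e \<omega>) \<partial>M)"
    unfolding W_def using m P(2)
    by (intro expectation_flip[OF n, where \<Phi> = "\<lambda>x. g (\<Prod>e\<in>E. x e)"]) (auto intro!: arg_cong[where f = g] prod.cong)
  then show ?thesis by (simp add: prod_flip[OF P(4) e0] W_def)
qed

text \<open>About \<open>n ^ q / q\<close> cycles each contribute the \<open>q\<close>-th power of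
  an even moment of order \<open>1 / n\<close>. The weight \<open>(W n E \<omega>)\<^sup>2\<close>
  raises the index of that moment by one, which is the shift that turns it into the moment of order
  \<open>m\<close> of a Beta variable.\<close>

lemma cycle_moment_limit:
  assumes \<alpha>: "0 < \<alpha>" "\<alpha> < 2" and rv: "regularly_varying_tail M (X 1 1) \<alpha>" and q: "q \<ge> 1"
  shows "(\<lambda>n. \<Sum>E\<in>cycle_sets n q. \<integral>\<omega>. (W n E \<omega>)\<^sup>2 * ((W n E \<omega>)\<^sup>2) ^ m \<partial>M) \<longlonglongrightarrow>
     (\<integral>v. v ^ m \<partial>beta_product_distribution \<alpha> q) / real q"
proof -
  have "(\<Sum>E\<in>cycle_sets n q. \<integral>\<omega>. (W n E \<omega>)\<^sup>2 * ((W n E \<omega>)\<^sup>2) ^ m \<partial>M) =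
      (real (card (simple_cycles {..<n} q)) / real n ^ q) * (real n * even_moment n (Suc m)) ^ q / real q" if n: "n \<ge> 1" for n
  proof -
    have "(\<Sum>E\<in>cycle_sets n q. \<integral>\<omega>. (W n E \<omega>)\<^sup>2 * ((W n E \<omega>)\<^sup>2) ^ m \<partial>M) = (\<Sum>E\<in>cycle_sets n q. even_moment n (Suc m) ^ q)"
    proof (rule sum.cong[OF refl])
      fix E assume E: "E \<in> cycle_sets n q"
      have "(W n E \<omega>)\<^sup>2 * ((W n E \<omega>)\<^sup>2) ^ m = W n E \<omega> ^ (2 * Suc m)" for \<omega>
        by (simp add: power_mult power2_eq_square)
      then show "(\<integral>\<omega>. (W n E \<omega>)\<^sup>2 * ((W n E \<omega>)\<^sup>2) ^ m \<partial>M) = even_moment n (Suc m) ^ q"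
        using expectation_cycle_even_power[OF cycle_setsD(2,3)[OF E], of "Suc m"] cycle_setsD(1)[OF E] by simp
    qed
    also have "\<dots> = real (card (cycle_sets n q)) * even_moment n (Suc m) ^ q" by simp
    also have "real (card (cycle_sets n q)) = real (card (simple_cycles {..<n} q)) / real q"
      using sum_simple_cycles_edges[of "{..<n}" q "\<lambda>_. 1"] q by (simp add: cycle_sets_def)
    finally show ?thesis using n by (simp add: power_mult_distrib)
  qed
  moreover have "(\<lambda>n. (real (card (simple_cycles {..<n} q)) / real n ^ q) * (real n * even_moment n (Suc m)) ^ q / real q)
     \<longlonglongrightarrow> 1 * beta_moment \<alpha> (Suc m) ^ q / real q"
    unfolding beta_moment_def using q
    by (intro tendsto_intros card_simple_cycles_limit even_moment_limit[OF \<alpha> rv]) auto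
  ultimately show ?thesis
    using Lim_transform_eventually[OF _ eventually_mono[OF eventually_ge_at_top[of 1]]]
    unfolding beta_product_moment[OF \<alpha>] by fastforce
qed

text \<open>The laws of the squared weights, weighted by their own value and summed over the cycles,
  have converging moments and bounded total mass, so polynomial approximation extends the limit to
  continuous functions.\<close>

lemma cycle_continuous_limit:
  fixes H :: "real \<Rightarrow> real"
  assumes \<alpha>: "0 < \<alpha>" "\<alpha> < 2" and rv: "regularly_varying_tail M (X 1 1) \<alpha>" and q: "q \<ge> 1"
    and H: "continuous_on {0..1} H" and Hm [measurable]: "H \<in> borel_measurable borel"
  shows "(\<lambda>n. \<Sum>E\<in>cycle_sets n q. \<integral>\<omega>. (W n E \<omega>)\<^sup>2 * H ((W n E \<omega>)\<^sup>2) \<partial>M) \<longlonglongrightarrow>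
     (\<integral>v. H v \<partial>beta_product_distribution \<alpha> q) / real q"
proof -
  let ?\<mu> = "beta_product_distribution \<alpha> q"
  interpret mu: prob_space ?\<mu> by (rule prob_space_beta_product[OF \<alpha>])
  note ae = AE_beta_product[OF \<alpha>, of q]
  define \<Lambda> where "\<Lambda> n G = (\<Sum>E\<in>cycle_sets n q. \<integral>\<omega>. (W n E \<omega>)\<^sup>2 * G ((W n E \<omega>)\<^sup>2) \<partial>M)" for n and G :: "real \<Rightarrow> real"
  have int: "integrable M (\<lambda>\<omega>. (W n E \<omega>)\<^sup>2 * G ((W n E \<omega>)\<^sup>2))"
    if G: "continuous_on {0..1} G" and [measurable]: "G \<in> borel_measurable borel" and E: "E \<in> cycle_sets n q" for G n E
  proof -
    obtain B where B: "\<And>v. v \<in> {0..1} \<Longrightarrow> \<bar>G v\<bar> \<le> B"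
      using continuous_on_Icc_bound[OF G] unfolding real_norm_def by blast
    show ?thesis
    proof (rule integrable_bounded_W[OF cycle_setsD(2)[OF E], where f = "\<lambda>w. w\<^sup>2 * G (w\<^sup>2)" and B = "1 * B"])
      show "norm (w\<^sup>2 * G (w\<^sup>2)) \<le> 1 * B" if "\<bar>w\<bar> \<le> 1" for w
        unfolding norm_mult using that B[of "w\<^sup>2"] by (intro mult_mono) (auto simp: abs_square_le_1)
    qed measurable
  qed
  have intmu: "integrable ?\<mu> G" if G: "continuous_on {0..1} G" and [measurable]: "G \<in> borel_measurable borel" for G :: "real \<Rightarrow> real"
  proof -
    obtain B where B: "\<And>v. v \<in> {0..1} \<Longrightarrow> \<bar>G v\<bar> \<le> B"
      using continuous_on_Icc_bound[OF G] unfolding real_norm_def by blast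
    show ?thesis
    proof (rule mu.integrable_const_bound[of _ B])
      show "AE v in ?\<mu>. norm (G v) \<le> B" using ae by eventually_elim (use B in auto)
    qed measurable
  qed
  have poly: "(\<lambda>n. \<Lambda> n (\<lambda>v. \<Sum>i\<le>d. a i * v ^ i)) \<longlonglongrightarrow> (\<integral>v. (\<Sum>i\<le>d. a i * v ^ i) \<partial>?\<mu>) / real q" for a :: "nat \<Rightarrow> real" and d
  proof -
    have i1: "integrable ?\<mu> (\<lambda>v. a i * v ^ i)" for i by (intro intmu continuous_intros) measurable
    have "(\<integral>v. (\<Sum>i\<le>d. a i * v ^ i) \<partial>?\<mu>) / real q = (\<Sum>i\<le>d. a i * ((\<integral>v. v ^ i \<partial>?\<mu>) / real q))"
      using i1 by (simp add: Bochner_Integration.integral_sum sum_divide_distrib)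
    moreover have "\<Lambda> n (\<lambda>v. \<Sum>i\<le>d. a i * v ^ i) = (\<Sum>i\<le>d. a i * \<Lambda> n (\<lambda>v. v ^ i))" for n
    proof -
      have i2: "integrable M (\<lambda>\<omega>. (W n E \<omega>)\<^sup>2 * ((W n E \<omega>)\<^sup>2) ^ i)" if "E \<in> cycle_sets n q" for E i
        by (rule int[OF _ _ that]) (auto intro!: continuous_intros)
      have "\<Lambda> n (\<lambda>v. \<Sum>i\<le>d. a i * v ^ i) = (\<Sum>E\<in>cycle_sets n q. \<Sum>i\<le>d. a i * (\<integral>\<omega>. (W n E \<omega>)\<^sup>2 * ((W n E \<omega>)\<^sup>2) ^ i \<partial>M))"
        unfolding \<Lambda>_def
      proof (rule sum.cong[OF refl])
        fix E assume E: "E \<in> cycle_sets n q"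
        have "(\<integral>\<omega>. (W n E \<omega>)\<^sup>2 * (\<Sum>i\<le>d. a i * ((W n E \<omega>)\<^sup>2) ^ i) \<partial>M) = (\<integral>\<omega>. (\<Sum>i\<le>d. a i * ((W n E \<omega>)\<^sup>2 * ((W n E \<omega>)\<^sup>2) ^ i)) \<partial>M)"
          by (simp add: sum_distrib_left mult_ac)
        also have "\<dots> = (\<Sum>i\<le>d. a i * (\<integral>\<omega>. (W n E \<omega>)\<^sup>2 * ((W n E \<omega>)\<^sup>2) ^ i \<partial>M))"
          using i2[OF E] by (subst Bochner_Integration.integral_sum) auto
        finally show "(\<integral>\<omega>. (W n E \<omega>)\<^sup>2 * (\<Sum>i\<le>d. a i * ((W n E \<omega>)\<^sup>2) ^ i) \<partial>M) = (\<Sum>i\<le>d. a i * (\<integral>\<omega>. (W n E \<omega>)\<^sup>2 * ((W n E \<omega>)\<^sup>2) ^ i \<partial>M))" .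
      qed
      also have "\<dots> = (\<Sum>i\<le>d. \<Sum>E\<in>cycle_sets n q. a i * (\<integral>\<omega>. (W n E \<omega>)\<^sup>2 * ((W n E \<omega>)\<^sup>2) ^ i \<partial>M))" by (rule sum.swap)
      finally show ?thesis by (simp add: \<Lambda>_def sum_distrib_left)
    qed
    moreover have "(\<lambda>n. \<Sum>i\<le>d. a i * \<Lambda> n (\<lambda>v. v ^ i)) \<longlonglongrightarrow> (\<Sum>i\<le>d. a i * ((\<integral>v. v ^ i \<partial>?\<mu>) / real q))"
      unfolding \<Lambda>_def by (intro tendsto_sum tendsto_mult_left cycle_moment_limit[OF \<alpha> rv q])
    ultimately show ?thesis by (simp only:)
  qed
  have one: "(\<lambda>n. \<Lambda> n (\<lambda>v. 1)) \<longlonglongrightarrow> 1 / real q"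
    using poly[of "\<lambda>_. 1" 0] by (simp add: mu.prob_space)
  show ?thesis
    unfolding \<Lambda>_def[symmetric]
  proof (rule LIMSEQ_I)
    fix r :: real assume r: "r > 0"
    \<comment> \<open>Of the four parts, two replace \<open>H\<close> by the polynomial before the
      limit, where the total mass is below 2; one replaces it in the limit, and one is for the
      convergence itself.\<close>
    define e where "e = r / 4"
    have e: "e > 0" using r by (simp add: e_def)
    obtain p where p: "real_polynomial_function p" "\<And>v. v \<in> {0..1} \<Longrightarrow> \<bar>H v - p v\<bar> < e"
      using Stone_Weierstrass_real_polynomial_function[OF compact_Icc H e] by blast
    obtain a d where pd: "p = (\<lambda>v. \<Sum>i\<le>d. a i * v ^ i)" using p(1) by (auto simp: real_polynomial_function_iff_sum)
    have pc: "continuous_on {0..1} p" and pm [measurable]: "p \<in> borel_measurable borel"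
      unfolding pd by (auto intro!: continuous_intros)
    have d1: "\<bar>\<Lambda> n H - \<Lambda> n p\<bar> \<le> e * \<Lambda> n (\<lambda>v. 1)" for n
    proof -
      have "\<bar>\<Lambda> n H - \<Lambda> n p\<bar> \<le> (\<Sum>E\<in>cycle_sets n q. \<bar>(\<integral>\<omega>. (W n E \<omega>)\<^sup>2 * H ((W n E \<omega>)\<^sup>2) \<partial>M) - (\<integral>\<omega>. (W n E \<omega>)\<^sup>2 * p ((W n E \<omega>)\<^sup>2) \<partial>M)\<bar>)"
        unfolding \<Lambda>_def sum_subtractf[symmetric] by (rule sum_abs)
      also have "\<dots> \<le> (\<Sum>E\<in>cycle_sets n q. e * (\<integral>\<omega>. (W n E \<omega>)\<^sup>2 * 1 \<partial>M))"
      proof (rule sum_mono)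
        fix E assume E: "E \<in> cycle_sets n q"
        have "\<bar>(\<integral>\<omega>. (W n E \<omega>)\<^sup>2 * H ((W n E \<omega>)\<^sup>2) \<partial>M) - (\<integral>\<omega>. (W n E \<omega>)\<^sup>2 * p ((W n E \<omega>)\<^sup>2) \<partial>M)\<bar>
          \<le> (\<integral>\<omega>. \<bar>(W n E \<omega>)\<^sup>2 * H ((W n E \<omega>)\<^sup>2) - (W n E \<omega>)\<^sup>2 * p ((W n E \<omega>)\<^sup>2)\<bar> \<partial>M)"
          by (rule abs_integral_diff_le[OF int[OF H Hm E] int[OF pc pm E]])
        also have "\<dots> \<le> (\<integral>\<omega>. e * ((W n E \<omega>)\<^sup>2 * 1) \<partial>M)"
        proof (rule integral_mono)
          show "integrable M (\<lambda>\<omega>. \<bar>(W n E \<omega>)\<^sup>2 * H ((W n E \<omega>)\<^sup>2) - (W n E \<omega>)\<^sup>2 * p ((W n E \<omega>)\<^sup>2)\<bar>)"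
            by (intro integrable_abs Bochner_Integration.integrable_diff int[OF H Hm E] int[OF pc pm E])
          show "integrable M (\<lambda>\<omega>. e * ((W n E \<omega>)\<^sup>2 * 1))"
            using integrable_W_sq[OF cycle_setsD(2)[OF E]] by simp
          fix \<omega>
          have "(W n E \<omega>)\<^sup>2 \<in> {0..1}" using W_sq_le_1[OF cycle_setsD(2)[OF E]] by simp
          then have "(W n E \<omega>)\<^sup>2 * \<bar>H ((W n E \<omega>)\<^sup>2) - p ((W n E \<omega>)\<^sup>2)\<bar> \<le> (W n E \<omega>)\<^sup>2 * e"
            using p(2) by (intro mult_left_mono) (auto intro: less_imp_le)
          then show "\<bar>(W n E \<omega>)\<^sup>2 * H ((W n E \<omega>)\<^sup>2) - (W n E \<omega>)\<^sup>2 * p ((W n E \<omega>)\<^sup>2)\<bar> \<le> e * ((W n E \<omega>)\<^sup>2 * 1)"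
            by (simp add: right_diff_distrib[symmetric] abs_mult mult.commute)
        qed
        finally show "\<bar>(\<integral>\<omega>. (W n E \<omega>)\<^sup>2 * H ((W n E \<omega>)\<^sup>2) \<partial>M) - (\<integral>\<omega>. (W n E \<omega>)\<^sup>2 * p ((W n E \<omega>)\<^sup>2) \<partial>M)\<bar>
          \<le> e * (\<integral>\<omega>. (W n E \<omega>)\<^sup>2 * 1 \<partial>M)" by simp
      qed
      finally show ?thesis by (simp add: \<Lambda>_def sum_distrib_left)
    qed
    have d2: "\<bar>(\<integral>v. H v \<partial>?\<mu>) - (\<integral>v. p v \<partial>?\<mu>)\<bar> \<le> e"
    proof -
      have "\<bar>(\<integral>v. H v \<partial>?\<mu>) - (\<integral>v. p v \<partial>?\<mu>)\<bar> \<le> (\<integral>v. \<bar>H v - p v\<bar> \<partial>?\<mu>)"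
        by (rule abs_integral_diff_le[OF intmu[OF H Hm] intmu[OF pc pm]])
      also have "\<dots> \<le> (\<integral>v. e \<partial>?\<mu>)"
      proof (rule integral_mono_AE)
        show "AE v in ?\<mu>. \<bar>H v - p v\<bar> \<le> e" using ae by eventually_elim (use p(2) in \<open>auto intro!: less_imp_le\<close>)
      qed (use intmu[OF H Hm] intmu[OF pc pm] in auto)
      finally show ?thesis by (simp add: mu.prob_space)
    qed
    have q1: "1 / real q \<le> 1" using q by simp
    have "eventually (\<lambda>n. \<Lambda> n (\<lambda>v. 1) < 2) sequentially"
      using order_tendstoD(2)[OF one] q1 by (metis le_less_trans one_less_numeral_iff semiring_norm(76))
    moreover have "eventually (\<lambda>n. dist (\<Lambda> n p) ((\<integral>v. p v \<partial>?\<mu>) / real q) < e) sequentially"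
      using tendstoD[OF poly[of a d] e] by (simp add: pd)
    ultimately have "eventually (\<lambda>n. norm (\<Lambda> n H - (\<integral>v. H v \<partial>?\<mu>) / real q) < r) sequentially"
    proof eventually_elim
      case (elim n)
      have "e * \<Lambda> n (\<lambda>v. 1) \<le> e * 2" using elim e by (intro mult_left_mono) auto
      then have a1: "\<bar>\<Lambda> n H - \<Lambda> n p\<bar> \<le> 2 * e" using d1[of n] by linarith
      have "\<bar>(\<integral>v. H v \<partial>?\<mu>) / real q - (\<integral>v. p v \<partial>?\<mu>) / real q\<bar> = \<bar>(\<integral>v. H v \<partial>?\<mu>) - (\<integral>v. p v \<partial>?\<mu>)\<bar> * (1 / real q)"
        by (simp add: diff_divide_distrib[symmetric])
      also have "\<dots> \<le> e * 1" using d2 q1 by (intro mult_mono) auto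
      finally have a2: "\<bar>(\<integral>v. H v \<partial>?\<mu>) / real q - (\<integral>v. p v \<partial>?\<mu>) / real q\<bar> \<le> e" by simp
      have a3: "\<bar>\<Lambda> n p - (\<integral>v. p v \<partial>?\<mu>) / real q\<bar> < e" using elim(2) unfolding dist_real_def .
      have "\<bar>\<Lambda> n H - (\<integral>v. H v \<partial>?\<mu>) / real q\<bar> < 2 * e + e + e"
        using a1 a2 a3 unfolding abs_le_iff abs_less_iff by linarith
      then show ?case by (simp add: e_def)
    qed
    then show "\<exists>no. \<forall>n\<ge>no. norm (\<Lambda> n H - (\<integral>v. H v \<partial>?\<mu>) / real q) < r" by (auto simp: eventually_sequentially)
  qed
qed

end

section \<open>Signed cycle weights, and second moments of the error terms\<close>

lemma sum_closed_walks_pairs_le: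
  assumes n: "n \<ge> 1"
  shows "(\<Sum>xs\<in>closed_walks {..<n} k. \<Sum>ys\<in>closed_walks {..<n} k. (2 / real n) ^ card (set (xs @ ys))) \<le> fact (Suc (2 * k))"
proof -
  let ?A = "closed_walks {..<n} k \<times> closed_walks {..<n} k"
  have inj: "inj_on (\<lambda>(xs, ys). xs @ ys) ?A"
    by (auto simp: inj_on_def closed_walks_def)
  have "(\<Sum>xs\<in>closed_walks {..<n} k. \<Sum>ys\<in>closed_walks {..<n} k. (2 / real n) ^ card (set (xs @ ys))) =
    (\<Sum>p\<in>?A. (2 / real n) ^ card (set (case p of (xs, ys) \<Rightarrow> xs @ ys)))"
    by (simp add: sum.cartesian_product case_prod_unfold)
  also have "\<dots> = (\<Sum>zs\<in>(\<lambda>(xs, ys). xs @ ys) ` ?A. (2 / real n) ^ card (set zs))"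
    by (subst sum.reindex[OF inj]) (simp add: o_def)
  also have "\<dots> \<le> (\<Sum>zs\<in>closed_walks {..<n} (2 * k). (2 / real n) ^ card (set zs))"
    by (intro sum_mono2 finite_closed_walks) (auto simp: closed_walks_def)
  also have "\<dots> \<le> fact (Suc (2 * k))"
    using sum_walks_card_bound[of "{..<n}" "2 * k"] n by (auto simp: lessThan_empty_iff)
  finally show ?thesis .
qed

definition edge_mult :: "'v list \<Rightarrow> 'v \<times> 'v \<Rightarrow> nat" where
  "edge_mult zs e = card {i \<in> {..<length zs}. (zs ! i, zs ! (Suc i mod length zs)) = e}"

lemma cyc_weight_edge_mult:
  assumes "finite U" "cyc_edges zs \<subseteq> U"
  shows "cyc_weight y zs = (\<Prod>e\<in>U. y e ^ edge_mult zs e)"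
proof -
  let ?g = "\<lambda>i. (zs ! i, zs ! (Suc i mod length zs))"
  have "cyc_weight y zs = (\<Prod>e\<in>U. \<Prod>i\<in>{i \<in> {..<length zs}. ?g i = e}. y (?g i))"
    unfolding cyc_weight_def using assms by (intro prod.group[symmetric]) (auto simp: cyc_edges_def)
  also have "\<dots> = (\<Prod>e\<in>U. \<Prod>i\<in>{i \<in> {..<length zs}. ?g i = e}. y e)"
    by (intro prod.cong refl) auto
  finally show ?thesis by (simp add: edge_mult_def)
qed

lemma edge_mult_pos: "e \<in> cyc_edges zs \<Longrightarrow> edge_mult zs e \<ge> 1"
  by (auto simp: cyc_edges_def edge_mult_def Suc_le_eq card_gt_0_iff)

text \<open>What is left of the linear term \<open>w\<close> after subtraction of
  \<open>w\<^sup>2\<close> times a polynomial, namely \<open>w\<close> times a partial geometric sum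
  in \<open>1 - w\<^sup>2\<close>.\<close>

definition trunc :: "nat \<Rightarrow> real \<Rightarrow> real" where
  "trunc N w = w * (1 - w\<^sup>2) ^ N"

lemma trunc_measurable [measurable]: "trunc N \<in> borel_measurable borel"
  unfolding trunc_def[abs_def] by measurable

lemma trunc_minus: "trunc N (- w) = - trunc N w"
  by (simp add: trunc_def)

lemma trunc_abs_le_1: "\<bar>w\<bar> \<le> 1 \<Longrightarrow> \<bar>trunc N w\<bar> \<le> 1"
  using abs_square_le_1[of w]
  by (auto simp: trunc_def abs_mult power_abs intro!: mult_le_one power_le_one)

context symmetric_iid_array
begin

lemma integrable_continuous_W:
  fixes f :: "real \<Rightarrow> 'c::euclidean_space"
  assumes f: "continuous_on UNIV f" and E: "E \<subseteq> square n"
  shows "integrable M (\<lambda>\<omega>. f (W n E \<omega>))"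
proof -
  obtain B where B: "\<And>w. w \<in> {-1..1} \<Longrightarrow> norm (f w) \<le> B"
    using continuous_on_Icc_bound[OF continuous_on_subset[OF f subset_UNIV]] by blast
  show ?thesis
    by (rule integrable_bounded_W[OF E borel_measurable_continuous_onI[OF f], of B]) (use B in \<open>auto simp: abs_le_iff\<close>)
qed

text \<open>By symmetry of the weight only the even part of \<open>p\<close> contributes, and on
  \<open>[-1, 1]\<close> this is a continuous function of the squared weight.\<close>

lemma cycle_real_limit:
  fixes p :: "real \<Rightarrow> real"
  assumes \<alpha>: "0 < \<alpha>" "\<alpha> < 2" and rv: "regularly_varying_tail M (X 1 1) \<alpha>" and q: "q \<ge> 1"
    and p: "continuous_on UNIV p"
  shows "(\<lambda>n. \<Sum>E\<in>cycle_sets n q. \<integral>\<omega>. (W n E \<omega>)\<^sup>2 * p (W n E \<omega>) \<partial>M) \<longlonglongrightarrow>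
     (\<integral>v. (p (sqrt v) + p (- sqrt v)) / 2 \<partial>beta_product_distribution \<alpha> q) / real q"
proof -
  have [measurable]: "p \<in> borel_measurable borel" using p by (rule borel_measurable_continuous_onI)
  define H where "H v = (p (sqrt v) + p (- sqrt v)) / 2" for v
  have Hc: "continuous_on {0..1} H"
    unfolding H_def by (intro continuous_intros continuous_on_compose2[OF p]) auto
  have Hm: "H \<in> borel_measurable borel" unfolding H_def by measurable
  have half: "a = b \<Longrightarrow> a = (a + b) / 2" for a b :: real by simp
  have "(\<integral>\<omega>. (W n E \<omega>)\<^sup>2 * p (W n E \<omega>) \<partial>M) = (\<integral>\<omega>. (W n E \<omega>)\<^sup>2 * H ((W n E \<omega>)\<^sup>2) \<partial>M)" if E: "E \<in> cycle_sets n q" for n E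
  proof -
    have i1: "integrable M (\<lambda>\<omega>. (W n E \<omega>)\<^sup>2 * p (W n E \<omega>))"
      by (rule integrable_continuous_W[OF _ cycle_setsD(2)[OF E], where f = "\<lambda>w. w\<^sup>2 * p w"]) (intro continuous_intros p)
    have i2: "integrable M (\<lambda>\<omega>. (W n E \<omega>)\<^sup>2 * p (- W n E \<omega>))"
      by (rule integrable_continuous_W[OF _ cycle_setsD(2)[OF E], where f = "\<lambda>w. w\<^sup>2 * p (- w)"])
         (intro continuous_intros continuous_on_compose2[OF p]; simp)
    have "(\<integral>\<omega>. (W n E \<omega>)\<^sup>2 * p (W n E \<omega>) \<partial>M) = (\<integral>\<omega>. (W n E \<omega>)\<^sup>2 * p (- W n E \<omega>) \<partial>M)"
      using expectation_W_neg[OF E q, of "\<lambda>w. w\<^sup>2 * p w"] by simp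
    then have "(\<integral>\<omega>. (W n E \<omega>)\<^sup>2 * p (W n E \<omega>) \<partial>M) = ((\<integral>\<omega>. (W n E \<omega>)\<^sup>2 * p (W n E \<omega>) \<partial>M) + (\<integral>\<omega>. (W n E \<omega>)\<^sup>2 * p (- W n E \<omega>) \<partial>M)) / 2"
      by (rule half)
    also have "\<dots> = (\<integral>\<omega>. ((W n E \<omega>)\<^sup>2 * p (W n E \<omega>) + (W n E \<omega>)\<^sup>2 * p (- W n E \<omega>)) / 2 \<partial>M)"
      using i1 i2 by simp
    also have "\<dots> = (\<integral>\<omega>. (W n E \<omega>)\<^sup>2 * H ((W n E \<omega>)\<^sup>2) \<partial>M)"
    proof (intro Bochner_Integration.integral_cong refl)
      fix \<omega>
      show "((W n E \<omega>)\<^sup>2 * p (W n E \<omega>) + (W n E \<omega>)\<^sup>2 * p (- W n E \<omega>)) / 2 = (W n E \<omega>)\<^sup>2 * H ((W n E \<omega>)\<^sup>2)"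
        by (cases "W n E \<omega> \<ge> 0") (simp_all add: H_def algebra_simps)
    qed
    finally show ?thesis .
  qed
  then have eq: "(\<Sum>E\<in>cycle_sets n q. \<integral>\<omega>. (W n E \<omega>)\<^sup>2 * p (W n E \<omega>) \<partial>M) =
      (\<Sum>E\<in>cycle_sets n q. \<integral>\<omega>. (W n E \<omega>)\<^sup>2 * H ((W n E \<omega>)\<^sup>2) \<partial>M)" for n
    by (rule sum.cong[OF refl])
  show ?thesis
    unfolding eq using cycle_continuous_limit[OF \<alpha> rv q Hc Hm] unfolding H_def .
qed

lemma cycle_complex_limit:
  fixes p :: "real \<Rightarrow> complex"
  assumes \<alpha>: "0 < \<alpha>" "\<alpha> < 2" and rv: "regularly_varying_tail M (X 1 1) \<alpha>" and q: "q \<ge> 1"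
    and p: "continuous_on UNIV p"
  shows "(\<lambda>n. \<Sum>E\<in>cycle_sets n q. \<integral>\<omega>. of_real ((W n E \<omega>)\<^sup>2) * p (W n E \<omega>) \<partial>M) \<longlonglongrightarrow>
     (\<integral>v. (p (sqrt v) + p (- sqrt v)) / 2 \<partial>beta_product_distribution \<alpha> q) / of_nat q"
proof -
  interpret mu: prob_space "beta_product_distribution \<alpha> q" by (rule prob_space_beta_product[OF \<alpha>])
  have i1: "integrable M (\<lambda>\<omega>. of_real ((W n E \<omega>)\<^sup>2) * p (W n E \<omega>))" if E: "E \<in> cycle_sets n q" for n E
    by (rule integrable_continuous_W[OF _ cycle_setsD(2)[OF E], where f = "\<lambda>w. of_real (w\<^sup>2) * p w"]) (intro continuous_intros p)
  have i2: "integrable (beta_product_distribution \<alpha> q) (\<lambda>v. (p (sqrt v) + p (- sqrt v)) / 2)"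
  proof -
    have c: "continuous_on UNIV (\<lambda>v. (p (sqrt v) + p (- sqrt v)) / 2)"
      by (intro continuous_intros continuous_on_compose2[OF p]) auto
    obtain B where B: "\<And>v. v \<in> {0..1} \<Longrightarrow> norm ((p (sqrt v) + p (- sqrt v)) / 2) \<le> B"
      using continuous_on_Icc_bound[OF continuous_on_subset[OF c subset_UNIV]] by blast
    have [measurable]: "(\<lambda>v. (p (sqrt v) + p (- sqrt v)) / 2) \<in> borel_measurable borel"
      using c by (rule borel_measurable_continuous_onI)
    show ?thesis
    proof (rule mu.integrable_const_bound[of _ B])
      show "AE v in beta_product_distribution \<alpha> q. norm ((p (sqrt v) + p (- sqrt v)) / 2) \<le> B"
        using AE_beta_product[OF \<alpha>, of q] by eventually_elim (rule B, simp)
    qed measurable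
  qed
  have re: "(\<lambda>n. \<Sum>E\<in>cycle_sets n q. \<integral>\<omega>. (W n E \<omega>)\<^sup>2 * Re (p (W n E \<omega>)) \<partial>M) \<longlonglongrightarrow>
     (\<integral>v. (Re (p (sqrt v)) + Re (p (- sqrt v))) / 2 \<partial>beta_product_distribution \<alpha> q) / real q"
    and im: "(\<lambda>n. \<Sum>E\<in>cycle_sets n q. \<integral>\<omega>. (W n E \<omega>)\<^sup>2 * Im (p (W n E \<omega>)) \<partial>M) \<longlonglongrightarrow>
     (\<integral>v. (Im (p (sqrt v)) + Im (p (- sqrt v))) / 2 \<partial>beta_product_distribution \<alpha> q) / real q"
    by (intro cycle_real_limit \<alpha> rv q continuous_intros p)+
  have sr: "Re (\<Sum>E\<in>cycle_sets n q. \<integral>\<omega>. of_real ((W n E \<omega>)\<^sup>2) * p (W n E \<omega>) \<partial>M) = (\<Sum>E\<in>cycle_sets n q. \<integral>\<omega>. (W n E \<omega>)\<^sup>2 * Re (p (W n E \<omega>)) \<partial>M)" for n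
    unfolding Re_sum by (intro sum.cong refl, subst integral_Re[OF i1, symmetric]) (simp_all del: of_real_power)
  have si: "Im (\<Sum>E\<in>cycle_sets n q. \<integral>\<omega>. of_real ((W n E \<omega>)\<^sup>2) * p (W n E \<omega>) \<partial>M) = (\<Sum>E\<in>cycle_sets n q. \<integral>\<omega>. (W n E \<omega>)\<^sup>2 * Im (p (W n E \<omega>)) \<partial>M)" for n
    unfolding Im_sum by (intro sum.cong refl, subst integral_Im[OF i1, symmetric]) (simp_all del: of_real_power)
  have Rel: "Re ((\<integral>v. (p (sqrt v) + p (- sqrt v)) / 2 \<partial>beta_product_distribution \<alpha> q) / of_nat q) =
      (\<integral>v. (Re (p (sqrt v)) + Re (p (- sqrt v))) / 2 \<partial>beta_product_distribution \<alpha> q) / real q"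
    unfolding Re_divide_of_nat integral_Re[OF i2, symmetric] by simp
  have Iml: "Im ((\<integral>v. (p (sqrt v) + p (- sqrt v)) / 2 \<partial>beta_product_distribution \<alpha> q) / of_nat q) =
      (\<integral>v. (Im (p (sqrt v)) + Im (p (- sqrt v))) / 2 \<partial>beta_product_distribution \<alpha> q) / real q"
    unfolding Im_divide_of_nat integral_Im[OF i2, symmetric] by simp
  show ?thesis unfolding tendsto_complex_iff sr si Rel Iml using re im by blast
qed

text \<open>Of two different cycles of the same length, \<open>E\<close> has an edge
  \<open>e0\<close> outside \<open>E'\<close>, since equal cardinality excludes inclusion. Flipping
  its sign reverses the odd function \<open>trunc N\<close> of one weight only, so the off-diagonal
  terms vanish.\<close>

lemma truncation_L2:
  assumes q: "q \<ge> 1"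
  shows "(\<integral>\<omega>. (\<Sum>E\<in>cycle_sets n q. trunc N (W n E \<omega>))\<^sup>2 \<partial>M) = (\<Sum>E\<in>cycle_sets n q. \<integral>\<omega>. (W n E \<omega>)\<^sup>2 * ((1 - (W n E \<omega>)\<^sup>2) ^ N)\<^sup>2 \<partial>M)"
proof -
  have int: "integrable M (\<lambda>\<omega>. trunc N (W n E \<omega>) * trunc N (W n E' \<omega>))" if "E \<in> cycle_sets n q" "E' \<in> cycle_sets n q" for E E'
    using trunc_abs_le_1[OF W_abs_le_1[OF cycle_setsD(2)[OF that(1)]]] trunc_abs_le_1[OF W_abs_le_1[OF cycle_setsD(2)[OF that(2)]]]
    by (intro integrable_const_bound[of _ 1]) (auto simp: abs_mult intro!: mult_le_one)
  have off: "(\<integral>\<omega>. trunc N (W n E \<omega>) * trunc N (W n E' \<omega>) \<partial>M) = 0" if E: "E \<in> cycle_sets n q" "E' \<in> cycle_sets n q" "E' \<noteq> E" for E E'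
  proof -
    note P = cycle_setsD[OF E(1)] and P' = cycle_setsD[OF E(2)]
    have "\<not> E \<subseteq> E'" using card_subset_eq[OF P'(4), of E] P(1) P'(1) E(3) by auto
    then obtain e0 where e0: "e0 \<in> E" "e0 \<notin> E'" by auto
    then have n: "n \<ge> 1" using P(2) by (auto simp: square_def)
    have m: "(\<lambda>x. \<Prod>e\<in>F. x e) \<in> borel_measurable (\<Pi>\<^sub>M e\<in>square n. borel :: real measure)" if "finite F" "F \<subseteq> square n" for F
      using prod_PiM_measurable[OF that, of "\<lambda>_. 1"] by simp
    note [measurable] = m[OF P(4,2)] m[OF P'(4,2)]
    have r: "(\<Prod>e\<in>F. (\<lambda>e\<in>square n. x e) e) = (\<Prod>e\<in>F. x e)" if "F \<subseteq> square n" for F and x :: "nat \<times> nat \<Rightarrow> real"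
      using that by (intro prod.cong) auto
    have "(\<integral>\<omega>. trunc N (W n E \<omega>) * trunc N (W n E' \<omega>) \<partial>M) =
      (\<integral>\<omega>. trunc N (\<Prod>e\<in>E. if e = e0 then - Y n e \<omega> else Y n e \<omega>) * trunc N (\<Prod>e\<in>E'. if e = e0 then - Y n e \<omega> else Y n e \<omega>) \<partial>M)"
      unfolding W_def
      by (rule expectation_flip[OF n, where \<Phi> = "\<lambda>x. trunc N (\<Prod>e\<in>E. x e) * trunc N (\<Prod>e\<in>E'. x e)"])
         (measurable, simp only: r[OF P(2)] r[OF P'(2)])
    also have "(\<lambda>\<omega>. trunc N (\<Prod>e\<in>E. if e = e0 then - Y n e \<omega> else Y n e \<omega>) * trunc N (\<Prod>e\<in>E'. if e = e0 then - Y n e \<omega> else Y n e \<omega>)) =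
      (\<lambda>\<omega>. - (trunc N (W n E \<omega>) * trunc N (W n E' \<omega>)))"
    proof
      fix \<omega>
      have "(\<Prod>e\<in>E'. if e = e0 then - Y n e \<omega> else Y n e \<omega>) = W n E' \<omega>"
        unfolding W_def using e0 by (intro prod.cong) auto
      then show "trunc N (\<Prod>e\<in>E. if e = e0 then - Y n e \<omega> else Y n e \<omega>) * trunc N (\<Prod>e\<in>E'. if e = e0 then - Y n e \<omega> else Y n e \<omega>) =
         - (trunc N (W n E \<omega>) * trunc N (W n E' \<omega>))"
        by (simp add: prod_flip[OF P(4) e0(1)] trunc_minus W_def)
    qed
    finally show ?thesis by simp
  qed
  have "(\<integral>\<omega>. (\<Sum>E\<in>cycle_sets n q. trunc N (W n E \<omega>))\<^sup>2 \<partial>M) =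
     (\<integral>\<omega>. (\<Sum>E\<in>cycle_sets n q. \<Sum>E'\<in>cycle_sets n q. trunc N (W n E \<omega>) * trunc N (W n E' \<omega>)) \<partial>M)"
    by (simp add: power2_eq_square sum_product)
  also have "\<dots> = (\<Sum>E\<in>cycle_sets n q. \<Sum>E'\<in>cycle_sets n q. \<integral>\<omega>. trunc N (W n E \<omega>) * trunc N (W n E' \<omega>) \<partial>M)"
    using int by (simp add: Bochner_Integration.integral_sum)
  also have "\<dots> = (\<Sum>E\<in>cycle_sets n q. \<integral>\<omega>. trunc N (W n E \<omega>) * trunc N (W n E \<omega>) \<partial>M)"
  proof (rule sum.cong[OF refl])
    fix E assume E: "E \<in> cycle_sets n q"
    have "(\<Sum>E'\<in>cycle_sets n q. \<integral>\<omega>. trunc N (W n E \<omega>) * trunc N (W n E' \<omega>) \<partial>M) =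
      (\<Sum>E'\<in>cycle_sets n q. if E' = E then \<integral>\<omega>. trunc N (W n E \<omega>) * trunc N (W n E \<omega>) \<partial>M else 0)"
      using off[OF E] by (intro sum.cong) auto
    then show "(\<Sum>E'\<in>cycle_sets n q. \<integral>\<omega>. trunc N (W n E \<omega>) * trunc N (W n E' \<omega>) \<partial>M) = (\<integral>\<omega>. trunc N (W n E \<omega>) * trunc N (W n E \<omega>) \<partial>M)"
      using E by simp
  qed
  finally show ?thesis by (simp add: trunc_def power2_eq_square mult_ac)
qed

definition nonfunctional_walks :: "nat \<Rightarrow> nat \<Rightarrow> nat list set" where
  "nonfunctional_walks n k = {zs \<in> closed_walks {..<n} k. \<not> inj_on fst (cyc_edges zs)}"

text \<open>In the double sum a pair with an edge of odd total multiplicity has mean 0. In every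
  other pair each edge occurs at least twice, so the mean is at most \<open>2 / n\<close> to the
  number of edges, which exceeds the number of vertices.\<close>

lemma nonfunctional_walks_L2:
  assumes n: "n \<ge> 4 * k" "n \<ge> 2"
  shows "(\<integral>\<omega>. (\<Sum>zs\<in>nonfunctional_walks n k. cyc_weight (\<lambda>e. Y n e \<omega>) zs)\<^sup>2 \<partial>M) \<le> fact (Suc (2 * k)) * (2 / real n)"
proof -
  let ?w = "\<lambda>zs \<omega>. cyc_weight (\<lambda>e. Y n e \<omega>) zs"
  let ?B = "nonfunctional_walks n k"
  have sub: "cyc_edges zs \<subseteq> square n" if "zs \<in> closed_walks {..<n} k" for zs
    using that cyc_edges_subset[of zs "{..<n}"] by (auto simp: closed_walks_def square_def)
  have BW: "?B \<subseteq> closed_walks {..<n} k" by (auto simp: nonfunctional_walks_def)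
  have prod: "?w zs \<omega> * ?w zs' \<omega> = (\<Prod>e\<in>cyc_edges zs \<union> cyc_edges zs'. Y n e \<omega> ^ (edge_mult zs e + edge_mult zs' e))" for zs zs' \<omega>
    using cyc_weight_edge_mult[of "cyc_edges zs \<union> cyc_edges zs'" zs "\<lambda>e. Y n e \<omega>"]
      cyc_weight_edge_mult[of "cyc_edges zs \<union> cyc_edges zs'" zs' "\<lambda>e. Y n e \<omega>"]
    by (simp add: power_add prod.distrib)
  have int: "integrable M (\<lambda>\<omega>. ?w zs \<omega> * ?w zs' \<omega>)" if "zs \<in> ?B" "zs' \<in> ?B" for zs zs'
    unfolding prod using that BW sub by (intro integrable_prod_Y) auto
  have le: "(\<integral>\<omega>. ?w zs \<omega> * ?w zs' \<omega> \<partial>M) \<le> (2 / real n) * (2 / real n) ^ card (set (zs @ zs'))" if z: "zs \<in> ?B" "zs' \<in> ?B" for zs zs'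
  proof -
    let ?U = "cyc_edges zs \<union> cyc_edges zs'"
    let ?m = "\<lambda>e. edge_mult zs e + edge_mult zs' e"
    have U: "?U \<subseteq> square n" using z BW sub by auto
    show ?thesis
    proof (cases "\<exists>e\<in>?U. odd (?m e)")
      case True
      then obtain e where e: "e \<in> ?U" "odd (?m e)" by blast
      have "(\<integral>\<omega>. ?w zs \<omega> * ?w zs' \<omega> \<partial>M) = 0" unfolding prod
        by (rule expectation_odd[where m = ?m, OF U e(1)]) (use e(2) in simp)
      then show ?thesis by simp
    next
      case False
      have m2: "?m e \<ge> 2" if "e \<in> ?U" for e
      proof -
        have "?m e \<ge> 1" using that edge_mult_pos[of e zs] edge_mult_pos[of e zs'] by auto
        moreover have "even (?m e)" using False that by blast
        ultimately show ?thesis by (metis One_nat_def Suc_1 le_antisym not_less_eq_eq odd_one)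
      qed
      have "(\<integral>\<omega>. ?w zs \<omega> * ?w zs' \<omega> \<partial>M) \<le> (\<integral>\<omega>. (\<Prod>e\<in>?U. (Y n e \<omega>)\<^sup>2) \<partial>M)"
      proof (rule integral_mono[OF int[OF z]])
        show "integrable M (\<lambda>\<omega>. \<Prod>e\<in>?U. (Y n e \<omega>)\<^sup>2)" using integrable_prod_Y[OF U, of "\<lambda>_. 2"] by simp
        fix \<omega>
        have "?w zs \<omega> * ?w zs' \<omega> \<le> \<bar>\<Prod>e\<in>?U. Y n e \<omega> ^ ?m e\<bar>" unfolding prod by (rule abs_ge_self)
        also have "\<dots> = (\<Prod>e\<in>?U. \<bar>Y n e \<omega>\<bar> ^ ?m e)" by (simp only: abs_prod power_abs)
        also have "\<dots> \<le> (\<Prod>e\<in>?U. \<bar>Y n e \<omega>\<bar> ^ 2)"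
          using m2 U Y_abs_le_1 by (intro prod_mono conjI power_decreasing) auto
        finally show "?w zs \<omega> * ?w zs' \<omega> \<le> (\<Prod>e\<in>?U. (Y n e \<omega>)\<^sup>2)" by simp
      qed
      also have "\<dots> \<le> (2 / real n) ^ card ?U"
      proof (rule expectation_prod_sq_le[OF U])
        have "card ?U \<le> card (cyc_edges zs) + card (cyc_edges zs')" by (rule card_Un_le)
        also have "\<dots> \<le> k + k"
          using card_cyc_edges_le[of zs] card_cyc_edges_le[of zs'] subsetD[OF BW z(1)] subsetD[OF BW z(2)]
          by (simp add: closed_walks_def)
        finally show "2 * card ?U \<le> n" using n by simp
      qed
      also have "\<dots> \<le> (2 / real n) * (2 / real n) ^ card (set (zs @ zs'))"
      proof (rule power_le_next_power[OF Suc_leI n(2)])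
        have "\<not> inj_on fst ?U" using z(1) inj_on_subset[of fst ?U "cyc_edges zs"] by (auto simp: nonfunctional_walks_def)
        then have "card (fst ` ?U) < card ?U" by (intro card_fst_image_less) auto
        then show "card (set (zs @ zs')) < card ?U" by (simp add: image_Un fst_cyc_edges)
      qed
      finally show ?thesis .
    qed
  qed
  have "(\<integral>\<omega>. (\<Sum>zs\<in>?B. ?w zs \<omega>)\<^sup>2 \<partial>M) = (\<integral>\<omega>. (\<Sum>zs\<in>?B. \<Sum>zs'\<in>?B. ?w zs \<omega> * ?w zs' \<omega>) \<partial>M)"
    by (simp add: power2_eq_square sum_product)
  also have "\<dots> = (\<Sum>zs\<in>?B. \<Sum>zs'\<in>?B. \<integral>\<omega>. ?w zs \<omega> * ?w zs' \<omega> \<partial>M)"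
    using int by (simp add: Bochner_Integration.integral_sum)
  also have "\<dots> \<le> (\<Sum>zs\<in>?B. \<Sum>zs'\<in>?B. (2 / real n) * (2 / real n) ^ card (set (zs @ zs')))"
    by (intro sum_mono le)
  also have "\<dots> \<le> (\<Sum>zs\<in>closed_walks {..<n} k. \<Sum>zs'\<in>closed_walks {..<n} k. (2 / real n) * (2 / real n) ^ card (set (zs @ zs')))"
    using BW by (intro order_trans[OF sum_mono[OF sum_mono2] sum_mono2] sum_nonneg) auto
  also have "\<dots> = (2 / real n) * (\<Sum>zs\<in>closed_walks {..<n} k. \<Sum>zs'\<in>closed_walks {..<n} k. (2 / real n) ^ card (set (zs @ zs')))"
    by (simp only: sum_distrib_left)
  also have "\<dots> \<le> (2 / real n) * fact (Suc (2 * k))"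
    using n by (intro mult_left_mono sum_closed_walks_pairs_le) auto
  finally show ?thesis by (simp only: mult.commute)
qed

text \<open>A walk with one outgoing edge per row repeats a simple cycle, and the \<open>q\<close>
  rotations of that cycle contribute equal terms.\<close>

lemma trace_decomposition:
  assumes k: "k \<ge> 1"
  shows "mat_trace (self_normalized_matrix X n \<omega> ^\<^sub>m k) =
    (\<Sum>q | q dvd k. real q * (\<Sum>E\<in>cycle_sets n q. W n E \<omega> ^ (k div q))) +
    (\<Sum>zs\<in>nonfunctional_walks n k. cyc_weight (\<lambda>e. Y n e \<omega>) zs)"
proof -
  let ?w = "cyc_weight (\<lambda>e. Y n e \<omega>)"
  have split: "closed_walks {..<n} k = {zs. zs \<in> closed_walks {..<n} k \<and> inj_on fst (cyc_edges zs)} \<union> nonfunctional_walks n k"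
    by (auto simp: nonfunctional_walks_def)
  have fin: "finite {zs. zs \<in> closed_walks {..<n} k \<and> inj_on fst (cyc_edges zs)}" "finite (nonfunctional_walks n k)"
    using finite_closed_walks[of "{..<n}" k] by (auto simp: nonfunctional_walks_def intro: finite_subset)
  have "mat_trace (self_normalized_matrix X n \<omega> ^\<^sub>m k) =
    (\<Sum>zs | zs \<in> closed_walks {..<n} k \<and> inj_on fst (cyc_edges zs). ?w zs) + (\<Sum>zs\<in>nonfunctional_walks n k. ?w zs)"
    unfolding trace_self_normalized[OF k]
    by (subst split, rule sum.union_disjoint[OF fin]) (auto simp: nonfunctional_walks_def)
  also have "(\<Sum>zs | zs \<in> closed_walks {..<n} k \<and> inj_on fst (cyc_edges zs). ?w zs) =
     (\<Sum>q | q dvd k. \<Sum>c\<in>simple_cycles {..<n} q. ?w (periodic_walk k c))"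
    by (rule sum_functional_walks[OF _ k]) simp
  also have "\<dots> = (\<Sum>q | q dvd k. real q * (\<Sum>E\<in>cycle_sets n q. W n E \<omega> ^ (k div q)))"
  proof (rule sum.cong[OF refl])
    fix q assume q: "q \<in> {q. q dvd k}"
    have "(\<Sum>c\<in>simple_cycles {..<n} q. ?w (periodic_walk k c)) = (\<Sum>c\<in>simple_cycles {..<n} q. W n (cyc_edges c) \<omega> ^ (k div q))"
    proof (rule sum.cong[OF refl])
      fix c assume c: "c \<in> simple_cycles {..<n} q"
      then have "?w (periodic_walk k c) = ?w c ^ (k div length c)"
        using q k by (intro cyc_weight_periodic_walk) (auto simp: simple_cycles_def)
      also have "?w c = W n (cyc_edges c) \<omega>"
        unfolding W_def using c by (intro cyc_weight_distinct) (auto simp: simple_cycles_def)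
      finally show "?w (periodic_walk k c) = W n (cyc_edges c) \<omega> ^ (k div q)"
        using c by (simp add: simple_cycles_def)
    qed
    also have "\<dots> = real q * (\<Sum>E\<in>cycle_sets n q. W n E \<omega> ^ (k div q))"
      unfolding cycle_sets_def using q k by (intro sum_simple_cycles_edges) (auto intro!: Suc_leI Nat.gr0I)
    finally show "(\<Sum>c\<in>simple_cycles {..<n} q. ?w (periodic_walk k c)) = real q * (\<Sum>E\<in>cycle_sets n q. W n E \<omega> ^ (k div q))" .
  qed
  finally show ?thesis .
qed

end

section \<open>Characteristic functions of the limit\<close>

text \<open>By Cauchy-Schwarz. Integrability is claimed only eventually, since the hypothesis allows
  infinite second moments for finitely many \<open>n\<close>.\<close>

lemma tendsto_expectation_abs_0:
  fixes D :: "nat \<Rightarrow> 'b \<Rightarrow> real"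
  assumes "prob_space P" and [measurable]: "\<And>n. D n \<in> borel_measurable P"
    and lim: "(\<lambda>n. \<integral>\<^sup>+\<omega>. ennreal ((D n \<omega>)\<^sup>2) \<partial>P) \<longlonglongrightarrow> 0"
  shows "eventually (\<lambda>n. integrable P (D n)) sequentially" and "(\<lambda>n. \<integral>\<omega>. \<bar>D n \<omega>\<bar> \<partial>P) \<longlonglongrightarrow> 0"
proof -
  interpret P: prob_space P by fact
  have fin: "eventually (\<lambda>n. (\<integral>\<^sup>+\<omega>. ennreal ((D n \<omega>)\<^sup>2) \<partial>P) < 1) sequentially"
    using order_tendstoD(2)[OF lim] by simp
  have sq: "eventually (\<lambda>n. integrable P (\<lambda>\<omega>. (D n \<omega>)\<^sup>2)) sequentially"
    using fin
  proof eventually_elim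
    case (elim n)
    then show ?case by (auto simp: integrable_iff_bounded intro: less_trans)
  qed
  then show "eventually (\<lambda>n. integrable P (D n)) sequentially"
    by eventually_elim (rule P.expectation_abs_le_sqrt(1), simp_all)
  have "(\<lambda>n. enn2real (\<integral>\<^sup>+\<omega>. ennreal ((D n \<omega>)\<^sup>2) \<partial>P)) \<longlonglongrightarrow> 0"
    by (rule tendsto_enn2real) (use lim in simp_all)
  from tendsto_real_sqrt[OF this] have s0: "(\<lambda>n. sqrt (enn2real (\<integral>\<^sup>+\<omega>. ennreal ((D n \<omega>)\<^sup>2) \<partial>P))) \<longlonglongrightarrow> 0" by simp
  show "(\<lambda>n. \<integral>\<omega>. \<bar>D n \<omega>\<bar> \<partial>P) \<longlonglongrightarrow> 0"
  proof (rule Lim_null_comparison[OF _ s0])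
    show "eventually (\<lambda>n. norm (\<integral>\<omega>. \<bar>D n \<omega>\<bar> \<partial>P) \<le> sqrt (enn2real (\<integral>\<^sup>+\<omega>. ennreal ((D n \<omega>)\<^sup>2) \<partial>P))) sequentially"
      using sq
    proof eventually_elim
      case (elim n)
      have "(\<integral>\<omega>. (D n \<omega>)\<^sup>2 \<partial>P) = enn2real (\<integral>\<^sup>+\<omega>. ennreal ((D n \<omega>)\<^sup>2) \<partial>P)"
        by (rule integral_eq_nn_integral) auto
      with P.expectation_abs_le_sqrt(2)[OF _ elim] show ?case by (simp add: integral_nonneg_AE)
    qed
  qed
qed

text \<open>Each \<open>X q\<close> is measurable for the events of \<open>N q\<close>, so its own
  events form a subfamily of an independent family.\<close>

lemma (in prob_space) integral_N_indep_vars: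
  fixes X :: "'q \<Rightarrow> 'a \<Rightarrow> real"
  assumes X: "\<And>q. q \<in> Q \<Longrightarrow> X q \<in> borel_measurable M"
    and Xs: "\<And>q. q \<in> Q \<Longrightarrow> X q \<in> borel_measurable (sigma (space M)
        {(\<lambda>\<omega>. emeasure (N q \<omega>) A) -` B \<inter> space M | A B. A \<in> sets \<S> \<and> B \<in> sets borel})"
    and ind: "indep_sets (\<lambda>q. random_measure_events M \<S> (N q)) Q"
  shows "indep_vars (\<lambda>_. borel) X Q"
  unfolding indep_vars_def2
proof (intro conjI ballI X)
  show "indep_sets (\<lambda>q. {X q -` A \<inter> space M |A. A \<in> sets borel}) Q"
  proof (rule indep_sets_mono_sets[OF ind])
    fix q assume q: "q \<in> Q"
    let ?G = "{(\<lambda>\<omega>. emeasure (N q \<omega>) A) -` B \<inter> space M | A B. A \<in> sets \<S> \<and> B \<in> sets borel}"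
    have G: "?G \<subseteq> Pow (space M)" by auto
    show "{X q -` A \<inter> space M |A. A \<in> sets borel} \<subseteq> random_measure_events M \<S> (N q)"
    proof safe
      fix A :: "real set" assume "A \<in> sets borel"
      then have "X q -` A \<inter> space (sigma (space M) ?G) \<in> sets (sigma (space M) ?G)"
        by (rule measurable_sets[OF Xs[OF q]])
      then show "X q -` A \<inter> space M \<in> random_measure_events M \<S> (N q)"
        by (simp add: random_measure_events_def space_measure_of[OF G] sets_measure_of[OF G])
    qed
  qed
qed

text \<open>Each \<open>I q\<close> is approximated by compensated integrals of functions in L1, for
  which the formula for a plain Poisson integral applies; both sides are continuous in L2.
  Independence is used for the approximations, because the version \<open>I q\<close> itself need
  not be measurable for the events of \<open>N q\<close>.\<close>

lemma joint_char_poisson_family: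
  fixes N :: "nat \<Rightarrow> 'b \<Rightarrow> 's measure" and \<nu> :: "nat \<Rightarrow> 's measure" and f :: "'s \<Rightarrow> real"
    and h :: "nat \<Rightarrow> 's \<Rightarrow> real" and c :: "nat \<Rightarrow> real"
  assumes "prob_space P" and Q: "finite Q"
    and pp: "\<And>q. q \<in> Q \<Longrightarrow> poisson_process P (\<nu> q) (N q)" and sets: "\<And>q. q \<in> Q \<Longrightarrow> sets (\<nu> q) = sets \<S>"
    and ind: "prob_space.indep_sets P (\<lambda>q. random_measure_events P \<S> (N q)) Q"
    and comp: "\<And>q. q \<in> Q \<Longrightarrow> compensated_poisson_integral P (\<nu> q) (N q) f (I q)"
    and h: "\<And>q. q \<in> Q \<Longrightarrow> integrable (\<nu> q) (h q)" "\<And>q. q \<in> Q \<Longrightarrow> integrable (\<nu> q) (\<lambda>u. (h q u)\<^sup>2)"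
  shows "(\<integral>\<omega>. cis (\<Sum>q\<in>Q. c q * I q \<omega> + (\<integral>u. h q u \<partial>N q \<omega>)) \<partial>P) =
    exp (\<Sum>q\<in>Q. poisson_exponent (\<nu> q) (\<lambda>u. c q * f u) (h q))"
proof -
  interpret P: prob_space P by fact
  have ppp: "poisson_point_process P (\<nu> q) (N q)" if "q \<in> Q" for q
    using pp[OF that] by (simp add: poisson_point_process_def poisson_point_process_axioms_def P.prob_space_axioms)
  have "\<forall>q\<in>Q. \<exists>g :: nat \<Rightarrow> 's \<Rightarrow> real. (\<forall>n. integrable (\<nu> q) (g n) \<and> integrable (\<nu> q) (\<lambda>u. (g n u)\<^sup>2)) \<and>
        (\<lambda>n. \<integral>\<^sup>+u. ennreal ((g n u - f u)\<^sup>2) \<partial>\<nu> q) \<longlonglongrightarrow> 0 \<and>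
        (\<lambda>n. \<integral>\<^sup>+\<omega>. ennreal (((\<integral>u. g n u \<partial>N q \<omega>) - (\<integral>u. g n u \<partial>\<nu> q) - I q \<omega>)\<^sup>2) \<partial>P) \<longlonglongrightarrow> 0"
    using comp unfolding compensated_poisson_integral_def by blast
  from bchoice[OF this] obtain g :: "nat \<Rightarrow> nat \<Rightarrow> 's \<Rightarrow> real" where
    g0: "\<forall>q\<in>Q. (\<forall>n. integrable (\<nu> q) (g q n) \<and> integrable (\<nu> q) (\<lambda>u. (g q n u)\<^sup>2)) \<and>
        (\<lambda>n. \<integral>\<^sup>+u. ennreal ((g q n u - f u)\<^sup>2) \<partial>\<nu> q) \<longlonglongrightarrow> 0 \<and>
        (\<lambda>n. \<integral>\<^sup>+\<omega>. ennreal (((\<integral>u. g q n u \<partial>N q \<omega>) - (\<integral>u. g q n u \<partial>\<nu> q) - I q \<omega>)\<^sup>2) \<partial>P) \<longlonglongrightarrow> 0"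
    by blast
  have g: "integrable (\<nu> q) (g q n)" "integrable (\<nu> q) (\<lambda>u. (g q n u)\<^sup>2)"
    and gf: "(\<lambda>n. \<integral>\<^sup>+u. ennreal ((g q n u - f u)\<^sup>2) \<partial>\<nu> q) \<longlonglongrightarrow> 0"
    and gI: "(\<lambda>n. \<integral>\<^sup>+\<omega>. ennreal (((\<integral>u. g q n u \<partial>N q \<omega>) - (\<integral>u. g q n u \<partial>\<nu> q) - I q \<omega>)\<^sup>2) \<partial>P) \<longlonglongrightarrow> 0"
    if "q \<in> Q" for q n
    using g0 that by blast+
  have f: "f \<in> borel_measurable (\<nu> q)" "integrable (\<nu> q) (\<lambda>u. (f u)\<^sup>2)" "I q \<in> borel_measurable P" if "q \<in> Q" for q
    using comp[OF that] by (auto simp: compensated_poisson_integral_def)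
  define G where "G q n \<omega> = (\<integral>u. g q n u \<partial>N q \<omega>) - (\<integral>u. g q n u \<partial>\<nu> q)" for q n \<omega>
  define H where "H q \<omega> = (\<integral>u. h q u \<partial>N q \<omega>)" for q \<omega>
  have Nm: "(\<lambda>\<omega>. \<integral>u. \<phi> u \<partial>N q \<omega>) \<in> borel_measurable P" if "q \<in> Q" "\<phi> \<in> borel_measurable (\<nu> q)" for q and \<phi> :: "'s \<Rightarrow> real"
    by (rule poisson_point_process.integral_N_measurable[OF ppp[OF that(1)] _ _ that(2)])
  \<comment> \<open>Measurability for the sigma-algebra generated by the counts of
    \<open>N q\<close>, to which the independence hypothesis refers.\<close>
  have Ns: "(\<lambda>\<omega>. \<integral>u. \<phi> u \<partial>N q \<omega>) \<in> borel_measurable (sigma (space P)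
        {(\<lambda>\<omega>. emeasure (N q \<omega>) A) -` B \<inter> space P | A B. A \<in> sets \<S> \<and> B \<in> sets borel})"
    if q: "q \<in> Q" and \<phi>: "\<phi> \<in> borel_measurable (\<nu> q)" for q and \<phi> :: "'s \<Rightarrow> real"
  proof (rule integral_random_measure_measurable[OF _ _ \<phi>])
    let ?G = "{(\<lambda>\<omega>. emeasure (N q \<omega>) A) -` B \<inter> space P | A B. A \<in> sets \<S> \<and> B \<in> sets borel}"
    have Gp: "?G \<subseteq> Pow (space P)" by auto
    show "sets (N q \<omega>) = sets (\<nu> q)" if "\<omega> \<in> space (sigma (space P) ?G)" for \<omega>
      using poisson_point_process.sets_N[OF ppp[OF q]] that by (simp add: space_measure_of[OF Gp])
    show "(\<lambda>\<omega>. emeasure (N q \<omega>) A) \<in> borel_measurable (sigma (space P) ?G)" if "A \<in> sets (\<nu> q)" for A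
    proof (rule measurableI)
      fix B :: "ennreal set" assume "B \<in> sets borel"
      then have "(\<lambda>\<omega>. emeasure (N q \<omega>) A) -` B \<inter> space P \<in> ?G" using that sets[OF q] by auto
      then show "(\<lambda>\<omega>. emeasure (N q \<omega>) A) -` B \<inter> space (sigma (space P) ?G) \<in> sets (sigma (space P) ?G)"
        by (simp only: space_measure_of[OF Gp] sets_measure_of[OF Gp] sigma_sets.Basic)
    qed simp
  qed
  have gm: "g q n \<in> borel_measurable (\<nu> q)" "h q \<in> borel_measurable (\<nu> q)" if "q \<in> Q" for q n
    using g(1)[OF that, of n] h(1)[OF that] by auto
  have GHm: "G q n \<in> borel_measurable P" "H q \<in> borel_measurable P" if "q \<in> Q" for q n
    unfolding G_def[abs_def] H_def[abs_def] using Nm[OF that gm(1)[OF that]] Nm[OF that gm(2)[OF that]] by simp_all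
  have cis_int: "integrable P (\<lambda>\<omega>. cis (X \<omega>))" if "X \<in> borel_measurable P" for X
    using that by (intro P.integrable_const_bound[of _ 1]) (simp_all add: cis_conv_exp)
  have single: "(\<integral>\<omega>. cis (c q * G q n \<omega> + H q \<omega>) \<partial>P) = exp (poisson_exponent (\<nu> q) (\<lambda>u. c q * g q n u) (h q))" if q: "q \<in> Q" for q n
  proof -
    \<comment> \<open>The deterministic compensator; it becomes the term linear in
      \<open>c q * g q n u\<close> of the exponent.\<close>
    define a where "a = c q * (\<integral>u. g q n u \<partial>\<nu> q)"
    have int: "integrable (\<nu> q) (\<lambda>u. c q * g q n u + h q u)" using g(1)[OF q] h(1)[OF q] by simp
    have "(\<integral>\<omega>. cis (c q * G q n \<omega> + H q \<omega>) \<partial>P) = (\<integral>\<omega>. cis (- a) * cis (\<integral>u. c q * g q n u + h q u \<partial>N q \<omega>) \<partial>P)"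
    proof (rule integral_cong_AE)
      show "AE \<omega> in P. cis (c q * G q n \<omega> + H q \<omega>) = cis (- a) * cis (\<integral>u. c q * g q n u + h q u \<partial>N q \<omega>)"
        using poisson_point_process.AE_integrable_N[OF ppp[OF q] g(1)[OF q, of n]]
          poisson_point_process.AE_integrable_N[OF ppp[OF q] h(1)[OF q]]
      proof eventually_elim
        case (elim \<omega>)
        then have "(\<integral>u. c q * g q n u + h q u \<partial>N q \<omega>) = c q * (\<integral>u. g q n u \<partial>N q \<omega>) + H q \<omega>"
          by (simp add: H_def)
        then show ?case by (simp add: cis_mult G_def a_def algebra_simps)
      qed
      show "(\<lambda>\<omega>. cis (c q * G q n \<omega> + H q \<omega>)) \<in> borel_measurable P"
        using GHm[OF q] by (simp add: cis_conv_exp)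
      have "(\<lambda>u. c q * g q n u + h q u) \<in> borel_measurable (\<nu> q)" using gm[OF q] by simp
      from Nm[OF q this] show "(\<lambda>\<omega>. cis (- a) * cis (\<integral>u. c q * g q n u + h q u \<partial>N q \<omega>)) \<in> borel_measurable P"
        by (simp add: cis_conv_exp)
    qed
    also have "\<dots> = cis (- a) * exp (\<integral>u. (cis (c q * g q n u + h q u) - 1) \<partial>\<nu> q)"
      using poisson_point_process.char_integral[OF ppp[OF q] int] by simp
    also have "\<dots> = exp ((\<integral>u. (cis (c q * g q n u + h q u) - 1) \<partial>\<nu> q) - \<i> * of_real a)"
      by (simp add: cis_conv_exp exp_diff exp_minus field_simps)
    also have "(\<integral>u. (cis (c q * g q n u + h q u) - 1) \<partial>\<nu> q) - \<i> * of_real a = poisson_exponent (\<nu> q) (\<lambda>u. c q * g q n u) (h q)"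
    proof -
      have i1: "integrable (\<nu> q) (\<lambda>u. cis (c q * g q n u + h q u) - 1)"
        using int by (rule poisson_point_process.integrable_cis_minus_one[OF ppp[OF q]])
      have i2: "integrable (\<nu> q) (\<lambda>u. \<i> * complex_of_real (c q * g q n u))" using g(1)[OF q, of n] by simp
      have "(\<integral>u. \<i> * complex_of_real (c q * g q n u) \<partial>\<nu> q) = \<i> * of_real a"
        by (simp only: a_def integral_mult_right_zero integral_complex_of_real)
      then show ?thesis unfolding poisson_exponent_def using i1 i2 by (simp only: Bochner_Integration.integral_diff)
    qed
    finally show ?thesis .
  qed
  have prod: "(\<integral>\<omega>. cis (\<Sum>q\<in>Q. c q * G q n \<omega> + H q \<omega>) \<partial>P) = exp (\<Sum>q\<in>Q. poisson_exponent (\<nu> q) (\<lambda>u. c q * g q n u) (h q))" for n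
  proof -
    have "P.indep_vars (\<lambda>_. borel) (\<lambda>q \<omega>. c q * G q n \<omega> + H q \<omega>) Q"
    proof (rule P.integral_N_indep_vars[OF _ _ ind])
      fix q assume q: "q \<in> Q"
      show "(\<lambda>\<omega>. c q * G q n \<omega> + H q \<omega>) \<in> borel_measurable P" using GHm[OF q] by simp
      show "(\<lambda>\<omega>. c q * G q n \<omega> + H q \<omega>) \<in> borel_measurable (sigma (space P)
        {(\<lambda>\<omega>. emeasure (N q \<omega>) A) -` B \<inter> space P | A B. A \<in> sets \<S> \<and> B \<in> sets borel})"
        unfolding G_def H_def using Ns[OF q gm(1)[OF q, of n]] Ns[OF q gm(2)[OF q]]
        by (intro borel_measurable_add borel_measurable_diff borel_measurable_times borel_measurable_const)
    qed
    then have iv: "P.indep_vars (\<lambda>_. borel) (\<lambda>q \<omega>. cis (c q * G q n \<omega> + H q \<omega>)) Q"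
      by (rule P.indep_vars_compose2) (simp add: cis_conv_exp)
    have "(\<integral>\<omega>. cis (\<Sum>q\<in>Q. c q * G q n \<omega> + H q \<omega>) \<partial>P) = (\<integral>\<omega>. (\<Prod>q\<in>Q. cis (c q * G q n \<omega> + H q \<omega>)) \<partial>P)"
      using Q by (simp add: cis_conv_exp sum_distrib_left exp_sum)
    also have "\<dots> = (\<Prod>q\<in>Q. \<integral>\<omega>. cis (c q * G q n \<omega> + H q \<omega>) \<partial>P)"
      using GHm by (intro P.indep_vars_lebesgue_integral Q iv cis_int) auto
    also have "\<dots> = exp (\<Sum>q\<in>Q. poisson_exponent (\<nu> q) (\<lambda>u. c q * g q n u) (h q))"
      using Q by (simp add: single exp_sum)
    finally show ?thesis .
  qed
  have R: "(\<lambda>n. exp (\<Sum>q\<in>Q. poisson_exponent (\<nu> q) (\<lambda>u. c q * g q n u) (h q))) \<longlonglongrightarrow> exp (\<Sum>q\<in>Q. poisson_exponent (\<nu> q) (\<lambda>u. c q * f u) (h q))"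
  proof (intro tendsto_exp tendsto_sum)
    fix q assume q: "q \<in> Q"
    have "(\<lambda>n. enn2real (\<integral>\<^sup>+u. ennreal ((g q n u - f u)\<^sup>2) \<partial>\<nu> q)) \<longlonglongrightarrow> 0"
      by (rule tendsto_enn2real) (use gf[OF q] in simp_all)
    moreover have "enn2real (\<integral>\<^sup>+u. ennreal ((g q n u - f u)\<^sup>2) \<partial>\<nu> q) = (\<integral>u. (g q n u - f u)\<^sup>2 \<partial>\<nu> q)" for n
      using gm(1)[OF q] f(1)[OF q] by (intro integral_eq_nn_integral[symmetric]) auto
    ultimately have "(\<lambda>n. (c q)\<^sup>2 * (\<integral>u. (g q n u - f u)\<^sup>2 \<partial>\<nu> q)) \<longlonglongrightarrow> (c q)\<^sup>2 * 0"
      by (intro tendsto_mult_left) simp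
    then have l: "(\<lambda>n. \<integral>u. (c q * g q n u - c q * f u)\<^sup>2 \<partial>\<nu> q) \<longlonglongrightarrow> 0"
      by (simp add: right_diff_distrib[symmetric] power_mult_distrib)
    show "(\<lambda>n. poisson_exponent (\<nu> q) (\<lambda>u. c q * g q n u) (h q)) \<longlonglongrightarrow> poisson_exponent (\<nu> q) (\<lambda>u. c q * f u) (h q)"
      using gm[OF q] f(1,2)[OF q] g(2)[OF q] h[OF q] l
      by (intro poisson_exponent_tendsto) (auto simp: power_mult_distrib)
  qed
  define D where "D q n \<omega> = G q n \<omega> - I q \<omega>" for q n \<omega>
  have Dm: "D q n \<in> borel_measurable P" if "q \<in> Q" for q n
    unfolding D_def[abs_def] using GHm(1)[OF that] f(3)[OF that] by simp
  have D0: "eventually (\<lambda>n. integrable P (D q n)) sequentially" "(\<lambda>n. \<integral>\<omega>. \<bar>D q n \<omega>\<bar> \<partial>P) \<longlonglongrightarrow> 0" if q: "q \<in> Q" for q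
  proof -
    have "(\<lambda>n. \<integral>\<^sup>+\<omega>. ennreal ((D q n \<omega>)\<^sup>2) \<partial>P) \<longlonglongrightarrow> 0" using gI[OF q] by (simp add: D_def G_def)
    from tendsto_expectation_abs_0[OF P.prob_space_axioms Dm[OF q] this]
    show "eventually (\<lambda>n. integrable P (D q n)) sequentially" "(\<lambda>n. \<integral>\<omega>. \<bar>D q n \<omega>\<bar> \<partial>P) \<longlonglongrightarrow> 0" .
  qed
  have sumD: "(\<lambda>n. \<Sum>q\<in>Q. \<bar>c q\<bar> * (\<integral>\<omega>. \<bar>D q n \<omega>\<bar> \<partial>P)) \<longlonglongrightarrow> 0"
    by (rule tendsto_null_sum) (auto intro!: tendsto_mult_right_zero D0)
  have "eventually (\<lambda>n. \<forall>q\<in>Q. integrable P (D q n)) sequentially"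
    using D0(1) Q by (simp add: eventually_ball_finite)
  then have ev: "eventually (\<lambda>n. norm ((\<integral>\<omega>. cis (\<Sum>q\<in>Q. c q * G q n \<omega> + H q \<omega>) \<partial>P) - (\<integral>\<omega>. cis (\<Sum>q\<in>Q. c q * I q \<omega> + H q \<omega>) \<partial>P))
      \<le> (\<Sum>q\<in>Q. \<bar>c q\<bar> * (\<integral>\<omega>. \<bar>D q n \<omega>\<bar> \<partial>P))) sequentially"
  proof eventually_elim
    case (elim n)
    have m1: "(\<lambda>\<omega>. \<Sum>q\<in>Q. c q * G q n \<omega> + H q \<omega>) \<in> borel_measurable P"
      using GHm by (intro borel_measurable_sum borel_measurable_add borel_measurable_times) auto
    have m2: "(\<lambda>\<omega>. \<Sum>q\<in>Q. c q * I q \<omega> + H q \<omega>) \<in> borel_measurable P"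
      using GHm f(3) by (intro borel_measurable_sum borel_measurable_add borel_measurable_times) auto
    have "norm ((\<integral>\<omega>. cis (\<Sum>q\<in>Q. c q * G q n \<omega> + H q \<omega>) \<partial>P) - (\<integral>\<omega>. cis (\<Sum>q\<in>Q. c q * I q \<omega> + H q \<omega>) \<partial>P)) =
      norm (\<integral>\<omega>. cis (\<Sum>q\<in>Q. c q * G q n \<omega> + H q \<omega>) - cis (\<Sum>q\<in>Q. c q * I q \<omega> + H q \<omega>) \<partial>P)"
      by (simp only: Bochner_Integration.integral_diff[OF cis_int[OF m1] cis_int[OF m2]])
    also have "\<dots> \<le> (\<integral>\<omega>. (\<Sum>q\<in>Q. \<bar>c q\<bar> * \<bar>D q n \<omega>\<bar>) \<partial>P)"
    proof (rule order_trans[OF integral_norm_bound integral_mono])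
      show "integrable P (\<lambda>\<omega>. norm (cis (\<Sum>q\<in>Q. c q * G q n \<omega> + H q \<omega>) - cis (\<Sum>q\<in>Q. c q * I q \<omega> + H q \<omega>)))"
        by (intro integrable_norm Bochner_Integration.integrable_diff cis_int m1 m2)
      show "integrable P (\<lambda>\<omega>. \<Sum>q\<in>Q. \<bar>c q\<bar> * \<bar>D q n \<omega>\<bar>)" using elim by auto
      fix \<omega>
      have "norm (cis (\<Sum>q\<in>Q. c q * G q n \<omega> + H q \<omega>) - cis (\<Sum>q\<in>Q. c q * I q \<omega> + H q \<omega>)) \<le>
        \<bar>(\<Sum>q\<in>Q. c q * G q n \<omega> + H q \<omega>) - (\<Sum>q\<in>Q. c q * I q \<omega> + H q \<omega>)\<bar>" by (rule norm_cis_diff_le)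
      also have "\<dots> = \<bar>\<Sum>q\<in>Q. c q * D q n \<omega>\<bar>"
        by (simp add: sum_subtractf[symmetric] D_def right_diff_distrib)
      also have "\<dots> \<le> (\<Sum>q\<in>Q. \<bar>c q\<bar> * \<bar>D q n \<omega>\<bar>)" by (rule order_trans[OF sum_abs]) (simp add: abs_mult)
      finally show "norm (cis (\<Sum>q\<in>Q. c q * G q n \<omega> + H q \<omega>) - cis (\<Sum>q\<in>Q. c q * I q \<omega> + H q \<omega>)) \<le> (\<Sum>q\<in>Q. \<bar>c q\<bar> * \<bar>D q n \<omega>\<bar>)" .
    qed
    also have "\<dots> = (\<Sum>q\<in>Q. \<bar>c q\<bar> * (\<integral>\<omega>. \<bar>D q n \<omega>\<bar> \<partial>P))"
      using elim by (subst Bochner_Integration.integral_sum) auto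
    finally show ?case .
  qed
  have L: "(\<lambda>n. \<integral>\<omega>. cis (\<Sum>q\<in>Q. c q * G q n \<omega> + H q \<omega>) \<partial>P) \<longlonglongrightarrow> (\<integral>\<omega>. cis (\<Sum>q\<in>Q. c q * I q \<omega> + H q \<omega>) \<partial>P)"
    by (rule LIM_zero_cancel, rule Lim_null_comparison[OF ev sumD])
  from LIMSEQ_unique[OF L[unfolded prod] R] show ?thesis by (simp only: H_def)
qed

section \<open>Integrals against the intensity of the Poisson processes\<close>

text \<open>The weight \<open>1 / v\<close> of the intensity is almost surely positive and finite
  under the Beta product, so the nonnegative integral formula carries over to real values.\<close>

lemma q_poisson_integral_nonneg:
  fixes \<phi> :: "real \<Rightarrow> real"
  assumes \<alpha>: "0 < \<alpha>" "\<alpha> < 2" and [measurable]: "\<phi> \<in> borel_measurable borel" and nn: "\<And>u. \<phi> u \<ge> 0"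
    and int: "integrable (beta_product_distribution \<alpha> q) (\<lambda>v. (\<phi> v + \<phi> (- v)) / (2 * real q * v))"
  shows "integrable (q_poisson_intensity \<alpha> q) \<phi>"
    and "(\<integral>u. \<phi> u \<partial>q_poisson_intensity \<alpha> q) = (\<integral>v. (\<phi> v + \<phi> (- v)) / (2 * real q * v) \<partial>beta_product_distribution \<alpha> q)"
proof -
  let ?\<mu> = "beta_product_distribution \<alpha> q" and ?\<nu> = "q_poisson_intensity \<alpha> q"
  have m: "\<phi> \<in> borel_measurable ?\<nu>" by (simp add: measurable_cong_sets[OF sets_q_poisson_intensity refl])
  have "(\<integral>\<^sup>+u. ennreal (\<phi> u) \<partial>?\<nu>) = (\<integral>\<^sup>+v. ennreal (1 / (2 * real q * v)) * (ennreal (\<phi> v) + ennreal (\<phi> (- v))) \<partial>?\<mu>)"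
    by (rule nn_integral_q_poisson_intensity) simp
  also have "\<dots> = (\<integral>\<^sup>+v. ennreal ((\<phi> v + \<phi> (- v)) / (2 * real q * v)) \<partial>?\<mu>)"
  proof (rule nn_integral_cong_AE)
    show "AE v in ?\<mu>. ennreal (1 / (2 * real q * v)) * (ennreal (\<phi> v) + ennreal (\<phi> (- v))) = ennreal ((\<phi> v + \<phi> (- v)) / (2 * real q * v))"
      using AE_beta_product[OF \<alpha>, of q]
    proof eventually_elim
      case (elim v)
      have "ennreal (1 / (2 * real q * v)) * ennreal (\<phi> v + \<phi> (- v)) = ennreal (1 / (2 * real q * v) * (\<phi> v + \<phi> (- v)))"
        using elim by (intro ennreal_mult'[symmetric]) auto
      then show ?case using nn by (simp add: ennreal_plus)
    qed
  qed
  also have "\<dots> = ennreal (\<integral>v. (\<phi> v + \<phi> (- v)) / (2 * real q * v) \<partial>?\<mu>)"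
  proof (rule nn_integral_eq_integral[OF int])
    show "AE v in ?\<mu>. 0 \<le> (\<phi> v + \<phi> (- v)) / (2 * real q * v)"
      using AE_beta_product[OF \<alpha>, of q] by eventually_elim (use nn in \<open>auto intro!: divide_nonneg_nonneg add_nonneg_nonneg\<close>)
  qed
  finally have eq: "(\<integral>\<^sup>+u. ennreal (\<phi> u) \<partial>?\<nu>) = ennreal (\<integral>v. (\<phi> v + \<phi> (- v)) / (2 * real q * v) \<partial>?\<mu>)" .
  have "0 \<le> (\<integral>v. (\<phi> v + \<phi> (- v)) / (2 * real q * v) \<partial>?\<mu>)"
  proof (rule integral_nonneg_AE)
    show "AE v in ?\<mu>. 0 \<le> (\<phi> v + \<phi> (- v)) / (2 * real q * v)"
      using AE_beta_product[OF \<alpha>, of q] by eventually_elim (use nn in \<open>auto intro!: divide_nonneg_nonneg add_nonneg_nonneg\<close>)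
  qed
  then have "has_bochner_integral ?\<nu> \<phi> (\<integral>v. (\<phi> v + \<phi> (- v)) / (2 * real q * v) \<partial>?\<mu>)"
    using m nn eq by (intro has_bochner_integral_nn_integral) auto
  then show "integrable ?\<nu> \<phi>" "(\<integral>u. \<phi> u \<partial>?\<nu>) = (\<integral>v. (\<phi> v + \<phi> (- v)) / (2 * real q * v) \<partial>?\<mu>)"
    by (simp_all add: has_bochner_integral_iff)
qed

text \<open>The weight \<open>1 / v\<close> gives the intensity infinite mass near 0; a function of
  order \<open>|u|\<close> compensates it.\<close>

lemma integrable_beta_product_quotient:
  fixes \<phi> :: "real \<Rightarrow> 'c::euclidean_space"
  assumes \<alpha>: "0 < \<alpha>" "\<alpha> < 2" and [measurable]: "\<phi> \<in> borel_measurable borel"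
    and le: "\<And>u. \<bar>u\<bar> \<le> 1 \<Longrightarrow> norm (\<phi> u) \<le> C * \<bar>u\<bar>" and q: "q \<ge> 1"
  shows "integrable (beta_product_distribution \<alpha> q) (\<lambda>v. (\<phi> v + \<phi> (- v)) /\<^sub>R (2 * real q * v))"
proof -
  interpret prob_space "beta_product_distribution \<alpha> q" by (rule prob_space_beta_product[OF \<alpha>])
  show ?thesis
  proof (rule integrable_const_bound[of _ C])
    show "AE v in beta_product_distribution \<alpha> q. norm ((\<phi> v + \<phi> (- v)) /\<^sub>R (2 * real q * v)) \<le> C"
      using AE_beta_product[OF \<alpha>, of q]
    proof eventually_elim
      case (elim v)
      have C: "0 \<le> C" using order_trans[OF norm_ge_zero le[of 1]] by simp
      have "norm (\<phi> v + \<phi> (- v)) \<le> C * v + C * v"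
        using le[of v] le[of "- v"] elim by (intro norm_triangle_mono) auto
      also have "\<dots> \<le> C * (2 * real q * v)"
      proof -
        have "C * v * 1 \<le> C * v * real q" using C elim q by (intro mult_left_mono) auto
        then show ?thesis by (simp add: algebra_simps)
      qed
      finally show ?case using elim q by (simp add: divide_inverse[symmetric] divide_le_eq abs_mult mult.commute)
    qed
  qed measurable
qed

lemma q_poisson_integral_real:
  fixes \<phi> :: "real \<Rightarrow> real"
  assumes \<alpha>: "0 < \<alpha>" "\<alpha> < 2" and [measurable]: "\<phi> \<in> borel_measurable borel"
    and le: "\<And>u. \<bar>u\<bar> \<le> 1 \<Longrightarrow> norm (\<phi> u) \<le> C * \<bar>u\<bar>" and q: "q \<ge> 1"
  shows "integrable (q_poisson_intensity \<alpha> q) \<phi>"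
    and "(\<integral>u. \<phi> u \<partial>q_poisson_intensity \<alpha> q) = (\<integral>v. (\<phi> v + \<phi> (- v)) / (2 * real q * v) \<partial>beta_product_distribution \<alpha> q)"
proof -
  define p n where "p u = max (\<phi> u) 0" and "n u = max (- \<phi> u) 0" for u
  have [measurable]: "p \<in> borel_measurable borel" "n \<in> borel_measurable borel" unfolding p_def[abs_def] n_def[abs_def] by measurable
  have pn: "\<phi> u = p u - n u" "p u \<ge> 0" "n u \<ge> 0" for u by (auto simp: p_def n_def)
  have b: "\<bar>u\<bar> \<le> 1 \<Longrightarrow> norm (p u) \<le> C * \<bar>u\<bar>" "\<bar>u\<bar> \<le> 1 \<Longrightarrow> norm (n u) \<le> C * \<bar>u\<bar>" for u
    using le[of u] by (auto simp: p_def n_def)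
  have ip: "integrable (beta_product_distribution \<alpha> q) (\<lambda>v. (p v + p (- v)) / (2 * real q * v))"
    and "in": "integrable (beta_product_distribution \<alpha> q) (\<lambda>v. (n v + n (- v)) / (2 * real q * v))"
    using integrable_beta_product_quotient[OF \<alpha> _ b(1) q] integrable_beta_product_quotient[OF \<alpha> _ b(2) q]
    unfolding divide_real_def[symmetric] real_scaleR_def mult.commute[of "inverse _"] by simp_all
  note P = q_poisson_integral_nonneg[OF \<alpha> _ pn(2) ip, simplified] and N = q_poisson_integral_nonneg[OF \<alpha> _ pn(3) "in", simplified]
  have eq: "\<phi> = (\<lambda>u. p u - n u)" using pn(1) by auto
  show "integrable (q_poisson_intensity \<alpha> q) \<phi>" unfolding eq using P(1) N(1) by auto
  have "(\<integral>u. \<phi> u \<partial>q_poisson_intensity \<alpha> q) = (\<integral>v. (p v + p (- v)) / (2 * real q * v) \<partial>beta_product_distribution \<alpha> q)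
     - (\<integral>v. (n v + n (- v)) / (2 * real q * v) \<partial>beta_product_distribution \<alpha> q)"
    unfolding eq using P N by simp
  also have "\<dots> = (\<integral>v. (p v + p (- v)) / (2 * real q * v) - (n v + n (- v)) / (2 * real q * v) \<partial>beta_product_distribution \<alpha> q)"
    using ip "in" by simp
  also have "\<dots> = (\<integral>v. (\<phi> v + \<phi> (- v)) / (2 * real q * v) \<partial>beta_product_distribution \<alpha> q)"
    by (intro Bochner_Integration.integral_cong refl) (simp add: pn(1) diff_divide_distrib[symmetric] algebra_simps)
  finally show "(\<integral>u. \<phi> u \<partial>q_poisson_intensity \<alpha> q) = (\<integral>v. (\<phi> v + \<phi> (- v)) / (2 * real q * v) \<partial>beta_product_distribution \<alpha> q)" .
qed

lemma q_poisson_integral_complex: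
  fixes \<phi> :: "real \<Rightarrow> complex"
  assumes \<alpha>: "0 < \<alpha>" "\<alpha> < 2" and m: "\<phi> \<in> borel_measurable borel"
    and le: "\<And>u. \<bar>u\<bar> \<le> 1 \<Longrightarrow> norm (\<phi> u) \<le> C * \<bar>u\<bar>" and q: "q \<ge> 1"
  shows "integrable (q_poisson_intensity \<alpha> q) \<phi>"
    and "(\<integral>u. \<phi> u \<partial>q_poisson_intensity \<alpha> q) = (\<integral>v. (\<phi> v + \<phi> (- v)) /\<^sub>R (2 * real q * v) \<partial>beta_product_distribution \<alpha> q)"
proof -
  have mr: "(\<lambda>u. Re (\<phi> u)) \<in> borel_measurable borel" "(\<lambda>u. Im (\<phi> u)) \<in> borel_measurable borel" using m by auto
  have lr: "\<bar>u\<bar> \<le> 1 \<Longrightarrow> norm (Re (\<phi> u)) \<le> C * \<bar>u\<bar>" "\<bar>u\<bar> \<le> 1 \<Longrightarrow> norm (Im (\<phi> u)) \<le> C * \<bar>u\<bar>" for u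
    using le[of u] abs_Re_le_cmod[of "\<phi> u"] abs_Im_le_cmod[of "\<phi> u"] by auto
  note R = q_poisson_integral_real[OF \<alpha> mr(1) lr(1) q] and I = q_poisson_integral_real[OF \<alpha> mr(2) lr(2) q]
  show i: "integrable (q_poisson_intensity \<alpha> q) \<phi>"
  proof -
    have "integrable (q_poisson_intensity \<alpha> q) (\<lambda>u. complex_of_real (Re (\<phi> u)) + \<i> * complex_of_real (Im (\<phi> u)))"
      using R(1) I(1) by (intro Bochner_Integration.integrable_add integrable_mult_right integrable_of_real)
    then show ?thesis by (simp only: complex_eq[symmetric])
  qed
  note j = integrable_beta_product_quotient[OF \<alpha> m le q]
  show "(\<integral>u. \<phi> u \<partial>q_poisson_intensity \<alpha> q) = (\<integral>v. (\<phi> v + \<phi> (- v)) /\<^sub>R (2 * real q * v) \<partial>beta_product_distribution \<alpha> q)"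
  proof (rule complex_eqI)
    have "Re (\<integral>u. \<phi> u \<partial>q_poisson_intensity \<alpha> q) = (\<integral>v. (Re (\<phi> v) + Re (\<phi> (- v))) / (2 * real q * v) \<partial>beta_product_distribution \<alpha> q)"
      by (subst integral_Re[OF i, symmetric]) (rule R(2))
    also have "\<dots> = (\<integral>v. Re ((\<phi> v + \<phi> (- v)) /\<^sub>R (2 * real q * v)) \<partial>beta_product_distribution \<alpha> q)"
      by (intro Bochner_Integration.integral_cong refl)
        (simp only: scaleR_complex.sel plus_complex.sel divide_inverse mult.commute[of "inverse _"])
    also have "\<dots> = Re (\<integral>v. (\<phi> v + \<phi> (- v)) /\<^sub>R (2 * real q * v) \<partial>beta_product_distribution \<alpha> q)"
      by (rule integral_Re[OF j])
    finally show "Re (\<integral>u. \<phi> u \<partial>q_poisson_intensity \<alpha> q) = Re (\<integral>v. (\<phi> v + \<phi> (- v)) /\<^sub>R (2 * real q * v) \<partial>beta_product_distribution \<alpha> q)" .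
    have "Im (\<integral>u. \<phi> u \<partial>q_poisson_intensity \<alpha> q) = (\<integral>v. (Im (\<phi> v) + Im (\<phi> (- v))) / (2 * real q * v) \<partial>beta_product_distribution \<alpha> q)"
      by (subst integral_Im[OF i, symmetric]) (rule I(2))
    also have "\<dots> = (\<integral>v. Im ((\<phi> v + \<phi> (- v)) /\<^sub>R (2 * real q * v)) \<partial>beta_product_distribution \<alpha> q)"
      by (intro Bochner_Integration.integral_cong refl)
        (simp only: scaleR_complex.sel plus_complex.sel divide_inverse mult.commute[of "inverse _"])
    also have "\<dots> = Im (\<integral>v. (\<phi> v + \<phi> (- v)) /\<^sub>R (2 * real q * v) \<partial>beta_product_distribution \<alpha> q)"
      by (rule integral_Im[OF j])
    finally show "Im (\<integral>u. \<phi> u \<partial>q_poisson_intensity \<alpha> q) = Im (\<integral>v. (\<phi> v + \<phi> (- v)) /\<^sub>R (2 * real q * v) \<partial>beta_product_distribution \<alpha> q)" .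
  qed
qed

lemma power2_sqrt_eq_abs: "(sqrt u)\<^sup>2 = \<bar>u\<bar>"
proof (cases "u \<ge> 0")
  case False
  then have "(sqrt (- u))\<^sup>2 = - u" by simp
  then show ?thesis using False by (simp add: real_sqrt_minus)
qed simp

lemma abs_sqrt_le_1: "\<bar>u\<bar> \<le> 1 \<Longrightarrow> \<bar>sqrt u\<bar> \<le> 1"
  using power2_sqrt_eq_abs[of u] abs_square_le_1[of "sqrt u"] by simp

text \<open>The library extends the square root to negative numbers as an odd function.\<close>

lemma signed_half_power_eq_power:
  assumes "m \<ge> 1"
  shows "signed_half_power m u = sqrt u ^ m"
proof -
  have "\<bar>u\<bar> powr (real m / 2) = \<bar>sqrt u\<bar> ^ m"
  proof (cases "u = 0")
    case False
    have "\<bar>u\<bar> powr (real m / 2) = (\<bar>u\<bar> powr (1 / 2)) ^ m"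
      using False by (simp add: powr_power)
    moreover have "\<bar>u\<bar> powr (1 / 2) = \<bar>sqrt u\<bar>"
      by (simp add: powr_half_sqrt) (simp add: abs_if real_sqrt_minus)
    ultimately show ?thesis by simp
  qed (use assms in simp)
  moreover have "sgn u * \<bar>sqrt u\<bar> = sqrt u"
    by (cases u "0::real" rule: linorder_cases) auto
  ultimately show ?thesis
    by (simp add: signed_half_power_def flip: power_mult_distrib)
qed

lemma abs_times_continuous_sqrt:
  fixes G :: "real \<Rightarrow> real"
  assumes G: "continuous_on UNIV G"
  shows "(\<lambda>u. \<bar>u\<bar> * G (sqrt u)) \<in> borel_measurable borel"
    and "\<exists>C. \<forall>u. \<bar>u\<bar> \<le> 1 \<longrightarrow> norm (\<bar>u\<bar> * G (sqrt u)) \<le> C * \<bar>u\<bar>"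
proof -
  have [measurable]: "G \<in> borel_measurable borel" using G by (rule borel_measurable_continuous_onI)
  show "(\<lambda>u. \<bar>u\<bar> * G (sqrt u)) \<in> borel_measurable borel" by measurable
  obtain C where C: "\<forall>w\<in>{-1..1}. norm (G w) \<le> C"
    using continuous_on_Icc_bound[OF continuous_on_subset[OF G subset_UNIV]] by blast
  have "norm (\<bar>u\<bar> * G (sqrt u)) \<le> C * \<bar>u\<bar>" if "\<bar>u\<bar> \<le> 1" for u
  proof -
    have "sqrt u \<in> {-1..1}" using abs_sqrt_le_1[OF that] by (simp add: abs_le_iff)
    then have "\<bar>u\<bar> * norm (G (sqrt u)) \<le> \<bar>u\<bar> * C" using C by (intro mult_left_mono) auto
    then show ?thesis by (simp add: abs_mult mult.commute)
  qed
  then show "\<exists>C. \<forall>u. \<bar>u\<bar> \<le> 1 \<longrightarrow> norm (\<bar>u\<bar> * G (sqrt u)) \<le> C * \<bar>u\<bar>" by blast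
qed

text \<open>A point \<open>u\<close> of the process stands for a cycle weight
  \<open>w = sqrt u\<close>, with its sign, so that \<open>|u| * G (sqrt u)\<close> is the
  counterpart of \<open>w\<^sup>2 * G w\<close>. The factor \<open>|u|\<close> cancels the
  \<open>1 / u\<close> of the intensity.\<close>

lemma q_poisson_abs_times:
  fixes G :: "real \<Rightarrow> real"
  assumes \<alpha>: "0 < \<alpha>" "\<alpha> < 2" and q: "q \<ge> 1" and G: "continuous_on UNIV G"
  shows "integrable (q_poisson_intensity \<alpha> q) (\<lambda>u. \<bar>u\<bar> * G (sqrt u))"
    and "(\<integral>u. \<bar>u\<bar> * G (sqrt u) \<partial>q_poisson_intensity \<alpha> q) =
      (\<integral>v. (G (sqrt v) + G (- sqrt v)) / 2 \<partial>beta_product_distribution \<alpha> q) / real q"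
proof -
  obtain C where C: "\<And>u. \<bar>u\<bar> \<le> 1 \<Longrightarrow> norm (\<bar>u\<bar> * G (sqrt u)) \<le> C * \<bar>u\<bar>"
    using abs_times_continuous_sqrt(2)[OF G] by blast
  note I = q_poisson_integral_real[OF \<alpha> abs_times_continuous_sqrt(1)[OF G] C q]
  have [measurable]: "G \<in> borel_measurable borel" using G by (rule borel_measurable_continuous_onI)
  show "integrable (q_poisson_intensity \<alpha> q) (\<lambda>u. \<bar>u\<bar> * G (sqrt u))" by (rule I(1))
  have "(\<integral>u. \<bar>u\<bar> * G (sqrt u) \<partial>q_poisson_intensity \<alpha> q) =
      (\<integral>v. (\<bar>v\<bar> * G (sqrt v) + \<bar>- v\<bar> * G (sqrt (- v))) / (2 * real q * v) \<partial>beta_product_distribution \<alpha> q)"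
    by (rule I(2))
  also have "\<dots> = (\<integral>v. ((G (sqrt v) + G (- sqrt v)) / 2) / real q \<partial>beta_product_distribution \<alpha> q)"
  proof (rule integral_cong_AE)
    show "AE v in beta_product_distribution \<alpha> q. (\<bar>v\<bar> * G (sqrt v) + \<bar>- v\<bar> * G (sqrt (- v))) / (2 * real q * v) = ((G (sqrt v) + G (- sqrt v)) / 2) / real q"
      using AE_beta_product[OF \<alpha>, of q]
    proof eventually_elim
      case (elim v)
      have "(v * a + v * b) / (2 * real q * v) = ((a + b) / 2) / real q" for a b :: real
        using elim q by (simp add: field_simps)
      then show ?case using elim by (simp add: real_sqrt_minus)
    qed
  qed measurable
  finally show "(\<integral>u. \<bar>u\<bar> * G (sqrt u) \<partial>q_poisson_intensity \<alpha> q) =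
      (\<integral>v. (G (sqrt v) + G (- sqrt v)) / 2 \<partial>beta_product_distribution \<alpha> q) / real q"
    by simp
qed

text \<open>The base \<open>1 - v\<close> lies almost surely in \<open>[0, 1)\<close>, as the Beta
  product gives no mass to 0.\<close>

lemma one_minus_power_limit:
  assumes \<alpha>: "0 < \<alpha>" "\<alpha> < 2"
  shows "(\<lambda>N. \<integral>v. ((1 - v) ^ N)\<^sup>2 \<partial>beta_product_distribution \<alpha> q) \<longlonglongrightarrow> 0"
proof -
  interpret prob_space "beta_product_distribution \<alpha> q" by (rule prob_space_beta_product[OF \<alpha>])
  have "(\<lambda>N. \<integral>v. ((1 - v) ^ N)\<^sup>2 \<partial>beta_product_distribution \<alpha> q) \<longlonglongrightarrow> (\<integral>v. 0 \<partial>beta_product_distribution \<alpha> q)"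
  proof (rule integral_dominated_convergence[where w = "\<lambda>_. 1"])
    show "AE v in beta_product_distribution \<alpha> q. (\<lambda>N. ((1 - v) ^ N)\<^sup>2) \<longlonglongrightarrow> 0"
      using AE_beta_product[OF \<alpha>, of q]
    proof eventually_elim
      case (elim v)
      then have "(\<lambda>N. ((1 - v) ^ N)\<^sup>2) \<longlonglongrightarrow> 0\<^sup>2" by (intro tendsto_power LIMSEQ_realpow_zero) auto
      then show ?case by simp
    qed
    show "AE v in beta_product_distribution \<alpha> q. norm (((1 - v) ^ N)\<^sup>2) \<le> 1" for N
      using AE_beta_product[OF \<alpha>, of q] by eventually_elim (simp add: power_le_one)
  qed auto
  then show ?thesis by simp
qed

text \<open>The continuous extension of \<open>(cis x - 1) / x\<close>. It exhibits
  \<open>cis (w\<^sup>2 * G w) - 1\<close> as \<open>w\<^sup>2\<close> times a continuous function,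
  the form to which the limit over cycles applies.\<close>

definition cis_quotient :: "real \<Rightarrow> complex" where
  "cis_quotient x = (if x = 0 then \<i> else (cis x - 1) / of_real x)"

lemma cis_quotient: "of_real x * cis_quotient x = cis x - 1"
  by (simp add: cis_quotient_def)

lemma continuous_cis_quotient: "continuous_on UNIV cis_quotient"
proof (rule continuous_at_imp_continuous_on, rule ballI)
  fix x :: real
  show "isCont cis_quotient x"
  proof (cases "x = 0")
    case True
    have le: "norm (cis_quotient y - \<i>) \<le> \<bar>y\<bar> / 2" for y
    proof (cases "y = 0")
      case False
      then have "cis_quotient y - \<i> = (cis y - 1 - \<i> * of_real y) / of_real y"
        by (simp add: cis_quotient_def diff_divide_distrib)
      also have "norm \<dots> \<le> (y\<^sup>2 / 2) / \<bar>y\<bar>"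
        unfolding norm_divide norm_of_real by (intro divide_right_mono norm_cis_second_order) auto
      also have "\<dots> = \<bar>y\<bar> / 2" using False by (simp add: power2_eq_square abs_if)
      finally show ?thesis .
    qed (simp add: cis_quotient_def)
    have "((\<lambda>y :: real. \<bar>y\<bar> / 2) \<longlongrightarrow> \<bar>0\<bar> / 2) (at 0)" by (intro tendsto_intros) simp
    then have "((\<lambda>y. cis_quotient y - \<i>) \<longlongrightarrow> 0) (at 0)"
      by (intro Lim_null_comparison[OF always_eventually[OF allI[OF le]]]) simp
    then have "(cis_quotient \<longlongrightarrow> \<i>) (at 0)" by (rule LIM_zero_cancel)
    moreover have "cis_quotient 0 = \<i>" by (simp add: cis_quotient_def)
    ultimately show ?thesis unfolding True isCont_def by (simp only:)
  next
    case False
    have "continuous_on (- {0}) (\<lambda>y. (cis y - 1) / complex_of_real y)" by (intro continuous_intros) auto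
    then have "continuous_on (- {0}) cis_quotient"
      by (rule continuous_on_eq) (simp add: cis_quotient_def)
    moreover have "open (- {0 :: real})" by (rule open_Compl) simp
    ultimately show ?thesis using False by (simp add: continuous_on_eq_continuous_at)
  qed
qed

context symmetric_iid_array
begin

text \<open>The Poisson approximation reduces the claim to convergence of the exponent, and the
  exponent is a sum over cycles of the means of \<open>w\<^sup>2\<close> times a continuous function
  of \<open>w\<close>.\<close>

lemma cycle_sum_char_limit:
  fixes G :: "nat \<Rightarrow> real \<Rightarrow> real"
  assumes \<alpha>: "0 < \<alpha>" "\<alpha> < 2" and rv: "regularly_varying_tail M (X 1 1) \<alpha>"
    and G: "\<And>q. continuous_on UNIV (G q)"
  shows "(\<lambda>n. \<integral>\<omega>. cis (\<Sum>E\<in>all_cycles n K. (W n E \<omega>)\<^sup>2 * G (card E) (W n E \<omega>)) \<partial>M) \<longlonglongrightarrow>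
    exp (\<Sum>q\<in>{1..K}. \<integral>u. (cis (\<bar>u\<bar> * G q (sqrt u)) - 1) \<partial>q_poisson_intensity \<alpha> q)"
proof -
  have "\<forall>q. \<exists>b. \<forall>w\<in>{-1..1}. norm (G q w) \<le> b"
    using continuous_on_Icc_bound[OF continuous_on_subset[OF G subset_UNIV]] by blast
  then obtain b where b: "\<And>q w. w \<in> {-1..1} \<Longrightarrow> \<bar>G q w\<bar> \<le> b q" unfolding real_norm_def by metis
  have b0: "0 \<le> b q" for q using b[of 0 q] by simp
  have [measurable]: "G q \<in> borel_measurable borel" for q using G by (rule borel_measurable_continuous_onI)
  \<comment> \<open>Cutting off the lengths above \<open>K\<close> yields one bound \<open>B\<close>
    for all \<open>q\<close>.\<close>
  define h where "h q w = (if q \<in> {1..K} then w\<^sup>2 * G q w else 0)" for q w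
  define B where "B = (\<Sum>q\<in>{1..K}. b q)"
  have B0: "B \<ge> 0" unfolding B_def using b0 by (intro sum_nonneg) auto
  have hm: "h q \<in> borel_measurable borel" for q unfolding h_def by measurable
  have hB: "\<bar>h q w\<bar> \<le> B * w\<^sup>2" if "\<bar>w\<bar> \<le> 1" for q w
  proof (cases "q \<in> {1..K}")
    case True
    have "b q \<le> B" unfolding B_def using True b0 by (intro member_le_sum) auto
    moreover have "\<bar>G q w\<bar> \<le> b q" using b[of w q] that by (simp add: abs_le_iff)
    ultimately have "w\<^sup>2 * \<bar>G q w\<bar> \<le> w\<^sup>2 * B" by (intro mult_left_mono) auto
    then show ?thesis using True by (simp add: h_def abs_mult mult.commute)
  next
    case False
    then have "h q w = 0" unfolding h_def by (rule if_not_P)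
    then show ?thesis using B0 by simp
  qed
  have hE: "h (card E) w = w\<^sup>2 * G (card E) w" if "E \<in> all_cycles n K" for n E w
    using all_cyclesD(3,4)[OF that] by (simp add: h_def)
  define \<psi> where "\<psi> n = (\<integral>\<omega>. cis (\<Sum>E\<in>all_cycles n K. h (card E) (W n E \<omega>)) \<partial>M)" for n
  define A where "A n = (\<Sum>E\<in>all_cycles n K. \<integral>\<omega>. cis (h (card E) (W n E \<omega>)) - 1 \<partial>M)" for n
  define L where "L = (\<Sum>q\<in>{1..K}. \<integral>u. (cis (\<bar>u\<bar> * G q (sqrt u)) - 1) \<partial>q_poisson_intensity \<alpha> q)"
  have approx: "(\<lambda>n. \<psi> n - exp (A n)) \<longlonglongrightarrow> 0"
  proof (rule Lim_null_comparison)
    let ?c = "exp (2 * (B * (real K * fact (Suc K)))) * (2 * B\<^sup>2 * (real K ^ 2 * fact (Suc (2 * K))))"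
    show "eventually (\<lambda>n. norm (\<psi> n - exp (A n)) \<le> ?c * (2 / real n)) sequentially"
      using eventually_ge_at_top[of "4 * K"] eventually_ge_at_top[of 2]
    proof eventually_elim
      case (elim n)
      from cycle_sum_char_approx[of h B, OF hm hB B0 elim]
      show ?case unfolding \<psi>_def A_def by (simp only: mult.assoc mult.commute mult.left_commute)
    qed
    have "(\<lambda>n. ?c * (2 / real n)) \<longlonglongrightarrow> ?c * 0" by (intro tendsto_mult_left lim_const_over_n)
    then show "(\<lambda>n. ?c * (2 / real n)) \<longlonglongrightarrow> 0" by simp
  qed
  have "A \<longlonglongrightarrow> L"
    unfolding A_def[abs_def] sum_all_cycles L_def
  proof (rule tendsto_sum)
    fix q assume q: "q \<in> {1..K}"
    then have q1: "q \<ge> 1" by simp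
    define kk where "kk w = of_real (G q w) * cis_quotient (w\<^sup>2 * G q w)" for w
    have kc: "continuous_on UNIV kk"
      unfolding kk_def by (intro continuous_intros G continuous_on_compose2[OF continuous_cis_quotient]) auto
    have kk: "of_real (w\<^sup>2) * kk w = cis (w\<^sup>2 * G q w) - 1" for w
      using cis_quotient[of "w\<^sup>2 * G q w"] by (simp add: kk_def mult_ac)
    have [measurable]: "kk \<in> borel_measurable borel" using kc by (rule borel_measurable_continuous_onI)
    have "(\<Sum>E\<in>cycle_sets n q. \<integral>\<omega>. cis (h (card E) (W n E \<omega>)) - 1 \<partial>M) = (\<Sum>E\<in>cycle_sets n q. \<integral>\<omega>. of_real ((W n E \<omega>)\<^sup>2) * kk (W n E \<omega>) \<partial>M)" for n
    proof (rule sum.cong[OF refl])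
      fix E assume "E \<in> cycle_sets n q"
      then have "card E = q" by (rule cycle_setsD(1))
      then show "(\<integral>\<omega>. cis (h (card E) (W n E \<omega>)) - 1 \<partial>M) = (\<integral>\<omega>. of_real ((W n E \<omega>)\<^sup>2) * kk (W n E \<omega>) \<partial>M)"
        unfolding kk using q by (simp add: h_def)
    qed
    moreover have "(\<integral>u. (cis (\<bar>u\<bar> * G q (sqrt u)) - 1) \<partial>q_poisson_intensity \<alpha> q) =
      (\<integral>v. (kk (sqrt v) + kk (- sqrt v)) / 2 \<partial>beta_product_distribution \<alpha> q) / of_nat q"
    proof -
      have m: "(\<lambda>u. cis (\<bar>u\<bar> * G q (sqrt u)) - 1) \<in> borel_measurable borel" unfolding cis_conv_exp by measurable
      obtain C where C: "\<forall>u. \<bar>u\<bar> \<le> 1 \<longrightarrow> norm (\<bar>u\<bar> * G q (sqrt u)) \<le> C * \<bar>u\<bar>"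
        using abs_times_continuous_sqrt(2)[OF G] by blast
      have le: "norm (cis (\<bar>u\<bar> * G q (sqrt u)) - 1) \<le> C * \<bar>u\<bar>" if "\<bar>u\<bar> \<le> 1" for u
        using C that norm_cis_minus_one_le[of "\<bar>u\<bar> * G q (sqrt u)"] by (metis order_trans real_norm_def)
      have "(\<integral>u. (cis (\<bar>u\<bar> * G q (sqrt u)) - 1) \<partial>q_poisson_intensity \<alpha> q) =
        (\<integral>v. ((cis (\<bar>v\<bar> * G q (sqrt v)) - 1) + (cis (\<bar>- v\<bar> * G q (sqrt (- v))) - 1)) /\<^sub>R (2 * real q * v) \<partial>beta_product_distribution \<alpha> q)"
        by (rule q_poisson_integral_complex(2)[OF \<alpha> m le q1])
      also have "\<dots> = (\<integral>v. ((kk (sqrt v) + kk (- sqrt v)) / 2) / of_nat q \<partial>beta_product_distribution \<alpha> q)"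
      proof (rule integral_cong_AE)
        show "AE v in beta_product_distribution \<alpha> q. ((cis (\<bar>v\<bar> * G q (sqrt v)) - 1) + (cis (\<bar>- v\<bar> * G q (sqrt (- v))) - 1)) /\<^sub>R (2 * real q * v) =
          ((kk (sqrt v) + kk (- sqrt v)) / 2) / of_nat q"
          using AE_beta_product[OF \<alpha>, of q]
        proof eventually_elim
          case (elim v)
          have e: "cis (\<bar>v\<bar> * G q (sqrt v)) - 1 = of_real v * kk (sqrt v)" "cis (\<bar>- v\<bar> * G q (sqrt (- v))) - 1 = of_real v * kk (- sqrt v)"
            using kk[of "sqrt v"] kk[of "- sqrt v"] elim by (simp_all add: real_sqrt_minus)
          have "(of_real v * a + of_real v * b) /\<^sub>R (2 * real q * v) = ((a + b) / 2) / of_nat q" for a b :: complex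
            using elim q1 by (simp add: scaleR_conv_of_real field_simps)
          then show ?case unfolding e .
        qed
        show "(\<lambda>v. ((cis (\<bar>v\<bar> * G q (sqrt v)) - 1) + (cis (\<bar>- v\<bar> * G q (sqrt (- v))) - 1)) /\<^sub>R (2 * real q * v)) \<in> borel_measurable (beta_product_distribution \<alpha> q)"
          unfolding cis_conv_exp by measurable
      qed measurable
      finally show ?thesis by simp
    qed
    ultimately show "(\<lambda>n. \<Sum>E\<in>cycle_sets n q. \<integral>\<omega>. cis (h (card E) (W n E \<omega>)) - 1 \<partial>M) \<longlonglongrightarrow>
      (\<integral>u. (cis (\<bar>u\<bar> * G q (sqrt u)) - 1) \<partial>q_poisson_intensity \<alpha> q)"
      using cycle_complex_limit[OF \<alpha> rv q1 kc] by (simp only:)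
  qed
  then have "(\<lambda>n. (\<psi> n - exp (A n)) + exp (A n)) \<longlonglongrightarrow> 0 + exp L"
    by (intro tendsto_add approx tendsto_exp)
  then have "\<psi> \<longlonglongrightarrow> exp L" by simp
  moreover have "\<psi> = (\<lambda>n. \<integral>\<omega>. cis (\<Sum>E\<in>all_cycles n K. (W n E \<omega>)\<^sup>2 * G (card E) (W n E \<omega>)) \<partial>M)"
    unfolding \<psi>_def by (simp add: hE cong: sum.cong)
  ultimately show ?thesis by (simp add: L_def)
qed

end

section \<open>Joint convergence of the traces\<close>

text \<open>An exchange of the limits in \<open>n\<close> and \<open>N\<close>: for fixed
  \<open>N\<close> the error need not vanish, only its limit \<open>\<delta> N\<close> has to be
  small for large \<open>N\<close>.\<close>

lemma tendsto_by_approximation: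
  fixes a :: "nat \<Rightarrow> 'v::real_normed_vector"
  assumes le: "\<And>N. eventually (\<lambda>n. norm (a n - b N n) \<le> \<epsilon> N n) sequentially"
    and \<epsilon>: "\<And>N. \<epsilon> N \<longlonglongrightarrow> \<delta> N" and \<delta>: "\<delta> \<longlonglongrightarrow> 0"
    and b: "\<And>N. b N \<longlonglongrightarrow> c N" and c: "c \<longlonglongrightarrow> l"
  shows "a \<longlonglongrightarrow> l"
proof (rule tendstoI)
  fix e :: real assume e: "e > 0"
  have "eventually (\<lambda>N. \<delta> N < e / 3 \<and> dist (c N) l < e / 3) sequentially"
    using order_tendstoD(2)[OF \<delta>, of "e / 3"] tendstoD[OF c, of "e / 3"] e by (simp add: eventually_conj_iff)
  then obtain N where N: "\<delta> N < e / 3" "dist (c N) l < e / 3" by (auto simp: eventually_sequentially)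
  have e3: "0 < e / 3" using e by simp
  show "eventually (\<lambda>n. dist (a n) l < e) sequentially"
    using le[of N] order_tendstoD(2)[OF \<epsilon> N(1)] tendstoD[OF b[of N] e3]
  proof eventually_elim
    case (elim n)
    have "dist (a n) l \<le> dist (a n) (b N n) + dist (b N n) (c N) + dist (c N) l" by metric
    also have "\<dots> < e" using elim N e by (simp add: dist_norm)
    finally show ?case .
  qed
qed

lemma (in prob_space) integrable_square_bounded_sum:
  fixes f :: "'i \<Rightarrow> 'a \<Rightarrow> real"
  assumes m: "\<And>i. i \<in> I \<Longrightarrow> f i \<in> borel_measurable M" and le: "\<And>i \<omega>. i \<in> I \<Longrightarrow> \<bar>f i \<omega>\<bar> \<le> 1"
  shows "integrable M (\<lambda>\<omega>. (\<Sum>i\<in>I. f i \<omega>)\<^sup>2)"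
proof (rule integrable_const_bound[of _ "(real (card I))\<^sup>2"])
  have "\<bar>\<Sum>i\<in>I. f i \<omega>\<bar> \<le> real (card I)" for \<omega>
    using sum_bounded_above[of I "\<lambda>i. \<bar>f i \<omega>\<bar>" 1] le by (intro order_trans[OF sum_abs]) simp
  then have "(\<Sum>i\<in>I. f i \<omega>)\<^sup>2 \<le> (real (card I))\<^sup>2" for \<omega> by (metis abs_le_square_iff abs_of_nat)
  then show "AE \<omega> in M. norm ((\<Sum>i\<in>I. f i \<omega>)\<^sup>2) \<le> (real (card I))\<^sup>2" by simp
  show "(\<lambda>\<omega>. (\<Sum>i\<in>I. f i \<omega>)\<^sup>2) \<in> borel_measurable M" using m by measurable
qed

text \<open>In the combination of traces with coefficients \<open>t\<close>, the cycles of length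
  \<open>q\<close> enter linearly through the indices with \<open>k i = q\<close>; the factor
  \<open>q\<close> counts rotations.\<close>

definition linear_coeff :: "('l::finite \<Rightarrow> real) \<Rightarrow> ('l \<Rightarrow> nat) \<Rightarrow> nat \<Rightarrow> real" where
  "linear_coeff t k q = real q * (\<Sum>i\<in>UNIV. if k i = q then t i else 0)"

text \<open>The other contributions of the cycles of length \<open>q\<close>, divided by
  \<open>w\<^sup>2\<close>. The subtraction of 2 is not truncated: a proper divisor of a positive
  \<open>k i\<close> has quotient at least 2.\<close>

definition higher_part :: "('l::finite \<Rightarrow> real) \<Rightarrow> ('l \<Rightarrow> nat) \<Rightarrow> nat \<Rightarrow> real \<Rightarrow> real" where
  "higher_part t k q w = real q * (\<Sum>i\<in>UNIV. if q dvd k i \<and> k i \<noteq> q then t i * w ^ (k i div q - 2) else 0)"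

lemma div_ge_2:
  assumes "q dvd m" "m \<noteq> q" "m \<ge> (1::nat)"
  shows "m div q \<ge> 2"
proof -
  obtain r where r: "m = q * r" using assms(1) by blast
  then have "r \<noteq> 0" "r \<noteq> 1" "q > 0" using assms by auto
  then show ?thesis using r by simp
qed

lemma divisor_part_eq:
  assumes k: "\<And>i. k i \<ge> 1"
  shows "real q * (\<Sum>i\<in>UNIV. if q dvd k i then t i * w ^ (k i div q) else 0) =
    linear_coeff t k q * w + w\<^sup>2 * higher_part t k q w"
proof -
  have "(if q dvd k i then t i * w ^ (k i div q) else 0) =
    (if k i = q then t i else 0) * w + w\<^sup>2 * (if q dvd k i \<and> k i \<noteq> q then t i * w ^ (k i div q - 2) else 0)" for i
  proof (cases "q dvd k i \<and> k i \<noteq> q")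
    case True
    then have "k i div q = 2 + (k i div q - 2)" using div_ge_2[of q "k i"] k[of i] by simp
    then have "w ^ (k i div q) = w\<^sup>2 * w ^ (k i div q - 2)" by (metis power_add)
    then show ?thesis using True by simp
  next
    case False
    then show ?thesis using k[of i] by auto
  qed
  then show ?thesis
    unfolding linear_coeff_def higher_part_def
    by (simp only: sum.distrib sum_distrib_right[symmetric] sum_distrib_left[symmetric])
      (simp only: distrib_left mult.assoc mult.left_commute)
qed

text \<open>\<open>F\<close> abstracts from the two uses, the traces for finite \<open>n\<close> and
  the limit family.\<close>

lemma sum_divisors_swap:
  fixes t :: "'l::finite \<Rightarrow> real" and F :: "nat \<Rightarrow> nat \<Rightarrow> real"
  assumes k: "\<And>i. k i \<ge> 1" and K: "\<And>i. k i \<le> K"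
  shows "(\<Sum>i\<in>UNIV. t i * (\<Sum>q | q dvd k i. F q (k i div q))) =
    (\<Sum>q\<in>{1..K}. \<Sum>i\<in>UNIV. if q dvd k i then t i * F q (k i div q) else 0)"
proof -
  have "(\<Sum>q | q dvd k i. F q (k i div q)) = (\<Sum>q\<in>{1..K}. if q dvd k i then F q (k i div q) else 0)" for i
  proof -
    have k0: "0 < k i" using k[of i] by linarith
    have "1 \<le> q \<and> q \<le> K" if "q dvd k i" for q
      using dvd_imp_le[OF that k0] dvd_pos_nat[OF k0 that] K[of i] by linarith
    then have "{q. q dvd k i} = {q \<in> {1..K}. q dvd k i}" by auto
    then have "(\<Sum>q | q dvd k i. F q (k i div q)) = (\<Sum>q\<in>{q \<in> {1..K}. q dvd k i}. F q (k i div q))"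
      by (rule sum.cong) (rule refl)
    also have "\<dots> = (\<Sum>q\<in>{1..K}. if q dvd k i then F q (k i div q) else 0)"
      by (rule sum.inter_filter) simp
    finally show ?thesis .
  qed
  then have "(\<Sum>i\<in>UNIV. t i * (\<Sum>q | q dvd k i. F q (k i div q))) =
    (\<Sum>i\<in>UNIV. \<Sum>q\<in>{1..K}. if q dvd k i then t i * F q (k i div q) else 0)"
    by (simp only: sum_distrib_left if_distrib[of "(*) _"] mult_zero_right)
  also have "\<dots> = (\<Sum>q\<in>{1..K}. \<Sum>i\<in>UNIV. if q dvd k i then t i * F q (k i div q) else 0)"
    by (rule sum.swap)
  finally show ?thesis .
qed

text \<open>The polynomial \<open>(w - trunc N w) / w\<^sup>2\<close>: it gives the truncated linear
  term the form \<open>w\<^sup>2 * G w\<close> that the Poisson approximation admits.\<close>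

definition geometric_part :: "nat \<Rightarrow> real \<Rightarrow> real" where
  "geometric_part N w = w * (\<Sum>j<N. (1 - w\<^sup>2) ^ j)"

lemma power2_times_geometric_part: "w\<^sup>2 * geometric_part N w = w - trunc N w"
proof -
  have "w\<^sup>2 * (\<Sum>j<N. (1 - w\<^sup>2) ^ j) = 1 - (1 - w\<^sup>2) ^ N"
    using one_diff_power_eq[of "1 - w\<^sup>2" N] by simp
  then have "w * (w\<^sup>2 * (\<Sum>j<N. (1 - w\<^sup>2) ^ j)) = w * (1 - (1 - w\<^sup>2) ^ N)" by simp
  then show ?thesis by (simp add: geometric_part_def trunc_def right_diff_distrib mult.left_commute)
qed

lemma continuous_geometric_part: "continuous_on UNIV (geometric_part N)"
  unfolding geometric_part_def[abs_def] by (intro continuous_intros)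

lemma continuous_higher_part: "continuous_on UNIV (higher_part t k q)"
proof -
  have "higher_part t k q = (\<lambda>w. real q * (\<Sum>i\<in>UNIV. (if q dvd k i \<and> k i \<noteq> q then t i else 0) * w ^ (k i div q - 2)))"
    unfolding higher_part_def[abs_def] by (intro ext arg_cong2[where f = "(*)"] refl sum.cong) simp
  then show ?thesis by (simp only:) (intro continuous_intros)
qed

text \<open>The truncated linear part is integrable and odd, so its integral against the symmetric
  intensity is 0, and the compensation is inserted for free.\<close>

lemma q_poisson_exponent_truncated:
  assumes \<alpha>: "0 < \<alpha>" "\<alpha> < 2" and q: "q \<ge> 1" and H: "continuous_on UNIV H"
  shows "(\<integral>u. (cis (\<bar>u\<bar> * (c * geometric_part N (sqrt u) + H (sqrt u))) - 1) \<partial>q_poisson_intensity \<alpha> q) =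
    poisson_exponent (q_poisson_intensity \<alpha> q) (\<lambda>u. \<bar>u\<bar> * (c * geometric_part N (sqrt u))) (\<lambda>u. \<bar>u\<bar> * H (sqrt u))"
proof -
  let ?\<nu> = "q_poisson_intensity \<alpha> q"
  have cG: "continuous_on UNIV (\<lambda>w. c * geometric_part N w)"
    by (intro continuous_intros continuous_geometric_part)
  have cGH: "continuous_on UNIV (\<lambda>w. c * geometric_part N w + H w)" by (intro continuous_intros cG H)
  note IG = q_poisson_abs_times[OF \<alpha> q cG] and IGH = q_poisson_abs_times(1)[OF \<alpha> q cGH]
  have "geometric_part N (- w) = - geometric_part N w" for w by (simp add: geometric_part_def)
  then have 0: "(\<integral>u. \<bar>u\<bar> * (c * geometric_part N (sqrt u)) \<partial>?\<nu>) = 0" unfolding IG(2) by simp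
  have i1: "integrable ?\<nu> (\<lambda>u. cis (\<bar>u\<bar> * (c * geometric_part N (sqrt u) + H (sqrt u))) - 1)"
  proof (rule Bochner_Integration.integrable_bound[OF IGH])
    show "(\<lambda>u. cis (\<bar>u\<bar> * (c * geometric_part N (sqrt u) + H (sqrt u))) - 1) \<in> borel_measurable ?\<nu>"
    proof (rule measurable_compose[OF borel_measurable_integrable[OF IGH], of "\<lambda>x. cis x - 1"])
      show "(\<lambda>x. cis x - 1) \<in> borel_measurable borel" unfolding cis_conv_exp by measurable
    qed
  qed (simp add: norm_cis_minus_one_le[simplified])
  have i2: "integrable ?\<nu> (\<lambda>u. \<i> * complex_of_real (\<bar>u\<bar> * (c * geometric_part N (sqrt u))))"
    by (intro integrable_mult_right integrable_of_real IG(1))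
  have "(\<integral>u. \<i> * complex_of_real (\<bar>u\<bar> * (c * geometric_part N (sqrt u))) \<partial>?\<nu>) = 0"
    by (simp only: integral_mult_right_zero integral_complex_of_real 0) simp
  with i1 i2 show ?thesis
    unfolding poisson_exponent_def distrib_left[symmetric] by (simp only: Bochner_Integration.integral_diff) simp
qed

text \<open>The squared L2 distance to the full linear term is explicit: a multiple of the integral
  of \<open>(1 - v) ^ (2 * N)\<close> against the Beta product.\<close>

lemma poisson_exponent_truncated_tendsto:
  assumes \<alpha>: "0 < \<alpha>" "\<alpha> < 2" and q: "q \<ge> 1" and H: "continuous_on UNIV H"
  shows "(\<lambda>N. poisson_exponent (q_poisson_intensity \<alpha> q) (\<lambda>u. \<bar>u\<bar> * (c * geometric_part N (sqrt u))) (\<lambda>u. \<bar>u\<bar> * H (sqrt u)))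
    \<longlonglongrightarrow> poisson_exponent (q_poisson_intensity \<alpha> q) (\<lambda>u. c * sqrt u) (\<lambda>u. \<bar>u\<bar> * H (sqrt u))"
proof (rule poisson_exponent_tendsto)
  let ?\<nu> = "q_poisson_intensity \<alpha> q"
  have [measurable]: "geometric_part N \<in> borel_measurable borel" for N
    by (rule borel_measurable_continuous_onI[OF continuous_geometric_part])
  show "(\<lambda>u. c * sqrt u) \<in> borel_measurable ?\<nu>" "(\<lambda>u. \<bar>u\<bar> * (c * geometric_part N (sqrt u))) \<in> borel_measurable ?\<nu>" for N
    by measurable
  have "continuous_on UNIV (\<lambda>w :: real. c\<^sup>2)" by simp
  from q_poisson_abs_times(1)[OF \<alpha> q this] show "integrable ?\<nu> (\<lambda>u. (c * sqrt u)\<^sup>2)"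
    by (simp only: power_mult_distrib power2_sqrt_eq_abs mult.commute)
  have sq: "integrable ?\<nu> (\<lambda>u. (\<bar>u\<bar> * G (sqrt u))\<^sup>2)" if "continuous_on UNIV G" for G
  proof -
    have "continuous_on UNIV (\<lambda>w. w\<^sup>2 * (G w)\<^sup>2)" by (intro continuous_intros that)
    from q_poisson_abs_times(1)[OF \<alpha> q this] show ?thesis
      by (simp only: power_mult_distrib power2_sqrt_eq_abs power2_eq_square[of "\<bar>_\<bar>"] mult.assoc)
  qed
  show "integrable ?\<nu> (\<lambda>u. (\<bar>u\<bar> * (c * geometric_part N (sqrt u)))\<^sup>2)" for N
    by (rule sq) (intro continuous_intros continuous_geometric_part)
  show "integrable ?\<nu> (\<lambda>u. (\<bar>u\<bar> * H (sqrt u))\<^sup>2)" by (rule sq[OF H])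
  show "integrable ?\<nu> (\<lambda>u. \<bar>u\<bar> * H (sqrt u))" by (rule q_poisson_abs_times(1)[OF \<alpha> q H])
  have "(\<integral>u. (\<bar>u\<bar> * (c * geometric_part N (sqrt u)) - c * sqrt u)\<^sup>2 \<partial>?\<nu>) =
    c\<^sup>2 * (\<integral>v. ((1 - v) ^ N)\<^sup>2 \<partial>beta_product_distribution \<alpha> q) / real q" for N
  proof -
    have c: "continuous_on UNIV (\<lambda>w :: real. c\<^sup>2 * ((1 - w\<^sup>2) ^ N)\<^sup>2)" by (intro continuous_intros)
    have "(\<bar>u\<bar> * (c * geometric_part N (sqrt u)) - c * sqrt u)\<^sup>2 = \<bar>u\<bar> * (c\<^sup>2 * ((1 - (sqrt u)\<^sup>2) ^ N)\<^sup>2)" for u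
    proof -
      have "\<bar>u\<bar> * (c * geometric_part N (sqrt u)) - c * sqrt u = c * ((sqrt u)\<^sup>2 * geometric_part N (sqrt u) - sqrt u)"
        by (simp add: power2_sqrt_eq_abs algebra_simps)
      also have "\<dots> = - (c * (sqrt u * (1 - (sqrt u)\<^sup>2) ^ N))"
        unfolding power2_times_geometric_part by (simp add: trunc_def)
      finally show ?thesis
        by (simp only: power2_minus power_mult_distrib power2_sqrt_eq_abs mult.left_commute)
    qed
    then have "(\<integral>u. (\<bar>u\<bar> * (c * geometric_part N (sqrt u)) - c * sqrt u)\<^sup>2 \<partial>?\<nu>) =
      (\<integral>v. (c\<^sup>2 * ((1 - (sqrt v)\<^sup>2) ^ N)\<^sup>2 + c\<^sup>2 * ((1 - (- sqrt v)\<^sup>2) ^ N)\<^sup>2) / 2 \<partial>beta_product_distribution \<alpha> q) / real q"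
      using q_poisson_abs_times(2)[OF \<alpha> q c] by (simp only:)
    also have "(\<integral>v. (c\<^sup>2 * ((1 - (sqrt v)\<^sup>2) ^ N)\<^sup>2 + c\<^sup>2 * ((1 - (- sqrt v)\<^sup>2) ^ N)\<^sup>2) / 2 \<partial>beta_product_distribution \<alpha> q) =
      (\<integral>v. c\<^sup>2 * ((1 - v) ^ N)\<^sup>2 \<partial>beta_product_distribution \<alpha> q)"
    proof (rule integral_cong_AE)
      show "AE v in beta_product_distribution \<alpha> q.
        (c\<^sup>2 * ((1 - (sqrt v)\<^sup>2) ^ N)\<^sup>2 + c\<^sup>2 * ((1 - (- sqrt v)\<^sup>2) ^ N)\<^sup>2) / 2 = c\<^sup>2 * ((1 - v) ^ N)\<^sup>2"
        using AE_beta_product[OF \<alpha>, of q] by eventually_elim simp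
    qed measurable
    finally show ?thesis by simp
  qed
  moreover have "(\<lambda>N. c\<^sup>2 * (\<integral>v. ((1 - v) ^ N)\<^sup>2 \<partial>beta_product_distribution \<alpha> q) / real q) \<longlonglongrightarrow> c\<^sup>2 * 0 / real q"
    by (intro tendsto_divide_zero tendsto_mult_left one_minus_power_limit[OF \<alpha>] tendsto_intros) (use q in auto)
  ultimately show "(\<lambda>N. \<integral>u. (\<bar>u\<bar> * (c * geometric_part N (sqrt u)) - c * sqrt u)\<^sup>2 \<partial>?\<nu>) \<longlonglongrightarrow> 0" by simp
qed

context symmetric_iid_array
begin

lemma nonfunctional_walk_weight:
  assumes zs: "zs \<in> nonfunctional_walks n k"
  shows "(\<lambda>\<omega>. cyc_weight (\<lambda>e. Y n e \<omega>) zs) \<in> borel_measurable M" and "\<bar>cyc_weight (\<lambda>e. Y n e \<omega>) zs\<bar> \<le> 1"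
proof -
  show "(\<lambda>\<omega>. cyc_weight (\<lambda>e. Y n e \<omega>) zs) \<in> borel_measurable M" unfolding cyc_weight_def by measurable
  have "cyc_edges zs \<subseteq> square n"
    using zs cyc_edges_subset[of zs "{..<n}"] by (auto simp: nonfunctional_walks_def closed_walks_def square_def)
  then have "\<bar>Y n (zs ! i, zs ! (Suc i mod length zs)) \<omega>\<bar> \<le> 1" if "i < length zs" for i
    using that by (intro Y_abs_le_1) (auto simp: cyc_edges_def)
  then show "\<bar>cyc_weight (\<lambda>e. Y n e \<omega>) zs\<bar> \<le> 1"
    unfolding cyc_weight_def abs_prod by (intro prod_le_1) auto
qed

lemma trace_measurable:
  assumes "k \<ge> 1"
  shows "(\<lambda>\<omega>. mat_trace (self_normalized_matrix X n \<omega> ^\<^sub>m k)) \<in> borel_measurable M"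
  unfolding trace_decomposition[OF assms]
  by (intro borel_measurable_add borel_measurable_sum borel_measurable_times borel_measurable_const
    borel_measurable_power W_measurable nonfunctional_walk_weight(1))

lemma trace_combination:
  fixes t :: "'l::finite \<Rightarrow> real"
  assumes k: "\<And>i. k i \<ge> 1" and K: "\<And>i. k i \<le> K"
  shows "(\<Sum>i\<in>UNIV. t i * mat_trace (self_normalized_matrix X n \<omega> ^\<^sub>m k i)) =
    (\<Sum>E\<in>all_cycles n K. linear_coeff t k (card E) * W n E \<omega> + (W n E \<omega>)\<^sup>2 * higher_part t k (card E) (W n E \<omega>)) +
    (\<Sum>i\<in>UNIV. t i * (\<Sum>zs\<in>nonfunctional_walks n (k i). cyc_weight (\<lambda>e. Y n e \<omega>) zs))"
proof -
  have "(\<Sum>i\<in>UNIV. t i * (\<Sum>q | q dvd k i. real q * (\<Sum>E\<in>cycle_sets n q. W n E \<omega> ^ (k i div q)))) =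
    (\<Sum>q\<in>{1..K}. \<Sum>i\<in>UNIV. if q dvd k i then t i * (real q * (\<Sum>E\<in>cycle_sets n q. W n E \<omega> ^ (k i div q))) else 0)"
    by (rule sum_divisors_swap[OF k K, where F = "\<lambda>q m. real q * (\<Sum>E\<in>cycle_sets n q. W n E \<omega> ^ m)"])
  also have "\<dots> = (\<Sum>q\<in>{1..K}. \<Sum>E\<in>cycle_sets n q. linear_coeff t k (card E) * W n E \<omega> + (W n E \<omega>)\<^sup>2 * higher_part t k (card E) (W n E \<omega>))"
  proof (rule sum.cong[OF refl])
    fix q
    have "(\<Sum>i\<in>UNIV. if q dvd k i then t i * (real q * (\<Sum>E\<in>cycle_sets n q. W n E \<omega> ^ (k i div q))) else 0) =
      (\<Sum>i\<in>UNIV. \<Sum>E\<in>cycle_sets n q. real q * (if q dvd k i then t i * W n E \<omega> ^ (k i div q) else 0))"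
      by (intro sum.cong refl) (simp add: sum_distrib_left mult.left_commute)
    also have "\<dots> = (\<Sum>E\<in>cycle_sets n q. real q * (\<Sum>i\<in>UNIV. if q dvd k i then t i * W n E \<omega> ^ (k i div q) else 0))"
      unfolding sum_distrib_left by (rule sum.swap)
    also have "\<dots> = (\<Sum>E\<in>cycle_sets n q. linear_coeff t k (card E) * W n E \<omega> + (W n E \<omega>)\<^sup>2 * higher_part t k (card E) (W n E \<omega>))"
      unfolding divisor_part_eq[OF k] by (intro sum.cong refl) (simp only: cycle_setsD(1))
    finally show "(\<Sum>i\<in>UNIV. if q dvd k i then t i * (real q * (\<Sum>E\<in>cycle_sets n q. W n E \<omega> ^ (k i div q))) else 0) =
      (\<Sum>E\<in>cycle_sets n q. linear_coeff t k (card E) * W n E \<omega> + (W n E \<omega>)\<^sup>2 * higher_part t k (card E) (W n E \<omega>))" .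
  qed
  finally show ?thesis
    unfolding trace_decomposition[OF k] distrib_left sum.distrib sum_all_cycles by (simp only:)
qed

text \<open>The two phases differ by the truncation errors and by the walks in which a row carries
  two edges; both enter through their L2 norms.\<close>

lemma trace_char_approx:
  fixes t :: "'l::finite \<Rightarrow> real"
  assumes k: "\<And>i. k i \<ge> 1" and K: "\<And>i. k i \<le> K" and n: "n \<ge> 4 * K" "n \<ge> 2"
  shows "norm ((\<integral>\<omega>. cis (\<Sum>i\<in>UNIV. t i * mat_trace (self_normalized_matrix X n \<omega> ^\<^sub>m k i)) \<partial>M) -
      (\<integral>\<omega>. cis (\<Sum>E\<in>all_cycles n K. (W n E \<omega>)\<^sup>2 *
        (linear_coeff t k (card E) * geometric_part N (W n E \<omega>) + higher_part t k (card E) (W n E \<omega>))) \<partial>M)) \<le>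
    (\<Sum>q\<in>{1..K}. \<bar>linear_coeff t k q\<bar> * sqrt (\<Sum>E\<in>cycle_sets n q. \<integral>\<omega>. (W n E \<omega>)\<^sup>2 * ((1 - (W n E \<omega>)\<^sup>2) ^ N)\<^sup>2 \<partial>M)) +
    (\<Sum>i\<in>UNIV. \<bar>t i\<bar> * sqrt (fact (Suc (2 * k i)) * (2 / real n)))"
proof -
  define T where "T \<omega> = (\<Sum>i\<in>UNIV. t i * mat_trace (self_normalized_matrix X n \<omega> ^\<^sub>m k i))" for \<omega>
  define U where "U \<omega> = (\<Sum>E\<in>all_cycles n K. (W n E \<omega>)\<^sup>2 *
    (linear_coeff t k (card E) * geometric_part N (W n E \<omega>) + higher_part t k (card E) (W n E \<omega>)))" for \<omega>
  define S where "S q \<omega> = (\<Sum>E\<in>cycle_sets n q. trunc N (W n E \<omega>))" for q \<omega>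
  define R where "R i \<omega> = (\<Sum>zs\<in>nonfunctional_walks n (k i). cyc_weight (\<lambda>e. Y n e \<omega>) zs)" for i \<omega>
  have [measurable]: "geometric_part N \<in> borel_measurable borel" "higher_part t k q \<in> borel_measurable borel" for q
    by (rule borel_measurable_continuous_onI[OF continuous_geometric_part] borel_measurable_continuous_onI[OF continuous_higher_part])+
  have Tm: "T \<in> borel_measurable M"
    unfolding T_def[abs_def] by (intro borel_measurable_sum borel_measurable_times borel_measurable_const trace_measurable k)
  have Um: "U \<in> borel_measurable M" unfolding U_def[abs_def] by measurable
  have Sm [measurable]: "S q \<in> borel_measurable M" for q unfolding S_def[abs_def] by measurable
  have Rm [measurable]: "R i \<in> borel_measurable M" for i
    unfolding R_def[abs_def] by (intro borel_measurable_sum nonfunctional_walk_weight(1))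
  have S2: "integrable M (\<lambda>\<omega>. (S q \<omega>)\<^sup>2)" for q
    unfolding S_def
  proof (rule integrable_square_bounded_sum)
    show "\<bar>trunc N (W n E \<omega>)\<bar> \<le> 1" if "E \<in> cycle_sets n q" for E \<omega>
      by (rule trunc_abs_le_1[OF W_abs_le_1[OF cycle_setsD(2)[OF that]]])
  qed measurable
  have R2: "integrable M (\<lambda>\<omega>. (R i \<omega>)\<^sup>2)" for i
    unfolding R_def by (rule integrable_square_bounded_sum) (rule nonfunctional_walk_weight; assumption)+
  note SI = expectation_abs_le_sqrt[OF Sm S2] and RI = expectation_abs_le_sqrt[OF Rm R2]
  have diff: "T \<omega> - U \<omega> = (\<Sum>q\<in>{1..K}. linear_coeff t k q * S q \<omega>) + (\<Sum>i\<in>UNIV. t i * R i \<omega>)" for \<omega>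
  proof -
    have U: "U \<omega> = (\<Sum>E\<in>all_cycles n K. linear_coeff t k (card E) * W n E \<omega> + (W n E \<omega>)\<^sup>2 * higher_part t k (card E) (W n E \<omega>)
      - linear_coeff t k (card E) * trunc N (W n E \<omega>))"
      unfolding U_def
    proof (rule sum.cong[OF refl])
      fix E
      have "w\<^sup>2 * (c * geometric_part N w + h) = c * w + w\<^sup>2 * h - c * trunc N w" for w c h
      proof -
        have "w\<^sup>2 * (c * geometric_part N w + h) = c * (w\<^sup>2 * geometric_part N w) + w\<^sup>2 * h" by (simp add: algebra_simps)
        then show ?thesis unfolding power2_times_geometric_part by (simp add: algebra_simps)
      qed
      then show "(W n E \<omega>)\<^sup>2 * (linear_coeff t k (card E) * geometric_part N (W n E \<omega>) + higher_part t k (card E) (W n E \<omega>)) =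
        linear_coeff t k (card E) * W n E \<omega> + (W n E \<omega>)\<^sup>2 * higher_part t k (card E) (W n E \<omega>)
        - linear_coeff t k (card E) * trunc N (W n E \<omega>)" .
    qed
    have "(\<Sum>E\<in>all_cycles n K. linear_coeff t k (card E) * trunc N (W n E \<omega>)) = (\<Sum>q\<in>{1..K}. linear_coeff t k q * S q \<omega>)"
      unfolding sum_all_cycles S_def sum_distrib_left by (intro sum.cong refl) (simp only: cycle_setsD(1))
    then show ?thesis
      unfolding U sum_subtractf T_def trace_combination[OF k K] R_def by simp
  qed
  have cis_int: "integrable M (\<lambda>\<omega>. cis (f \<omega>))" if "f \<in> borel_measurable M" for f
    using that by (intro integrable_const_bound[of _ 1]) (simp_all add: cis_conv_exp)
  have "norm ((\<integral>\<omega>. cis (T \<omega>) \<partial>M) - (\<integral>\<omega>. cis (U \<omega>) \<partial>M)) = norm (\<integral>\<omega>. cis (T \<omega>) - cis (U \<omega>) \<partial>M)"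
    using cis_int[OF Tm] cis_int[OF Um] by simp
  also have "\<dots> \<le> (\<integral>\<omega>. norm (cis (T \<omega>) - cis (U \<omega>)) \<partial>M)" by (rule integral_norm_bound)
  also have "\<dots> \<le> (\<integral>\<omega>. (\<Sum>q\<in>{1..K}. \<bar>linear_coeff t k q\<bar> * \<bar>S q \<omega>\<bar>) + (\<Sum>i\<in>UNIV. \<bar>t i\<bar> * \<bar>R i \<omega>\<bar>) \<partial>M)"
  proof (rule integral_mono)
    show "integrable M (\<lambda>\<omega>. norm (cis (T \<omega>) - cis (U \<omega>)))"
      by (intro integrable_norm Bochner_Integration.integrable_diff cis_int Tm Um)
    show "integrable M (\<lambda>\<omega>. (\<Sum>q\<in>{1..K}. \<bar>linear_coeff t k q\<bar> * \<bar>S q \<omega>\<bar>) + (\<Sum>i\<in>UNIV. \<bar>t i\<bar> * \<bar>R i \<omega>\<bar>))"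
      by (intro Bochner_Integration.integrable_add Bochner_Integration.integrable_sum integrable_mult_right integrable_abs SI(1) RI(1))
    fix \<omega>
    have "norm (cis (T \<omega>) - cis (U \<omega>)) \<le> \<bar>T \<omega> - U \<omega>\<bar>" by (rule norm_cis_diff_le)
    also have "\<dots> \<le> \<bar>\<Sum>q\<in>{1..K}. linear_coeff t k q * S q \<omega>\<bar> + \<bar>\<Sum>i\<in>UNIV. t i * R i \<omega>\<bar>"
      unfolding diff by (rule abs_triangle_ineq)
    also have "\<dots> \<le> (\<Sum>q\<in>{1..K}. \<bar>linear_coeff t k q\<bar> * \<bar>S q \<omega>\<bar>) + (\<Sum>i\<in>UNIV. \<bar>t i\<bar> * \<bar>R i \<omega>\<bar>)"
      unfolding abs_mult[symmetric] by (intro add_mono sum_abs)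
    finally show "norm (cis (T \<omega>) - cis (U \<omega>)) \<le> (\<Sum>q\<in>{1..K}. \<bar>linear_coeff t k q\<bar> * \<bar>S q \<omega>\<bar>) + (\<Sum>i\<in>UNIV. \<bar>t i\<bar> * \<bar>R i \<omega>\<bar>)" .
  qed
  also have "\<dots> = (\<Sum>q\<in>{1..K}. \<bar>linear_coeff t k q\<bar> * (\<integral>\<omega>. \<bar>S q \<omega>\<bar> \<partial>M)) + (\<Sum>i\<in>UNIV. \<bar>t i\<bar> * (\<integral>\<omega>. \<bar>R i \<omega>\<bar> \<partial>M))"
    using SI(1) RI(1) by (simp add: Bochner_Integration.integral_sum)
  also have "\<dots> \<le> (\<Sum>q\<in>{1..K}. \<bar>linear_coeff t k q\<bar> * sqrt (\<Sum>E\<in>cycle_sets n q. \<integral>\<omega>. (W n E \<omega>)\<^sup>2 * ((1 - (W n E \<omega>)\<^sup>2) ^ N)\<^sup>2 \<partial>M)) +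
    (\<Sum>i\<in>UNIV. \<bar>t i\<bar> * sqrt (fact (Suc (2 * k i)) * (2 / real n)))"
  proof (intro add_mono sum_mono mult_left_mono abs_ge_zero)
    fix q assume "q \<in> {1..K}"
    then have "q \<ge> 1" by simp
    from SI(2)[of q] show "(\<integral>\<omega>. \<bar>S q \<omega>\<bar> \<partial>M) \<le> sqrt (\<Sum>E\<in>cycle_sets n q. \<integral>\<omega>. (W n E \<omega>)\<^sup>2 * ((1 - (W n E \<omega>)\<^sup>2) ^ N)\<^sup>2 \<partial>M)"
      unfolding truncation_L2[OF \<open>q \<ge> 1\<close>, symmetric] by (simp only: S_def)
  next
    fix i
    have "n \<ge> 4 * k i" using n(1) K[of i] by linarith
    from nonfunctional_walks_L2[OF this n(2)]
    have "(\<integral>\<omega>. (R i \<omega>)\<^sup>2 \<partial>M) \<le> fact (Suc (2 * k i)) * (2 / real n)" by (simp only: R_def)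
    with RI(2)[of i] show "(\<integral>\<omega>. \<bar>R i \<omega>\<bar> \<partial>M) \<le> sqrt (fact (Suc (2 * k i)) * (2 / real n))"
      by (meson order_trans real_sqrt_le_mono)
  qed
  finally show ?thesis unfolding T_def U_def .
qed

text \<open>For fixed \<open>N\<close> the limit in \<open>n\<close> comes from the Poisson
  approximation; letting \<open>N\<close> grow restores the full linear term, now in compensated
  form.\<close>

lemma trace_char_limit:
  fixes t :: "'l::finite \<Rightarrow> real"
  assumes \<alpha>: "0 < \<alpha>" "\<alpha> < 2" and rv: "regularly_varying_tail M (X 1 1) \<alpha>"
    and k: "\<And>i. k i \<ge> 1" and K: "\<And>i. k i \<le> K"
  shows "(\<lambda>n. \<integral>\<omega>. cis (\<Sum>i\<in>UNIV. t i * mat_trace (self_normalized_matrix X n \<omega> ^\<^sub>m k i)) \<partial>M) \<longlonglongrightarrow>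
    exp (\<Sum>q\<in>{1..K}. poisson_exponent (q_poisson_intensity \<alpha> q) (\<lambda>u. linear_coeff t k q * sqrt u) (\<lambda>u. \<bar>u\<bar> * higher_part t k q (sqrt u)))"
proof (rule tendsto_by_approximation)
  let ?c = "linear_coeff t k" and ?H = "higher_part t k" and ?\<mu> = "beta_product_distribution \<alpha>"
  let ?b = "\<lambda>N n. \<integral>\<omega>. cis (\<Sum>E\<in>all_cycles n K. (W n E \<omega>)\<^sup>2 *
        (?c (card E) * geometric_part N (W n E \<omega>) + ?H (card E) (W n E \<omega>))) \<partial>M"
  let ?\<epsilon> = "\<lambda>N n. (\<Sum>q\<in>{1..K}. \<bar>?c q\<bar> * sqrt (\<Sum>E\<in>cycle_sets n q. \<integral>\<omega>. (W n E \<omega>)\<^sup>2 * ((1 - (W n E \<omega>)\<^sup>2) ^ N)\<^sup>2 \<partial>M)) +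
    (\<Sum>i\<in>UNIV. \<bar>t i\<bar> * sqrt (fact (Suc (2 * k i)) * (2 / real n)))"
  let ?\<delta> = "\<lambda>N. (\<Sum>q\<in>{1..K}. \<bar>?c q\<bar> * sqrt ((\<integral>v. ((1 - v) ^ N)\<^sup>2 \<partial>?\<mu> q) / real q)) +
    (\<Sum>i\<in>UNIV. \<bar>t i\<bar> * sqrt (fact (Suc (2 * k i)) * 0))"
  let ?\<Phi> = "\<lambda>N. exp (\<Sum>q\<in>{1..K}. \<integral>u. (cis (\<bar>u\<bar> * (?c q * geometric_part N (sqrt u) + ?H q (sqrt u))) - 1) \<partial>q_poisson_intensity \<alpha> q)"
  show "eventually (\<lambda>n. norm ((\<integral>\<omega>. cis (\<Sum>i\<in>UNIV. t i * mat_trace (self_normalized_matrix X n \<omega> ^\<^sub>m k i)) \<partial>M) - ?b N n) \<le> ?\<epsilon> N n) sequentially" for N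
    using eventually_ge_at_top[of "4 * K"] eventually_ge_at_top[of 2]
    by eventually_elim (rule trace_char_approx[OF k K])
  show "?\<epsilon> N \<longlonglongrightarrow> ?\<delta> N" for N
  proof (intro tendsto_add tendsto_sum tendsto_mult_left tendsto_real_sqrt lim_const_over_n)
    fix q assume "q \<in> {1..K}"
    then have q: "q \<ge> 1" by simp
    have c: "continuous_on {0..1::real} (\<lambda>v. ((1 - v) ^ N)\<^sup>2)" by (intro continuous_intros)
    show "(\<lambda>n. \<Sum>E\<in>cycle_sets n q. \<integral>\<omega>. (W n E \<omega>)\<^sup>2 * ((1 - (W n E \<omega>)\<^sup>2) ^ N)\<^sup>2 \<partial>M) \<longlonglongrightarrow> (\<integral>v. ((1 - v) ^ N)\<^sup>2 \<partial>?\<mu> q) / real q"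
      by (rule cycle_continuous_limit[OF \<alpha> rv q c]) measurable
  qed
  have "?\<delta> \<longlonglongrightarrow> (\<Sum>q\<in>{1..K}. \<bar>?c q\<bar> * sqrt (0 * inverse (real q))) + (\<Sum>i\<in>UNIV. \<bar>t i\<bar> * sqrt (fact (Suc (2 * k i)) * 0))"
    unfolding divide_inverse
    by (intro tendsto_add tendsto_sum tendsto_mult_left tendsto_mult_right tendsto_real_sqrt one_minus_power_limit[OF \<alpha>] tendsto_const)
  then show "?\<delta> \<longlonglongrightarrow> 0" by simp
  have "continuous_on UNIV (\<lambda>w. ?c q * geometric_part N w + ?H q w)" for N q
    by (intro continuous_intros continuous_geometric_part continuous_higher_part)
  from cycle_sum_char_limit[OF \<alpha> rv this] show "?b N \<longlonglongrightarrow> ?\<Phi> N" for N .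
  show "?\<Phi> \<longlonglongrightarrow> exp (\<Sum>q\<in>{1..K}. poisson_exponent (q_poisson_intensity \<alpha> q) (\<lambda>u. ?c q * sqrt u) (\<lambda>u. \<bar>u\<bar> * ?H q (sqrt u)))"
  proof (intro tendsto_exp tendsto_sum)
    fix q assume "q \<in> {1..K}"
    then have q: "q \<ge> 1" by simp
    show "(\<lambda>N. \<integral>u. (cis (\<bar>u\<bar> * (?c q * geometric_part N (sqrt u) + ?H q (sqrt u))) - 1) \<partial>q_poisson_intensity \<alpha> q) \<longlonglongrightarrow>
      poisson_exponent (q_poisson_intensity \<alpha> q) (\<lambda>u. ?c q * sqrt u) (\<lambda>u. \<bar>u\<bar> * ?H q (sqrt u))"
      unfolding q_poisson_exponent_truncated[OF \<alpha> q continuous_higher_part]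
      by (rule poisson_exponent_truncated_tendsto[OF \<alpha> q continuous_higher_part])
  qed
qed

end

section \<open>The characteristic function of the limit family, and the conclusion\<close>

text \<open>The divisor sum defining \<open>Z\<close> is split in the same way as the traces: the
  terms with \<open>k i = q\<close> give the compensated integral, and all others a plain Poisson
  integral of a function with a factor \<open>|u|\<close>.\<close>

lemma poisson_family_char:
  fixes t :: "'l::finite \<Rightarrow> real"
  assumes \<alpha>: "0 < \<alpha>" "\<alpha> < 2" and Z: "alpha_poisson_family P \<alpha> Z"
    and k: "\<And>i. k i \<ge> 1" and K: "\<And>i. k i \<le> K"
  shows "\<And>i. Z (k i) \<in> borel_measurable P"
    and "(\<integral>\<omega>. cis (\<Sum>i\<in>UNIV. t i * Z (k i) \<omega>) \<partial>P) =
      exp (\<Sum>q\<in>{1..K}. poisson_exponent (q_poisson_intensity \<alpha> q) (\<lambda>u. linear_coeff t k q * sqrt u) (\<lambda>u. \<bar>u\<bar> * higher_part t k q (sqrt u)))"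
proof -
  let ?\<nu> = "q_poisson_intensity \<alpha>"
  obtain N V where P: "prob_space P" and pp: "\<And>q. q \<ge> 1 \<Longrightarrow> poisson_process P (?\<nu> q) (N q)"
    and ind: "prob_space.indep_sets P (\<lambda>q. random_measure_events P borel (N q)) {1..}"
    and Vm: "\<And>q m \<omega>. q \<ge> 1 \<Longrightarrow> m \<ge> 2 \<Longrightarrow> \<omega> \<in> space P \<Longrightarrow> V q m \<omega> = real q * (\<integral>u. signed_half_power m u \<partial>N q \<omega>)"
    and V1: "\<And>q. q \<ge> 1 \<Longrightarrow> \<exists>I. compensated_poisson_integral P (?\<nu> q) (N q) (signed_half_power 1) I \<and> (\<forall>\<omega>\<in>space P. V q 1 \<omega> = real q * I \<omega>)"
    and Zk: "\<And>k \<omega>. k \<ge> 1 \<Longrightarrow> \<omega> \<in> space P \<Longrightarrow> Z k \<omega> = (\<Sum>q | q dvd k. V q (k div q) \<omega>)"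
    using Z unfolding alpha_poisson_family_def by blast
  interpret P: prob_space P by fact
  have ppp: "poisson_point_process P (?\<nu> q) (N q)" if "q \<ge> 1" for q
    using pp[OF that] by (simp add: poisson_point_process_def poisson_point_process_axioms_def P.prob_space_axioms)
  have half: "signed_half_power 1 = sqrt" using signed_half_power_eq_power[OF order_refl] by (simp add: fun_eq_iff)
  have "\<forall>q\<in>{1..}. \<exists>I. compensated_poisson_integral P (?\<nu> q) (N q) (signed_half_power 1) I \<and> (\<forall>\<omega>\<in>space P. V q 1 \<omega> = real q * I \<omega>)"
    using V1 by simp
  from bchoice[OF this] obtain I where I: "\<forall>q\<in>{1..}. compensated_poisson_integral P (?\<nu> q) (N q) (signed_half_power 1) (I q) \<and>
      (\<forall>\<omega>\<in>space P. V q 1 \<omega> = real q * I q \<omega>)" by blast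
  have comp: "compensated_poisson_integral P (?\<nu> q) (N q) sqrt (I q)" if "q \<ge> 1" for q
    using I that unfolding half by blast
  have VI: "V q 1 \<omega> = real q * I q \<omega>" if "q \<ge> 1" "\<omega> \<in> space P" for q \<omega> using I that by blast
  have VN: "V q m \<omega> = real q * (\<integral>u. sqrt u ^ m \<partial>N q \<omega>)" if "q \<ge> 1" "m \<ge> 2" "\<omega> \<in> space P" for q m \<omega>
  proof -
    have "signed_half_power m = (\<lambda>u. sqrt u ^ m)"
      using that(2) by (intro ext signed_half_power_eq_power) simp
    then show ?thesis using Vm[OF that] by (simp only:)
  qed
  have Vmeas: "V q m \<in> borel_measurable P" if q: "q \<ge> 1" and m: "m \<ge> 1" for q m
  proof (cases "m = 1")
    case True
    have "I q \<in> borel_measurable P" using comp[OF q] by (simp add: compensated_poisson_integral_def)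
    then have "(\<lambda>\<omega>. real q * I q \<omega>) \<in> borel_measurable P" by measurable
    then show ?thesis unfolding True by (rule measurable_cong[THEN iffD2, rotated]) (rule VI[OF q])
  next
    case False
    then have m2: "m \<ge> 2" using m by simp
    have "(\<lambda>u. sqrt u ^ m) \<in> borel_measurable (?\<nu> q)" by measurable
    then have "(\<lambda>\<omega>. \<integral>u. sqrt u ^ m \<partial>N q \<omega>) \<in> borel_measurable P"
      by (rule poisson_point_process.integral_N_measurable[OF ppp[OF q], rotated 2])
    then have "(\<lambda>\<omega>. real q * (\<integral>u. sqrt u ^ m \<partial>N q \<omega>)) \<in> borel_measurable P" by measurable
    then show ?thesis by (rule measurable_cong[THEN iffD2, rotated]) (rule VN[OF q m2])
  qed
  show Zmeas: "Z (k i) \<in> borel_measurable P" for i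
  proof -
    have div: "q \<ge> 1" "k i div q \<ge> 1" if "q dvd k i" for q
      using that k[of i] by (auto simp: Suc_le_eq dvd_pos_nat div_greater_zero_iff dvd_imp_le)
    have "(\<lambda>\<omega>. \<Sum>q | q dvd k i. V q (k i div q) \<omega>) \<in> borel_measurable P"
      using div by (intro borel_measurable_sum Vmeas) auto
    then show ?thesis by (rule measurable_cong[THEN iffD2, rotated]) (rule Zk[OF k])
  qed
  \<comment> \<open>Almost sure integrability allows the sum over \<open>i\<close> to be moved
    through the integral against \<open>N q\<close>.\<close>
  have int: "AE \<omega> in P. \<forall>q\<in>{1..K}. \<forall>i. integrable (N q \<omega>) (\<lambda>u. \<bar>u\<bar> * sqrt u ^ (k i div q - 2))"
  proof (rule AE_finite_allI)
    fix q assume "q \<in> {1..K}"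
    then have q: "q \<ge> 1" by simp
    have "AE \<omega> in P. integrable (N q \<omega>) (\<lambda>u. \<bar>u\<bar> * sqrt u ^ (k i div q - 2))" for i
      by (rule poisson_point_process.AE_integrable_N[OF ppp[OF q] q_poisson_abs_times(1)[OF \<alpha> q]])
        (intro continuous_intros)
    then have "AE \<omega> in P. \<forall>i\<in>UNIV. integrable (N q \<omega>) (\<lambda>u. \<bar>u\<bar> * sqrt u ^ (k i div q - 2))"
      by (intro AE_finite_allI) auto
    then show "AE \<omega> in P. \<forall>i. integrable (N q \<omega>) (\<lambda>u. \<bar>u\<bar> * sqrt u ^ (k i div q - 2))" by simp
  qed simp
  have rep: "AE \<omega> in P. (\<Sum>i\<in>UNIV. t i * Z (k i) \<omega>) =
    (\<Sum>q\<in>{1..K}. linear_coeff t k q * I q \<omega> + (\<integral>u. \<bar>u\<bar> * higher_part t k q (sqrt u) \<partial>N q \<omega>))"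
    using int AE_space
  proof eventually_elim
    case (elim \<omega>)
    have "(\<Sum>i\<in>UNIV. t i * Z (k i) \<omega>) = (\<Sum>q\<in>{1..K}. \<Sum>i\<in>UNIV. if q dvd k i then t i * V q (k i div q) \<omega> else 0)"
      unfolding Zk[OF k elim(2)] by (rule sum_divisors_swap[OF k K, where F = "\<lambda>q m. V q m \<omega>"])
    also have "\<dots> = (\<Sum>q\<in>{1..K}. linear_coeff t k q * I q \<omega> + (\<integral>u. \<bar>u\<bar> * higher_part t k q (sqrt u) \<partial>N q \<omega>))"
    proof (rule sum.cong[OF refl])
      fix q assume q: "q \<in> {1..K}"
      then have q1: "q \<ge> 1" by simp
      let ?J = "\<lambda>i. \<integral>u. \<bar>u\<bar> * sqrt u ^ (k i div q - 2) \<partial>N q \<omega>"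
      have "(\<integral>u. \<bar>u\<bar> * higher_part t k q (sqrt u) \<partial>N q \<omega>) =
        (\<integral>u. real q * (\<Sum>i\<in>UNIV. (if q dvd k i \<and> k i \<noteq> q then t i else 0) * (\<bar>u\<bar> * sqrt u ^ (k i div q - 2))) \<partial>N q \<omega>)"
        unfolding higher_part_def
        by (intro Bochner_Integration.integral_cong refl) (simp add: sum_distrib_left if_distrib[of "(*) _"] mult_ac cong: if_cong)
      also have "\<dots> = real q * (\<Sum>i\<in>UNIV. (if q dvd k i \<and> k i \<noteq> q then t i else 0) * ?J i)"
        using elim(1) q by (simp add: Bochner_Integration.integral_sum)
      finally have J: "(\<integral>u. \<bar>u\<bar> * higher_part t k q (sqrt u) \<partial>N q \<omega>) = \<dots>" .
      have "(if q dvd k i then t i * V q (k i div q) \<omega> else 0) =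
        real q * ((if k i = q then t i else 0) * I q \<omega> + (if q dvd k i \<and> k i \<noteq> q then t i else 0) * ?J i)" for i
      proof (cases "q dvd k i \<and> k i \<noteq> q")
        case True
        then have m: "k i div q \<ge> 2" using div_ge_2[of q "k i"] k[of i] by simp
        have "sqrt u ^ (k i div q) = \<bar>u\<bar> * sqrt u ^ (k i div q - 2)" for u
          unfolding power2_sqrt_eq_abs[symmetric] power_add[symmetric] le_add_diff_inverse[OF m] by (rule refl)
        with VN[OF q1 m elim(2)] True show ?thesis by simp
      next
        case False
        show ?thesis
        proof (cases "k i = q")
          case True
          then have "k i div q = 1" using q1 by simp
          with VI[OF q1 elim(2)] True show ?thesis by simp
        qed (use False in simp)
      qed
      then show "(\<Sum>i\<in>UNIV. if q dvd k i then t i * V q (k i div q) \<omega> else 0) =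
        linear_coeff t k q * I q \<omega> + (\<integral>u. \<bar>u\<bar> * higher_part t k q (sqrt u) \<partial>N q \<omega>)"
        unfolding J linear_coeff_def
        by (simp only: sum_distrib_left[symmetric] sum.distrib sum_distrib_right[symmetric] distrib_left mult.assoc)
    qed
    finally show ?case .
  qed
  have h: "integrable (?\<nu> q) (\<lambda>u. \<bar>u\<bar> * higher_part t k q (sqrt u))"
    "integrable (?\<nu> q) (\<lambda>u. (\<bar>u\<bar> * higher_part t k q (sqrt u))\<^sup>2)" if q: "q \<ge> 1" for q
  proof -
    show "integrable (?\<nu> q) (\<lambda>u. \<bar>u\<bar> * higher_part t k q (sqrt u))"
      by (rule q_poisson_abs_times(1)[OF \<alpha> q continuous_higher_part])
    have "continuous_on UNIV (\<lambda>w. w\<^sup>2 * (higher_part t k q w)\<^sup>2)" by (intro continuous_intros continuous_higher_part)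
    from q_poisson_abs_times(1)[OF \<alpha> q this] show "integrable (?\<nu> q) (\<lambda>u. (\<bar>u\<bar> * higher_part t k q (sqrt u))\<^sup>2)"
      by (simp only: power_mult_distrib power2_sqrt_eq_abs power2_eq_square[of "\<bar>_\<bar>"] mult.assoc)
  qed
  have "(\<integral>\<omega>. cis (\<Sum>i\<in>UNIV. t i * Z (k i) \<omega>) \<partial>P) =
    (\<integral>\<omega>. cis (\<Sum>q\<in>{1..K}. linear_coeff t k q * I q \<omega> + (\<integral>u. \<bar>u\<bar> * higher_part t k q (sqrt u) \<partial>N q \<omega>)) \<partial>P)"
  proof (rule integral_cong_AE)
    show "(\<lambda>\<omega>. cis (\<Sum>i\<in>UNIV. t i * Z (k i) \<omega>)) \<in> borel_measurable P"
      unfolding cis_conv_exp using Zmeas by measurable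
    have "I q \<in> borel_measurable P" "(\<lambda>\<omega>. \<integral>u. \<bar>u\<bar> * higher_part t k q (sqrt u) \<partial>N q \<omega>) \<in> borel_measurable P" if "q \<in> {1..K}" for q
    proof -
      have q: "q \<ge> 1" using that by simp
      show "I q \<in> borel_measurable P" using comp[OF q] by (simp add: compensated_poisson_integral_def)
      show "(\<lambda>\<omega>. \<integral>u. \<bar>u\<bar> * higher_part t k q (sqrt u) \<partial>N q \<omega>) \<in> borel_measurable P"
        by (rule poisson_point_process.integral_N_measurable[OF ppp[OF q] _ _ borel_measurable_integrable[OF h(1)[OF q]]])
    qed
    then have "(\<lambda>\<omega>. \<Sum>q\<in>{1..K}. linear_coeff t k q * I q \<omega> + (\<integral>u. \<bar>u\<bar> * higher_part t k q (sqrt u) \<partial>N q \<omega>)) \<in> borel_measurable P"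
      by (intro borel_measurable_sum borel_measurable_add borel_measurable_times borel_measurable_const)
    then show "(\<lambda>\<omega>. cis (\<Sum>q\<in>{1..K}. linear_coeff t k q * I q \<omega> + (\<integral>u. \<bar>u\<bar> * higher_part t k q (sqrt u) \<partial>N q \<omega>))) \<in> borel_measurable P"
      unfolding cis_conv_exp by measurable
    show "AE \<omega> in P. cis (\<Sum>i\<in>UNIV. t i * Z (k i) \<omega>) =
      cis (\<Sum>q\<in>{1..K}. linear_coeff t k q * I q \<omega> + (\<integral>u. \<bar>u\<bar> * higher_part t k q (sqrt u) \<partial>N q \<omega>))"
      using rep by eventually_elim (rule arg_cong)
  qed
  also have "\<dots> = exp (\<Sum>q\<in>{1..K}. poisson_exponent (?\<nu> q) (\<lambda>u. linear_coeff t k q * sqrt u) (\<lambda>u. \<bar>u\<bar> * higher_part t k q (sqrt u)))"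
  proof (rule joint_char_poisson_family[OF P, where \<S> = borel])
    show "P.indep_sets (\<lambda>q. random_measure_events P borel (N q)) {1..K}"
      by (rule P.indep_sets_mono_index[OF _ ind]) auto
  qed (use pp comp h in auto)
  finally show "(\<integral>\<omega>. cis (\<Sum>i\<in>UNIV. t i * Z (k i) \<omega>) \<partial>P) =
      exp (\<Sum>q\<in>{1..K}. poisson_exponent (?\<nu> q) (\<lambda>u. linear_coeff t k q * sqrt u) (\<lambda>u. \<bar>u\<bar> * higher_part t k q (sqrt u)))" .
qed

lemma borel_measurable_vec_lambda:
  fixes f :: "'l::finite \<Rightarrow> 'a \<Rightarrow> real"
  assumes "\<And>i. f i \<in> borel_measurable M"
  shows "(\<lambda>\<omega>. (\<chi> i. f i \<omega>) :: real ^ 'l) \<in> borel_measurable M"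
  unfolding borel_measurable_euclidean_space[of "\<lambda>\<omega>. (\<chi> i. f i \<omega>) :: real ^ 'l" M]
  using assms by (auto simp: Basis_vec_def inner_axis)

theorem theorem2p7:
  fixes \<alpha> :: real
    and M :: "'a measure" and X :: "nat \<Rightarrow> nat \<Rightarrow> 'a \<Rightarrow> real"
    and P :: "'b measure" and Z :: "nat \<Rightarrow> 'b \<Rightarrow> real"
    and k :: "'l::finite \<Rightarrow> nat"
  assumes "0 < \<alpha>" and "\<alpha> < 2"
    and "symmetric_iid_array M X"
    and "regularly_varying_tail M (X 1 1) \<alpha>"
    and "\<And>i. k i \<ge> 1"
    and "alpha_poisson_family P \<alpha> Z"
  shows "converges_in_distribution
           M (\<lambda>n \<omega>. (\<chi> i. mat_trace (self_normalized_matrix X n \<omega> ^\<^sub>m k i)) :: real ^ 'l)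
           P (\<lambda>\<omega>. (\<chi> i. Z (k i) \<omega>) :: real ^ 'l)"
proof -
  interpret symmetric_iid_array M X by fact
  \<comment> \<open>A common bound for the exponents, which limits the lengths of the cycles that
    occur.\<close>
  have K: "k i \<le> Max (range k)" for i by simp
  have P: "prob_space P" using assms(6) by (simp add: alpha_poisson_family_def)
  note fam = poisson_family_char[OF assms(1,2,6,5) K]
  have Tm: "(\<lambda>\<omega>. (\<chi> i. mat_trace (self_normalized_matrix X n \<omega> ^\<^sub>m k i)) :: real ^ 'l) \<in> borel_measurable M" for n
    by (rule borel_measurable_vec_lambda[OF trace_measurable[OF assms(5)]])
  have Sm: "(\<lambda>\<omega>. (\<chi> i. Z (k i) \<omega>) :: real ^ 'l) \<in> borel_measurable P"
    by (rule borel_measurable_vec_lambda[OF fam(1)])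
  \<comment> \<open>The inner product with \<open>t\<close> is a linear combination of the
    coordinates, for which traces and limit family lead to the same closed form.\<close>
  have char: "(\<lambda>n. \<integral>\<omega>. cis (t \<bullet> (\<chi> i. mat_trace (self_normalized_matrix X n \<omega> ^\<^sub>m k i))) \<partial>M) \<longlonglongrightarrow>
      (\<integral>\<omega>. cis (t \<bullet> (\<chi> i. Z (k i) \<omega>)) \<partial>P)" for t :: "real ^ 'l"
    unfolding inner_vec_def inner_real_def vec_lambda_beta fam(2)
    by (rule trace_char_limit[OF assms(1,2,4,5) K])
  show ?thesis
    unfolding converges_in_distribution_def
    using Tm Sm levy_continuity_multivariate[OF prob_space_axioms P Tm Sm char] by blast
qed

end
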